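(* Let $J$ be a (closed) Jordan arc in $\mathbb D$ with endpoints $\zeta_1$ and $\zeta_2$, and let $\gamma$ be the (closed) hyperbolic line segment joining $\zeta_1$ and $\zeta_2$ in $\mathbb D$. Let $C$ be the Euclidean circle (or Euclidean line with $\infty$ attached) containing $\gamma$, let $C_0$ be the connected component of $C\setminus J$ containing a point outside $\mathbb D$, and let $\tilde\gamma=C\setminus C_0$. Let $\hat J$ denote the reflection of $J$ with respect to the circle $C$. Let $f$ be a meromorphic univalent function on $\mathbb D$ with a pole at $s\in\mathbb D$. Suppose that $s\notin\operatorname{hull}(\tilde\gamma\cup J)$. Then $$\ell(f(\gamma))\le\begin{cases}A_1\,\ell(f(J)) & \text{if } s\notin\operatorname{hull}^\circ(J\cup\hat J),\\[2pt] A_\tau^+\,\ell(f(J)) & \text{if } s\in\operatorname{hull}^\circ(J\cup\hat J),\end{cases}$$ where $\tau=\tanh d_{\mathbb D}(s,\tilde\gamma)$.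
   Context: Let $\mathbb D=\{\zeta\in\mathbb C:|\zeta|<1\}$, let $\mathbb T^-=\{\zeta\in\mathbb C:|\zeta|=1,\ \operatorname{Re}\zeta<0\}$, and let $\mathbb I_1=\{iv:-1<v<1\}$. For a curve in $\mathbb C$, $\ell\in[0,+\infty]$ denotes its Euclidean length (for a Jordan arc this equals its suitably normalized 1-dimensional Hausdorff measure). Univalent means injective. Hyperbolic distance on $\mathbb D$ (curvature $-4$): $d_{\mathbb D}(\zeta,\omega)=\operatorname{artanh}\left|\frac{\zeta-\omega}{1-\zeta\bar\omega}\right|$, with $\operatorname{artanh}x=\frac12\log\frac{1+x}{1-x}$; for a set $E\subset\mathbb D$, $d_{\mathbb D}(s,E)=\inf_{\omega\in E}d_{\mathbb D}(s,\omega)$. Hyperbolic line segments lie on circles or lines orthogonal to $\partial\mathbb D$. For a closed curve $K$ in $\mathbb C$ (regarded as a compact set), $\operatorname{hull}(K)=\mathbb C\setminus U_\infty$, where $U_\infty$ is the unique unbounded connected component of $\mathbb C\setminus K$, and $\operatorname{hull}^\circ(K)$ is the interior of $\operatorname{hull}(K)$. $A_1$ is the best possible constant in the Gehring–Hayman theorem, i.e. the smallest constant such that $\ell(f(\mathbb I_1))\le A_1\,\ell(f(\mathbb T^-))$ for every analytic univalent function $f:\mathbb D\to\mathbb C$ that extends continuously to $\mathbb T^-$. For $p\in(0,1)$, $\mathcal M_p$ is the class of meromorphic univalent functions on $\mathbb D$ with a simple pole at $p$ that extend continuously to $\mathbb T^-$, $\mathcal M_p^0=\{f\in\mathcal M_p:\ell(f(\mathbb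 T^-))<+\infty\}$, $$A_p=\sup_{f\in\mathcal M_p^0}\frac{\ell(f(\mathbb I_1))}{\ell(f(\mathbb T^-))},\qquad A_p^+=\sup_{p\le p'<1}A_{p'}.$$ *)

theory Defs
  imports "HOL-Complex_Analysis.Complex_Analysis"
begin

section \<open>Length of curves\<close>

text \<open>Total variation of the curve \<open>g\<close> over the parameter set \<open>I\<close>: the supremum of the lengths of
  the inscribed polygonal lines with vertices \<open>g (xs ! 0), g (xs ! 1), \<dots>\<close>.  It may be infinite, and
  \<open>I\<close> may be an open interval.\<close>

definition curve_length :: "real set \<Rightarrow> (real \<Rightarrow> complex) \<Rightarrow> ennreal" where
  "curve_length I g =
     (SUP xs \<in> {xs. sorted xs \<and> set xs \<subseteq> I}.
        \<Sum>i<length xs - 1. ennreal (dist (g (xs ! i)) (g (xs ! Suc i))))"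


section \<open>Hyperbolic geometry of the unit disk\<close>

definition hyp_dist :: "complex \<Rightarrow> complex \<Rightarrow> real" where
  "hyp_dist z w = artanh (cmod ((z - w) / (1 - z * cnj w)))"

definition hyp_setdist :: "complex \<Rightarrow> complex set \<Rightarrow> real" where
  "hyp_setdist s E = (INF w\<in>E. hyp_dist s w)"

text \<open>The closed geodesic segment: the points at which the triangle inequality is an equality.\<close>

definition hyp_segment :: "complex \<Rightarrow> complex \<Rightarrow> complex set" where
  "hyp_segment a b = {z \<in> ball 0 1. hyp_dist a z + hyp_dist z b = hyp_dist a b}"


section \<open>The Riemann sphere, circles and lines\<close>

text \<open>\<open>None\<close> is the point at infinity, \<open>Some z\<close> the finite point \<open>z\<close>.\<close>

definition riemann_sphere :: "complex option topology" where
  "riemann_sphere = Alexandroff_compactification euclidean"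

text \<open>\<open>Circle c r\<close> has centre \<open>c\<close> and radius \<open>r\<close>; \<open>Line a b\<close> passes through \<open>a\<close> and \<open>b\<close>.\<close>

datatype circline = Circle complex real | Line complex complex

fun proper_circline :: "circline \<Rightarrow> bool" where
  "proper_circline (Circle c r) \<longleftrightarrow> r > 0"
| "proper_circline (Line a b) \<longleftrightarrow> a \<noteq> b"

fun circline_points :: "circline \<Rightarrow> complex option set" where
  "circline_points (Circle c r) = Some ` sphere c r"
| "circline_points (Line a b) = insert None (Some ` (affine hull {a, b}))"

text \<open>The reflection at finite points.  The value at the centre of a circle, whose mirror image is
  the point at infinity, is a dummy.  It is harmless for the reflection of subsets of the unit disk
  in a circle orthogonal to the unit circle, as the centre of such a circle lies outside the disk.\<close>

fun reflect :: "circline \<Rightarrow> complex \<Rightarrow> complex" where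
  "reflect (Circle c r) z = c + of_real (r\<^sup>2) / cnj (z - c)"
| "reflect (Line a b) z = a + (b - a) * cnj ((z - a) / (b - a))"

text \<open>For compact \<open>K\<close>, \<open>outside K\<close> is the unique unbounded component of \<open>- K\<close>.\<close>

definition filled_hull :: "complex set \<Rightarrow> complex set" where
  "filled_hull K = - outside K"


section \<open>Univalent meromorphic functions\<close>

text \<open>A function that is \<open>nicely_meromorphic_on\<close> a set takes the dummy value \<open>0\<close> at its poles, so
  injectivity is required of the induced map into the Riemann sphere.\<close>

definition sphere_value :: "(complex \<Rightarrow> complex) \<Rightarrow> complex \<Rightarrow> complex option" where
  "sphere_value f z = (if is_pole f z then None else Some (f z))"

definition meromorphic_univalent :: "(complex \<Rightarrow> complex) \<Rightarrow> bool" where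
  "meromorphic_univalent f \<longleftrightarrow>
     f nicely_meromorphic_on ball 0 1 \<and> inj_on (sphere_value f) (ball 0 1)"


section \<open>The constants of Gehring-Hayman type\<close>

definition left_semicircle :: "complex set" where
  "left_semicircle = {z. cmod z = 1 \<and> Re z < 0}"

text \<open>The lengths of the images of the vertical diameter \<open>{\<i> v | -1 < v < 1}\<close> and of
  \<open>left_semicircle\<close>.\<close>

definition diameter_image_length :: "(complex \<Rightarrow> complex) \<Rightarrow> ennreal" where
  "diameter_image_length f = curve_length {-1<..<1} (\<lambda>v. f (\<i> * of_real v))"

definition semicircle_image_length :: "(complex \<Rightarrow> complex) \<Rightarrow> ennreal" where
  "semicircle_image_length f = curve_length {pi/2<..<3*pi/2} (\<lambda>t. f (cis t))"

text \<open>The values of \<open>f\<close> on \<open>left_semicircle\<close> are those of its continuous extension.\<close>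

definition GH_const :: ennreal where
  "GH_const = Inf {A. \<forall>f. f holomorphic_on ball 0 1 \<longrightarrow> inj_on f (ball 0 1) \<longrightarrow>
     continuous_on (ball 0 1 \<union> left_semicircle) f \<longrightarrow>
     diameter_image_length f \<le> A * semicircle_image_length f}"

definition M_class :: "real \<Rightarrow> (complex \<Rightarrow> complex) set" where
  "M_class p = {f. meromorphic_univalent f \<and>
     is_pole f (of_real p) \<and> zorder f (of_real p) = -1 \<and>
     continuous_on (ball 0 1 \<union> left_semicircle - {of_real p}) f}"

definition M0_class :: "real \<Rightarrow> (complex \<Rightarrow> complex) set" where
  "M0_class p = {f \<in> M_class p. semicircle_image_length f < \<infinity>}"

definition GH_pole_const :: "real \<Rightarrow> ennreal" where
  "GH_pole_const p = (SUP f\<in>M0_class p. diameter_image_length f / semicircle_image_length f)"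

definition GH_pole_const_sup :: "real \<Rightarrow> ennreal" where
  "GH_pole_const_sup p = (SUP q\<in>{p..<1}. GH_pole_const q)"

end

theory Submission
  imports Defs
begin

text \<open>
 A disk automorphism carries \<open>\<gamma>\<close> to a segment of the imaginary axis.  Then \<open>C\<close> becomes the axis, as far as
 the disk is concerned, and the reflection in \<open>C\<close> becomes \<open>z \<mapsto> - cnj z\<close> (\<open>circline_through_axis\<close>).

 \<^item> Localization.  The parameters at which \<open>J\<close> meets the axis form a compact set.  Over each of its gaps \<open>J\<close> is
 a crosscut \<open>c\<close> on one side of the axis.  Between axis points of \<open>J\<close> that are close together the image of the axis segment is at most
 \<open>1 + \<epsilon>\<close> times as long as its chord, hence as the image of the piece of \<open>J\<close>.  As both constants are at
 least \<open>1\<close>, it suffices to bound the image of the axis segment between the ends of one crosscut \<open>c\<close> by the image of \<open>c\<close>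
 (\<open>axis_length_le_gaps\<close>).

 \<^item> One crosscut.  Let \<open>G\<close> be the Jordan domain bounded by \<open>c\<close> and its mirror image.  Its symmetric Riemann map
 \<open>\<phi>\<close> extends to the closed disk by Caratheodory's theorem (\<open>caratheodory_jordan\<close>), maps the vertical diameter
 to the axis segment and the left semicircle to \<open>c\<close>.  So \<open>f \<circ> \<phi>\<close> competes in the definition of the constants.
 If \<open>s \<notin> G\<close>, it is holomorphic, and \<open>GH_const\<close> works (\<open>no_pole_bound\<close>).  If \<open>s \<in> G\<close>, its pole lies in the
 right half of the disk because \<open>s\<close> is outside the hull of \<open>c\<close> and the axis segment.  An automorphism that preserves the diameter moves
 the pole to some \<open>p > 0\<close>, and \<open>p \<ge> \<tau>\<close> by the lemma of Schwarz and Pick (\<open>inner_pole_bound\<close>).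

 \<^item> In the second case of the theorem \<open>s\<close> need not lie in the domain \<open>G\<close> of every crosscut, so functions without a pole must be
 compared with \<open>GH_pole_const_sup \<tau>\<close> as well (\<open>outer_pole_bound\<close>).  They are limits of functions whose pole tends to \<open>1\<close>.  For
 \<open>k\<close> univalent on the closed disk, remove from the sphere the image of the circle without a short arc around
 \<open>1\<close>.  As the arc shrinks, the Riemann maps of these simply connected domains converge to \<open>k\<close>, and by a
 lemma of Koebe the preimages of infinity converge to \<open>1\<close>.  Lengths of images of the semicircle converge
 after an affine contraction towards \<open>1\<close>, which puts the semicircle into the open disk; lengths of images of the diameter
 are lower semicontinuous (\<open>diameter_shrink_le\<close>).  If \<open>h\<close> is only continuous on the closed disk, with a rectifiable
 boundary curve, then \<open>h (r z)\<close> for \<open>r \<rightarrow> 1\<close> takes the place of \<open>h\<close> (\<open>diameter_le_pole_const_univalent\<close>).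
\<close>

abbreviation disk :: "complex set" where "disk \<equiv> ball 0 1"
abbreviation imag :: "real => complex" where "imag \<equiv> \<lambda>y. \<i> * of_real y"

section \<open>Length of curves\<close>

fun polygon_length :: "(real => complex) => real list => ennreal" where
 "polygon_length g (x # y # xs) = ennreal (dist (g x) (g y)) + polygon_length g (y # xs)"
| "polygon_length g _ = 0"

lemma polygon_length_sum:
 "polygon_length g xs = (\<Sum>i<length xs - 1. ennreal (dist (g (xs ! i)) (g (xs ! Suc i))))"
proof (induction g xs rule: polygon_length.induct)
 case (1 g x y xs)
 have "(\<Sum>i<length (x # y # xs) - 1. ennreal (dist (g ((x # y # xs) ! i)) (g ((x # y # xs) ! Suc i)))) =
  (\<Sum>i<Suc (length xs). ennreal (dist (g ((x # y # xs) ! i)) (g ((x # y # xs) ! Suc i))))" by simp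
 also have "... = ennreal (dist (g x) (g y)) + (\<Sum>i<length xs. ennreal (dist (g ((y # xs) ! i)) (g ((y # xs) ! Suc i))))" by (subst sum.lessThan_Suc_shift) simp
 finally show ?case using 1 by simp
qed auto

lemma curve_length_eq: "curve_length I g = (SUP xs \<in> {xs. sorted xs \<and> set xs \<subseteq> I}. polygon_length g xs)"
 unfolding curve_length_def polygon_length_sum by (rule refl)

lemma polygon_length_le: "sorted xs ==> set xs \<subseteq> I ==> polygon_length g xs <= curve_length I g" unfolding curve_length_eq by (intro SUP_upper) auto

lemma curve_length_leI: "(!!xs. sorted xs ==> set xs \<subseteq> I ==> polygon_length g xs <= L) ==> curve_length I g <= L"
 unfolding curve_length_eq by (intro SUP_least) auto

lemma curve_length_mono: "I \<subseteq> I' ==> curve_length I g <= curve_length I' g" by (intro curve_length_leI polygon_length_le) auto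

lemma polygon_length_cong: "(!!x. x \<in> set xs ==> g x = h x) ==> polygon_length g xs = polygon_length h xs" by (induction g xs rule: polygon_length.induct) auto

lemma curve_length_cong: "(!!x. x \<in> I ==> g x = h x) ==> curve_length I g = curve_length I h"
 unfolding curve_length_eq by (intro SUP_cong refl polygon_length_cong) auto

lemma dist_le_curve_length: "x \<in> I ==> y \<in> I ==> ennreal (dist (g x) (g y)) <= curve_length I g"
proof (induction x y rule: linorder_wlog)
 case (le x y)
 thus ?case using polygon_length_le[of "[x,y]" I g] by simp
qed (simp add: dist_commute)

lemma polygon_length_append: "polygon_length g (xs @ m # ys) = polygon_length g (xs @ [m]) + polygon_length g (m # ys)"
proof (induction g xs rule: polygon_length.induct)
 case ("2_2" g v)
 thus ?case by (cases ys) auto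
qed (auto simp: add.assoc)

text \<open>A new vertex does not shorten a polygon, by the triangle inequality.\<close>

lemma polygon_length_insert: "polygon_length g (xs @ ys) <= polygon_length g (xs @ [m]) + polygon_length g (m # ys)"
proof (induction g xs rule: polygon_length.induct)
 case (1 g x y xs)
 thus ?case by (simp add: add.assoc add_left_mono)
next
 case ("2_1" g)
 thus ?case by (cases ys) auto
next
 case ("2_2" g v)
 show ?case
 proof (cases ys)
  case (Cons y zs)
  have "ennreal (dist (g v) (g y)) <= ennreal (dist (g v) (g m)) + ennreal (dist (g m) (g y))" by (simp add: dist_triangle flip: ennreal_plus)
  thus ?thesis using Cons by (simp add: add_right_mono flip: add.assoc)
 qed auto
qed

lemma polygon_length_map: "polygon_length g (map h xs) = polygon_length (g \<circ> h) xs"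
proof (induction xs)
 case (Cons x xs)
 thus ?case by (cases xs) auto
qed simp

lemma polygon_length_rev: "polygon_length g (rev xs) = polygon_length g xs"
proof (induction g xs rule: polygon_length.induct)
 case (1 g x y xs)
 have "polygon_length g (rev (x # y # xs)) = polygon_length g (rev xs @ y # [x])" by simp
 also have "... = polygon_length g (rev xs @ [y]) + polygon_length g [y, x]" by (rule polygon_length_append)
 finally show ?case using 1 by (simp add: dist_commute add.commute)
qed auto

lemma curve_length_compose_mono:
 assumes "mono_on I h" "h ` I \<subseteq> I'" shows "curve_length I (g \<circ> h) <= curve_length I' g"
proof (rule curve_length_leI)
 fix xs assume "sorted xs" "set xs \<subseteq> I"
 hence "sorted (map h xs)" using assms(1) by (auto simp: sorted_map sorted_wrt_iff_nth_less monotone_on_def subset_iff)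
 thus "polygon_length (g \<circ> h) xs <= curve_length I' g"
  using assms(2) \<open>set xs \<subseteq> I\<close> polygon_length_le[of "map h xs" I' g] by (auto simp: polygon_length_map)
qed

lemma curve_length_compose_antimono:
 assumes "antimono_on I h" "h ` I \<subseteq> I'" shows "curve_length I (g \<circ> h) <= curve_length I' g"
proof (rule curve_length_leI)
 fix xs assume "sorted xs" "set xs \<subseteq> I"
 hence "sorted (rev (map h xs))" using assms(1) unfolding sorted_wrt_rev sorted_wrt_map by (auto simp: sorted_wrt_iff_nth_less monotone_on_def subset_iff)
 thus "polygon_length (g \<circ> h) xs <= curve_length I' g" using assms(2) \<open>set xs \<subseteq> I\<close> polygon_length_le[of "rev (map h xs)" I' g]
  unfolding polygon_length_rev by (auto simp: polygon_length_map)
qed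

text \<open>A continuous injection of an interval is monotone in one direction or the other, so that curve length does not depend on the parametrization of an arc.\<close>

lemma curve_length_compose_inj:
 fixes h :: "real => real"
 assumes "is_interval I" "continuous_on I h" "inj_on h I" "h ` I \<subseteq> I'"
 shows "curve_length I (g \<circ> h) <= curve_length I' g"
proof -
 have "strict_mono_on I h \<or> strict_antimono_on I h" using injective_eq_monotone_map assms by blast
 thus ?thesis
 proof
  assume "strict_mono_on I h"
  thus ?thesis using assms(4) by (intro curve_length_compose_mono strict_mono_on_imp_mono_on)
 next
  assume "strict_antimono_on I h"
  hence "antimono_on I h" by (auto simp: monotone_on_def order_le_less)
  thus ?thesis using assms(4) by (intro curve_length_compose_antimono)
 qed
qed

lemma curve_length_split:
 assumes m: "m \<in> I" shows "curve_length I g = curve_length (I \<inter> {..m}) g + curve_length (I \<inter> {m..}) g"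
proof (rule antisym)
 show "curve_length I g <= curve_length (I \<inter> {..m}) g + curve_length (I \<inter> {m..}) g"
 proof (rule curve_length_leI)
  fix xs assume xs: "sorted xs" "set xs \<subseteq> I"
  define ys where "ys = takeWhile (\<lambda>x. x <= m) xs"
  define zs where "zs = dropWhile (\<lambda>x. x <= m) xs"
  have e: "xs = ys @ zs" by (simp add: ys_def zs_def)
  have ys: "sorted ys" "set ys \<subseteq> I \<inter> {..m}" using xs unfolding e by (auto simp: sorted_append) (auto simp: ys_def dest: set_takeWhileD)
  have "m <= z" if "z \<in> set zs" for z
  proof -
   have "zs \<noteq> []" using that by auto
   hence "\<not> hd zs <= m" unfolding zs_def by (rule hd_dropWhile)
   moreover have "hd zs <= z" using xs(1) that \<open>zs \<noteq> []\<close> unfolding e by (cases zs) (auto simp: sorted_append)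
   ultimately show ?thesis by linarith
  qed
  hence "sorted (m # zs)" "set (m # zs) \<subseteq> I \<inter> {m..}" "sorted (ys @ [m])" "set (ys @ [m]) \<subseteq> I \<inter> {..m}"
   using xs ys m unfolding e by (auto simp: sorted_append)
  hence "polygon_length g (ys @ [m]) + polygon_length g (m # zs) <= curve_length (I \<inter> {..m}) g + curve_length (I \<inter> {m..}) g"
   by (intro add_mono polygon_length_le)
  thus "polygon_length g xs <= curve_length (I \<inter> {..m}) g + curve_length (I \<inter> {m..}) g" unfolding e using polygon_length_insert order_trans by blast
 qed
 have "polygon_length g xs + polygon_length g ys <= curve_length I g"
  if xs: "sorted xs" "set xs \<subseteq> I \<inter> {..m}" and ys: "sorted ys" "set ys \<subseteq> I \<inter> {m..}" for xs ys
 proof -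
  have "polygon_length g xs <= polygon_length g (xs @ [m])" using polygon_length_insert[of g xs "[]" m] by simp
  moreover have "polygon_length g ys <= polygon_length g (m # ys)" by (cases ys) auto
  ultimately have "polygon_length g xs + polygon_length g ys <= polygon_length g (xs @ m # ys)" using polygon_length_append[of g xs m ys] by (simp add: add_mono)
  also have "... <= curve_length I g" using xs ys m by (intro polygon_length_le) (auto simp: sorted_append intro: order_trans)
  finally show ?thesis .
 qed
 note * = this
 have ne: "{xs. sorted xs \<and> set xs \<subseteq> J} \<noteq> ({} :: real list set)" for J
 proof -
  have "[] \<in> {xs. sorted xs \<and> set xs \<subseteq> J}" by simp
  thus ?thesis by blast
 qed
 have "polygon_length g xs + curve_length (I \<inter> {m..}) g <= curve_length I g" if "sorted xs" "set xs \<subseteq> I \<inter> {..m}" for xs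
  unfolding curve_length_eq[of "I \<inter> {m..}"] by (subst ennreal_SUP_add_right[OF ne], rule SUP_least) (use *[OF that] in auto)
 thus "curve_length (I \<inter> {..m}) g + curve_length (I \<inter> {m..}) g <= curve_length I g" unfolding curve_length_eq[of "I \<inter> {..m}"]
  by (subst ennreal_SUP_add_left[symmetric, OF ne]) (auto intro!: SUP_least)
qed

lemma curve_length_interval_split:
 assumes "a <= m" "m <= b" shows "curve_length {a..b} g = curve_length {a..m} g + curve_length {m..b} g"
proof -
 have "{a..b} \<inter> {..m} = {a..m}" "{a..b} \<inter> {m..} = {m..b}" using assms by auto
 thus ?thesis using curve_length_split[of m "{a..b}" g] assms by simp
qed

lemma tendsto_polygon_length:
 assumes "!!t. t \<in> set xs ==> ((\<lambda>n. G n t) \<longlongrightarrow> g t) F"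
 shows "((\<lambda>n. polygon_length (G n) xs) \<longlongrightarrow> polygon_length g xs) F" using assms
proof (induction g xs rule: polygon_length.induct)
 case (1 g x y xs)
 thus ?case by (auto intro!: tendsto_add tendsto_ennrealI tendsto_dist)
qed auto

text \<open>The length of each inscribed polygon is continuous under pointwise convergence; a supremum of continuous functions is lower semicontinuous.\<close>

lemma curve_length_lower_semicontinuous:
 assumes "!!t. t \<in> I ==> ((\<lambda>n. G n t) \<longlongrightarrow> g t) F" "F \<noteq> bot"
  and "eventually (\<lambda>n. curve_length I (G n) <= B n) F" "(B \<longlongrightarrow> L) F"
 shows "curve_length I g <= L"
proof (rule curve_length_leI)
 fix xs assume xs: "sorted xs" "set xs \<subseteq> I"
 show "polygon_length g xs <= L"
 proof (rule tendsto_le[OF assms(2,4) tendsto_polygon_length[of xs G g F]])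
  show "((\<lambda>n. G n t) \<longlongrightarrow> g t) F" if "t \<in> set xs" for t using assms(1) xs that by auto
  show "eventually (\<lambda>n. polygon_length (G n) xs <= B n) F" using assms(3) by eventually_elim (use polygon_length_le[OF xs] order_trans in blast)
 qed
qed

lemma curve_length_compare:
 assumes cmp: "!!x y. x \<in> I ==> y \<in> I ==> dist (g x) (g y) <= L * dist (h x) (h y)" and L: "L \<ge> 0"
 shows "curve_length I g <= ennreal L * curve_length I h"
proof (rule curve_length_leI)
 fix xs assume xs: "sorted xs" "set xs \<subseteq> I"
 have "polygon_length g xs <= ennreal L * polygon_length h xs" using xs(2)
 proof (induction xs)
  case C: (Cons x xs)
  show ?case
  proof (cases xs)
   case (Cons y ys)
   have "dist (g x) (g y) <= L * dist (h x) (h y)" using cmp C.prems Cons by simp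
   hence "ennreal (dist (g x) (g y)) <= ennreal L * ennreal (dist (h x) (h y))" using L by (simp add: ennreal_leI flip: ennreal_mult)
   thus ?thesis using C.IH C.prems Cons by (simp add: distrib_left add_mono)
  qed auto
 qed auto
 also have "... <= ennreal L * curve_length I h" by (intro mult_left_mono polygon_length_le xs) auto
 finally show "polygon_length g xs <= ennreal L * curve_length I h" .
qed

lemma polygon_length_Lipschitz:
 assumes "sorted (x # xs)" "!!u v. u \<in> set (x # xs) ==> v \<in> set (x # xs) ==> u <= v ==> dist (g u) (g v) <= L * (v - u)" "L \<ge> 0"
 shows "polygon_length g (x # xs) <= ennreal (L * (last (x # xs) - x))" using assms
proof (induction xs arbitrary: x)
 case (Cons y xs)
 have xy: "x <= y" "y <= last (y # xs)" using Cons.prems(1) by auto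
 have "polygon_length g (x # y # xs) <= ennreal (L * (y - x)) + ennreal (L * (last (y # xs) - y))" unfolding polygon_length.simps
 proof (rule add_mono)
  show "ennreal (dist (g x) (g y)) <= ennreal (L * (y - x))" using Cons.prems xy by (intro ennreal_leI) auto
  show "polygon_length g (y # xs) <= ennreal (L * (last (y # xs) - y))" using Cons.prems by (intro Cons.IH) auto
 qed
 also have "... = ennreal (L * (last (x # y # xs) - x))" using xy Cons.prems(3) by (subst ennreal_plus[symmetric]) (auto simp: algebra_simps intro!: mult_left_mono)
 finally show ?case .
qed auto

lemma curve_length_Lipschitz:
 assumes "I \<subseteq> {a..b}" "!!u v. u \<in> I ==> v \<in> I ==> u <= v ==> dist (g u) (g v) <= L * (v - u)" "L \<ge> 0" "a <= b"
 shows "curve_length I g <= ennreal (L * (b - a))"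
proof (rule curve_length_leI)
 fix xs assume xs: "sorted xs" "set xs \<subseteq> I"
 show "polygon_length g xs <= ennreal (L * (b - a))"
 proof (cases xs)
  case (Cons x zs)
  have "polygon_length g xs <= ennreal (L * (last xs - x))" using xs assms(2,3) unfolding Cons by (intro polygon_length_Lipschitz) auto
  also have "... <= ennreal (L * (b - a))"
  proof -
   have "last xs \<in> {a..b}" "x \<in> {a..b}" using xs assms(1) Cons last_in_set[of xs] by auto
   thus ?thesis using assms(3) by (intro ennreal_leI mult_left_mono) auto
  qed
  finally show ?thesis .
 qed auto
qed

text \<open>The affine contractions of the closed interval into the open one tend to the identity; apply lower semicontinuity.\<close>

lemma curve_length_open_interval:
 assumes "continuous_on {a..b} g" "a < b"
 shows "curve_length {a<..<b} g = curve_length {a..b} g"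
proof (rule antisym)
 show "curve_length {a<..<b} g <= curve_length {a..b} g" by (intro curve_length_mono) auto
 define m where "m = (a + b) / 2"
 define h where "h n t = m + (1 - 1 / real (n+2)) * (t - m)" for n :: nat and t :: real
 have mab: "a < m" "m < b" using assms by (auto simp: m_def)
 have h: "h n t \<in> {a<..<b}" if "t \<in> {a..b}" for n t
 proof -
  define q where "q = 1 - 1 / real (n+2)"
  have q: "0 < q" "q < 1" by (auto simp: q_def field_simps)
  have "q * (t - m) <= q * (b - m)" "q * (a - m) <= q * (t - m)" using that q by (auto intro!: mult_left_mono)
  moreover have "q * (b - m) < 1 * (b - m)" using q mab by (intro mult_strict_right_mono) auto
  moreover have "1 * (a - m) < q * (a - m)" using q mab by (intro mult_strict_right_mono_neg) auto
  ultimately have "m + q * (t - m) < b" and "a < m + q * (t - m)" by simp_all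
  thus ?thesis by (simp add: h_def q_def)
 qed
 show "curve_length {a..b} g <= curve_length {a<..<b} g"
 proof (rule curve_length_lower_semicontinuous[where G = "\<lambda>n. g \<circ> h n" and F = sequentially])
  fix t assume t: "t \<in> {a..b}"
  have "(\<lambda>n. h n t) \<longlonglongrightarrow> m + (1 - 0) * (t - m)" unfolding h_def by (intro tendsto_intros) real_asymp
  hence "(\<lambda>n. h n t) \<longlonglongrightarrow> t" by simp
  thus "(\<lambda>n. (g \<circ> h n) t) \<longlonglongrightarrow> g t"
   unfolding o_def using h[OF t] t by (intro continuous_on_tendsto_compose[OF assms(1)]) (auto intro!: eventuallyI less_imp_le)
 next
  have "mono_on {a..b} (h n)" for n by (auto simp: h_def monotone_on_def intro!: mult_left_mono)
  thus "eventually (\<lambda>n. curve_length {a..b} (g \<circ> h n) <= curve_length {a<..<b} g) sequentially"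
   using h by (intro eventuallyI curve_length_compose_mono) auto
 qed auto
qed

text \<open>The arc \<open>a\<close> runs inside the arc \<open>b\<close>, whose parameter is a continuous function \<open>b'\<close> of the point.\<close>

lemma curve_length_reparametrize:
 fixes a b :: "real => complex"
 assumes "is_interval I" "continuous_on I a" "inj_on a I" "a ` I \<subseteq> b ` I'"
  and b: "continuous_on (b ` I') b'" "!!t. t \<in> I' ==> b' (b t) = t"
 shows "curve_length I (f \<circ> a) <= curve_length I' (f \<circ> b)"
proof -
 have bb: "b (b' z) = z" "b' z \<in> I'" if "z \<in> b ` I'" for z using that b(2) by auto
 have "curve_length I (f \<circ> a) = curve_length I ((f \<circ> b) \<circ> (b' \<circ> a))" using assms(4) bb by (intro curve_length_cong) auto
 also have "... <= curve_length I' (f \<circ> b)"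
 proof (rule curve_length_compose_inj[OF assms(1)])
  show "continuous_on I (b' \<circ> a)" using assms by (intro continuous_on_compose continuous_on_subset[OF b(1)])
  show "inj_on (b' \<circ> a) I" using assms(3,4) bb by (auto simp: inj_on_def) (metis image_subset_iff)
  show "(b' \<circ> a) ` I \<subseteq> I'" using assms(4) bb by auto
 qed
 finally show ?thesis .
qed

section \<open>Univalent meromorphic functions and the two constants\<close>

lemma meromorphic_univalentD:
 assumes "meromorphic_univalent F" "s \<in> disk" "is_pole F s"
 shows "F holomorphic_on disk - {s}" "inj_on F (disk - {s})"
proof -
 have nm: "F nicely_meromorphic_on disk" and inj: "inj_on (sphere_value F) disk" using assms(1) by (auto simp: meromorphic_univalent_def)
 have np: "\<not> is_pole F z" if "z \<in> disk - {s}" for z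
 proof
  assume "is_pole F z"
  hence "sphere_value F z = sphere_value F s" using assms(3) by (simp add: sphere_value_def)
  thus False using inj that assms(2) by (auto dest: inj_onD)
 qed
 have "F analytic_on (disk - {s})" unfolding analytic_on_analytic_at[of F "disk - {s}"] using np nm nicely_meromorphic_on_imp_analytic_at[of F "disk"] by blast
 thus "F holomorphic_on disk - {s}" by (rule analytic_imp_holomorphic)
 show "inj_on F (disk - {s})"
 proof (rule inj_onI)
  fix x y assume xy: "x \<in> disk - {s}" "y \<in> disk - {s}" "F x = F y"
  hence "sphere_value F x = sphere_value F y" using np by (simp add: sphere_value_def)
  thus "x = y" using inj xy by (auto dest: inj_onD)
 qed
qed

text \<open>A pole of higher order would make the reciprocal, which has a zero of that order, non-injective near the pole.\<close>

lemma zorder_univalent_pole: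
 assumes S: "open S" "p \<in> S" and hol: "f holomorphic_on S - {p}" and inj: "inj_on f (S - {p})" and pole: "is_pole f p"
 shows "zorder f p = -1"
proof -
 define g where "g = zor_poly f p"
 define N where "N = nat (- zorder f p)"
 obtain r where r: "r > 0" "cball p r \<subseteq> S" "g holomorphic_on cball p r"
  "\<forall>w\<in>cball p r - {p}. f w = g w / (w - p) ^ N \<and> g w \<noteq> 0" and z0: "zorder f p < 0" "g p \<noteq> 0"
  using zorder_exist_pole[OF hol S pole] unfolding g_def N_def by auto
 have N: "zorder f p = - int N" "N > 0" using z0 by (auto simp: N_def)
 define h where "h w = (w - p) ^ N * inverse (g w)" for w
 have gnz: "g w \<noteq> 0" if "w \<in> ball p r" for w using r(4) z0(2) that by (cases "w = p") auto
 have holg: "g holomorphic_on ball p r" using r(3) by (rule holomorphic_on_subset) auto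
 have holh: "h holomorphic_on ball p r" unfolding h_def using gnz holg by (intro holomorphic_intros) auto
 have hf: "h w = inverse (f w)" "f w \<noteq> 0" if "w \<in> ball p r" "w \<noteq> p" for w
 proof -
  have "f w = g w / (w - p) ^ N" "g w \<noteq> 0" using r(4) that by auto
  thus "h w = inverse (f w)" "f w \<noteq> 0" using that by (simp_all add: h_def divide_inverse)
 qed
 have "inj_on h (ball p r)"
 proof (rule inj_onI)
  fix x y assume xy: "x \<in> ball p r" "y \<in> ball p r" "h x = h y"
  have hp: "h p = 0" using N by (simp add: h_def)
  show "x = y"
  proof (cases "x = p \<or> y = p")
   case True thus ?thesis using hf xy hp by (metis inverse_nonzero_iff_nonzero)
  next
   case False
   hence "f x = f y" using hf xy by (metis inverse_eq_iff_eq)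
   moreover have "x \<in> S - {p}" "y \<in> S - {p}" using xy False r(2) by auto
   ultimately show ?thesis using inj by (auto dest: inj_onD)
  qed
 qed
 hence dn: "deriv h p \<noteq> 0" using holomorphic_injective_imp_regular[OF holh open_ball, of p] r(1) by simp
 have "N = 1"
 proof (rule ccontr)
  assume "N \<noteq> 1"
  then obtain m where m: "N = Suc (Suc m)" using N(2) by (cases N; cases "N - 1") auto
  have "(g has_field_derivative deriv g p) (at p)" using holomorphic_derivI[OF holg open_ball, of p] r(1) by simp
  hence "(h has_field_derivative 0) (at p)" unfolding h_def m using z0(2) by (auto intro!: derivative_eq_intros)
  thus False using dn DERIV_imp_deriv by blast
 qed
 thus ?thesis using N by simp
qed

lemma M_classI:
 assumes p: "0 <= p" "p < 1" and hol: "f holomorphic_on disk - {of_real p}"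
  and inj: "inj_on f (disk - {of_real p})" and pole: "is_pole f (of_real p)" and f0: "f (of_real p) = 0"
  and cont: "continuous_on (disk \<union> left_semicircle - {of_real p}) f"
 shows "f \<in> M_class p"
proof -
 have pD: "complex_of_real p \<in> disk" using p by simp
 have op: "open (disk - {complex_of_real p})" by (intro open_delete open_ball)
 have an: "f analytic_on disk - {of_real p}" using hol op by (simp add: analytic_on_open)
 have np: "\<not> is_pole f z" if "z \<in> disk - {of_real p}" for z
  using an that analytic_at_imp_no_pole[of f z] by (meson analytic_on_subset empty_subsetI insert_subset)
 have "f nicely_meromorphic_on disk"
 proof (rule nicely_meromorphic_onI_open[of _ _ "{of_real p}"])
  show "isolated_singularity_at f x" if "x \<in> disk" for x
  proof (cases "x = of_real p")
   case True
   thus ?thesis unfolding isolated_singularity_at_def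
   proof -
    obtain r where r: "r > 0" "ball x r \<subseteq> disk" by (rule openE[OF open_ball \<open>x \<in> disk\<close>])
    have "f analytic_on ball x r - {x}" by (rule analytic_on_subset[OF an]) (use r(2) True in blast)
    thus "\<exists>r>0. f analytic_on ball x r - {x}" using r(1) by blast
   qed
  next
   case False
   hence "f analytic_on {x}" using an that by (meson analytic_on_subset Diff_iff empty_subsetI insert_subset singletonD)
   thus ?thesis by (rule isolated_singularity_at_analytic)
  qed
 qed (use an pole f0 in \<open>simp_all\<close>)
 moreover have "inj_on (sphere_value f) disk"
 proof (rule inj_onI)
  fix x y assume xy: "x \<in> disk" "y \<in> disk" "sphere_value f x = sphere_value f y"
  show "x = y"
  proof (cases "x = of_real p \<or> y = of_real p")
   case True thus ?thesis using xy np[of x] np[of y] pole by (auto simp: sphere_value_def split: if_splits)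
  next
   case False
   hence "f x = f y" using xy np[of x] np[of y] by (auto simp: sphere_value_def split: if_splits)
   thus ?thesis using inj xy False by (auto dest: inj_onD)
  qed
 qed
 ultimately show ?thesis unfolding M_class_def meromorphic_univalent_def using pole cont zorder_univalent_pole[OF open_ball pD hol inj pole] by simp
qed

lemma dist_cis: "(dist (cis a) (cis b))\<^sup>2 = 4 * (sin ((a - b) / 2))\<^sup>2"
proof -
 have "(dist (cis a) (cis b))\<^sup>2 = (cos a - cos b)\<^sup>2 + (sin a - sin b)\<^sup>2" by (simp add: dist_norm cmod_power2)
 also have "... = 2 - 2 * (cos a * cos b + sin a * sin b)" using sin_cos_squared_add[of a] sin_cos_squared_add[of b] by (simp add: power2_eq_square algebra_simps)
 also have "... = 2 - 2 * cos (a - b)" by (simp add: cos_diff)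
 also have "... = 2 - 2 * cos (2 * ((a - b) / 2))" by (simp only: nonzero_mult_div_cancel_left times_divide_eq_right)
 also have "... = 4 * (sin ((a - b) / 2))\<^sup>2" unfolding cos_double_sin by simp
 finally show ?thesis .
qed

lemma dist_cis_le: "dist (cis a) (cis b) <= \<bar>a - b\<bar>"
proof (rule power2_le_imp_le)
 have "(sin ((a - b) / 2))\<^sup>2 <= ((a - b) / 2)\<^sup>2" using abs_sin_x_le_abs_x[of "(a - b) / 2"] by (simp only: abs_le_square_iff)
 thus "(dist (cis a) (cis b))\<^sup>2 <= \<bar>a - b\<bar>\<^sup>2" unfolding dist_cis by (simp add: power_divide)
qed simp

lemma left_semicircle_eq: "left_semicircle = cis ` {pi/2<..<3*pi/2}"
proof (intro equalityI subsetI)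
 fix z assume "z \<in> left_semicircle"
 hence z: "norm z = 1" "Re z < 0" by (auto simp: left_semicircle_def)
 define t where "t = Arg (-z)"
 have "-z \<noteq> 0" "0 < Re (-z)" using z by auto
 hence "\<bar>t\<bar> < pi/2" "-z = cis t" unfolding t_def using Re_Ln_pos_lt[of "-z"] z(1) Arg_eq_Im_Ln[of "-z"] Arg_eq[of "-z"] by (auto simp: cis_conv_exp)
 hence "z = - cis t" using \<open>-z = cis t\<close> by (metis minus_minus)
 hence "z = cis (pi + t)" by (simp add: cis_mult[symmetric])
 moreover have "pi + t \<in> {pi/2<..<3*pi/2}" using \<open>\<bar>t\<bar> < pi/2\<close> by (auto simp: abs_less_iff)
 ultimately show "z \<in> cis ` {pi/2<..<3*pi/2}" by blast
next
 fix z assume "z \<in> cis ` {pi/2<..<3*pi/2}"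
 then obtain t where t: "z = cis t" "t \<in> {pi/2<..<3*pi/2}" by blast
 have "cos (t - pi) > 0" using t by (intro cos_gt_zero_pi) auto
 thus "z \<in> left_semicircle" using t by (simp add: left_semicircle_def cos_diff)
qed

lemma semicircle_image_length_pos_inj:
 assumes "inj_on f left_semicircle"
 shows "semicircle_image_length f > 0"
proof -
 have c: "pi \<in> {pi/2<..<3*pi/2}" "2*pi/3 \<in> {pi/2<..<3*pi/2}" using pi_gt_zero by (auto simp: field_simps)
 hence m: "cis pi \<in> left_semicircle" "cis (2*pi/3) \<in> left_semicircle" unfolding left_semicircle_eq by blast+
 have "cos pi \<noteq> cos (2*pi/3)" using cos_120 by simp
 hence "cis pi \<noteq> cis (2*pi/3)" by (metis cis.simps(1))
 hence "f (cis pi) \<noteq> f (cis (2*pi/3))" using inj_onD[OF assms _ m] by blast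
 hence "0 < ennreal (dist (f (cis pi)) (f (cis (2*pi/3))))" by simp
 also have "... <= semicircle_image_length f" unfolding semicircle_image_length_def by (rule dist_le_curve_length[OF c])
 finally show ?thesis .
qed

context
 fixes p :: real and F :: "complex => complex"
 assumes p: "0 < p" "p <= 1" and F: "F = (\<lambda>z. 1 / (z - of_real p))"
begin

lemma dist_F: "z \<noteq> of_real p ==> w \<noteq> of_real p ==>
 (dist (F z) (F w))\<^sup>2 = (dist z w)\<^sup>2 / ((norm (z - of_real p))\<^sup>2 * (norm (w - of_real p))\<^sup>2)"
proof -
 assume "z \<noteq> of_real p" "w \<noteq> of_real p"
 hence "F z - F w = (w - z) / ((z - of_real p) * (w - of_real p))" by (simp add: F field_simps)
 thus ?thesis by (simp add: dist_norm norm_divide norm_mult power_divide power_mult_distrib norm_minus_commute)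
qed

lemma norm_cis_p: "(norm (cis t - of_real p))\<^sup>2 = 1 + p\<^sup>2 - 2 * p * cos t"
 using sin_cos_squared_add[of t] by (simp add: cmod_power2) (simp add: power2_eq_square algebra_simps)

text \<open>For the inversion in \<open>p\<close> the semicircle is compared point by point with the diameter: \<open>cis t\<close> corresponds to \<open>\<i> cot (t/2)\<close>. For \<open>p = 1\<close> the semicircle becomes a segment and the diameter a semicircle on it.\<close>

lemma dist_F_compare:
 assumes a: "pi/2 < a" "a < 3*pi/2" and b: "pi/2 < b" "b < 3*pi/2"
 shows "dist (F (cis a)) (F (cis b)) <= dist (F (imag (cot (a/2)))) (F (imag (cot (b/2))))"
proof (rule power2_le_imp_le)
 have s: "sin (t/2) > 0" "cos t <= 0" if "pi/2 < t" "t < 3*pi/2" for t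
 proof -
  show "sin (t/2) > 0" using that by (intro sin_gt_zero) auto
  have "cos (t - pi) \<ge> 0" using that by (intro cos_ge_zero) auto
  thus "cos t <= 0" by (simp add: cos_diff)
 qed
 define \<sigma> where "\<sigma> = (sin ((a - b) / 2))\<^sup>2"
 define P where "P t = 1 + p\<^sup>2 - 2 * p * cos t" for t
 define Q where "Q t = p\<^sup>2 + (cot (t/2))\<^sup>2" for t
 have P0: "P t > 0" if "cos t <= 0" for t
 proof -
  have "p * cos t <= 0" using that p by (intro mult_nonneg_nonpos) auto
  thus ?thesis unfolding P_def using zero_le_power2[of p] by linarith
 qed
 have Q0: "Q t > 0" for t using p by (simp add: Q_def add_pos_nonneg)
 have PQ: "2 * (sin (t/2))\<^sup>2 * Q t <= P t" if t: "pi/2 < t" "t < 3*pi/2" for t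
 proof -
  have c2: "2 * (sin (t/2))\<^sup>2 = 1 - cos t" "2 * (cos (t/2))\<^sup>2 = 1 + cos t" using cos_double_sin[of "t/2"] cos_double_cos[of "t/2"] by auto
  have "2 * (sin (t/2))\<^sup>2 * Q t = p\<^sup>2 * (2 * (sin (t/2))\<^sup>2) + 2 * (cos (t/2))\<^sup>2"
   using s(1)[OF t] by (simp add: Q_def cot_def power_divide field_simps)
  also have "... = p\<^sup>2 * (1 - cos t) + (1 + cos t)" unfolding c2 ..
  also have "... <= P t"
  proof -
   have "p\<^sup>2 <= p" using p by (simp add: power2_eq_square mult_left_le)
   hence "0 <= 1 + 2 * p - p\<^sup>2" using p by linarith
   hence "cos t * (1 + 2 * p - p\<^sup>2) <= 0" using s(2)[OF t] by (simp add: mult_nonpos_nonneg)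
   thus ?thesis by (simp add: P_def algebra_simps)
  qed
  finally show ?thesis .
 qed
 have ne: "cis t \<noteq> of_real p" "imag x \<noteq> of_real p" if "pi/2 < t" "t < 3*pi/2" for t x using s(2)[OF that] p by (auto simp: complex_eq_iff)
 have L: "(dist (F (cis a)) (F (cis b)))\<^sup>2 = 4 * \<sigma> / (P a * P b)" using ne a b by (subst dist_F) (auto simp: dist_cis norm_cis_p P_def \<sigma>_def)
 have nQ: "(norm (imag (cot (t/2)) - of_real p))\<^sup>2 = Q t" for t by (simp add: cmod_power2 Q_def)
 have dc: "(dist (imag (cot (a/2))) (imag (cot (b/2))))\<^sup>2 = \<sigma> / ((sin (a/2))\<^sup>2 * (sin (b/2))\<^sup>2)"
 proof -
  have "cot (a/2) - cot (b/2) = - sin ((a-b)/2) / (sin (a/2) * sin (b/2))"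
   using s(1)[OF a] s(1)[OF b] by (simp add: cot_def field_simps sin_diff[of "a/2" "b/2", unfolded diff_divide_distrib[symmetric]])
  hence "(cot (a/2) - cot (b/2))\<^sup>2 = \<sigma> / ((sin (a/2))\<^sup>2 * (sin (b/2))\<^sup>2)" by (simp add: \<sigma>_def power_divide power_mult_distrib)
  moreover have "(dist (imag (cot (a/2))) (imag (cot (b/2))))\<^sup>2 = (cot (a/2) - cot (b/2))\<^sup>2" by (simp add: dist_norm cmod_power2)
  ultimately show ?thesis by simp
 qed
 have R: "(dist (F (imag (cot (a/2)))) (F (imag (cot (b/2)))))\<^sup>2 = \<sigma> / (((sin (a/2))\<^sup>2 * (sin (b/2))\<^sup>2) * (Q a * Q b))"
  using ne[OF a] by (subst dist_F) (simp_all add: nQ dc)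
 have "(2 * (sin (a/2))\<^sup>2 * Q a) * (2 * (sin (b/2))\<^sup>2 * Q b) <= P a * P b"
  using PQ[OF a] PQ[OF b] Q0 P0 s(2)[OF a] by (intro mult_mono) (auto simp: less_imp_le)
 hence le: "4 * (((sin (a/2))\<^sup>2 * (sin (b/2))\<^sup>2) * (Q a * Q b)) <= P a * P b" by (simp add: algebra_simps)
 have pos: "((sin (a/2))\<^sup>2 * (sin (b/2))\<^sup>2) * (Q a * Q b) > 0" using s(1)[OF a] s(1)[OF b] Q0 by (intro mult_pos_pos) auto
 have "4 * \<sigma> / (P a * P b) <= 4 * \<sigma> / (4 * (((sin (a/2))\<^sup>2 * (sin (b/2))\<^sup>2) * (Q a * Q b)))"
  using le pos by (intro divide_left_mono) (auto simp: \<sigma>_def P0 s(2)[OF a] s(2)[OF b])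
 thus "(dist (F (cis a)) (F (cis b)))\<^sup>2 <= (dist (F (imag (cot (a/2)))) (F (imag (cot (b/2)))))\<^sup>2" unfolding L R by simp
qed simp

lemma semicircle_le_diameter_F: "semicircle_image_length F <= diameter_image_length F"
proof -
 have s: "sin (t/2) > 0" if "t \<in> {pi/2<..<3*pi/2}" for t using that by (intro sin_gt_zero) auto
 have "semicircle_image_length F <= ennreal 1 * curve_length {pi/2<..<3*pi/2} ((\<lambda>v. F (imag v)) \<circ> (\<lambda>t. cot (t/2)))"
  unfolding semicircle_image_length_def using dist_F_compare by (intro curve_length_compare) auto
 also have "... = curve_length {pi/2<..<3*pi/2} ((\<lambda>v. F (imag v)) \<circ> (\<lambda>t. cot (t/2)))" by simp
 also have "... <= curve_length {-1<..<1} (\<lambda>v. F (imag v))"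
 proof (rule curve_length_compose_antimono)
  show "antimono_on {pi/2<..<3*pi/2} (\<lambda>t. cot (t/2))" unfolding monotone_on_def
  proof (intro ballI impI)
   fix a b assume ab: "a \<in> {pi/2<..<3*pi/2}" "b \<in> {pi/2<..<3*pi/2}" "a <= b"
   have "cot (a/2) - cot (b/2) = sin ((b-a)/2) / (sin (a/2) * sin (b/2))"
    using s[OF ab(1)] s[OF ab(2)] by (simp add: cot_def field_simps sin_diff[of "b/2" "a/2", unfolded diff_divide_distrib[symmetric]])
   moreover have "sin ((b-a)/2) \<ge> 0" using ab by (intro sin_ge_zero) auto
   moreover have "sin (a/2) * sin (b/2) > 0" using s[OF ab(1)] s[OF ab(2)] by simp
   ultimately show "cot (a/2) \<ge> cot (b/2)" by (smt (verit) divide_nonneg_pos)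
  qed
  show "(\<lambda>t. cot (t/2)) ` {pi/2<..<3*pi/2} \<subseteq> {-1<..<1}"
  proof safe
   fix t assume t: "t \<in> {pi/2<..<3*pi/2}"
   have "cos (t - pi) > 0" using t by (intro cos_gt_zero_pi) auto
   hence "cos t < 0" by (simp add: cos_diff)
   hence "(cos (t/2))\<^sup>2 < (sin (t/2))\<^sup>2" using cos_double[of "t/2"] by simp
   hence "\<bar>cos (t/2)\<bar> < sin (t/2)" using s[OF t] by (metis abs_of_pos abs_square_less_1 power2_abs power_less_imp_less_base less_imp_le)
   hence "\<bar>cot (t/2)\<bar> < 1" using s[OF t] by (simp add: cot_def abs_divide)
   thus "cot (t/2) \<in> {-1<..<1}" by (simp add: abs_less_iff)
  qed
 qed
 finally show ?thesis unfolding diameter_image_length_def .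
qed

lemma semicircle_F_finite: "semicircle_image_length F < \<infinity>" and semicircle_F_pos: "semicircle_image_length F > 0"
proof -
 have ge1: "norm (cis t - of_real p) \<ge> 1" if "t \<in> {pi/2<..<3*pi/2}" for t
 proof -
  have "cos (t - pi) > 0" using that by (intro cos_gt_zero_pi) auto
  hence "cos t < 0" by (simp add: cos_diff)
  hence "p * cos t <= 0" using p by (simp add: mult_nonneg_nonpos)
  hence "1\<^sup>2 <= (norm (cis t - of_real p))\<^sup>2" unfolding norm_cis_p using zero_le_power2[of p] by (simp only: power_one mult.assoc; linarith)
  thus ?thesis by (rule power2_le_imp_le) simp
 qed
 have "semicircle_image_length F <= ennreal (1 * (3*pi/2 - pi/2))" unfolding semicircle_image_length_def
 proof (rule curve_length_Lipschitz)
  fix u v assume uv: "u \<in> {pi/2<..<3*pi/2}" "v \<in> {pi/2<..<3*pi/2}" "u <= v"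
  have ne: "cis u \<noteq> of_real p" "cis v \<noteq> of_real p" using ge1[OF uv(1)] ge1[OF uv(2)] by auto
  define A where "A = (norm (cis u - of_real p))\<^sup>2"
  define B where "B = (norm (cis v - of_real p))\<^sup>2"
  have "1 <= A" "1 <= B" using ge1[OF uv(1)] ge1[OF uv(2)] by (simp_all add: A_def B_def one_le_power)
  hence AB: "1 <= A * B" using mult_mono[of 1 A 1 B] by simp
  have "(dist (F (cis u)) (F (cis v)))\<^sup>2 = (dist (cis u) (cis v))\<^sup>2 / (A * B)" unfolding dist_F[OF ne] A_def B_def ..
  also have "... <= (dist (cis u) (cis v))\<^sup>2 / 1" using AB by (intro divide_left_mono) auto
  finally have "(dist (F (cis u)) (F (cis v)))\<^sup>2 <= (dist (cis u) (cis v))\<^sup>2" by simp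
  hence "dist (F (cis u)) (F (cis v)) <= dist (cis u) (cis v)" by (rule power2_le_imp_le) simp
  also have "... <= 1 * (v - u)" using dist_cis_le[of u v] uv(3) by simp
  finally show "dist (F (cis u)) (F (cis v)) <= 1 * (v - u)" .
 qed auto
 thus "semicircle_image_length F < \<infinity>" by (rule order.strict_trans1) simp
 have "z \<noteq> of_real p" if "z \<in> left_semicircle" for z using that p by (auto simp: left_semicircle_def)
 thus "semicircle_image_length F > 0" by (intro semicircle_image_length_pos_inj) (auto simp: inj_on_def F)
qed

end

text \<open>The function \<open>1 / (z - 1)\<close> maps the semicircle to a segment and the diameter to an arc with the same ends.\<close>

lemma GH_const_ge_1: "GH_const \<ge> 1" unfolding GH_const_def
proof (rule Inf_greatest)
 fix A :: ennreal assume A: "A \<in> {A. \<forall>f. f holomorphic_on disk --> inj_on f disk -->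
  continuous_on (disk \<union> left_semicircle) f --> diameter_image_length f <= A * semicircle_image_length f}"
 define F where "F = (\<lambda>z::complex. 1 / (z - of_real 1))"
 have ne: "z \<noteq> 1" if "z \<in> disk \<union> left_semicircle" for z :: complex using that by (auto simp: left_semicircle_def)
 have "F holomorphic_on disk" "inj_on F disk" "continuous_on (disk \<union> left_semicircle) F"
  unfolding F_def using ne by (auto intro!: holomorphic_intros continuous_intros simp: inj_on_def)
 hence "diameter_image_length F <= A * semicircle_image_length F" using A by blast
 hence *: "semicircle_image_length F <= A * semicircle_image_length F" using semicircle_le_diameter_F[OF _ _ F_def] order_trans by fastforce
 have "semicircle_image_length F < \<infinity>" "semicircle_image_length F > 0" using semicircle_F_finite[OF _ _ F_def] semicircle_F_pos[OF _ _ F_def] by auto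
 thus "1 <= A" using * by (metis ennreal_mult_le_mult_iff mult.commute mult.right_neutral top.not_eq_extremum infinity_ennreal_def not_gr_zero)
qed

lemma GH_pole_const_sup_ge_1: assumes "\<tau> < 1" shows "GH_pole_const_sup \<tau> \<ge> 1"
proof -
 define p where "p = max (1/2) \<tau>"
 have p: "0 < p" "p < 1" "\<tau> <= p" using assms by (auto simp: p_def)
 define F where "F = (\<lambda>z::complex. 1 / (z - of_real p))"
 have len: "semicircle_image_length F < \<infinity>" "semicircle_image_length F > 0" "semicircle_image_length F <= diameter_image_length F"
  using semicircle_F_finite[OF _ _ F_def] semicircle_F_pos[OF _ _ F_def] semicircle_le_diameter_F[OF _ _ F_def] p by auto
 have "F \<in> M_class p" unfolding F_def using p is_pole_inverse[of "of_real p"] by (intro M_classI) (auto intro!: holomorphic_intros continuous_intros simp: inj_on_def)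
 hence "F \<in> M0_class p" using len by (simp add: M0_class_def)
 have "1 = semicircle_image_length F / semicircle_image_length F" using len by (simp add: divide_eq_1_ennreal)
 also have "... <= diameter_image_length F / semicircle_image_length F" using len by (intro divide_right_mono_ennreal)
 also have "... <= GH_pole_const p" unfolding GH_pole_const_def by (intro SUP_upper) fact
 also have "... <= GH_pole_const_sup \<tau>" unfolding GH_pole_const_sup_def using p by (intro SUP_upper) auto
 finally show ?thesis .
qed

text \<open>Multiplication by a positive finite length commutes with infima, so the infimum that defines the constant is itself admissible.\<close>

lemma diameter_le_GH_const:
 assumes "f holomorphic_on disk" "inj_on f disk" "continuous_on (disk \<union> left_semicircle) f"
  and pos: "semicircle_image_length f > 0"
 shows "diameter_image_length f <= GH_const * semicircle_image_length f"
proof (cases "semicircle_image_length f = \<infinity>")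
 case True
 have "GH_const \<noteq> 0" using GH_const_ge_1 by auto
 thus ?thesis using True by (simp add: ennreal_mult_top)
next
 case False
 have "diameter_image_length f / semicircle_image_length f <= GH_const" unfolding GH_const_def
 proof (rule Inf_greatest)
  fix A :: ennreal assume "A \<in> {A. \<forall>f. f holomorphic_on disk --> inj_on f disk -->
  continuous_on (disk \<union> left_semicircle) f --> diameter_image_length f <= A * semicircle_image_length f}"
  hence "diameter_image_length f <= A * semicircle_image_length f" using assms by blast
  thus "diameter_image_length f / semicircle_image_length f <= A" using pos by (intro divide_le_posI_ennreal) (simp_all add: mult.commute)
 qed
 hence "semicircle_image_length f * (diameter_image_length f / semicircle_image_length f) <= semicircle_image_length f * GH_const" by (rule mult_left_mono) simp
 thus ?thesis using pos False by (simp add: ennreal_times_divide mult_divide_eq_ennreal mult.commute)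
qed

lemma diameter_le_GH_pole_const_sup:
 assumes f: "f \<in> M_class p" and p: "\<tau> <= p" "p < 1" and pos: "semicircle_image_length f > 0"
 shows "diameter_image_length f <= GH_pole_const_sup \<tau> * semicircle_image_length f"
proof (cases "semicircle_image_length f = \<infinity>")
 case True
 have "GH_pole_const_sup \<tau> \<noteq> 0" using GH_pole_const_sup_ge_1[of \<tau>] p by auto
 thus ?thesis using True by (simp add: ennreal_mult_top)
next
 case False
 hence "f \<in> M0_class p" using f by (simp add: M0_class_def top.not_eq_extremum)
 hence "diameter_image_length f / semicircle_image_length f <= GH_pole_const p" unfolding GH_pole_const_def by (intro SUP_upper)
 also have "... <= GH_pole_const_sup \<tau>" unfolding GH_pole_const_sup_def using p by (intro SUP_upper) auto
 finally have "semicircle_image_length f * (diameter_image_length f / semicircle_image_length f) <= semicircle_image_length f * GH_pole_const_sup \<tau>"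
  by (rule mult_left_mono) simp
 thus ?thesis using pos False by (simp add: ennreal_times_divide mult_divide_eq_ennreal mult.commute)
qed

section \<open>Koebe's lemma\<close>

text \<open>The maximum principle without continuity up to the boundary: an upper bound for the limits superior at the boundary points suffices.\<close>

lemma maximum_modulus_limsup:
 fixes u :: "complex => complex"
 assumes "open U" "bounded U" "u holomorphic_on U"
  and bd: "!!z e. z \<in> frontier U ==> e > 0 ==> \<exists>d>0. \<forall>y\<in>U. dist y z < d --> norm (u y) <= L + e"
  and w: "w \<in> U"
 shows "norm (u w) <= L"
proof (rule ccontr)
 assume "\<not> norm (u w) <= L"
 define e where "e = (norm (u w) - L) / 2"
 have e: "e > 0" "L + e < norm (u w)" using \<open>\<not> norm (u w) <= L\<close> by (auto simp: e_def field_simps)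
 define S where "S = {z \<in> U. norm (u z) \<ge> norm (u w)}"
 have contu: "continuous_on U u" using assms(3) holomorphic_on_imp_continuous_on by blast
 have "closed S" unfolding closed_sequential_limits
 proof (intro allI impI)
  fix X z assume X: "(\<forall>n. X n \<in> S) \<and> X \<longlonglongrightarrow> z"
  hence "z \<in> closure U" unfolding closure_sequential S_def by blast
  show "z \<in> S"
  proof (cases "z \<in> U")
   case True
   have "(\<lambda>n. norm (u (X n))) \<longlonglongrightarrow> norm (u z)" using X True contu unfolding S_def
    by (intro tendsto_norm) (auto simp: continuous_on_sequentially o_def)
   hence "norm (u w) <= norm (u z)" by (rule Lim_bounded2) (use X in \<open>auto simp: S_def\<close>)
   thus ?thesis using True by (simp add: S_def)
  next
   case False
   hence "z \<in> frontier U" using \<open>z \<in> closure U\<close> \<open>open U\<close> by (simp add: frontier_def interior_open)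
   then obtain d where d: "d > 0" "\<forall>y\<in>U. dist y z < d --> norm (u y) <= L + e" using bd e by blast
   obtain n where "dist (X n) z < d" using X d(1) by (meson lim_sequentially order_refl)
   thus ?thesis using d X e unfolding S_def by fastforce
  qed
 qed
 moreover have "bounded S" using assms(2) by (rule bounded_subset) (auto simp: S_def)
 ultimately have "compact S" by (simp add: compact_eq_bounded_closed)
 moreover have "w \<in> S" using w by (simp add: S_def)
 moreover have "continuous_on S (\<lambda>z. norm (u z))" by (intro continuous_on_norm continuous_on_subset[OF contu]) (auto simp: S_def)
 ultimately obtain x where x: "x \<in> S" "!!y. y \<in> S ==> norm (u y) <= norm (u x)" using continuous_attains_sup[of S "\<lambda>z. norm (u z)"] by blast
 have xm: "norm (u y) <= norm (u x)" if "y \<in> U" for y using x that unfolding S_def by force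
 define C where "C = connected_component_set U x"
 have xU: "x \<in> U" and uxw: "norm (u x) \<ge> norm (u w)" using x by (auto simp: S_def)
 have C: "open C" "connected C" "C \<subseteq> U" "x \<in> C" using \<open>open U\<close> xU by (auto simp: C_def open_connected_component connected_component_subset)
 have const: "u constant_on C" by (rule maximum_modulus_principle[OF _ C(1,2) C(1) order_refl C(4)])
   (use assms(3) C xm in \<open>auto intro: holomorphic_on_subset\<close>)
 have "bounded C" using C(3) assms(2) bounded_subset by blast
 hence "frontier C \<noteq> {}" using C(4) frontier_not_empty[of C] by (metis empty_iff not_bounded_UNIV)
 then obtain z where z: "z \<in> frontier C" by blast
 have "frontier C \<subseteq> frontier U" unfolding C_def using frontier_of_connected_component_subset by blast
 then obtain d where d: "d > 0" "\<forall>y\<in>U. dist y z < d --> norm (u y) <= L + e" using bd e z by blast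
 have "z \<in> closure C" using z by (simp add: frontier_def)
 then obtain y where y: "y \<in> C" "dist y z < d" using d(1) closure_approachable by blast
 hence "norm (u y) <= L + e" using d C by blast
 moreover have "u y = u x" using const y C(4) unfolding constant_on_def by metis
 ultimately show False using uxw e by simp
qed

text \<open>Near the boundary point \<open>n\<close>, which \<open>G\<close> separates from the origin, apply the maximum principle to \<open>(\<phi> - b) (r / (z - v))^m\<close> on a component of a disk about \<open>v\<close> minus \<open>G\<close>, with \<open>v\<close> just outside the unit disk. On the rim of that disk the second factor is \<open>1\<close>, on \<open>G\<close> the first is at most \<open>e\<close>, and at \<open>w\<close> the second is large.\<close>

lemma koebe_halfplane_estimate:
 fixes n b :: complex and \<phi> :: "complex => complex"
 assumes n: "norm n = 1" and k: "\<bar>k\<bar> < 1" and r: "r = (1 - \<bar>k\<bar>) / 2"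
  and hol: "\<phi> holomorphic_on disk" and M: "!!z. z \<in> disk ==> norm (\<phi> z - b) <= M"
  and G: "compact G" "G \<subseteq> disk" "G \<inter> cball 0 (1 - r/16) = {}"
  and eps: "!!z. z \<in> G ==> norm (\<phi> z - b) <= e" "e \<ge> 0"
  and Q: "compact Q" "!!z. z \<in> Q ==> Re (z * cnj n) <= k + r/16"
     "!!z. z \<in> Q ==> 1 - r/16 < norm z \<and> norm z <= 1" "!!z. z \<in> Q ==> norm z = 1 ==> Re (z * cnj n) <= k"
  and sep: "\<not> connected_component (- (G \<union> Q \<union> {z. norm z = 1 \<and> Re (z * cnj n) <= k})) 0 p"
  and p: "norm p > 1"
  and w: "w \<in> ball ((1 - r/8) *\<^sub>R n) (r/16)"
 shows "norm (\<phi> w - b) <= max (M / 2^m) (e * 2^m)"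
proof -
 have r0: "r > 0" "r <= 1/2" "1 - k \<ge> 2*r" using k r by auto
 define v where "v = (1 + r/4) *\<^sub>R n"
 define B where "B = ball v r"
 define A where "A = G \<union> Q \<union> {z. norm z = 1 \<and> Re (z * cnj n) <= k}"
 have nn: "n * cnj n = 1" using n by (simp add: complex_norm_square[symmetric])
 have nv: "norm v = 1 + r/4" using n r0 by (simp add: v_def)
 have Bre: "Re (z * cnj n) > k + r" if "z \<in> B" for z
 proof -
  have "Re (v * cnj n) - Re (z * cnj n) = Re ((v - z) * cnj n)" by (simp add: algebra_simps)
  also have "... <= norm ((v - z) * cnj n)" by (rule complex_Re_le_cmod)
  also have "... < r" using that n by (simp add: B_def norm_mult dist_norm)
  finally have "Re (v * cnj n) - Re (z * cnj n) < r" .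
  moreover have "v * cnj n = of_real (1 + r/4)" using nn by (simp add: v_def scaleR_conv_of_real mult.assoc)
  ultimately show ?thesis using r0 by simp
 qed
 have BQ: "B \<inter> Q = {}" using Bre Q(2) r0 by fastforce
 have BT: "B \<inter> {z. norm z = 1 \<and> Re (z * cnj n) <= k} = {}" using Bre r0 by fastforce
 have BA: "B - G \<subseteq> - A" using BQ BT by (auto simp: A_def)
 have wn: "norm w < 1 - r/16"
 proof -
  have "norm w <= norm ((1 - r/8) *\<^sub>R n) + norm (w - (1 - r/8) *\<^sub>R n)" by (rule norm_triangle_sub)
  also have "norm ((1 - r/8) *\<^sub>R n) = 1 - r/8" using n r0 by simp
  finally show ?thesis using w by (simp add: dist_norm norm_minus_commute)
 qed
 have wv: "norm (w - v) < r/2"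
 proof -
  have "norm (w - v) <= norm (w - (1 - r/8) *\<^sub>R n) + norm ((1 - r/8) *\<^sub>R n - v)"
   using norm_triangle_ineq[of "w - (1 - r/8) *\<^sub>R n" "(1 - r/8) *\<^sub>R n - v"] by simp
  also have "(1 - r/8) *\<^sub>R n - v = (- 3*r/8) *\<^sub>R n" unfolding v_def scaleR_diff_left[symmetric] by (simp add: field_simps)
  finally show ?thesis using w n r0 by (simp add: dist_norm norm_minus_commute)
 qed
 have wB: "w \<in> B - G" using wv wn G(3) r0 by (auto simp: B_def dist_norm norm_minus_commute)
 define U where "U = connected_component_set (B - G) w"
 have U: "open U" "connected U" "U \<subseteq> B - G" "w \<in> U" using wB G(1) connected_component_subset[of "B - G" w]
  by (auto simp: U_def B_def intro!: open_connected_component open_Diff compact_imp_closed)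
 have Ann: "z \<notin> A" if "norm z < 1 - r/16" for z using that G(3) Q(3)[of z] r0 by (auto simp: A_def)
 have UD: "U \<subseteq> disk"
 proof (rule ccontr)
  assume "\<not> U \<subseteq> disk"
  then obtain z where z: "z \<in> U" "norm z \<ge> 1" by (auto simp: subset_iff not_less)
  have "connected_component (- A) 0 w" unfolding connected_component_def by (rule exI[of _ "ball 0 (1 - r/16)"]) (use Ann wn r0 in auto)
  moreover have "connected_component (- A) w z" unfolding connected_component_def by (rule exI[of _ U]) (use U z BA in auto)
  moreover have "connected_component (- A) z p"
  proof -
   have zT: "\<not> (norm z = 1 \<and> Re (z * cnj n) <= k)" and zQ: "z \<notin> Q" using z U BT BQ by auto
   have 1: "connected (- cball (0::complex) 1)" by (rule connected_complement_bounded_convex) auto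
   have "z \<in> closure (- cball (0::complex) 1)"
   proof -
    have "z \<in> - disk" using z by simp
    thus ?thesis by (simp add: closure_complement interior_cball)
   qed
   hence "connected (insert z (- cball 0 1))" by (metis 1 connected_intermediate_closure insert_subset closure_subset subset_insertI)
   moreover have "insert z (- cball 0 1) \<subseteq> - A" using z zT zQ G(2) Q(3) by (auto simp: A_def)
   ultimately show ?thesis using p unfolding connected_component_def by (intro exI[of _ "insert z (- cball 0 1)"]) auto
  qed
  ultimately have "connected_component (- A) 0 p" by (meson connected_component_trans)
  thus False using sep by (simp add: A_def)
 qed
 have vD: "v \<notin> disk" using nv r0 by simp
 define u where "u z = (\<phi> z - b) * (of_real r / (z - v)) ^ m" for z
 have holu: "u holomorphic_on U" unfolding u_def using UD vD by (intro holomorphic_intros holomorphic_on_subset[OF hol UD]) auto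
 have M0: "M \<ge> 0" using order_trans[OF norm_ge_zero M[of 0]] by simp
 have "norm (u w) <= max M (e * 4^m)"
 proof (rule maximum_modulus_limsup[OF U(1) _ holu _ U(4)])
  show "bounded U" using bounded_subset[of B U] U(3) by (auto simp: B_def)
  fix z d :: "complex" and \<delta> :: real
  assume z: "z \<in> frontier U" and \<delta>: "\<delta> > 0"
  have zcl: "z \<in> closure U" "z \<notin> U" using z U(1) by (auto simp: frontier_def interior_open)
  have zcb: "z \<in> cball v r"
  proof -
   have "closure U \<subseteq> closure B" using U(3) by (intro closure_mono) auto
   thus ?thesis using zcl(1) r0 by (auto simp: B_def)
  qed
  show "\<exists>d>0. \<forall>y\<in>U. dist y z < d --> norm (u y) <= max M (e * 4^m) + \<delta>"
  proof (cases "z \<in> G")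
   case True
   have zD: "z \<in> disk" using True G by blast
   have "isCont u z"
   proof -
    have "u holomorphic_on disk" unfolding u_def using vD by (intro holomorphic_intros hol) auto
    thus ?thesis using zD by (metis continuous_on_eq_continuous_at holomorphic_on_imp_continuous_on open_ball)
   qed
   then obtain d where d: "d > 0" "!!y. dist y z < d ==> dist (u y) (u z) < \<delta>" using \<delta> unfolding continuous_at_eps_delta by blast
   have zv: "norm (z - v) \<ge> r/4"
   proof -
    have "norm v <= norm z + norm (z - v)" using norm_triangle_sub[of v z] by (simp add: norm_minus_commute)
    thus ?thesis using nv zD by simp
   qed
   have "norm (u z) = norm (\<phi> z - b) * (r / norm (z - v)) ^ m" using r0 by (simp add: u_def norm_mult norm_power norm_divide)
   also have "... <= e * 4 ^ m" using True zv r0 eps by (intro mult_mono power_mono) (auto simp: divide_simps)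
   finally have "norm (u z) <= e * 4 ^ m" .
   thus ?thesis
   proof (intro exI[of _ d] conjI ballI impI)
    fix y assume "y \<in> U" "dist y z < d"
    hence "norm (u y - u z) < \<delta>" using d(2) by (simp add: dist_norm)
    thus "norm (u y) <= max M (e * 4^m) + \<delta>" using norm_triangle_sub[of "u y" "u z"] \<open>norm (u z) <= e * 4 ^ m\<close> by linarith
   qed (use d in auto)
  next
   case False
   have "norm (z - v) = r"
   proof (rule ccontr)
    assume "norm (z - v) \<noteq> r"
    hence zB: "z \<in> B - G" using zcb False by (auto simp: B_def dist_norm norm_minus_commute)
    have oBG: "open (B - G)" using G(1) by (auto simp: B_def compact_imp_closed)
    then obtain d where d: "d > 0" "ball z d \<subseteq> B - G" using zB openE by blast
    obtain y where y: "y \<in> U" "dist y z < d" using zcl(1) d(1) closure_approachable by blast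
    have "connected (U \<union> ball z d)" using y U by (intro connected_Un) (auto simp: dist_commute)
    hence "U \<union> ball z d \<subseteq> U" using U(4) d U(3) unfolding U_def by (intro connected_component_maximal) auto
    thus False using zcl(2) d(1) by (metis Un_iff centre_in_ball subsetD)
   qed
   hence "isCont (\<lambda>y. M * (r / norm (y - v)) ^ m) z" and eq: "M * (r / norm (z - v)) ^ m = M" using r0 by (auto intro!: continuous_intros)
   then obtain d where d: "d > 0" "!!y. dist y z < d ==> dist (M * (r / norm (y - v)) ^ m) M < \<delta>" using \<delta> unfolding continuous_at_eps_delta by metis
   show ?thesis
   proof (intro exI[of _ d] conjI ballI impI)
    fix y assume y: "y \<in> U" "dist y z < d"
    have "norm (u y) = norm (\<phi> y - b) * (r / norm (y - v)) ^ m" using r0 by (simp add: u_def norm_mult norm_power norm_divide)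
    also have "... <= M * (r / norm (y - v)) ^ m" using M y UD r0 by (intro mult_right_mono) auto
    also have "... <= M + \<delta>" using d(2)[OF y(2)] by (simp add: dist_norm abs_if split: if_splits)
    finally show "norm (u y) <= max M (e * 4^m) + \<delta>" by simp
   qed (use d in auto)
  qed
 qed
 moreover have "norm (\<phi> w - b) * 2 ^ m <= norm (u w)"
 proof -
  have "w \<noteq> v" using UD U(4) vD by auto
  hence wv0: "norm (w - v) > 0" by simp
  have "norm (u w) = norm (\<phi> w - b) * (r / norm (w - v)) ^ m" using r0 by (simp add: u_def norm_mult norm_power norm_divide)
  moreover have "2 <= r / norm (w - v)" using wv wv0 by (simp add: field_simps)
  ultimately show ?thesis by (simp add: mult_left_mono power_mono)
 qed
 ultimately have "norm (\<phi> w - b) * 2^m <= max M (e * 4^m)" by simp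
 hence "norm (\<phi> w - b) <= max M (e * 4^m) / 2^m" by (simp add: field_simps)
 also have "... = max (M / 2^m) (e * 2^m)"
 proof -
  have "(4::real)^m = 2^m * 2^m" by (simp flip: power_mult_distrib)
  hence "e * 4^m / 2^m = e * 2^m" by simp
  thus ?thesis by (simp add: max_divide_distrib_right)
 qed
 finally show ?thesis .
qed

lemma koebe_dichotomy:
 fixes \<xi> \<eta> n b :: complex
 assumes \<xi>: "norm \<xi> = 1" and \<eta>: "norm \<eta> = 1" and ne: "\<xi> \<noteq> \<eta>"
  and n: "n = \<i> * (\<xi> - \<eta>) / norm (\<xi> - \<eta>)" and k: "k = Re (\<xi> * cnj n)" and r: "r = (1 - \<bar>k\<bar>) / 2"
 shows "norm n = 1" "\<bar>k\<bar> < 1" "Re (\<eta> * cnj n) = k"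
  and "!!z. norm z = 1 ==> Re (z * cnj n) = k ==> z = \<xi> \<or> z = \<eta>"
  and "[|\<phi> holomorphic_on disk; !!z. z \<in> disk ==> norm (\<phi> z - b) <= M;
   compact G; connected G; G \<subseteq> disk; G \<inter> cball 0 (1 - r/16) = {}; x \<in> G; y \<in> G;
   dist x \<xi> < r/16; dist y \<eta> < r/16; !!z. z \<in> G ==> norm (\<phi> z - b) <= e; e \<ge> 0|] ==>
   (\<forall>w\<in>ball ((1 - r/8) *\<^sub>R n) (r/16). \<forall>m. norm (\<phi> w - b) <= max (M / 2^m) (e * 2^m)) \<or>
   (\<forall>w\<in>ball ((1 - r/8) *\<^sub>R (-n)) (r/16). \<forall>m. norm (\<phi> w - b) <= max (M / 2^m) (e * 2^m))"
proof -
 have ne': "norm (\<xi> - \<eta>) > 0" using ne by simp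
 show n1: "norm n = 1" using ne' by (simp add: n norm_mult norm_divide)
 have nn: "n * cnj n = 1" using n1 by (simp add: complex_norm_square[symmetric])
 have "Re ((\<xi> - \<eta>) * cnj n) = 0" using ne' by (simp add: n)
 thus \<eta>k: "Re (\<eta> * cnj n) = k" by (simp add: k algebra_simps)
 have sq: "(Re (z * cnj n))\<^sup>2 + (Im (z * cnj n))\<^sup>2 = 1" if "norm z = 1" for z
  using that n1 by (metis cmod_power2 complex_mod_cnj mult.right_neutral norm_mult one_power2)
 have inj: "z = w" if "Re (z * cnj n) = Re (w * cnj n)" "Im (z * cnj n) = Im (w * cnj n)" for z w
 proof -
  have "z * cnj n * n = w * cnj n * n" using complex_eqI[OF that] by simp
  moreover have "n \<noteq> 0" using n1 by auto
  ultimately show ?thesis using nn by (simp add: mult.assoc mult.commute)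
 qed
 have im: "Im (\<xi> * cnj n) = - Im (\<eta> * cnj n)"
 proof -
  have "(Im (\<xi> * cnj n))\<^sup>2 = (Im (\<eta> * cnj n))\<^sup>2" using sq[OF \<xi>] sq[OF \<eta>] k \<eta>k by simp
  hence "Im (\<xi> * cnj n) = Im (\<eta> * cnj n) \<or> Im (\<xi> * cnj n) = - Im (\<eta> * cnj n)" by (simp only: power2_eq_iff)
  moreover have "Re (\<xi> * cnj n) = Re (\<eta> * cnj n)" using k \<eta>k by linarith
  ultimately show ?thesis using inj[of \<xi> \<eta>] ne by blast
 qed
 have im0: "Im (\<xi> * cnj n) \<noteq> 0"
 proof
  assume "Im (\<xi> * cnj n) = 0"
  hence "Im (\<xi> * cnj n) = Im (\<eta> * cnj n)" using im by linarith
  thus False using inj[of \<xi> \<eta>] ne k \<eta>k by metis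
 qed
 have "k\<^sup>2 < 1" using sq[OF \<xi>] im0 k by (smt (verit) zero_less_power2)
 thus k1: "\<bar>k\<bar> < 1" by (simp add: abs_square_less_1)
 show line: "z = \<xi> \<or> z = \<eta>" if "norm z = 1" "Re (z * cnj n) = k" for z
 proof -
  have "(Im (z * cnj n))\<^sup>2 = (Im (\<xi> * cnj n))\<^sup>2" using sq[OF \<xi>] sq[OF that(1)] that(2) k by simp
  hence "Im (z * cnj n) = Im (\<xi> * cnj n) \<or> Im (z * cnj n) = - Im (\<xi> * cnj n)" by (simp only: power2_eq_iff)
  hence "Im (z * cnj n) = Im (\<xi> * cnj n) \<or> Im (z * cnj n) = Im (\<eta> * cnj n)" using im by linarith
  moreover have "Re (z * cnj n) = Re (\<xi> * cnj n)" "Re (z * cnj n) = Re (\<eta> * cnj n)" using that(2) k \<eta>k by linarith+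
  ultimately show ?thesis using inj by blast
 qed
 have r0: "r > 0" "r <= 1/2" using k1 r by auto
 show "(\<forall>w\<in>ball ((1 - r/8) *\<^sub>R n) (r/16). \<forall>m. norm (\<phi> w - b) <= max (M / 2^m) (e * 2^m)) \<or>
   (\<forall>w\<in>ball ((1 - r/8) *\<^sub>R (-n)) (r/16). \<forall>m. norm (\<phi> w - b) <= max (M / 2^m) (e * 2^m))"
  if hol: "\<phi> holomorphic_on disk" and M: "!!z. z \<in> disk ==> norm (\<phi> z - b) <= M"
   and G: "compact G" "connected G" "G \<subseteq> disk" "G \<inter> cball 0 (1 - r/16) = {}"
   and xy: "x \<in> G" "y \<in> G" "dist x \<xi> < r/16" "dist y \<eta> < r/16"
   and eps: "!!z. z \<in> G ==> norm (\<phi> z - b) <= e" "e \<ge> 0"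
 proof -
  define Q where "Q = closed_segment x \<xi> \<union> closed_segment y \<eta>"
  have Qball: "dist z \<xi> < r/16 \<or> dist z \<eta> < r/16" if "z \<in> Q" for z
  proof -
   have "closed_segment x \<xi> \<subseteq> ball \<xi> (r/16)" "closed_segment y \<eta> \<subseteq> ball \<eta> (r/16)"
    using xy r0 by (intro closed_segment_subset; simp add: dist_commute)+
   thus ?thesis using that by (auto simp: Q_def dist_commute)
  qed
  have Qn: "1 - r/16 < norm z \<and> norm z <= 1" if "z \<in> Q" for z
  proof
   show "1 - r/16 < norm z"
   proof -
    have "norm \<xi> <= norm z + dist z \<xi>" "norm \<eta> <= norm z + dist z \<eta>"
     using norm_triangle_sub[of \<xi> z] norm_triangle_sub[of \<eta> z] by (simp_all add: dist_norm norm_minus_commute)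
    thus ?thesis using Qball[OF that] \<xi> \<eta> by linarith
   qed
   have "Q \<subseteq> cball 0 1" unfolding Q_def using xy G(3) \<xi> \<eta> by (intro Un_least closed_segment_subset) auto
   thus "norm z <= 1" using that by auto
  qed
  have Q1: "z = \<xi> \<or> z = \<eta>" if "z \<in> Q" "norm z = 1" for z
  proof -
   have *: "z = c" if "z \<in> closed_segment a c" "norm a < 1" "norm c = 1" for a c
   proof (rule ccontr)
    assume "z \<noteq> c"
    hence "z \<in> open_segment a c" using that \<open>norm z = 1\<close> by (auto simp: open_segment_def)
    hence "norm z < 1" using dist_decreases_open_segment[of z a c 0] that by (auto simp: dist_norm)
    thus False using \<open>norm z = 1\<close> by simp
   qed
   have "norm x < 1" "norm y < 1" using xy G(3) by auto
   thus ?thesis using that *[of x \<xi>] *[of y \<eta>] \<xi> \<eta> unfolding Q_def by blast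
  qed
  have Qre: "\<bar>Re (z * cnj n) - k\<bar> <= r/16" if "z \<in> Q" for z
  proof -
   have *: "\<bar>Re (z * cnj n) - Re (c * cnj n)\<bar> <= dist z c" for c
   proof -
    have "Re (z * cnj n) - Re (c * cnj n) = Re ((z - c) * cnj n)" by (simp add: algebra_simps)
    moreover have "norm ((z - c) * cnj n) = dist z c" using n1 by (simp add: norm_mult dist_norm)
   ultimately show ?thesis using abs_Re_le_cmod[of "(z - c) * cnj n"] by simp
   qed
   from Qball[OF that] show ?thesis
   proof
    assume "dist z \<xi> < r/16" thus ?thesis using *[of \<xi>] k by linarith
   next
    assume "dist z \<eta> < r/16" thus ?thesis using *[of \<eta>] \<eta>k by linarith
   qed
  qed
  have Qc: "compact Q" by (simp add: Q_def compact_Un)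
  define T1 where "T1 = {z. norm z = 1 \<and> Re (z * cnj n) <= k}"
  define T2 where "T2 = {z. norm z = 1 \<and> Re (z * cnj (-n)) <= -k}"
  have T12: "T1 \<inter> T2 = {\<xi>, \<eta>}" "T1 \<union> T2 = sphere 0 1"
  proof -
   have T2eq: "T2 = {z. norm z = 1 \<and> Re (z * cnj n) \<ge> k}" by (auto simp: T2_def)
   show "T1 \<union> T2 = sphere 0 1" unfolding T1_def T2eq by (auto simp del: times_complex.sel)
   have "z \<in> {\<xi>, \<eta>}" if "z \<in> T1 \<inter> T2" for z
   proof -
    have "norm z = 1" "Re (z * cnj n) = k" using that unfolding T1_def T2eq by (auto simp del: times_complex.sel)
    thus ?thesis using line by blast
   qed
   moreover have "\<xi> \<in> T1 \<inter> T2" "\<eta> \<in> T1 \<inter> T2" using \<xi> \<eta> k \<eta>k unfolding T1_def T2eq by (auto simp del: times_complex.sel)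
   ultimately show "T1 \<inter> T2 = {\<xi>, \<eta>}" by blast
  qed
  have cT: "compact T1" "compact T2"
  proof -
   have "T1 = sphere 0 1 \<inter> {z. Re (z * cnj n) <= k}" "T2 = sphere 0 1 \<inter> {z. Re (z * cnj (-n)) <= -k}" by (auto simp: T1_def T2_def)
   moreover have "closed {z. Re (z * cnj n) <= k}" "closed {z. Re (z * cnj (-n)) <= -k}" by (intro closed_Collect_le continuous_intros)+
   ultimately show "compact T1" "compact T2" by (auto simp: compact_Int_closed)
  qed
  have "connected (G \<union> Q)"
  proof -
   have "connected (G \<union> closed_segment x \<xi>)" using G(2) xy(1) ends_in_segment(1)[of x \<xi>] by (intro connected_Un) auto
   hence "connected ((G \<union> closed_segment x \<xi>) \<union> closed_segment y \<eta>)" using xy(2) ends_in_segment(1)[of y \<eta>]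
    by (intro connected_Un[of "G \<union> closed_segment x \<xi>" "closed_segment y \<eta>"]) auto
   thus ?thesis by (simp add: Q_def Un_assoc)
  qed
  moreover have "(G \<union> Q \<union> T1) \<inter> (G \<union> Q \<union> T2) = G \<union> Q"
  proof -
   have "{\<xi>, \<eta>} \<subseteq> Q" by (auto simp: Q_def)
   thus ?thesis using T12 by blast
  qed
  ultimately have con: "connected ((G \<union> Q \<union> T1) \<inter> (G \<union> Q \<union> T2))" by simp
  have "\<not> connected_component (- (sphere 0 1)) 0 (2::complex)"
  proof
   assume "connected_component (- (sphere 0 1)) 0 (2::complex)"
   then obtain S where S: "connected S" "S \<subseteq> - sphere 0 1" "0 \<in> S" "(2::complex) \<in> S" by (auto simp: connected_component_def)
   have "connected (norm ` S)" using S(1) by (intro connected_continuous_image continuous_intros)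
   hence "1 \<in> norm ` S" using S(3,4)
   proof -
    have "norm (0::complex) \<in> norm ` S" "norm (2::complex) \<in> norm ` S" using S(3,4) by (intro imageI; simp)+
    thus ?thesis using connectedD_interval[of "norm ` S" 0 2 1] \<open>connected (norm ` S)\<close> by simp
   qed
   thus False using S(2) by auto
  qed
  hence "\<not> connected_component (- ((G \<union> Q \<union> T1) \<union> (G \<union> Q \<union> T2))) 0 2"
  proof -
   have "- ((G \<union> Q \<union> T1) \<union> (G \<union> Q \<union> T2)) \<subseteq> - sphere 0 1" using T12(2) by blast
   thus ?thesis using \<open>\<not> connected_component (- (sphere 0 1)) 0 (2::complex)\<close> connected_component_of_subset by blast
  qed
  then consider "\<not> connected_component (- (G \<union> Q \<union> T1)) 0 2" | "\<not> connected_component (- (G \<union> Q \<union> T2)) 0 2"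
  proof -
   have "compact (G \<union> Q \<union> T1)" "closed (G \<union> Q \<union> T2)" using G(1) Qc cT by (simp_all add: compact_Un compact_imp_closed)
   with Janiszewski[of "G \<union> Q \<union> T1" "G \<union> Q \<union> T2" 0 2] con that
    \<open>\<not> connected_component (- ((G \<union> Q \<union> T1) \<union> (G \<union> Q \<union> T2))) 0 2\<close> show thesis by blast
  qed
  thus ?thesis
  proof cases
   case 1
   have A: "Re (z * cnj n) <= k + r/16" if "z \<in> Q" for z using Qre[OF that] by linarith
   have B: "Re (z * cnj n) <= k" if "z \<in> Q" "norm z = 1" for z using Q1[OF that] k \<eta>k by (auto simp del: times_complex.sel)
   have C: "\<not> connected_component (- (G \<union> Q \<union> {z. norm z = 1 \<and> Re (z * cnj n) <= k})) 0 2" using 1 unfolding T1_def .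
   have "norm (2::complex) > 1" by simp
   from koebe_halfplane_estimate[OF n1 k1 r hol M G(1,3,4) eps Qc A Qn B C this]
   show ?thesis by blast
  next
   case 2
   have n1': "norm (-n) = 1" and k1': "\<bar>-k\<bar> < 1" and r': "r = (1 - \<bar>-k\<bar>) / 2" using n1 k1 r by auto
   have cm: "z * cnj (-n) = - (z * cnj n)" for z by simp
   have A: "Re (z * cnj (-n)) <= -k + r/16" if "z \<in> Q" for z using Qre[OF that] unfolding cm uminus_complex.sel by linarith
   have B: "Re (z * cnj (-n)) <= -k" if "z \<in> Q" "norm z = 1" for z using Q1[OF that] k \<eta>k unfolding cm uminus_complex.sel by (auto simp del: times_complex.sel)
   have C: "\<not> connected_component (- (G \<union> Q \<union> {z. norm z = 1 \<and> Re (z * cnj (-n)) <= -k})) 0 2" using 2 unfolding T2_def .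
   have "norm (2::complex) > 1" by simp
   from koebe_halfplane_estimate[OF n1' k1' r' hol M G(1,3,4) eps Qc A Qn B C this]
   show ?thesis by blast
  qed
 qed
qed

text \<open>By the dichotomy the limit equals \<open>b\<close> near one of the points \<open>n\<close> and \<open>- n\<close>: first \<open>e \<rightarrow> 0\<close>, then \<open>m \<rightarrow> \<infinity>\<close>.\<close>

lemma koebe_lemma:
 fixes \<phi> :: "nat => complex => complex"
 assumes hol: "!!n. \<phi> n holomorphic_on disk"
  and M: "!!n z. z \<in> disk ==> norm (\<phi> n z - b) <= M"
  and lim: "!!z. z \<in> disk ==> (\<lambda>n. \<phi> n z) \<longlonglongrightarrow> h z"
  and G: "!!n. compact (G n)" "!!n. connected (G n)" "!!n. G n \<subseteq> disk"
  and Gesc: "!!c. c < 1 ==> eventually (\<lambda>n. G n \<inter> cball 0 c = {}) sequentially"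
  and xy: "!!n. x n \<in> G n" "!!n. y n \<in> G n" "x \<longlonglongrightarrow> \<xi>" "y \<longlonglongrightarrow> \<eta>" "norm \<xi> = 1" "norm \<eta> = 1" "\<xi> \<noteq> \<eta>"
  and eps: "!!n z. z \<in> G n ==> norm (\<phi> n z - b) <= e n" "e \<longlonglongrightarrow> 0"
 obtains w0 r0 where "r0 > 0" "ball w0 r0 \<subseteq> disk" "!!w. w \<in> ball w0 r0 ==> h w = b"
proof -
 define n where "n = \<i> * (\<xi> - \<eta>) / norm (\<xi> - \<eta>)"
 define k where "k = Re (\<xi> * cnj n)"
 define r where "r = (1 - \<bar>k\<bar>) / 2"
 note D = koebe_dichotomy[OF xy(5-7) n_def k_def r_def]
 have r0: "r > 0" "r <= 1/2" using D(2) by (auto simp: r_def)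
 \<comment> \<open>For one of the two signs the estimate holds infinitely often.\<close>
 define P where "P \<sigma> i \<longleftrightarrow> (\<forall>w\<in>ball ((1 - r/8) *\<^sub>R (\<sigma> *\<^sub>R n)) (r/16). \<forall>m. norm (\<phi> i w - b) <= max (M / 2^m) (e i * 2^m))"
  for \<sigma> :: real and i
 have "eventually (\<lambda>i. dist (x i) \<xi> < r/16) sequentially" "eventually (\<lambda>i. dist (y i) \<eta> < r/16) sequentially"
  using tendstoD[OF xy(3), of "r/16"] tendstoD[OF xy(4), of "r/16"] r0 by simp_all
 moreover have "eventually (\<lambda>i. G i \<inter> cball 0 (1 - r/16) = {}) sequentially" using r0 by (intro Gesc) auto
 ultimately have "eventually (\<lambda>i. P 1 i \<or> P (-1) i) sequentially"
 proof eventually_elim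
  case (elim i)
  have "e i \<ge> 0" using eps(1)[OF xy(1)[of i]] norm_ge_zero order_trans by blast
  thus ?case using D(5)[OF hol M G elim(3) xy(1,2) elim(1,2) eps(1)] unfolding P_def scaleR_one scaleR_minus1_left by blast
 qed
 hence "\<exists>\<^sub>F i in sequentially. P 1 i \<or> P (-1) i" by (rule eventually_frequently[OF sequentially_bot])
 hence "(\<exists>\<^sub>F i in sequentially. P 1 i) \<or> (\<exists>\<^sub>F i in sequentially. P (-1) i)" by (simp only: frequently_disj_iff)
 then obtain \<sigma> :: real where \<sigma>: "\<exists>\<^sub>F i in sequentially. P \<sigma> i" "\<bar>\<sigma>\<bar> = 1" by (metis abs_minus_cancel abs_one)
 show thesis
 proof (rule that)
  show "r/16 > 0" using r0 by simp
  show "ball ((1 - r/8) *\<^sub>R (\<sigma> *\<^sub>R n)) (r/16) \<subseteq> disk"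
  proof -
   have "norm ((1 - r/8) *\<^sub>R (\<sigma> *\<^sub>R n)) = 1 - r/8" using D(1) \<sigma>(2) r0 by (simp add: abs_mult)
   thus ?thesis using r0 by (simp add: ball_subset_ball_iff)
  qed
  fix w assume w: "w \<in> ball ((1 - r/8) *\<^sub>R (\<sigma> *\<^sub>R n)) (r/16)"
  have wD: "w \<in> disk" using w \<open>ball ((1 - r/8) *\<^sub>R (\<sigma> *\<^sub>R n)) (r/16) \<subseteq> disk\<close> by blast
  have "norm (h w - b) <= M / 2^m" for m
  proof (rule ccontr)
   assume "\<not> norm (h w - b) <= M / 2^m"
   moreover have M0: "M \<ge> 0" using order_trans[OF norm_ge_zero M[of 0 0]] by simp
   moreover have "0 <= M / 2^m" using M0 by simp
   ultimately have pos: "norm (h w - b) > M / 2^m" "norm (h w - b) > 0" by linarith+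
   have "(\<lambda>i. norm (\<phi> i w - b)) \<longlonglongrightarrow> norm (h w - b)" using lim[OF wD] by (intro tendsto_intros)
   moreover have "(\<lambda>i. max (M / 2^m) (e i * 2^m)) \<longlonglongrightarrow> max (M / 2^m) (0 * 2^m)" using eps(2) by (intro tendsto_intros)
   ultimately have "(\<lambda>i. norm (\<phi> i w - b) - max (M / 2^m) (e i * 2^m)) \<longlonglongrightarrow> norm (h w - b) - max (M / 2^m) (0 * 2^m)"
    by (rule tendsto_diff)
   moreover have "norm (h w - b) - max (M / 2^m) (0 * 2^m) > 0" using pos by simp
   ultimately have "eventually (\<lambda>i. norm (\<phi> i w - b) - max (M / 2^m) (e i * 2^m) > 0) sequentially" by (rule order_tendstoD)
   hence "eventually (\<lambda>i. \<not> P \<sigma> i) sequentially"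
   proof eventually_elim
    case (elim i)
    hence "\<not> norm (\<phi> i w - b) <= max (M / 2^m) (e i * 2^m)" by linarith
    thus ?case using w unfolding P_def by blast
   qed
   thus False using \<sigma>(1) unfolding frequently_def by blast
  qed
  moreover have "(\<lambda>m. M / 2^m) \<longlonglongrightarrow> 0" by real_asymp
  ultimately have "norm (h w - b) <= 0" by (intro LIMSEQ_le_const[of "\<lambda>m. M / 2^m"]) auto
  thus "h w = b" by simp
 qed
qed

section \<open>Caratheodory's theorem for Jordan domains\<close>

text \<open>If \<open>A\<close> is the part of the Jordan curve away from \<open>b\<close>, two points of the interior near \<open>b\<close> are separated neither by the curve nor by \<open>A\<close> together with a small circle about \<open>b\<close>. By Janiszewski's theorem they are not separated by the union.\<close>

lemma jordan_interior_locally_connected_at_boundary: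
 fixes c :: "real => complex"
 assumes c: "simple_path c" "pathfinish c = pathstart c" and b: "b \<in> path_image c" and e: "e > 0"
 obtains d where "d > 0"
  "!!z z'. z \<in> inside (path_image c) \<inter> ball b d ==> z' \<in> inside (path_image c) \<inter> ball b d ==>
   \<exists>S. compact S \<and> connected S \<and> z \<in> S \<and> z' \<in> S \<and> S \<subseteq> inside (path_image c) \<inter> ball b e"
proof -
 define K where "K = path_image c"
 obtain c' where c': "simple_path c'" "c' 0 = b" "c' 1 = b" "path_image c' = K"
 proof -
  obtain a where a: "a \<in> {0..1}" "c a = b" using b unfolding path_image_def by blast
  show thesis
  proof (rule that[of "shiftpath a c"])
   show "simple_path (shiftpath a c)" using c a by (simp add: simple_path_shiftpath)
   have "pathstart (shiftpath a c) = b" "pathfinish (shiftpath a c) = b" using a c by (simp_all add: pathstart_shiftpath pathfinish_shiftpath)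
   thus "shiftpath a c 0 = b" "shiftpath a c 1 = b" by (simp_all add: pathstart_def pathfinish_def)
   show "path_image (shiftpath a c) = K" using a c by (simp add: K_def path_image_shiftpath)
  qed
 qed
 have cc: "continuous_on {0..1} c'" using c'(1) by (simp add: simple_path_def path_def)
 obtain d0 where d0: "d0 > 0" "!!t. t \<in> {0..1} ==> dist t 0 < d0 ==> dist (c' t) (c' 0) < e"
  using cc e unfolding continuous_on_iff by (metis atLeastAtMost_iff order_refl zero_le_one)
 obtain d1 where d1: "d1 > 0" "!!t. t \<in> {0..1} ==> dist t 1 < d1 ==> dist (c' t) (c' 1) < e"
  using cc e unfolding continuous_on_iff by (metis atLeastAtMost_iff order_refl zero_le_one)
 define \<eta> where "\<eta> = min (min d0 d1) 1 / 2"
 have \<eta>: "\<eta> > 0" "\<eta> < d0" "\<eta> < d1" "\<eta> < 1" "\<eta> <= 1/2" using d0 d1 by (auto simp: \<eta>_def)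
 define A where "A = c' ` {\<eta>..1-\<eta>}"
 have sub: "{\<eta>..1-\<eta>} \<subseteq> {0..1}" using \<eta> by auto
 have A: "compact A" "connected A" "A \<subseteq> K" unfolding A_def c'(4)[symmetric] path_image_def using sub
  by (auto intro!: compact_continuous_image connected_continuous_image continuous_on_subset[OF cc])
 have bA: "b \<notin> A"
 proof
  assume "b \<in> A"
  then obtain t where t: "t \<in> {\<eta>..1-\<eta>}" "c' t = c' 0" using c'(2) unfolding A_def by auto
  moreover have "t \<in> {0..1}" "0 \<in> {0..1::real}" using t sub by auto
  ultimately have "t = 0 \<or> t = 1" using c'(1) unfolding simple_path_def loop_free_def by blast
  thus False using t \<eta> by auto
 qed
 have KA: "K - A \<subseteq> ball b e"
 proof
  fix z assume z: "z \<in> K - A"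
  then obtain t where t: "t \<in> {0..1}" "z = c' t" using c'(4) unfolding path_image_def by auto
  hence "t \<notin> {\<eta>..1-\<eta>}" using z unfolding A_def by auto
  hence "dist t 0 < d0 \<or> dist t 1 < d1" using t \<eta> by (auto simp: dist_real_def)
  thus "z \<in> ball b e" using d0(2)[OF t(1)] d1(2)[OF t(1)] c'(2,3) t(2) by (auto simp: dist_commute)
 qed
 obtain d where d: "d > 0" "ball b d \<subseteq> - A" "d <= e"
 proof -
  obtain d where "d > 0" "ball b d \<subseteq> - A" using bA A(1) openE[of "- A" b] by (auto simp: compact_imp_closed open_Compl)
  thus thesis using e that[of "min d e"] by (auto simp: subset_iff)
 qed
 show thesis
 proof (rule that[OF d(1)])
  fix z z' assume z: "z \<in> inside (path_image c) \<inter> ball b d" "z' \<in> inside (path_image c) \<inter> ball b d"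
  have JI: "open (inside K)" "connected (inside K)" "inside K \<inter> K = {}" using Jordan_inside_outside[OF c] inside_no_overlap[of K] by (auto simp: K_def)
  note z = z[folded K_def]
  have 1: "connected_component (- K) z z'" unfolding connected_component_def using JI z by (intro exI[of _ "inside K"]) blast
  have 2: "connected_component (- (sphere b e \<union> A)) z z'" unfolding connected_component_def using z d by (intro exI[of _ "ball b d"]) auto
  have "K \<inter> (sphere b e \<union> A) = A" using A(3) KA by auto
  hence con: "connected (K \<inter> (sphere b e \<union> A))" using A(2) by simp
  have cK: "compact K" using c(1) by (simp add: K_def compact_simple_path_image)
  have "connected_component (- (K \<union> (sphere b e \<union> A))) z z'"
   by (rule Janiszewski[OF cK _ con 1 2]) (use A(1) in \<open>auto intro: compact_imp_closed\<close>)
  moreover have op: "open (- (K \<union> (sphere b e \<union> A)))" using cK A(1) by (intro open_Compl closed_Un compact_imp_closed) auto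
  ultimately have "path_component (- (K \<union> (sphere b e \<union> A))) z z'" by (simp add: open_path_connected_component)
  then obtain p where p: "path p" "path_image p \<subseteq> - (K \<union> (sphere b e \<union> A))" "pathstart p = z" "pathfinish p = z'"
   unfolding path_component_def by blast
  have zp: "z \<in> path_image p" "z' \<in> path_image p" using p by (auto simp flip: p(3,4))
  have "path_image p \<subseteq> inside K"
  proof -
   have "connected_component_set (- K) z = inside K"
   proof
    show "inside K \<subseteq> connected_component_set (- K) z" using JI z by (intro connected_component_maximal) blast+
    show "connected_component_set (- K) z \<subseteq> inside K"
    proof
     fix y assume "y \<in> connected_component_set (- K) z"
     hence "connected_component (- K) z y" by simp
     thus "y \<in> inside K" using inside_same_component[of K z y] z by (simp add: K_def)
    qed
   qed
   moreover have "path_image p \<subseteq> connected_component_set (- K) z" using p zp by (intro connected_component_maximal) (auto simp: connected_path_image)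
   ultimately show ?thesis by simp
  qed
  moreover have "path_image p \<subseteq> ball b e"
  proof (rule ccontr)
   assume "\<not> path_image p \<subseteq> ball b e"
   then obtain y where y: "y \<in> path_image p" "dist b y \<ge> e" by (auto simp: subset_iff not_less)
   have "connected (dist b ` path_image p)" using p(1) by (intro connected_continuous_image continuous_intros connected_path_image)
   hence "e \<in> dist b ` path_image p"
   proof -
    have "dist b z <= e" using z d(3) by auto
    thus ?thesis using connectedD_interval[of "dist b ` path_image p" "dist b z" "dist b y" e] y zp
     \<open>connected (dist b ` path_image p)\<close> by blast
   qed
   thus False using p(2) by auto
  qed
  ultimately show "\<exists>S. compact S \<and> connected S \<and> z \<in> S \<and> z' \<in> S \<and> S \<subseteq> inside (path_image c) \<inter> ball b e"
   using zp p(1) unfolding K_def by (intro exI[of _ "path_image p"]) (auto simp: compact_path_image connected_path_image)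
 qed
qed

lemma riemann_map_boundary_modulus:
 fixes f g :: "complex => complex"
 assumes f: "continuous_on disk f" "!!z. z \<in> disk ==> f z \<in> G"
  and g: "!!w. w \<in> G ==> g w \<in> disk" "!!w. w \<in> G ==> f (g w) = w"
  and X: "!!n. X n \<in> G" "X \<longlonglongrightarrow> b" "b \<notin> G" "(\<lambda>n. g (X n)) \<longlonglongrightarrow> \<xi>"
 shows "norm \<xi> = 1"
proof -
 have "norm (g (X n)) <= 1" for n using g(1)[OF X(1)[of n]] by simp
 hence "norm \<xi> <= 1" using X(4) by (intro Lim_norm_ubound[of sequentially]) auto
 moreover have "\<not> norm \<xi> < 1"
 proof
  assume "norm \<xi> < 1"
  hence "(\<lambda>n. f (g (X n))) \<longlonglongrightarrow> f \<xi>"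
   using X(1) g(1) by (intro continuous_on_tendsto_compose[OF f(1) X(4)]) (use \<open>norm \<xi> < 1\<close> in auto)
  hence "X \<longlonglongrightarrow> f \<xi>" using g(2)[OF X(1)] by simp
  hence "f \<xi> = b" using X(2) LIMSEQ_unique by blast
  thus False using f(2)[of \<xi>] X(3) \<open>norm \<xi> < 1\<close> by simp
 qed
 ultimately show ?thesis by simp
qed

text \<open>If two sequences come together at a boundary point of the Jordan domain, local connectedness there joins them by small continua. Should their images under \<open>g\<close> stay apart, then \<open>f\<close> is nearly constant on continua running along the circle, and Koebe's lemma makes it constant.\<close>

lemma riemann_map_uniformly_continuous:
 fixes c :: "real => complex" and f g :: "complex => complex"
 assumes c: "simple_path c" "pathfinish c = pathstart c" and G: "G = inside (path_image c)"
  and f: "f holomorphic_on disk" "!!z. z \<in> disk ==> f z \<in> G"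
  and g: "g holomorphic_on G" "!!w. w \<in> G ==> g w \<in> disk" "!!w. w \<in> G ==> f (g w) = w"
 shows "uniformly_continuous_on G g" unfolding uniformly_continuous_on_sequentially
proof (intro allI impI, rule ccontr)
 fix x y assume xy: "(\<forall>n. x n \<in> G) \<and> (\<forall>n. y n \<in> G) \<and> (\<lambda>n. dist (x n) (y n)) \<longlonglongrightarrow> 0"
  and "\<not> (\<lambda>n. dist (g (x n)) (g (y n))) \<longlonglongrightarrow> 0"
 then obtain e where e: "e > 0" "!!N. \<exists>n\<ge>N. dist (g (x n)) (g (y n)) \<ge> e"
 proof -
  have "\<not> (\<forall>r>0. \<exists>no. \<forall>n\<ge>no. dist (dist (g (x n)) (g (y n))) 0 < r)"
   using \<open>\<not> (\<lambda>n. dist (g (x n)) (g (y n))) \<longlonglongrightarrow> 0\<close> unfolding lim_sequentially .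
  then obtain r where "r > 0" "!!no. \<exists>n\<ge>no. \<not> dist (dist (g (x n)) (g (y n))) 0 < r" by blast
  thus thesis using that[of r] by (simp add: not_less)
 qed
 have "\<exists>r0. \<forall>N. r0 N \<ge> N \<and> dist (g (x (r0 N))) (g (y (r0 N))) \<ge> e" using e(2) by (intro choice) blast
 then obtain r0 :: "nat => nat" where r0: "!!N. r0 N \<ge> N" "!!N. dist (g (x (r0 N))) (g (y (r0 N))) \<ge> e" by blast
 have bG: "bounded G" using c unfolding G by (simp add: bounded_inside compact_imp_bounded compact_simple_path_image)
 have cs: "compact (closure G \<times> cball (0::complex) 1 \<times> cball (0::complex) 1)" using bG by (intro compact_Times) (auto simp: compact_closure)
 define T where "T n = (x (r0 n), g (x (r0 n)), g (y (r0 n)))" for n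
 have "T n \<in> closure G \<times> cball 0 1 \<times> cball 0 1" for n using xy g(2)[of "x (r0 n)"] g(2)[of "y (r0 n)"] closure_subset[of G] by (auto simp: T_def)
 then obtain l r where l: "l \<in> closure G \<times> cball 0 1 \<times> cball 0 1" "strict_mono (r :: nat => nat)" "(T \<circ> r) \<longlonglongrightarrow> l"
  using cs unfolding compact_def by blast
 obtain b \<xi> \<eta> where l3: "l = (b, \<xi>, \<eta>)" by (cases l)
 define X where "X n = x (r0 (r n))" for n
 define Y where "Y n = y (r0 (r n))" for n
 have XG: "X n \<in> G" "Y n \<in> G" for n using xy by (auto simp: X_def Y_def)
 have fst: "X \<longlonglongrightarrow> b" using tendsto_fst[OF l(3)] by (simp add: l3 T_def o_def X_def[abs_def])
 have gX: "(\<lambda>n. g (X n)) \<longlonglongrightarrow> \<xi>" using tendsto_fst[OF tendsto_snd[OF l(3)]] by (simp add: l3 T_def o_def X_def)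
 have gY: "(\<lambda>n. g (Y n)) \<longlonglongrightarrow> \<eta>" using tendsto_snd[OF tendsto_snd[OF l(3)]] by (simp add: l3 T_def o_def Y_def)
 have Yb: "Y \<longlonglongrightarrow> b"
 proof -
  have "filterlim (\<lambda>n. r0 (r n)) sequentially sequentially"
  proof (rule filterlim_at_top_mono[OF filterlim_ident], rule eventuallyI)
   fix n show "n <= r0 (r n)" using r0(1)[of "r n"] seq_suble[OF l(2), of n] by linarith
  qed
  hence "(\<lambda>n. dist (X n) (Y n)) \<longlonglongrightarrow> 0"
   using xy filterlim_compose[of "\<lambda>n. dist (x n) (y n)" "nhds 0" sequentially "\<lambda>n. r0 (r n)" sequentially] unfolding X_def Y_def by blast
  hence "(\<lambda>n. X n - Y n) \<longlonglongrightarrow> 0" by (simp add: dist_norm tendsto_norm_zero_iff)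
  from tendsto_diff[OF fst this] show ?thesis by simp
 qed
 have dge: "dist \<xi> \<eta> \<ge> e" by (rule LIMSEQ_le_const[OF tendsto_dist[OF gX gY]]) (use r0(2) in \<open>auto simp: X_def Y_def\<close>)
 have contg: "continuous_on G g" and contf: "continuous_on disk f" using f(1) g(1) holomorphic_on_imp_continuous_on by blast+
 have bnG: "b \<notin> G"
 proof
  assume "b \<in> G"
  hence "(\<lambda>n. g (X n)) \<longlonglongrightarrow> g b" "(\<lambda>n. g (Y n)) \<longlonglongrightarrow> g b"
   using continuous_on_tendsto_compose[OF contg fst] continuous_on_tendsto_compose[OF contg Yb] XG by auto
  hence "g b = \<xi>" "g b = \<eta>" using gX gY by (auto intro: LIMSEQ_unique)
  thus False using dge e(1) by simp
 qed
 have \<xi>\<eta>: "norm \<xi> = 1" "norm \<eta> = 1" using riemann_map_boundary_modulus[OF contf f(2) g(2,3) XG(1) fst bnG gX]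
   riemann_map_boundary_modulus[OF contf f(2) g(2,3) XG(2) Yb bnG gY] by auto
 have bK: "b \<in> path_image c"
 proof -
  have "b \<in> closure G" using l(1) l3 by simp
  moreover have "open G" "frontier G = path_image c" using Jordan_inside_outside[OF c] unfolding G by auto
  ultimately show ?thesis using bnG by (auto simp: frontier_def interior_open)
 qed
 have "\<exists>n S. n \<ge> k \<and> compact S \<and> connected S \<and> X n \<in> S \<and> Y n \<in> S \<and> S \<subseteq> G \<inter> ball b (1 / Suc k)" for k
 proof -
  obtain d where d: "d > 0" "!!z z'. z \<in> G \<inter> ball b d ==> z' \<in> G \<inter> ball b d ==>
   \<exists>S. compact S \<and> connected S \<and> z \<in> S \<and> z' \<in> S \<and> S \<subseteq> G \<inter> ball b (1 / Suc k)"
   using jordan_interior_locally_connected_at_boundary[OF c bK, of "1 / Suc k"] unfolding G by auto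
  have "eventually (\<lambda>n. dist (X n) b < d \<and> dist (Y n) b < d \<and> n \<ge> k) sequentially"
   using tendstoD[OF fst d(1)] tendstoD[OF Yb d(1)] eventually_ge_at_top[of k] by eventually_elim auto
  then obtain n where "dist (X n) b < d" "dist (Y n) b < d" "n \<ge> k" by (auto simp: eventually_sequentially)
  thus ?thesis using d(2)[of "X n" "Y n"] XG by (auto simp: dist_commute)
 qed
 then obtain m S where mS: "!!k. m k \<ge> k" "!!k. compact (S k)" "!!k. connected (S k)" "!!k. X (m k) \<in> S k"
  "!!k. Y (m k) \<in> S k" "!!k. S k \<subseteq> G \<inter> ball b (1 / Suc k)" by metis
 have ml: "filterlim m sequentially sequentially" by (rule filterlim_at_top_mono[OF filterlim_ident]) (use mS(1) in auto)
 obtain B where B: "!!w. w \<in> G ==> norm (w - b) <= B" using bG bounded_any_center[of G b] by (auto simp: dist_norm norm_minus_commute)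
 obtain w0 \<rho> where "\<rho> > 0" "ball w0 \<rho> \<subseteq> disk" and fb: "!!w. w \<in> ball w0 \<rho> ==> f w = b"
 proof (rule koebe_lemma[of "\<lambda>_. f" b B f "\<lambda>k. g ` S k" "\<lambda>k. g (X (m k))" "\<lambda>k. g (Y (m k))" \<xi> \<eta> "\<lambda>k. 1 / Suc k"])
  show "f holomorphic_on disk" by (rule f)
  show "norm (f z - b) <= B" if "z \<in> disk" for z using f(2) B that by blast
  show "(\<lambda>n. f z) \<longlonglongrightarrow> f z" for z by simp
  show "compact (g ` S n)" "connected (g ` S n)" for n
   using mS(2,3,6) by (auto intro!: compact_continuous_image connected_continuous_image continuous_on_subset[OF contg])
  show "g ` S n \<subseteq> disk" for n using mS(6) g(2) by blast
  show "eventually (\<lambda>n. g ` S n \<inter> cball 0 a = {}) sequentially" if "a < 1" for a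
  proof -
   have "compact (f ` cball 0 a)" using that by (intro compact_continuous_image continuous_on_subset[OF contf]) auto
   moreover have "b \<notin> f ` cball 0 a"
   proof
    assume "b \<in> f ` cball 0 a"
    then obtain z where "z \<in> cball 0 a" "b = f z" by blast
    thus False using f(2)[of z] bnG that by simp
   qed
   ultimately obtain d where d: "d > 0" "ball b d \<subseteq> - f ` cball 0 a" using openE[of "- f ` cball 0 a" b] by (auto simp: compact_imp_closed open_Compl)
   have "(\<lambda>n. 1 / real (Suc n)) \<longlonglongrightarrow> 0" by real_asymp
   hence "eventually (\<lambda>n. 1 / real (Suc n) < d) sequentially" using d(1) by (rule order_tendstoD)
   thus ?thesis
   proof eventually_elim
    case (elim n)
    have False if "w \<in> S n" "g w \<in> cball 0 a" for w
    proof -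
     have "w \<in> G" using mS(6)[of n] that(1) by blast
     hence "w = f (g w)" using g(3) by simp
     hence "w \<in> f ` cball 0 a" using that by blast
     moreover have "w \<in> ball b d" using mS(6)[of n] that elim by auto
     ultimately show False using d(2) by blast
    qed
    thus ?case by blast
   qed
  qed
  show "g (X (m n)) \<in> g ` S n" "g (Y (m n)) \<in> g ` S n" for n using mS by auto
  show "(\<lambda>k. g (X (m k))) \<longlonglongrightarrow> \<xi>" "(\<lambda>k. g (Y (m k))) \<longlonglongrightarrow> \<eta>"
   using filterlim_compose[OF gX ml] filterlim_compose[OF gY ml] by auto
  show "norm \<xi> = 1" "norm \<eta> = 1" "\<xi> \<noteq> \<eta>" using \<xi>\<eta> dge e by auto
  show "norm (f z - b) <= 1 / real (Suc n)" if "z \<in> g ` S n" for z n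
  proof -
   obtain w where w: "w \<in> S n" "z = g w" using \<open>z \<in> g ` S n\<close> by blast
   hence "f z = w" using mS(6) g(3) by blast
   moreover have "dist b w < 1 / real (Suc n)" using mS(6)[of n] w by auto
   ultimately show ?thesis by (simp add: dist_norm norm_minus_commute)
  qed
  show "(\<lambda>k. 1 / real (Suc k)) \<longlonglongrightarrow> 0" by real_asymp
 qed (use that in blast)
 have "w0 \<in> disk" using \<open>\<rho> > 0\<close> \<open>ball w0 \<rho> \<subseteq> disk\<close> centre_in_ball by blast
 thus False using f(2)[of w0] fb[of w0] bnG \<open>\<rho> > 0\<close> by simp
qed

lemma connected_circular_sector:
 fixes \<xi> :: complex
 assumes \<xi>: "norm \<xi> = 1" and k: "-1 < k" "k < 1" and a: "0 < a"
 shows "connected {z. a <= norm z \<and> norm z < 1 \<and> Re (z * cnj \<xi>) <= k * norm z}"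
proof -
 define \<kappa> where "\<kappa> = arccos k"
 have \<kappa>: "0 < \<kappa>" "\<kappa> < pi" "cos \<kappa> = k" using k arccos_lt_bounded[of k] by (auto simp: \<kappa>_def)
 define h where "h p = of_real (fst p) * (\<xi> * cis (snd p))" for p :: "real \<times> real"
 have \<xi>\<xi>: "\<xi> * cnj \<xi> = 1" using \<xi> by (simp add: complex_norm_square[symmetric])
 have nh: "norm (h (\<rho>, \<theta>)) = \<bar>\<rho>\<bar>" for \<rho> \<theta> using \<xi> by (simp add: h_def norm_mult)
 have reh: "Re (h (\<rho>, \<theta>) * cnj \<xi>) = \<rho> * cos \<theta>" for \<rho> \<theta>
 proof -
  have "h (\<rho>, \<theta>) * cnj \<xi> = of_real \<rho> * cis \<theta> * (\<xi> * cnj \<xi>)" by (simp add: h_def algebra_simps)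
  thus ?thesis by (simp add: \<xi>\<xi>)
 qed
 have "{z. a <= norm z \<and> norm z < 1 \<and> Re (z * cnj \<xi>) <= k * norm z} = h ` ({a..<1} \<times> {\<kappa>..2*pi-\<kappa>})"
 proof (intro equalityI subsetI)
  fix z assume "z \<in> {z. a <= norm z \<and> norm z < 1 \<and> Re (z * cnj \<xi>) <= k * norm z}"
  hence z: "a <= norm z" "norm z < 1" "Re (z * cnj \<xi>) <= k * norm z" by auto
  define w where "w = z * cnj \<xi>"
  have nw: "norm w = norm z" using \<xi> by (simp add: w_def norm_mult)
  have zw: "z = w * \<xi>" using \<xi>\<xi> by (simp add: w_def mult.assoc mult.commute)
  define \<theta> where "\<theta> = Arg2pi w"
  have \<theta>: "0 <= \<theta>" "\<theta> < 2*pi" "w = of_real (norm w) * cis \<theta>" using Arg2pi[of w] by (auto simp: \<theta>_def cis_conv_exp is_Arg_def)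
  have "Re w = norm w * cos \<theta>" by (subst \<theta>(3)) simp
  hence "norm w * cos \<theta> <= norm w * cos \<kappa>" using z(3) nw \<kappa>(3) by (simp add: w_def mult.commute del: times_complex.sel)
  moreover have "norm w > 0" using z(1) a nw by linarith
  ultimately have cosk: "cos \<theta> <= cos \<kappa>" by (simp only: mult_le_cancel_left_pos)
  have "\<kappa> <= \<theta>"
  proof (rule ccontr)
   assume "\<not> \<kappa> <= \<theta>"
   hence "cos \<kappa> < cos \<theta>" using \<theta> \<kappa> by (intro cos_monotone_0_pi) auto
   thus False using cosk by simp
  qed
  moreover have "\<theta> <= 2*pi - \<kappa>"
  proof (rule ccontr)
   assume "\<not> \<theta> <= 2*pi - \<kappa>"
   hence "cos \<kappa> < cos (2*pi - \<theta>)" using \<theta> \<kappa> by (intro cos_monotone_0_pi) auto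
   thus False using cosk by simp
  qed
  moreover have "z = h (norm z, \<theta>)" using zw \<theta>(3) nw by (simp add: h_def mult.assoc mult.commute)
  ultimately show "z \<in> h ` ({a..<1} \<times> {\<kappa>..2*pi-\<kappa>})" using z by auto
 next
  fix z assume "z \<in> h ` ({a..<1} \<times> {\<kappa>..2*pi-\<kappa>})"
  then obtain \<rho> \<theta> where z: "z = h (\<rho>, \<theta>)" "a <= \<rho>" "\<rho> < 1" "\<kappa> <= \<theta>" "\<theta> <= 2*pi-\<kappa>" by auto
  have "cos \<theta> <= cos \<kappa>"
  proof (cases "\<theta> <= pi")
   case True thus ?thesis using z \<kappa> by (intro cos_monotone_0_pi_le) auto
  next
   case False
   hence "cos (2*pi - \<theta>) <= cos \<kappa>" using z \<kappa> by (intro cos_monotone_0_pi_le) auto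
   thus ?thesis by simp
  qed
  hence "\<rho> * cos \<theta> <= k * \<rho>" using z a \<kappa>(3) by (simp add: mult.commute)
  thus "z \<in> {z. a <= norm z \<and> norm z < 1 \<and> Re (z * cnj \<xi>) <= k * norm z}" using z a by (simp add: nh reh del: times_complex.sel)
 qed
 moreover have "connected (h ` ({a..<1} \<times> {\<kappa>..2*pi-\<kappa>}))"
  unfolding h_def by (intro connected_continuous_image connected_Times continuous_intros) (auto simp: cis_conv_exp intro!: continuous_intros)
 ultimately show ?thesis by simp
qed

text \<open>\<open>\<Psi>\<close> is the continuous extension of the Riemann map \<open>g\<close> to the closure of the Jordan domain, which exists by uniform continuity. What remains is its injectivity on the curve.\<close>

locale jordan_riemann_map =
 fixes c :: "real => complex" and G K :: "complex set" and f g \<Psi> :: "complex => complex"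
 assumes c: "simple_path c" "pathfinish c = pathstart c" and K: "K = path_image c" and G: "G = inside K"
  and f: "f holomorphic_on disk" "!!z. z \<in> disk ==> f z \<in> G" "!!z. z \<in> disk ==> g (f z) = z"
  and g: "g holomorphic_on G" "!!w. w \<in> G ==> g w \<in> disk" "!!w. w \<in> G ==> f (g w) = w"
  and \<Psi>: "continuous_on (closure G) \<Psi>" "!!w. w \<in> G ==> \<Psi> w = g w"
begin

lemma openG: "open G" and clG: "closure G = G \<union> K" and GK: "G \<inter> K = {}" and frG: "frontier G = K"
 and compK: "compact K" and bdG: "bounded G"
proof -
 show o: "open G" "frontier G = K" using Jordan_inside_outside[OF c] by (auto simp: G K)
 thus "closure G = G \<union> K" by (auto simp: frontier_def interior_open closure_subset[THEN subsetD])
 show "G \<inter> K = {}" using inside_no_overlap[of K] by (auto simp: G)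
 show "compact K" using c by (simp add: K compact_simple_path_image)
 thus "bounded G" by (simp add: G bounded_inside compact_imp_bounded)
qed

lemma norm_\<Psi>_G: "w \<in> G ==> norm (\<Psi> w) < 1" using g(2)[of w] \<Psi>(2)[of w] by simp

lemma norm_\<Psi>_K: assumes b: "b \<in> K" shows "norm (\<Psi> b) = 1"
proof -
 have "b \<in> closure G" using b clG by simp
 then obtain X where X: "!!n. X n \<in> G" "X \<longlonglongrightarrow> b" unfolding closure_sequential by blast
 have "(\<lambda>n. \<Psi> (X n)) \<longlonglongrightarrow> \<Psi> b"
  using X(1) \<open>b \<in> closure G\<close> closure_subset[of G] by (intro continuous_on_tendsto_compose[OF \<Psi>(1) X(2)]) (auto intro!: eventuallyI)
 hence "(\<lambda>n. g (X n)) \<longlonglongrightarrow> \<Psi> b" using \<Psi>(2)[OF X(1)] by simp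
 moreover have "b \<notin> G" using b GK by blast
 ultimately show ?thesis using riemann_map_boundary_modulus[of f G g X b "\<Psi> b"] f g X holomorphic_on_imp_continuous_on by blast
qed

lemma \<Psi>_image: "\<Psi> ` closure G = cball 0 1"
proof
 show "\<Psi> ` closure G \<subseteq> cball 0 1"
 proof
  fix z assume "z \<in> \<Psi> ` closure G"
  then obtain w where "w \<in> G \<union> K" "z = \<Psi> w" using clG by blast
  thus "z \<in> cball 0 1" using norm_\<Psi>_G[of w] norm_\<Psi>_K[of w] by auto
 qed
 have "disk \<subseteq> \<Psi> ` closure G"
 proof
  fix z :: complex assume "z \<in> disk"
  hence "z = \<Psi> (f z)" "f z \<in> G" using f \<Psi>(2) by auto
  thus "z \<in> \<Psi> ` closure G" using clG by blast
 qed
 moreover have "compact (\<Psi> ` closure G)" using bdG \<Psi>(1) by (intro compact_continuous_image) (auto simp: compact_closure)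
 ultimately have "closure disk \<subseteq> \<Psi> ` closure G" by (intro closure_minimal compact_imp_closed)
 thus "cball 0 1 \<subseteq> \<Psi> ` closure G" by simp
qed

text \<open>Points of the disk near the circle but away from \<open>\<xi>\<close> form a connected set; pull it back to the Jordan domain and let it approach the curve.\<close>

lemma connected_off_fibre:
 assumes \<xi>: "norm \<xi> = 1"
 shows "connected (K - {z \<in> K. \<Psi> z = \<xi>})" (is "connected (K - ?Y)")
proof (rule ccontr)
 assume "\<not> connected (K - ?Y)"
 then obtain O1 O2 where O: "open O1" "open O2" "K - ?Y \<subseteq> O1 \<union> O2" "O1 \<inter> O2 \<inter> (K - ?Y) = {}"
   "O1 \<inter> (K - ?Y) \<noteq> {}" "O2 \<inter> (K - ?Y) \<noteq> {}" unfolding connected_def by blast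
 obtain b1 b2 where b: "b1 \<in> O1" "b1 \<in> K" "\<Psi> b1 \<noteq> \<xi>" "b2 \<in> O2" "b2 \<in> K" "\<Psi> b2 \<noteq> \<xi>" using O(5,6) by auto
 have re1: "Re (z * cnj \<xi>) < 1" if "norm z = 1" "z \<noteq> \<xi>" for z
 proof -
  have n1: "norm (z * cnj \<xi>) = 1" using that \<xi> by (simp add: norm_mult)
  have "Re (z * cnj \<xi>) \<noteq> 1"
  proof
   assume r: "Re (z * cnj \<xi>) = 1"
   hence "z * cnj \<xi> = 1" using n1 by (simp add: cmod_eq_Re complex_eq_iff norm_complex_def)
   moreover have "\<xi> * cnj \<xi> = 1" using \<xi> by (simp add: complex_norm_square[symmetric])
   ultimately have "(z - \<xi>) * cnj \<xi> = 0" by (simp add: algebra_simps)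
   thus False using that(2) \<xi> by auto
  qed
  thus ?thesis using complex_Re_le_cmod[of "z * cnj \<xi>"] n1 by linarith
 qed
 define x1 where "x1 = Re (\<Psi> b1 * cnj \<xi>)"
 define x2 where "x2 = Re (\<Psi> b2 * cnj \<xi>)"
 have "x1 < 1" "x2 < 1" using re1[OF norm_\<Psi>_K[OF b(2)] b(3)] re1[OF norm_\<Psi>_K[OF b(5)] b(6)] by (simp_all only: x1_def x2_def)
 define k where "k = (1 + max 0 (max x1 x2)) / 2"
 have k: "-1 < k" "k < 1" "Re (\<Psi> b1 * cnj \<xi>) < k" "Re (\<Psi> b2 * cnj \<xi>) < k"
  using \<open>x1 < 1\<close> \<open>x2 < 1\<close> unfolding x1_def[symmetric] x2_def[symmetric] by (auto simp: k_def max_def)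
 define S where "S n = {z. 1 - 1 / real (n+2) <= norm z \<and> norm z < 1 \<and> Re (z * cnj \<xi>) <= k * norm z}" for n :: nat
 have conS: "connected (S n)" for n unfolding S_def using \<xi> k by (intro connected_circular_sector) auto
 define Z where "Z = {z \<in> K. Re (\<Psi> z * cnj \<xi>) <= k}"
 have cK: "continuous_on K \<Psi>" using \<Psi>(1) clG continuous_on_subset by blast
 have "closed Z" unfolding Z_def using compK cK by (intro continuous_on_closed_Collect_le compact_imp_closed continuous_intros)
 have ZY: "Z \<subseteq> K - ?Y"
 proof
  fix z assume z: "z \<in> Z"
  have "\<xi> * cnj \<xi> = 1" using \<xi> by (simp add: complex_norm_square[symmetric])
  hence "\<Psi> z \<noteq> \<xi>" using z k unfolding Z_def by (auto simp del: times_complex.sel)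
  thus "z \<in> K - ?Y" using z unfolding Z_def by auto
 qed
 have "closed (Z - O2)" "closed (Z - O1)" "(Z - O2) \<inter> (Z - O1) = {}" using \<open>closed Z\<close> O(1,2) ZY O(3) by (auto intro: closed_Diff)
 then obtain N1 N2 where N: "open N1" "open N2" "Z - O2 \<subseteq> N1" "Z - O1 \<subseteq> N2" "N1 \<inter> N2 = {}"
  using separation_normal[of "Z - O2" "Z - O1"] by metis
 have ZN: "Z \<subseteq> N1 \<union> N2" using N(3,4) ZY O(4) by blast
 have contf: "continuous_on disk f" using f(1) holomorphic_on_imp_continuous_on by blast
 have "\<exists>n. f ` S n \<subseteq> N1 \<union> N2"
 proof (rule ccontr)
  assume "\<nexists>n. f ` S n \<subseteq> N1 \<union> N2"
  hence "\<forall>n. \<exists>z. z \<in> S n \<and> f z \<notin> N1 \<union> N2" by blast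
  then obtain \<zeta> where \<zeta>: "!!n. \<zeta> n \<in> S n" "!!n. f (\<zeta> n) \<notin> N1 \<union> N2" by metis
  have \<zeta>D: "\<zeta> n \<in> disk" for n using \<zeta>(1)[of n] by (simp add: S_def)
  have "compact (closure G)" using bdG by (simp add: compact_closure)
  moreover have "f (\<zeta> n) \<in> closure G" for n using f(2)[OF \<zeta>D[of n]] clG by simp
  ultimately obtain p r where p: "p \<in> closure G" "strict_mono (r :: nat => nat)" "((\<lambda>n. f (\<zeta> n)) \<circ> r) \<longlonglongrightarrow> p"
   unfolding compact_def by metis
  have p3: "(\<lambda>n. f (\<zeta> (r n))) \<longlonglongrightarrow> p" using p(3) by (simp add: o_def)
  have "(\<lambda>n. \<Psi> (f (\<zeta> (r n)))) \<longlonglongrightarrow> \<Psi> p"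
   using f(2)[OF \<zeta>D] clG by (intro continuous_on_tendsto_compose[OF \<Psi>(1) p3 p(1)]) auto
  moreover have "\<Psi> (f (\<zeta> n)) = \<zeta> n" for n using \<Psi>(2)[OF f(2)[OF \<zeta>D]] f(3)[OF \<zeta>D] by simp
  ultimately have lim: "(\<lambda>n. \<zeta> (r n)) \<longlonglongrightarrow> \<Psi> p" by simp
  have rl: "filterlim r sequentially sequentially" using p(2) by (simp add: filterlim_subseq)
  have "(\<lambda>n. 1 - 1 / real (n + 2)) \<longlonglongrightarrow> 1" by real_asymp
  hence "(\<lambda>n. 1 - 1 / real (r n + 2)) \<longlonglongrightarrow> 1" using filterlim_compose[OF _ rl] by fast
  hence "1 <= norm (\<Psi> p)" by (rule LIMSEQ_le[OF _ tendsto_norm[OF lim]]) (use \<zeta>(1) in \<open>auto simp: S_def\<close>)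
  hence pK: "p \<in> K" using norm_\<Psi>_G[of p] p(1) clG by auto
  have "Re (\<Psi> p * cnj \<xi>) <= k * norm (\<Psi> p)"
  proof (rule LIMSEQ_le)
   show "(\<lambda>n. Re (\<zeta> (r n) * cnj \<xi>)) \<longlonglongrightarrow> Re (\<Psi> p * cnj \<xi>)" by (intro tendsto_intros lim)
   show "(\<lambda>n. k * norm (\<zeta> (r n))) \<longlonglongrightarrow> k * norm (\<Psi> p)" by (intro tendsto_intros lim)
   show "\<exists>N. \<forall>n\<ge>N. Re (\<zeta> (r n) * cnj \<xi>) <= k * norm (\<zeta> (r n))" using \<zeta>(1) unfolding S_def by blast
  qed
  hence "p \<in> Z" using pK norm_\<Psi>_K[OF pK] by (simp add: Z_def)
  hence "p \<in> N1 \<union> N2" using ZN by blast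
  moreover have "open (N1 \<union> N2)" using N by blast
  ultimately have "eventually (\<lambda>n. f (\<zeta> (r n)) \<in> N1 \<union> N2) sequentially" using p3 topological_tendstoD by blast
  hence "eventually (\<lambda>n. False) sequentially" by (rule eventually_mono) (use \<zeta>(2) in blast)
  thus False by simp
 qed
 then obtain n where n: "f ` S n \<subseteq> N1 \<union> N2" by blast
 have hit: "\<exists>z \<in> f ` S n. z \<in> N" if "b \<in> K" "Re (\<Psi> b * cnj \<xi>) < k" "open N" "b \<in> N" for b N
 proof -
  have "b \<in> closure G" using that clG by simp
  then obtain X where X: "!!n. X n \<in> G" "X \<longlonglongrightarrow> b" unfolding closure_sequential by blast
  have lim: "(\<lambda>n. \<Psi> (X n)) \<longlonglongrightarrow> \<Psi> b"
   using X(1) \<open>b \<in> closure G\<close> closure_subset[of G] by (intro continuous_on_tendsto_compose[OF \<Psi>(1) X(2)]) (auto intro!: eventuallyI)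
  have "(\<lambda>m. norm (\<Psi> (X m))) \<longlonglongrightarrow> norm (\<Psi> b)" by (intro tendsto_intros lim)
  hence "eventually (\<lambda>m. norm (\<Psi> (X m)) > 1 - 1 / real (n + 2)) sequentially" by (rule order_tendstoD) (use norm_\<Psi>_K[OF that(1)] in simp)
  moreover have "(\<lambda>m. k * norm (\<Psi> (X m)) - Re (\<Psi> (X m) * cnj \<xi>)) \<longlonglongrightarrow> k * norm (\<Psi> b) - Re (\<Psi> b * cnj \<xi>)"
   by (intro tendsto_intros lim)
  hence "eventually (\<lambda>m. k * norm (\<Psi> (X m)) - Re (\<Psi> (X m) * cnj \<xi>) > 0) sequentially"
   by (rule order_tendstoD) (use norm_\<Psi>_K[OF that(1)] that(2) in simp)
  moreover have "eventually (\<lambda>m. X m \<in> N) sequentially" using X(2) that topological_tendstoD by blast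
  ultimately have "eventually (\<lambda>m. X m \<in> N \<and> \<Psi> (X m) \<in> S n) sequentially"
  proof eventually_elim
   case (elim m)
   thus ?case using norm_\<Psi>_G[OF X(1)[of m]] unfolding S_def by auto
  qed
  then obtain m where "X m \<in> N" "\<Psi> (X m) \<in> S n" by (auto simp: eventually_sequentially)
  moreover have "f (\<Psi> (X m)) = X m" using \<Psi>(2) g(3) X(1) by simp
  ultimately show ?thesis by (metis imageI)
 qed
 have "b1 \<in> N1" "b2 \<in> N2" using b k O(4) N(3,4) ZY unfolding Z_def by auto
 then obtain z1 z2 where "z1 \<in> f ` S n" "z1 \<in> N1" "z2 \<in> f ` S n" "z2 \<in> N2" using hit[OF b(2) k(3) N(1)] hit[OF b(5) k(4) N(2)] by blast
 moreover have "connected (f ` S n)" using conS by (intro connected_continuous_image continuous_on_subset[OF contf]) (auto simp: S_def)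
 ultimately show False using n N(1,2,5) connectedD[of "f ` S n" N1 N2] by blast
qed

text \<open>If \<open>\<Psi>\<close> were constant on an arc of the curve, then \<open>(g - \<xi>) / (z - v)^m\<close>, with \<open>v\<close> outside the curve and close to the arc, would violate the maximum principle for large \<open>m\<close>.\<close>

lemma fibre_has_no_interior:
 assumes \<xi>: "norm \<xi> = 1" and b0: "b0 \<in> K" and r: "r > 0"
 shows "\<exists>b \<in> K \<inter> ball b0 r. \<Psi> b \<noteq> \<xi>"
proof (rule ccontr)
 assume "\<not> (\<exists>b \<in> K \<inter> ball b0 r. \<Psi> b \<noteq> \<xi>)"
 hence const: "!!b. b \<in> K ==> b \<in> ball b0 r ==> \<Psi> b = \<xi>" by blast
 have out: "open (outside K)" "frontier (outside K) = K" "inside K \<inter> outside K = {}" "outside K \<inter> K = {}"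
  using Jordan_inside_outside[OF c] inside_Int_outside[of K] outside_no_overlap[of K] by (auto simp: K)
 have "b0 \<in> closure (outside K)" using b0 out(2) by (auto simp: frontier_def)
 then obtain v where v: "v \<in> outside K" "dist v b0 < r/4" using r closure_approachable[of b0 "outside K"] by (metis zero_less_divide_iff zero_less_numeral)
 have "b0 \<in> closure G" using b0 clG by simp
 then obtain z0 where z0: "z0 \<in> G" "dist z0 b0 < r/8" using r closure_approachable[of b0 G] by (metis zero_less_divide_iff zero_less_numeral)
 have vG: "v \<notin> closure G" using v(1) out clG G by blast
 define U where "U = G \<inter> ball v (r/2)"
 define R where "R = r/2"
 have R: "R > 0" "r/2 = R" using r by (auto simp: R_def)
 have Ub0: "cball v (r/2) \<subseteq> ball b0 r"
 proof
  fix z assume "z \<in> cball v (r/2)"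
  thus "z \<in> ball b0 r" using dist_triangle[of b0 z v] v(2) r by (simp add: dist_commute)
 qed
 have z0v: "dist z0 v < r * 3/8" using dist_triangle[of z0 v b0] z0(2) v(2) r by (simp add: dist_commute)
 have z0U: "z0 \<in> U" using z0(1) z0v r by (simp add: U_def dist_commute)
 have "norm (\<Psi> z0 - \<xi>) <= 2 * (3/4)^m" for m
 proof -
  define u where "u z = (g z - \<xi>) * (of_real R / (z - v)) ^ m" for z
  have "norm (u z0) <= 2"
  proof (rule maximum_modulus_limsup[OF _ _ _ _ z0U])
   show "open U" "bounded U" using openG by (auto simp: U_def)
   show "u holomorphic_on U" unfolding u_def using vG closure_subset[of G] g(1) by (intro holomorphic_intros holomorphic_on_subset[OF g(1)]) (auto simp: U_def)
   fix z e assume z: "z \<in> frontier U" and e: "(e::real) > 0"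
   have zcl: "z \<in> closure U" "z \<notin> U" using z \<open>open U\<close> by (auto simp: frontier_def interior_open)
   have zG: "z \<in> closure G" using zcl(1) closure_mono[of U G] by (auto simp: U_def)
   have "closure U \<subseteq> closure (ball v (r/2))" by (intro closure_mono) (auto simp: U_def)
   hence zb: "z \<in> cball v (r/2)" using zcl(1) r by auto
   have zv: "z \<noteq> v" using zG vG by auto
   define uu where "uu y = (\<Psi> y - \<xi>) * (of_real R / (y - v)) ^ m" for y
   have le: "norm (uu z) <= 2"
   proof (cases "z \<in> K")
    case True
    hence "\<Psi> z = \<xi>" using const Ub0 zb by blast
    thus ?thesis by (simp add: uu_def)
   next
    case False
    hence "z \<in> G" using zG clG by blast
    hence "norm (z - v) = r/2" using zb zcl(2) by (auto simp: U_def dist_norm norm_minus_commute)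
    hence "norm (uu z) = norm (\<Psi> z - \<xi>)" using R by (simp add: uu_def norm_mult norm_power norm_divide)
    also have "... <= norm (\<Psi> z) + norm \<xi>" by (rule norm_triangle_ineq4)
    finally show ?thesis using norm_\<Psi>_G[OF \<open>z \<in> G\<close>] \<xi> by simp
   qed
   have "continuous_on (closure G) uu" unfolding uu_def using vG \<Psi>(1) by (intro continuous_intros) auto
   then obtain d where d: "d > 0" "!!y. y \<in> closure G ==> dist y z < d ==> dist (uu y) (uu z) < e" using zG e unfolding continuous_on_iff by metis
   show "\<exists>d>0. \<forall>y\<in>U. dist y z < d --> norm (u y) <= 2 + e"
   proof (intro exI[of _ d] conjI ballI impI)
    fix y assume y: "y \<in> U" "dist y z < d"
    hence "y \<in> G" by (simp add: U_def)
    hence "uu y = u y" "y \<in> closure G" using \<Psi>(2) clG by (auto simp: uu_def u_def)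
    hence "norm (u y - uu z) < e" using d(2)[of y] y(2) by (simp add: dist_norm)
    thus "norm (u y) <= 2 + e" using le norm_triangle_sub[of "u y" "uu z"] by linarith
   qed (use d in auto)
  qed
  moreover have "norm (u z0) = norm (\<Psi> z0 - \<xi>) * (R / dist z0 v) ^ m" using R z0(1) \<Psi>(2) by (simp add: u_def norm_mult norm_power norm_divide dist_norm)
  moreover have "(4/3)^m <= (R / dist z0 v)^m"
  proof -
   have "z0 \<noteq> v" using z0(1) vG clG by auto
   hence "4/3 <= R / dist z0 v" using z0v by (simp add: field_simps R_def)
   thus ?thesis by (intro power_mono) auto
  qed
  ultimately have "norm (\<Psi> z0 - \<xi>) * (4/3)^m <= 2" by (smt (verit) mult_left_mono norm_ge_zero)
  thus ?thesis by (simp add: power_divide field_simps)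
 qed
 moreover have "(\<lambda>m. 2 * (3/4::real)^m) \<longlonglongrightarrow> 0" by real_asymp
 ultimately have "norm (\<Psi> z0 - \<xi>) <= 0" by (intro LIMSEQ_le_const[of "\<lambda>m. 2 * (3/4::real)^m"]) auto
 thus False using norm_\<Psi>_G[OF z0(1)] \<xi> by simp
qed

text \<open>Two points of the curve with the same image divide it into two arcs. As the curve without the fibre is connected, one of the arcs lies in the fibre.\<close>

lemma inj_\<Psi>_K: "inj_on \<Psi> K"
proof (rule inj_onI, rule ccontr)
 fix b b' assume b: "b \<in> K" "b' \<in> K" "\<Psi> b = \<Psi> b'" "b \<noteq> b'"
 define \<xi> where "\<xi> = \<Psi> b"
 have \<xi>: "norm \<xi> = 1" using norm_\<Psi>_K b(1) by (simp add: \<xi>_def)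
 obtain a where a: "a \<in> {0..1}" "c a = b" using b(1) unfolding K path_image_def by blast
 define c' where "c' = shiftpath a c"
 have c': "simple_path c'" "path_image c' = K" "c' 0 = b" "c' 1 = b" using a c pathstart_shiftpath[of a c] pathfinish_shiftpath[of a c]
  by (simp_all add: c'_def simple_path_shiftpath path_image_shiftpath K pathstart_def pathfinish_def)
 have cc: "continuous_on {0..1} c'" using c'(1) by (simp add: simple_path_def path_def)
 have inj: "x = y \<or> x = 0 \<and> y = 1 \<or> x = 1 \<and> y = 0" if "x \<in> {0..1}" "y \<in> {0..1}" "c' x = c' y" for x y
  using c'(1) that unfolding simple_path_def loop_free_def by blast
 obtain t where t: "t \<in> {0..1}" "c' t = b'" using b(2) c'(2) unfolding path_image_def by blast
 have t01: "0 < t" "t < 1" using t b(4) c'(3,4) by (auto simp: less_le)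
 define I1 where "I1 = c' ` {0<..<t}"
 define I2 where "I2 = c' ` {t<..<1}"
 have I1: "I1 = K \<inter> - c' ` {t..1}" and I2: "I2 = K \<inter> - c' ` {0..t}"
 proof -
  have *: "x \<in> {0..1}" if "x \<in> {0<..<t} \<or> x \<in> {t<..<1} \<or> x \<in> {t..1} \<or> x \<in> {0..t}" for x using that t01 by auto
  have "c' x \<noteq> c' y" if "x \<in> {0<..<t}" "y \<in> {t..1}" for x y using inj[of x y] that *[of x] *[of y] by auto
  moreover have "c' x \<noteq> c' y" if "x \<in> {t<..<1}" "y \<in> {0..t}" for x y using inj[of x y] that *[of x] *[of y] by auto
  moreover have "z \<in> c' ` {0..t} \<or> z \<in> I2" "z \<in> c' ` {t..1} \<or> z \<in> I1" if "z \<in> K" for z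
  proof -
   have "z \<in> c' ` {0..1}" using that c'(2) by (simp add: path_image_def)
   then obtain x where x: "x \<in> {0..1}" "z = c' x" by blast
   have "c' 0 = c' 1" using c' by simp
   show "z \<in> c' ` {0..t} \<or> z \<in> I2"
   proof (cases "x <= t \<or> x = 1")
    case True
    hence "x \<in> {0..t} \<or> z = c' 0" using x \<open>c' 0 = c' 1\<close> by auto
    moreover have "0 \<in> {0..t}" using t01 by simp
    ultimately show ?thesis using x(2) by blast
   next
    case False
    hence "x \<in> {t<..<1}" using x by auto
    thus ?thesis using x(2) unfolding I2_def by blast
   qed
   show "z \<in> c' ` {t..1} \<or> z \<in> I1"
   proof (cases "x \<ge> t \<or> x = 0")
    case True
    hence "x \<in> {t..1} \<or> z = c' 1" using x \<open>c' 0 = c' 1\<close> by auto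
    moreover have "1 \<in> {t..1}" using t01 by simp
    ultimately show ?thesis using x(2) by blast
   next
    case False
    hence "x \<in> {0<..<t}" using x by auto
    thus ?thesis using x(2) unfolding I1_def by blast
   qed
  qed
  moreover have "I1 \<subseteq> K" "I2 \<subseteq> K"
  proof -
   have "{0<..<t} \<subseteq> {0..1}" "{t<..<1} \<subseteq> {0..1}" using t01 by auto
   thus "I1 \<subseteq> K" "I2 \<subseteq> K" unfolding I1_def I2_def c'(2)[symmetric] path_image_def by (simp_all add: image_mono)
  qed
  moreover have "I1 \<inter> c' ` {t..1} = {}" "I2 \<inter> c' ` {0..t} = {}" using calculation(1,2) unfolding I1_def I2_def by blast+
  ultimately show "I1 = K \<inter> - c' ` {t..1}" "I2 = K \<inter> - c' ` {0..t}" by (intro equalityI subsetI; blast)+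
 qed
 have comp: "compact (c' ` {t..1})" "compact (c' ` {0..t})" using t01 by (auto intro!: compact_continuous_image continuous_on_subset[OF cc])
 define Y where "Y = {z \<in> K. \<Psi> z = \<xi>}"
 have con: "connected (K - Y)" unfolding Y_def by (rule connected_off_fibre[OF \<xi>])
 have "K - Y \<subseteq> I1 \<union> I2"
 proof
  fix z assume z: "z \<in> K - Y"
  then obtain x where x: "x \<in> {0..1}" "z = c' x" using c'(2) unfolding path_image_def by blast
  have "z \<noteq> b" "z \<noteq> b'" using z b by (auto simp: Y_def \<xi>_def)
  hence "x \<noteq> 0" "x \<noteq> 1" "x \<noteq> t" using x c' t by auto
  thus "z \<in> I1 \<union> I2" using x unfolding I1_def I2_def by force
 qed
 moreover have "I1 \<inter> I2 = {}"
 proof -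
  have "I2 \<subseteq> c' ` {t..1}" unfolding I2_def by auto
  thus ?thesis using I1 by blast
 qed
 ultimately have "I1 \<inter> (K - Y) = {} \<or> I2 \<inter> (K - Y) = {}"
 proof -
  have o: "open (- c' ` {t..1})" "open (- c' ` {0..t})" using comp by (auto simp: compact_imp_closed open_Compl)
  assume a: "K - Y \<subseteq> I1 \<union> I2" "I1 \<inter> I2 = {}"
  have "(- c' ` {t..1}) \<inter> (- c' ` {0..t}) \<inter> (K - Y) = {}" using a(2) I1 I2 by blast
  moreover have "K - Y \<subseteq> (- c' ` {t..1}) \<union> (- c' ` {0..t})" using a(1) I1 I2 by blast
  ultimately have "(- c' ` {t..1}) \<inter> (K - Y) = {} \<or> (- c' ` {0..t}) \<inter> (K - Y) = {}" by (rule connectedD[OF con o])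
  thus ?thesis using I1 I2 by blast
 qed
 moreover have "I1 \<subseteq> K" "I2 \<subseteq> K" using I1 I2 by auto
 ultimately have "I1 \<subseteq> Y \<or> I2 \<subseteq> Y" by blast
 then obtain I where I: "I \<subseteq> Y" "I = I1 \<or> I = I2" by blast
 have "c' (t/2) \<in> I1" "c' ((t+1)/2) \<in> I2" unfolding I1_def I2_def by (intro imageI; use t01 in simp)+
 then obtain b0 where "b0 \<in> I" using I(2) by blast
 obtain C where C: "compact C" "I = K \<inter> - C" using I(2) I1 I2 comp by metis
 then obtain r where r: "r > 0" "ball b0 r \<subseteq> - C" using openE[of "- C" b0] \<open>b0 \<in> I\<close> by (auto simp: compact_imp_closed open_Compl)
 have "b0 \<in> K" using C \<open>b0 \<in> I\<close> by blast
 obtain b1 where "b1 \<in> K \<inter> ball b0 r" "\<Psi> b1 \<noteq> \<xi>" using fibre_has_no_interior[OF \<xi> \<open>b0 \<in> K\<close> r(1)] by blast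
 hence "b1 \<in> I" using C(2) r(2) by blast
 thus False using I(1) \<open>\<Psi> b1 \<noteq> \<xi>\<close> unfolding Y_def by blast
qed

lemma homeomorphism_\<Psi>: "\<exists>F. homeomorphism (G \<union> K) (cball 0 1) \<Psi> F \<and> (\<forall>z\<in>disk. F z = f z)"
proof -
 have "inj_on \<Psi> (G \<union> K)"
 proof (rule inj_onI)
  fix x y assume xy: "x \<in> G \<union> K" "y \<in> G \<union> K" "\<Psi> x = \<Psi> y"
  consider "x \<in> G" "y \<in> G" | "x \<in> K" "y \<in> K" | "x \<in> G" "y \<in> K" | "x \<in> K" "y \<in> G" using xy by blast
  thus "x = y"
  proof cases
   case 1 thus ?thesis using \<Psi>(2) g(3) xy(3) by metis
  next
   case 2 thus ?thesis using inj_\<Psi>_K xy(3) by (meson inj_onD)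
  next
   case 3 thus ?thesis using norm_\<Psi>_G[of x] norm_\<Psi>_K[of y] xy(3) by simp
  next
   case 4 thus ?thesis using norm_\<Psi>_G[of y] norm_\<Psi>_K[of x] xy(3) by simp
  qed
 qed
 moreover have "compact (G \<union> K)" using bdG clG by (metis compact_closure)
 ultimately obtain F where F: "homeomorphism (G \<union> K) (cball 0 1) \<Psi> F"
  using homeomorphism_compact[of "G \<union> K" \<Psi> "cball 0 1"] \<Psi>(1) \<Psi>_image clG by auto
 moreover have "F z = f z" if "z \<in> disk" for z using F f(2,3)[OF that] \<Psi>(2)[of "f z"] by (metis UnCI homeomorphism_apply1)
 ultimately show ?thesis by blast
qed

end

theorem caratheodory_jordan:
 fixes c :: "real => complex" and f g :: "complex => complex"
 assumes c: "simple_path c" "pathfinish c = pathstart c"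
  and f: "f holomorphic_on disk" "!!z. z \<in> disk ==> f z \<in> inside (path_image c)" "!!z. z \<in> disk ==> g (f z) = z"
  and g: "g holomorphic_on inside (path_image c)" "!!w. w \<in> inside (path_image c) ==> g w \<in> disk"
     "!!w. w \<in> inside (path_image c) ==> f (g w) = w"
 obtains F F' where "homeomorphism (cball 0 1) (inside (path_image c) \<union> path_image c) F F'"
  "!!z. z \<in> disk ==> F z = f z"
proof -
 have "uniformly_continuous_on (inside (path_image c)) g" by (rule riemann_map_uniformly_continuous[OF c refl f(1,2) g])
 then obtain \<Psi> where "uniformly_continuous_on (closure (inside (path_image c))) \<Psi>"
   "!!w. w \<in> inside (path_image c) ==> g w = \<Psi> w" using uniformly_continuous_on_extension_on_closure by metis
 then interpret jordan_riemann_map c "inside (path_image c)" "path_image c" f g \<Psi> using c f g by unfold_locales (auto intro: uniformly_continuous_imp_continuous)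
 show thesis using homeomorphism_\<Psi> that homeomorphism_symD by metis
qed

section \<open>Automorphisms of the disk preserving the vertical diameter\<close>

definition axis_map :: "real => complex => complex" where
 "axis_map a z = (z + imag a) / (1 - imag a * z)"

lemma axis_map_norm_identity:
 "(norm (1 - imag a * z))\<^sup>2 - (norm (z + imag a))\<^sup>2 = (1 - (norm z)\<^sup>2) * (1 - a\<^sup>2)"
 by (cases z) (simp add: cmod_power2, simp add: power2_eq_square algebra_simps)

lemma axis_map_denominator: "\<bar>a\<bar> < 1 ==> norm z <= 1 ==> 1 - imag a * z \<noteq> 0"
proof
 assume a: "\<bar>a\<bar> < 1" "norm z <= 1" and "1 - imag a * z = 0"
 hence "norm (imag a * z) = 1" by (metis eq_iff_diff_eq_0 norm_one)
 hence "\<bar>a\<bar> * norm z = 1" by (simp add: norm_mult)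
 moreover have "\<bar>a\<bar> * norm z <= \<bar>a\<bar>" using a by (simp add: mult_left_le)
 ultimately show False using a by simp
qed

lemma norm_axis_map: "\<bar>a\<bar> < 1 ==> norm z <= 1 ==>
 1 - (norm (axis_map a z))\<^sup>2 = (1 - (norm z)\<^sup>2) * (1 - a\<^sup>2) / (norm (1 - imag a * z))\<^sup>2"
 using axis_map_norm_identity[of a z] axis_map_denominator[of a z] by (simp add: axis_map_def norm_divide power_divide field_simps)

lemma Re_axis_map: "\<bar>a\<bar> < 1 ==> norm z <= 1 ==>
 Re (axis_map a z) = Re z * (1 - a\<^sup>2) / (norm (1 - imag a * z))\<^sup>2"
proof -
 have "Re ((z + imag a) * cnj (1 - imag a * z)) = Re z * (1 - a\<^sup>2)" by (cases z) (simp add: power2_eq_square algebra_simps)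
 thus ?thesis unfolding axis_map_def by (simp add: Re_divide_numeral complex_div_cnj[of "z + _"] flip: of_real_power)
qed

lemma axis_map_sign:
 assumes "\<bar>a\<bar> < 1" "norm z <= 1"
 shows "norm (axis_map a z) < 1 \<longleftrightarrow> norm z < 1" "norm (axis_map a z) = 1 \<longleftrightarrow> norm z = 1" "norm (axis_map a z) <= 1"
  "Re (axis_map a z) < 0 \<longleftrightarrow> Re z < 0" "Re (axis_map a z) > 0 \<longleftrightarrow> Re z > 0"
proof -
 have n: "(norm (1 - imag a * z))\<^sup>2 > 0" using axis_map_denominator[OF assms] by simp
 have a: "1 - a\<^sup>2 > 0" using assms(1) by (simp add: abs_square_less_1)
 have z: "1 - (norm z)\<^sup>2 \<ge> 0" using assms(2) by (simp add: abs_square_le_1)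
 define X where "X = (1 - a\<^sup>2) / (norm (1 - imag a * z))\<^sup>2"
 have X: "X > 0" using n a by (simp add: X_def)
 have e: "1 - (norm (axis_map a z))\<^sup>2 = (1 - (norm z)\<^sup>2) * X" "Re (axis_map a z) = Re z * X"
  unfolding X_def norm_axis_map[OF assms] Re_axis_map[OF assms] by simp_all
 have sq: "norm w < 1 \<longleftrightarrow> 1 - (norm w)\<^sup>2 > 0" "norm w = 1 \<longleftrightarrow> 1 - (norm w)\<^sup>2 = 0" "norm w <= 1 \<longleftrightarrow> 1 - (norm w)\<^sup>2 \<ge> 0" for w :: complex
  using abs_square_less_1[of "norm w"] abs_square_le_1[of "norm w"] power2_eq_1_iff[of "norm w"] norm_ge_zero[of w] by auto
 show "norm (axis_map a z) < 1 \<longleftrightarrow> norm z < 1" "norm (axis_map a z) = 1 \<longleftrightarrow> norm z = 1" "norm (axis_map a z) <= 1"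
  unfolding sq e using X z by (auto simp: zero_less_mult_iff)
 show "Re (axis_map a z) < 0 \<longleftrightarrow> Re z < 0" "Re (axis_map a z) > 0 \<longleftrightarrow> Re z > 0"
  unfolding e using X by (auto simp: zero_less_mult_iff mult_less_0_iff)
qed

lemma axis_map_inverse:
 assumes "\<bar>a\<bar> < 1" "norm z <= 1" shows "axis_map (-a) (axis_map a z) = z"
proof -
 have d: "1 - imag a * z \<noteq> 0" using axis_map_denominator assms by blast
 have "1 + imag a * axis_map a z \<noteq> 0" using axis_map_denominator[of "-a" "axis_map a z"] assms axis_map_sign(3)[OF assms] by simp
 have a: "1 - complex_of_real a * of_real a \<noteq> 0"
 proof -
  have "a * a \<noteq> 1" using assms(1) abs_square_less_1[of a] by (simp add: power2_eq_square)
  hence "complex_of_real (1 - a * a) \<noteq> 0" by (simp del: of_real_diff of_real_mult)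
  thus ?thesis by simp
 qed
 have "axis_map a z - imag a = z * (1 - of_real a * of_real a) / (1 - imag a * z)" using d by (simp add: axis_map_def divide_simps) (simp add: algebra_simps)
 moreover have "1 + imag a * axis_map a z = (1 - of_real a * of_real a) / (1 - imag a * z)" using d by (simp add: axis_map_def divide_simps) (simp add: algebra_simps)
 ultimately show ?thesis using d a unfolding axis_map_def[of "-a"] by simp
qed

lemma holomorphic_axis_map: "\<bar>a\<bar> < 1 ==> S \<subseteq> cball 0 1 ==> axis_map a holomorphic_on S"
 unfolding axis_map_def using axis_map_denominator[of a] by (intro holomorphic_intros) (auto simp: subset_iff)

text \<open>The point \<open>q\<close> lies on a geodesic perpendicular to the vertical diameter; \<open>a\<close> is found by the intermediate value theorem.\<close>

lemma axis_map_to_positive_real: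
 assumes q: "norm q < 1" "Re q > 0"
 obtains a p where "\<bar>a\<bar> < 1" "0 < p" "p < 1" "axis_map a (of_real p) = q" "axis_map (-a) q = of_real p"
proof -
 have cont: "continuous_on {-1..1} (\<lambda>a. Im q * (1 + a\<^sup>2) - a * (1 + (norm q)\<^sup>2))" by (intro continuous_intros)
 have y: "2 * \<bar>Im q\<bar> < 1 + (norm q)\<^sup>2"
 proof -
  have "0 < (Re q)\<^sup>2 + (1 - \<bar>Im q\<bar>)\<^sup>2" using q by (simp add: add_pos_nonneg)
  thus ?thesis unfolding cmod_power2 by (simp add: power2_eq_square algebra_simps)
 qed
 obtain a where a: "-1 <= a" "a <= 1" "Im q * (1 + a\<^sup>2) - a * (1 + (norm q)\<^sup>2) = 0"
  using IVT2'[of "\<lambda>a. Im q * (1 + a\<^sup>2) - a * (1 + (norm q)\<^sup>2)" 1 0 "-1"] cont y by (auto simp: abs_if split: if_splits)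
 have "a \<noteq> 1" "a \<noteq> -1" using a(3) y by (auto simp: abs_if split: if_splits)
 hence a1: "\<bar>a\<bar> < 1" using a by (auto simp: abs_if)
 define w where "w = axis_map (-a) q"
 have q1: "norm q <= 1" using q by simp
 have a1': "\<bar>-a\<bar> < 1" using a1 by simp
 have w: "norm w < 1" "Re w > 0" using axis_map_sign[OF a1' q1] q by (auto simp: w_def)
 have "Im ((q - imag a) * cnj (1 + imag a * q)) = Im q * (1 + a\<^sup>2) - a * (1 + (norm q)\<^sup>2)"
  unfolding cmod_power2 by (cases q) (simp add: power2_eq_square algebra_simps)
 hence "Im w = 0" using a(3) unfolding w_def axis_map_def by (simp add: complex_div_cnj[of "q - _"])
 hence wr: "w = of_real (Re w)" by (simp add: complex_eq_iff)
 show thesis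
 proof (rule that[OF a1])
  show "0 < Re w" by fact
  show "Re w < 1" using w(1) complex_Re_le_cmod[of w] by linarith
  show "axis_map a (of_real (Re w)) = q" using axis_map_inverse[OF a1' q1] unfolding wr[symmetric] by (simp add: w_def)
  show "axis_map (-a) q = of_real (Re w)" using wr by (simp add: w_def)
 qed
qed

text \<open>The inverse of \<open>cis\<close> on the left semicircle; the branch cut of the logarithm is turned away from it.\<close>

definition left_angle :: "complex => real" where "left_angle z = pi + Im (Ln (- z))"

lemma continuous_on_left_angle: "continuous_on left_semicircle left_angle" unfolding left_angle_def
 by (intro continuous_intros) (auto simp: left_semicircle_def complex_nonpos_Reals_iff)

lemma left_angle_cis: "t \<in> {pi/2<..<3*pi/2} ==> left_angle (cis t) = t"
proof -
 assume t: "t \<in> {pi/2<..<3*pi/2}"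
 have "- cis t = exp (imag (t - pi))" by (simp add: cis_conv_exp[symmetric] cis_divide[symmetric] del: of_real_diff)
 moreover have "Ln (exp (imag (t - pi))) = imag (t - pi)" using t by (intro Ln_exp) auto
 ultimately show ?thesis by (simp add: left_angle_def)
qed

lemma semicircle_image_length_reparametrize:
 assumes "continuous_on left_semicircle m" "inj_on m left_semicircle" "m ` left_semicircle \<subseteq> left_semicircle"
 shows "semicircle_image_length (f \<circ> m) <= semicircle_image_length f"
proof -
 have "curve_length {pi/2<..<3*pi/2} (f \<circ> (m \<circ> cis)) <= curve_length {pi/2<..<3*pi/2} (f \<circ> cis)"
 proof (rule curve_length_reparametrize[where b' = left_angle])
  show "continuous_on {pi/2<..<3*pi/2} (m \<circ> cis)" using assms(1) by (intro continuous_on_compose continuous_intros) (simp add: left_semicircle_eq)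
  have "inj_on cis {pi/2<..<3*pi/2}" by (metis inj_on_inverseI left_angle_cis)
  thus "inj_on (m \<circ> cis) {pi/2<..<3*pi/2}" using assms(2) by (simp add: comp_inj_on left_semicircle_eq)
  show "(m \<circ> cis) ` {pi/2<..<3*pi/2} \<subseteq> cis ` {pi/2<..<3*pi/2}" unfolding image_comp[symmetric] using assms(3) by (simp only: left_semicircle_eq)
  show "continuous_on (cis ` {pi/2<..<3*pi/2}) left_angle" using continuous_on_left_angle by (simp add: left_semicircle_eq)
 qed (auto simp: left_angle_cis is_interval_oo)
 thus ?thesis by (simp add: semicircle_image_length_def o_def)
qed

text \<open>Composition with \<open>axis_map a\<close> changes neither the vertical diameter nor the left semicircle as sets.\<close>

lemma pole_bound_off_axis:
 assumes q: "norm q < 1" "Re q > 0" and hol: "f holomorphic_on disk - {q}" and inj: "inj_on f (disk - {q})"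
  and pole: "is_pole f q" and fq: "f q = 0" and cont: "continuous_on (disk \<union> left_semicircle - {q}) f"
  and pos: "!!m. continuous_on left_semicircle m ==> inj_on m left_semicircle ==> m ` left_semicircle \<subseteq> left_semicircle ==>
   semicircle_image_length (f \<circ> m) > 0"
 obtains a p where "\<bar>a\<bar> < 1" "0 < p" "p < 1" "norm (axis_map (-a) q) = p"
  "!!\<tau>. \<tau> <= p ==> diameter_image_length f <= GH_pole_const_sup \<tau> * semicircle_image_length f"
proof -
 obtain a p where ap: "\<bar>a\<bar> < 1" "0 < p" "p < 1" "axis_map a (of_real p) = q" "axis_map (-a) q = of_real p" using axis_map_to_positive_real[OF q] by metis
 have a': "\<bar>-a\<bar> < 1" using ap by simp
 define m where "m = axis_map a"
 have inv: "axis_map (-a) (m z) = z" if "norm z <= 1" for z using axis_map_inverse[OF ap(1) that] by (simp add: m_def)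
 have inv': "m (axis_map (-a) z) = z" if "norm z <= 1" for z using axis_map_inverse[OF a' that] by (simp add: m_def)
 have injm: "inj_on m (cball 0 1)" by (rule inj_on_inverseI[of _ "axis_map (-a)"]) (use inv in auto)
 have mb: "m z \<in> disk - {q}" if "z \<in> disk - {of_real p}" for z
 proof -
  have "norm z <= 1" using that by simp
  hence "norm (m z) < 1" using axis_map_sign(1)[OF ap(1), of z] that by (simp add: m_def)
  moreover have "m z \<noteq> q" using inv[OF \<open>norm z <= 1\<close>] ap(5) that by auto
  ultimately show ?thesis by simp
 qed
 have ml: "m z \<in> left_semicircle" if "z \<in> left_semicircle" for z using that axis_map_sign(2,4)[OF ap(1), of z] by (simp add: left_semicircle_def m_def)
 have contm: "continuous_on (cball 0 1) m" unfolding m_def using holomorphic_axis_map[OF ap(1) order_refl] holomorphic_on_imp_continuous_on by blast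
 have lc: "left_semicircle \<subseteq> cball 0 1" by (auto simp: left_semicircle_def)
 define f1 where "f1 = f \<circ> m"
 have holm: "m holomorphic_on disk - {of_real p}" unfolding m_def using ap(1) by (intro holomorphic_axis_map) auto
 have "f1 \<in> M_class p"
 proof (rule M_classI)
  show "f1 holomorphic_on disk - {of_real p}" unfolding f1_def by (rule holomorphic_on_compose_gen[OF holm hol]) (use mb in blast)
  show "inj_on f1 (disk - {of_real p})" unfolding f1_def
  proof (rule comp_inj_on)
   show "inj_on m (disk - {of_real p})" using injm by (rule inj_on_subset) auto
   show "inj_on f (m ` (disk - {of_real p}))" using inj by (rule inj_on_subset) (use mb in blast)
  qed
  show "is_pole f1 (of_real p)" unfolding f1_def o_def
  proof (rule is_pole_compose[OF pole])
   have "isCont m (of_real p)" using contm ap by (auto intro: continuous_on_interior)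
   thus "m \<midarrow>of_real p\<rightarrow> q" using ap(4) unfolding isCont_def m_def by simp
   have "eventually (\<lambda>z. z \<in> disk - {of_real p}) (at (complex_of_real p))" using ap by (intro eventually_at_in_open) auto
   thus "eventually (\<lambda>z. m z \<noteq> q) (at (complex_of_real p))" by eventually_elim (use mb in blast)
  qed
  show "f1 (of_real p) = 0" using ap(4) fq by (simp add: f1_def m_def)
  have "continuous_on (disk \<union> left_semicircle - {of_real p}) m" using contm by (rule continuous_on_subset) (use lc in auto)
  thus "continuous_on (disk \<union> left_semicircle - {of_real p}) f1" unfolding f1_def
  proof (rule continuous_on_compose)
   show "continuous_on (m ` (disk \<union> left_semicircle - {of_real p})) f"
   proof (rule continuous_on_subset[OF cont], rule image_subsetI)
    fix z assume z: "z \<in> disk \<union> left_semicircle - {of_real p}"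
    show "m z \<in> disk \<union> left_semicircle - {q}"
    proof (cases "z \<in> disk")
     case True thus ?thesis using mb[of z] z by blast
    next
     case False thus ?thesis using ml[of z] z q by (auto simp: left_semicircle_def)
    qed
   qed
  qed
 qed (use ap in auto)
 have contm': "continuous_on left_semicircle m" using contm lc continuous_on_subset by blast
 have injm': "inj_on m left_semicircle" using injm lc inj_on_subset by blast
 have "diameter_image_length f <= diameter_image_length f1"
 proof -
  have im: "axis_map (-a) (imag v) = imag (Im (axis_map (-a) (\<i> * of_real v)))" "\<bar>Im (axis_map (-a) (imag v))\<bar> < 1" if "\<bar>v\<bar> < 1" for v
  proof -
   have n: "norm (imag v) < 1" "norm (imag v) <= 1" using that by (simp_all add: norm_mult)
   have "Re (axis_map (-a) (imag v)) = 0" using axis_map_sign(4,5)[OF a' n(2)] by force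
   thus "axis_map (-a) (imag v) = imag (Im (axis_map (-a) (\<i> * of_real v)))" by (simp add: complex_eq_iff)
   have "norm (axis_map (-a) (imag v)) < 1" using axis_map_sign(1)[OF a' n(2)] n by simp
   thus "\<bar>Im (axis_map (-a) (imag v))\<bar> < 1" using abs_Im_le_cmod order.strict_trans1 by blast
  qed
  have "curve_length {-1<..<1} (f \<circ> (\<lambda>v. imag v)) <= curve_length {-1<..<1} (f \<circ> (\<lambda>v. m (imag v)))"
  proof (rule curve_length_reparametrize[where b' = "\<lambda>w. Im (axis_map (-a) w)"])
   show "(\<lambda>v. imag v) ` {-1<..<1} \<subseteq> (\<lambda>v. m (imag v)) ` {-1<..<1}"
   proof (rule image_subsetI)
    fix v :: real assume v: "v \<in> {-1<..<1}"
    hence "\<bar>v\<bar> < 1" by auto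
    hence "imag v = m (imag (Im (axis_map (-a) (\<i> * of_real v))))" using im(1)[of v] inv'[of "imag v"] by (simp add: norm_mult)
    moreover have "Im (axis_map (-a) (imag v)) \<in> {-1<..<1}" using im(2)[OF \<open>\<bar>v\<bar> < 1\<close>] by (auto simp: abs_less_iff)
    ultimately show "imag v \<in> (\<lambda>v. m (imag v)) ` {-1<..<1}" by (rule image_eqI)
   qed
   have "(\<lambda>v. m (imag v)) ` {-1<..<1} \<subseteq> cball 0 1" using axis_map_sign(3)[OF ap(1)] by (auto simp: m_def norm_mult)
   thus "continuous_on ((\<lambda>v. m (imag v)) ` {-1<..<1}) (\<lambda>w. Im (axis_map (-a) w))"
    using holomorphic_axis_map[OF a'] by (intro continuous_intros holomorphic_on_imp_continuous_on)
   show "Im (axis_map (-a) (m (imag t))) = t" if "t \<in> {-1<..<1}" for t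
   proof -
    have "norm (imag t) <= 1" using that by (simp add: norm_mult abs_le_iff)
    thus ?thesis using inv by simp
   qed
  qed (auto intro!: continuous_intros simp: inj_on_def is_interval_oo)
  thus ?thesis by (simp add: diameter_image_length_def f1_def o_def)
 qed
 moreover have "semicircle_image_length f1 <= semicircle_image_length f" unfolding f1_def using contm' injm' ml by (intro semicircle_image_length_reparametrize) auto
 moreover have "semicircle_image_length f1 > 0" unfolding f1_def using contm' injm' ml by (intro pos) auto
 ultimately have "diameter_image_length f <= GH_pole_const_sup \<tau> * semicircle_image_length f" if "\<tau> <= p" for \<tau>
  using diameter_le_GH_pole_const_sup[OF \<open>f1 \<in> M_class p\<close> that ap(3)] by (meson mult_left_mono order_trans zero_le)
 thus thesis using that[of a p] ap by simp
qed

section \<open>The inside of a curve under homeomorphisms\<close>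

lemma image_inside_subset:
 fixes T :: "complex => complex"
 assumes S: "open S" "convex S" and cont: "continuous_on S T" and inj: "inj_on T S" and K: "compact K" "K \<subseteq> S"
 shows "T ` inside K \<subseteq> inside (T ` K)"
proof (rule image_subsetI)
 fix z assume z: "z \<in> inside K"
 have KS: "inside K \<subseteq> S" using outside_subset_convex[OF S(2) K(2)] inside_Int_outside[of K] by blast
 define U where "U = connected_component_set (- K) z"
 have zK: "z \<notin> K" using z inside_no_overlap[of K] by blast
 have U: "open U" "connected U" "z \<in> U" "U \<inter> K = {}" "bounded U" using K(1) zK z connected_component_subset[of "- K" z]
  by (auto simp: U_def inside_def compact_imp_closed open_Compl intro!: open_connected_component)
 have UI: "U \<subseteq> inside K" using z inside_same_component[of K z] by (auto simp: U_def)
 have clU: "closure U \<subseteq> U \<union> K"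
 proof -
  have "frontier U \<subseteq> frontier (- K)" unfolding U_def by (rule frontier_of_connected_component_subset)
  also have "... \<subseteq> K" using K(1) by (simp add: compact_imp_closed frontier_subset_closed frontier_complement)
  finally show ?thesis using U(1) by (auto simp: frontier_def interior_open)
 qed
 have clS: "closure U \<subseteq> S" using clU UI KS K(2) by blast
 have compcl: "compact (T ` closure U)" using U(5) clS by (intro compact_continuous_image continuous_on_subset[OF cont]) (auto simp: compact_closure)
 have US: "U \<subseteq> S" using UI KS by blast
 have oTU: "open (T ` U)" using U(1) US by (intro invariance_of_domain continuous_on_subset[OF cont] inj_on_subset[OF inj])
 have Tz: "T z \<notin> T ` K" using inj zK U(3) US K(2) by (auto dest: inj_onD)
 have "connected_component_set (- T ` K) (T z) \<subseteq> T ` U"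
 proof -
  define X where "X = connected_component_set (- T ` K) (T z)"
  have X: "connected X" "T z \<in> X" "X \<inter> T ` K = {}" using Tz connected_component_subset[of "- T ` K" "T z"] by (auto simp: X_def)
  have "X \<subseteq> T ` U \<union> - T ` closure U" using X(3) clU by blast
  moreover have "T ` U \<inter> - T ` closure U \<inter> X = {}" using closure_subset[of U] by blast
  moreover have "open (- T ` closure U)" using compcl by (simp add: compact_imp_closed open_Compl)
  ultimately have "T ` U \<inter> X = {} \<or> - T ` closure U \<inter> X = {}" using connectedD[OF X(1) oTU] by blast
  hence "- T ` closure U \<inter> X = {}" using X(2) U(3) by blast
  thus ?thesis using \<open>X \<subseteq> T ` U \<union> - T ` closure U\<close> unfolding X_def by blast
 qed
 moreover have "bounded (T ` U)" using compcl closure_subset[of U] by (meson bounded_subset compact_imp_bounded image_mono)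
 ultimately show "T z \<in> inside (T ` K)" using Tz by (auto simp: inside_def intro: bounded_subset)
qed

lemma inside_homeomorphic_image:
 fixes T :: "complex => complex"
 assumes "open S" "convex S" "open S'" "convex S'" "homeomorphism S S' T T'" "compact K" "K \<subseteq> S"
 shows "inside (T ` K) = T ` inside K"
proof
 note hom = assms(5)[unfolded homeomorphism_def]
 have inj: "inj_on T S" "inj_on T' S'" using hom by (auto intro: inj_on_inverseI)
 show "T ` inside K \<subseteq> inside (T ` K)" using assms inj hom by (intro image_inside_subset) auto
 have KS: "inside K \<subseteq> S" using outside_subset_convex[OF assms(2,7)] inside_Int_outside[of K] by blast
 have TK: "compact (T ` K)" "T ` K \<subseteq> S'" using hom assms(6,7) by (auto intro!: compact_continuous_image intro: continuous_on_subset)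
 have KS': "inside (T ` K) \<subseteq> S'" using outside_subset_convex[OF assms(4) TK(2)] inside_Int_outside[of "T ` K"] by blast
 have "T' ` inside (T ` K) \<subseteq> inside (T' ` T ` K)" using assms inj hom TK by (intro image_inside_subset) auto
 also have "T' ` T ` K = K"
 proof -
  have "T' (T x) = x" if "x \<in> K" for x using hom assms(7) that by blast
  thus ?thesis by (simp add: image_image)
 qed
 finally have sub: "T' ` inside (T ` K) \<subseteq> inside K" .
 show "inside (T ` K) \<subseteq> T ` inside K"
 proof
  fix w assume w: "w \<in> inside (T ` K)"
  hence "w = T (T' w)" using hom KS' by auto
  moreover have "T' w \<in> inside K" using sub w by blast
  ultimately show "w \<in> T ` inside K" by (rule image_eqI)
 qed
qed

section \<open>The symmetric domain of a crosscut\<close>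

definition reflect_axis :: "complex => complex" where "reflect_axis z = - cnj z"

lemma reflect_axis_simps [simp]: "reflect_axis (reflect_axis z) = z" "Re (reflect_axis z) = - Re z"
 "Im (reflect_axis z) = Im z" "norm (reflect_axis z) = norm z" by (auto simp: reflect_axis_def)

lemma reflect_axis_fixed: "reflect_axis z = z \<longleftrightarrow> Re z = 0" by (auto simp: complex_eq_iff)

lemma continuous_reflect_axis: "continuous_on S reflect_axis" unfolding reflect_axis_def by (intro continuous_intros)

lemma inj_reflect_axis: "inj_on reflect_axis S" by (rule inj_on_inverseI[of _ reflect_axis]) simp

lemma inside_reflect_axis: "compact K ==> inside (reflect_axis ` K) = reflect_axis ` inside K"
proof (rule inside_homeomorphic_image[of UNIV UNIV reflect_axis reflect_axis])
 show "homeomorphism UNIV UNIV reflect_axis reflect_axis" by (rule homeomorphismI) (auto simp: continuous_reflect_axis intro: surjI[THEN equalityD2])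
qed auto

locale axis_crosscut =
 fixes c :: "real => complex" and u v \<sigma> :: real
 assumes arc: "arc c" and ends: "pathstart c = imag u" "pathfinish c = imag v"
  and side: "!!t. 0 < t ==> t < 1 ==> \<sigma> * Re (c t) < 0" and \<sigma>: "\<sigma> \<noteq> 0"
begin

definition rc where "rc = reflect_axis \<circ> c"
definition loop where "loop = c +++ reversepath rc"
definition K where "K = path_image c \<union> reflect_axis ` path_image c"
definition G where "G = inside K"
definition seg where "seg = imag ` {min u v<..<max u v}"
definition chord where "chord = linepath (imag u) (imag v)"

lemma uv: "u \<noteq> v"
proof
 assume "u = v"
 hence "c 0 = c 1" using ends by (simp add: pathstart_def pathfinish_def)
 thus False using arc unfolding arc_def by (auto dest: inj_onD)
qed

lemma arc_rc: "arc rc" unfolding rc_def using arc by (auto simp: arc_def intro!: path_continuous_image continuous_reflect_axis comp_inj_on inj_reflect_axis)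

lemma path_image_rc: "path_image rc = reflect_axis ` path_image c" by (simp add: rc_def path_image_compose)

lemma ends_rc: "pathstart rc = imag u" "pathfinish rc = imag v" using ends by (auto simp: rc_def pathstart_compose pathfinish_compose reflect_axis_def complex_eq_iff)

lemma c_interior: "w \<in> path_image c ==> w \<noteq> imag u ==> w \<noteq> imag v ==> w \<in> c ` {0<..<1}"
 using ends unfolding path_image_def pathstart_def pathfinish_def by (force simp: less_le)

lemma c_image: "path_image c = insert (imag u) (insert (imag v) (c ` {0<..<1}))"
proof
 show "path_image c \<subseteq> insert (imag u) (insert (imag v) (c ` {0<..<1}))" using c_interior by blast
 have "c 0 \<in> path_image c" "c 1 \<in> path_image c" "c ` {0<..<1} \<subseteq> path_image c" by (auto simp: path_image_def)
 thus "insert (imag u) (insert (imag v) (c ` {0<..<1})) \<subseteq> path_image c" using ends by (simp add: pathstart_def pathfinish_def)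
qed

lemma c_side: "w \<in> c ` {0<..<1} ==> \<sigma> * Re w < 0" using side by auto

lemma c_side_le: "w \<in> path_image c ==> \<sigma> * Re w <= 0" unfolding c_image using c_side by fastforce

lemma c_rc_Int: "path_image c \<inter> path_image rc = {imag u, imag v}"
proof
 show "path_image c \<inter> path_image rc \<subseteq> {imag u, imag v}"
 proof
  fix w assume w: "w \<in> path_image c \<inter> path_image rc"
  hence "\<sigma> * Re w \<ge> 0" using c_side_le by (auto simp: path_image_rc)
  hence "w \<notin> c ` {0<..<1}" using c_side by fastforce
  thus "w \<in> {imag u, imag v}" using w c_image by auto
 qed
 show "{imag u, imag v} \<subseteq> path_image c \<inter> path_image rc"
  using pathstart_in_path_image[of c] pathfinish_in_path_image[of c] pathstart_in_path_image[of rc] pathfinish_in_path_image[of rc] by (simp add: ends ends_rc)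
qed

lemma loop: "simple_path loop" "pathfinish loop = pathstart loop" "path_image loop = K"
proof -
 show "simple_path loop" unfolding loop_def using arc arc_rc c_rc_Int by (intro simple_path_join_loop) (auto simp: ends ends_rc arc_reversepath)
 show "pathfinish loop = pathstart loop" by (simp add: loop_def ends ends_rc)
 show "path_image loop = K" unfolding loop_def K_def by (subst path_image_join) (auto simp: ends ends_rc path_image_rc)
qed

lemma compact_K: "compact K" using loop(1,3) compact_simple_path_image by fastforce

lemma reflect_K: "reflect_axis ` K = K" unfolding K_def image_Un image_image by auto

lemma reflect_G: "reflect_axis ` G = G" unfolding G_def using inside_reflect_axis[OF compact_K] reflect_K by simp

lemma G_props: "open G" "connected G" "G \<noteq> {}" "G \<inter> K = {}" "frontier G = K" "bounded G"
 using Jordan_inside_outside[OF loop(1,2)] inside_no_overlap[of K] unfolding loop(3) G_def by (auto simp: bounded_inside compact_imp_bounded compact_K)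

lemma K_axis: "w \<in> K ==> Re w = 0 \<longleftrightarrow> w = imag u \<or> w = imag v"
proof -
 assume w: "w \<in> K"
 have "x = imag u \<or> x = imag v" if "x \<in> path_image c" "Re x = 0" for x using that c_image c_side[of x] by auto
 from this[of w] this[of "reflect_axis w"] have "w = imag u \<or> w = imag v" if "Re w = 0" using that w reflect_axis_fixed[of w] unfolding K_def by auto
 thus ?thesis by auto
qed

lemma seg_eq: "seg = {w. Re w = 0 \<and> min u v < Im w \<and> Im w < max u v}"
proof (intro equalityI subsetI)
 fix w assume "w \<in> {w. Re w = 0 \<and> min u v < Im w \<and> Im w < max u v}"
 hence "w = imag (Im w)" "Im w \<in> {min u v<..<max u v}" by (auto simp: complex_eq_iff)
 thus "w \<in> seg" unfolding seg_def by blast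
qed (auto simp: seg_def)

lemma seg_K: "seg \<inter> K = {}" using K_axis uv unfolding seg_eq by fastforce

text \<open>The rest of the axis above or below the segment is connected, unbounded and disjoint from \<open>K\<close>.\<close>

lemma G_axis: "w \<in> G ==> Re w = 0 ==> w \<in> seg"
proof (rule ccontr)
 assume w: "w \<in> G" "Re w = 0" "w \<notin> seg"
 have wK: "w \<notin> K" using w G_props(4) by blast
 have "w \<noteq> imag u" "w \<noteq> imag v" using wK c_image unfolding K_def by auto
 hence "Im w \<noteq> u" "Im w \<noteq> v" using w(2) by (auto simp: complex_eq_iff)
 then consider "Im w > max u v" | "Im w < min u v" using w(2,3) unfolding seg_eq by (auto simp: min_def max_def split: if_splits)
 then obtain X :: "real set" where X: "is_interval X" "Im w \<in> X" "u \<notin> X" "v \<notin> X" "\<not> bounded X"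
 proof cases
  case 1
  have "\<not> bounded {Im w..}"
  proof
   assume "bounded {Im w..}"
   then obtain B where B: "!!x. Im w <= x ==> \<bar>x\<bar> <= B" by (auto simp: bounded_iff)
   from B[of "max (Im w) (B + 1)"] show False by simp
  qed
  thus thesis using 1 that[of "{Im w..}"] by (simp add: is_interval_ci)
 next
  case 2
  have "\<not> bounded {..Im w}"
  proof
   assume "bounded {..Im w}"
   then obtain B where B: "!!x. x <= Im w ==> \<bar>x\<bar> <= B" by (auto simp: bounded_iff)
   from B[of "min (Im w) (- B - 1)"] show False by simp
  qed
  thus thesis using 2 that[of "{..Im w}"] by (simp add: is_interval_ic)
 qed
 define Y where "Y = imag ` X"
 have "connected Y" unfolding Y_def using X(1) by (intro connected_continuous_image continuous_intros) (simp add: is_interval_connected_1)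
 moreover have "Y \<subseteq> - K" using K_axis X(3,4) unfolding Y_def by fastforce
 moreover have "w \<in> Y"
 proof -
  have "w = imag (Im w)" using w(2) by (simp add: complex_eq_iff)
  thus ?thesis unfolding Y_def using X(2) by blast
 qed
 ultimately have "Y \<subseteq> connected_component_set (- K) w" by (intro connected_component_maximal)
 moreover have "\<not> bounded Y"
 proof
  assume "bounded Y"
  then obtain B where "!!y. y \<in> Y ==> norm y <= B" unfolding bounded_iff by blast
  hence "!!t. t \<in> X ==> norm t <= B" unfolding Y_def by (force simp: norm_mult)
  thus False using X(5) unfolding bounded_iff by blast
 qed
 ultimately have "\<not> bounded (connected_component_set (- K) w)" using bounded_subset by blast
 thus False using w(1) unfolding G_def inside_def by blast
qed

lemma seg_subset_G: "seg \<subseteq> G"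
proof -
 obtain z where z: "z \<in> G" using G_props(3) by blast
 have "reflect_axis z \<in> G" using z reflect_G by blast
 have "connected (Re ` G)" using G_props(2) by (intro connected_continuous_image continuous_intros)
 moreover have "Re z \<in> Re ` G" "- Re z \<in> Re ` G" using z \<open>reflect_axis z \<in> G\<close> by (auto intro: image_eqI[of _ _ "reflect_axis z"])
 ultimately have "0 \<in> Re ` G" using connectedD_interval[of "Re ` G" "Re z" "- Re z" 0] connectedD_interval[of "Re ` G" "- Re z" "Re z" 0] by (cases "Re z <= 0") auto
 then obtain w where "w \<in> G" "Re w = 0" by auto
 hence "w \<in> seg" using G_axis by blast
 have "connected seg" unfolding seg_def by (intro connected_continuous_image continuous_intros) auto
 hence "seg \<subseteq> connected_component_set (- K) w" using seg_K \<open>w \<in> seg\<close> by (intro connected_component_maximal) auto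
 thus ?thesis using \<open>w \<in> G\<close> inside_same_component[of K w] unfolding G_def by auto
qed

text \<open>The segment divides \<open>G\<close> into two Jordan domains, and the one bounded by the mirror image of \<open>c\<close> lies on the other side of the axis.\<close>

lemma half_inside:
 assumes w: "w \<in> G" "\<sigma> * Re w < 0" shows "w \<in> inside (path_image c \<union> closed_segment (imag u) (imag v))"
proof -
 have ne: "imag u \<noteq> imag v" using uv by simp
 have Rech: "Re z = 0" if "z \<in> path_image chord" for z using that unfolding chord_def by (auto simp: closed_segment_def)
 have arcch: "arc chord" using ne by (simp add: chord_def)
 have ch: "path_image c \<inter> path_image chord = {imag u, imag v}" "path_image rc \<inter> path_image chord = {imag u, imag v}"
 proof -
  have "z \<in> {imag u, imag v}" if "z \<in> K" "z \<in> path_image chord" for z using K_axis[OF that(1)] Rech[OF that(2)] by blast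
  moreover have "{imag u, imag v} \<subseteq> path_image chord" by (auto simp: chord_def)
  ultimately show "path_image c \<inter> path_image chord = {imag u, imag v}" "path_image rc \<inter> path_image chord = {imag u, imag v}"
   using c_rc_Int unfolding K_def path_image_rc by blast+
 qed
 have mid: "imag ((u + v) / 2) \<in> path_image chord \<inter> G"
 proof -
  have "imag ((u + v) / 2) \<in> seg" using uv unfolding seg_eq by (auto simp: min_def max_def)
  moreover have "imag ((u + v) / 2) = midpoint (imag u) (imag v)" by (simp add: midpoint_def complex_eq_iff)
  ultimately show ?thesis using seg_subset_G by (auto simp: chord_def)
 qed
 have Krc: "path_image c \<union> path_image rc = K" by (simp add: K_def path_image_rc)
 have split: "inside (path_image c \<union> path_image chord) \<union> inside (path_image rc \<union> path_image chord) \<union>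
     (path_image chord - {imag u, imag v}) = G" by (rule split_inside_simple_closed_curve[of c "imag u" "imag v" rc chord])
   (use arc arc_rc arcch ends ends_rc ne c_rc_Int ch mid Krc in \<open>auto simp: arc_imp_simple_path chord_def G_def\<close>)
 have "w \<notin> path_image chord" using w(2) Rech by fastforce
 moreover have "w \<notin> inside (path_image rc \<union> path_image chord)"
 proof
  assume "w \<in> inside (path_image rc \<union> path_image chord)"
  moreover have "convex {z. \<sigma> * Re z \<ge> 0}"
  proof -
   have "{z. \<sigma> * Re z \<ge> 0} = {z. of_real \<sigma> \<bullet> z \<ge> 0}" by (simp add: inner_complex_def)
   thus ?thesis by (simp add: convex_halfspace_ge)
  qed
  moreover have "path_image rc \<union> path_image chord \<subseteq> {z. \<sigma> * Re z \<ge> 0}" using c_side_le Rech by (auto simp: path_image_rc)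
  ultimately have "w \<in> {z. \<sigma> * Re z \<ge> 0}" using outside_subset_convex[of "{z. \<sigma> * Re z \<ge> 0}"] inside_Int_outside by blast
  thus False using w(2) by simp
 qed
 ultimately show ?thesis using w(1) split by (auto simp: chord_def)
qed

text \<open>Let \<open>0\<close> correspond to the midpoint of the segment. A Riemann map with this property is unique up to a rotation, and a suitable rotation makes it commute with the reflection.\<close>

lemma symmetric_riemann_map:
 obtains g f where "g holomorphic_on disk" "!!z. z \<in> disk ==> g z \<in> G" "!!z. z \<in> disk ==> f (g z) = z"
  "f holomorphic_on G" "!!w. w \<in> G ==> f w \<in> disk" "!!w. w \<in> G ==> g (f w) = w"
  "!!z. z \<in> disk ==> g (reflect_axis z) = reflect_axis (g z)"
proof -
 have "simply_connected G" using simply_connected_inside_simple_path[OF loop(1)] by (simp add: loop(3) G_def)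
 moreover have "G \<noteq> UNIV" using G_props(6) by (metis not_bounded_UNIV)
 ultimately obtain f1 g1 where fg1: "f1 holomorphic_on G" "g1 holomorphic_on disk"
  "!!z. z \<in> G ==> f1 z \<in> disk \<and> g1 (f1 z) = z" "!!z. z \<in> disk ==> g1 z \<in> G \<and> f1 (g1 z) = z"
  using simply_connected_eq_biholomorphic_to_disc[OF G_props(1)] G_props(3) by blast
 define m where "m = imag ((u + v) / 2)"
 have "m \<in> seg" unfolding m_def seg_eq using uv by (auto simp: min_def max_def)
 hence m: "m \<in> G" "Re m = 0" using seg_subset_G by (auto simp: m_def)
 obtain h k where hk: "h (f1 m) = 0" "h holomorphic_on disk" "h ` disk \<subseteq> disk"
  "k holomorphic_on disk" "k ` disk \<subseteq> disk" "!!z. z \<in> disk ==> h (k z) = z" "!!z. z \<in> disk ==> k (h z) = z"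
  using ball_biholomorphism_exists[of "f1 m"] fg1(3)[OF m(1)] by blast
 define f0 where "f0 = h \<circ> f1"
 define g0 where "g0 = g1 \<circ> k"
 have f0: "f0 holomorphic_on G" "!!w. w \<in> G ==> f0 w \<in> disk" "!!w. w \<in> G ==> g0 (f0 w) = w" "f0 m = 0"
 proof -
  have hb: "h z \<in> disk" if "z \<in> disk" for z using hk(3) that by blast
  show "f0 holomorphic_on G" unfolding f0_def by (rule holomorphic_on_compose_gen[OF fg1(1) hk(2)]) (use fg1(3) in blast)
  show "f0 w \<in> disk" "g0 (f0 w) = w" if "w \<in> G" for w using fg1(3)[OF that] hb hk(7) by (auto simp: f0_def g0_def)
  show "f0 m = 0" using hk(1) by (simp add: f0_def)
 qed
 have g0: "g0 holomorphic_on disk" "!!z. z \<in> disk ==> g0 z \<in> G" "!!z. z \<in> disk ==> f0 (g0 z) = z"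
 proof -
  have kb: "k z \<in> disk" if "z \<in> disk" for z using hk(5) that by blast
  show "g0 holomorphic_on disk" unfolding g0_def by (rule holomorphic_on_compose_gen[OF hk(4) fg1(2) hk(5)])
  show "g0 z \<in> G" "f0 (g0 z) = z" if "z \<in> disk" for z using fg1(4)[OF kb[OF that]] hk(6)[OF that] by (auto simp: f0_def g0_def)
 qed
 have g00: "g0 0 = m" using f0(3)[OF m(1)] f0(4) by simp
 define H where "H z = f0 (reflect_axis (g0 (cnj z)))" for z
 have refG: "reflect_axis w \<in> G" if "w \<in> G" for w using that reflect_G by blast
 have HD: "H z \<in> disk" if "z \<in> disk" for z unfolding H_def using that by (intro f0(2) refG g0(2)) simp
 have "cnj \<circ> g0 \<circ> cnj holomorphic_on disk"
 proof (rule holomorphic_on_compose_cnj_cnj)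
  have "cnj ` disk \<subseteq> disk" by auto
  thus "g0 holomorphic_on cnj ` disk" by (rule holomorphic_on_subset[OF g0(1)])
 qed simp
 hence "(\<lambda>z. - (cnj \<circ> g0 \<circ> cnj) z) holomorphic_on disk" by (rule holomorphic_on_minus)
 hence hol: "(\<lambda>z. reflect_axis (g0 (cnj z))) holomorphic_on disk" by (simp add: reflect_axis_def o_def)
 have holH: "H holomorphic_on disk"
 proof -
  have "(\<lambda>z. reflect_axis (g0 (cnj z))) ` disk \<subseteq> G" using refG g0(2) by (intro image_subsetI) simp
  from holomorphic_on_compose_gen[OF hol f0(1) this] show ?thesis by (simp add: H_def[abs_def] o_def)
 qed
 have H0: "H 0 = 0" using g00 m reflect_axis_fixed[of m] f0(4) by (simp add: H_def)
 have HH: "H (cnj (H (cnj z))) = z" if "z \<in> disk" for z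
 proof -
  have "g0 z \<in> G" using g0(2) that by blast
  hence "g0 (H (cnj z)) = reflect_axis (g0 z)" by (simp add: H_def f0(3) refG)
  thus ?thesis using \<open>g0 z \<in> G\<close> that by (simp add: H_def g0(3))
 qed
 have HDn: "norm (H z) < 1" if "norm z < 1" for z using HD[of z] that by simp
 have "norm (H z) = norm z" if z: "norm z < 1" for z
 proof (rule antisym)
  show "norm (H z) <= norm z" by (rule Schwarz_Lemma(1)[OF holH H0 HDn z])
  have "H (cnj (H z)) = cnj z" using HH[of "cnj z"] z by simp
  hence "norm z = norm (H (cnj (H z)))" by simp
  also have "... <= norm (cnj (H z))" by (rule Schwarz_Lemma(1)[OF holH H0 HDn]) (use HDn[OF z] in auto)
  finally show "norm z <= norm (H z)" by simp
 qed
 from this[of "1/2"] have ex: "\<exists>z. norm z < 1 \<and> z \<noteq> 0 \<and> norm (H z) = norm z" by (intro exI[of _ "1/2"]) simp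
 obtain \<alpha> where \<alpha>: "!!z. norm z < 1 ==> H z = \<alpha> * z" "norm \<alpha> = 1" using Schwarz_Lemma(3)[OF holH H0 HDn, of 0] ex by auto
 define \<beta> where "\<beta> = csqrt (- \<alpha>)"
 have \<beta>: "\<beta> * \<beta> = - \<alpha>" "norm \<beta> = 1"
 proof -
  show "\<beta> * \<beta> = - \<alpha>" unfolding \<beta>_def using power2_csqrt[of "-\<alpha>"] by (simp add: power2_eq_square)
  hence "norm \<beta> * norm \<beta> = 1" using \<alpha>(2) by (metis norm_minus_cancel norm_mult)
  thus "norm \<beta> = 1" using power2_eq_1_iff[of "norm \<beta>"] norm_ge_zero[of \<beta>] by (auto simp: power2_eq_square)
 qed
 have \<beta>c: "\<beta> * cnj \<beta> = 1" using \<beta>(2) by (simp add: complex_norm_square[symmetric])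
 have \<beta>D: "\<beta> * z \<in> disk" "cnj \<beta> * z \<in> disk" if "z \<in> disk" for z using that \<beta>(2) by (simp_all add: norm_mult)
 show thesis
 proof (rule that[of "\<lambda>z. g0 (\<beta> * z)" "\<lambda>w. cnj \<beta> * f0 w"])
  have "(\<lambda>z. \<beta> * z) holomorphic_on disk" by (intro holomorphic_intros)
  moreover have "(\<lambda>z. \<beta> * z) ` disk \<subseteq> disk" using \<beta>D(1) by (intro image_subsetI)
  ultimately show "(\<lambda>z. g0 (\<beta> * z)) holomorphic_on disk"
   using holomorphic_on_compose_gen[of "\<lambda>z. \<beta> * z" "disk" g0 "disk"] g0(1) by (simp add: o_def)
  show "(\<lambda>w. cnj \<beta> * f0 w) holomorphic_on G" by (intro holomorphic_intros f0(1))
  show "g0 (\<beta> * z) \<in> G" if "z \<in> disk" for z using \<beta>D(1)[OF that] g0(2) by blast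
  show "cnj \<beta> * f0 (g0 (\<beta> * z)) = z" if "z \<in> disk" for z
   using \<beta>D(1)[OF that] g0(3) \<beta>c by (simp add: mult.assoc[symmetric] mult.commute[of "cnj \<beta>"])
  show "cnj \<beta> * f0 w \<in> disk" if "w \<in> G" for w using \<beta>D(2) f0(2) that by blast
  show "g0 (\<beta> * (cnj \<beta> * f0 w)) = w" if "w \<in> G" for w using f0(3) \<beta>c that by (simp add: mult.assoc[symmetric])
  show "g0 (\<beta> * reflect_axis z) = reflect_axis (g0 (\<beta> * z))" if z: "z \<in> disk" for z
  proof -
   have w: "cnj (\<beta> * z) \<in> disk" using \<beta>D(1)[OF z] by (metis complex_mod_cnj mem_ball_0)
   have "reflect_axis (g0 (\<beta> * z)) = g0 (H (cnj (\<beta> * z)))" using \<beta>D(1)[OF z] by (simp add: H_def f0(3) refG g0(2))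
   also have "H (cnj (\<beta> * z)) = \<alpha> * cnj (\<beta> * z)" using \<alpha>(1)[of "cnj (\<beta> * z)"] w by simp
   also have "... = \<beta> * (\<beta> * cnj \<beta>) * (- cnj z)"
   proof -
    have "\<alpha> = - (\<beta> * \<beta>)" using \<beta>(1) by simp
    thus ?thesis by (simp add: algebra_simps)
   qed
   also have "... = \<beta> * reflect_axis z" by (simp add: \<beta>c reflect_axis_def)
   finally show ?thesis by simp
  qed
 qed
qed

text \<open>By symmetry the vertical diameter corresponds to the fixed points of the reflection in \<open>G\<close>. The two semicircles then correspond to \<open>c\<close> and its mirror image, if necessary after a rotation by \<open>\<pi>\<close>.\<close>

lemma semicircle_parametrization:
 obtains \<phi> \<phi>' where "homeomorphism (cball 0 1) (G \<union> K) \<phi> \<phi>'" "\<phi> holomorphic_on disk" "\<phi> ` disk = G" "\<phi> ` sphere 0 1 = K"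
  "\<phi> ` left_semicircle = c ` {0<..<1}" "!!z. z \<in> disk ==> \<phi> z \<in> seg \<longleftrightarrow> Re z = 0"
  "!!z. z \<in> disk ==> Re z < 0 ==> \<phi> z \<in> inside (path_image c \<union> closed_segment (imag u) (imag v))"
proof -
 obtain g f where gf: "g holomorphic_on disk" "!!z. z \<in> disk ==> g z \<in> G" "!!z. z \<in> disk ==> f (g z) = z"
  "f holomorphic_on G" "!!w. w \<in> G ==> f w \<in> disk" "!!w. w \<in> G ==> g (f w) = w"
  "!!z. z \<in> disk ==> g (reflect_axis z) = reflect_axis (g z)" using symmetric_riemann_map by blast
 note JG = loop(3) G_def
 obtain F F' where F: "homeomorphism (cball 0 1) (G \<union> K) F F'" "!!z. z \<in> disk ==> F z = g z"
  by (rule caratheodory_jordan[OF loop(1,2), of g f]) (use gf in \<open>auto simp: loop(3) G_def[symmetric]\<close>)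
 have contF: "continuous_on (cball 0 1) F" and FF': "!!z. z \<in> cball 0 1 ==> F' (F z) = z" "!!w. w \<in> G \<union> K ==> F (F' w) = w"
  and Fim: "F ` cball 0 1 = G \<union> K" "F' ` (G \<union> K) = cball 0 1" using F(1) by (auto simp: homeomorphism_def)
 have Fball: "F ` disk = G"
 proof (intro equalityI subsetI)
  fix w assume "w \<in> G"
  hence "F (f w) = w" "f w \<in> disk" using F(2) gf by auto
  thus "w \<in> F ` disk" by (metis imageI)
 qed (use F(2) gf in auto)
 have Fsph: "F ` sphere 0 1 = K"
 proof -
  have inj: "inj_on F (cball 0 1)" by (rule inj_on_inverseI[of _ F']) (use FF' in auto)
  have "sphere (0::complex) 1 = cball 0 1 - disk" by auto
  hence "F ` sphere 0 1 = F ` cball 0 1 - F ` disk" using inj_on_image_set_diff[OF inj, of "cball 0 1" "disk"] by auto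
  also have "... = K" using Fim Fball G_props(4) by blast
  finally show ?thesis .
 qed
 have sym: "F (reflect_axis z) = reflect_axis (F z)" if "z \<in> cball 0 1" for z
 proof -
  have rc: "continuous_on (cball 0 1) (\<lambda>z. F (reflect_axis z))" by (rule continuous_on_compose2[OF contF continuous_reflect_axis]) auto
  have "continuous_on (closure disk) (\<lambda>z. F (reflect_axis z) - reflect_axis (F z))" using contF rc unfolding reflect_axis_def by (intro continuous_intros) auto
  hence "F (reflect_axis z) - reflect_axis (F z) = 0" by (rule continuous_constant_on_closure) (use F(2) gf(7) that in auto)
  thus ?thesis by simp
 qed
 have lc: "left_semicircle \<subseteq> cball 0 1" "left_semicircle \<subseteq> sphere 0 1" by (auto simp: left_semicircle_def)
 have Re0: "Re z = 0" if "z \<in> cball 0 1" "Re (F z) = 0" for z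
 proof -
  have "F (reflect_axis z) = F z" using sym[OF that(1)] that(2) reflect_axis_fixed by metis
  hence "reflect_axis z = z" using FF'(1)[of "reflect_axis z"] FF'(1)[OF that(1)] that(1) by (simp add: )
  thus ?thesis by (simp add: reflect_axis_fixed)
 qed
 have Re0': "Re (F z) = 0" if "z \<in> cball 0 1" "Re z = 0" for z using sym[OF that(1)] that(2) reflect_axis_fixed by metis
 have Kc: "w \<in> c ` {0<..<1}" if "w \<in> K" "\<sigma> * Re w < 0" for w
 proof -
  have "w \<in> path_image c"
  proof (rule ccontr)
   assume "w \<notin> path_image c"
   hence "reflect_axis w \<in> path_image c" using that(1) unfolding K_def by auto
   thus False using c_side_le[of "reflect_axis w"] that(2) by simp
  qed
  thus ?thesis using that(2) c_image by auto
 qed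
 define E where "E = {z. norm z <= 1 \<and> Re z < 0}"
 have "connected E"
 proof -
  have "E = cball 0 1 \<inter> {z. Re z < 0}" by (auto simp: E_def)
  hence "convex E" by (simp add: convex_Int convex_halfspace_Re_lt)
  thus ?thesis by (rule convex_connected)
 qed
 hence conE: "connected ((\<lambda>z. \<sigma> * Re (F z)) ` E)" by (intro connected_continuous_image continuous_intros continuous_on_subset[OF contF]) (auto simp: E_def)
 have ne0: "0 \<notin> (\<lambda>z. \<sigma> * Re (F z)) ` E" using Re0 \<sigma> by (force simp: E_def)
 have lE: "left_semicircle \<subseteq> E" by (auto simp: E_def left_semicircle_def)
 have "\<exists>\<epsilon>\<in>{1,-1}. \<forall>z\<in>E. \<sigma> * Re (F (\<epsilon> * z)) < 0"
 proof (cases "\<exists>z\<in>E. \<sigma> * Re (F z) < 0")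
  case True
  then obtain z where z: "z \<in> E" "\<sigma> * Re (F z) < 0" by blast
  have "\<sigma> * Re (F x) < 0" if "x \<in> E" for x
  proof (rule ccontr)
   assume "\<not> \<sigma> * Re (F x) < 0"
   hence "0 \<in> (\<lambda>z. \<sigma> * Re (F z)) ` E" using connectedD_interval[OF conE, of "\<sigma> * Re (F z)" "\<sigma> * Re (F x)" 0] z that by auto
   thus False using ne0 by blast
  qed
  thus ?thesis by (intro bexI[of _ 1]) auto
 next
  case False
  have "\<sigma> * Re (F (- z)) < 0" if z: "z \<in> E" for z
  proof -
   have zc: "- z \<in> cball 0 1" "reflect_axis (- z) \<in> E" using z by (auto simp: E_def)
   have "\<not> \<sigma> * Re (F (reflect_axis (-z))) < 0" using False zc by blast
   moreover have "\<sigma> * Re (F (reflect_axis (-z))) \<noteq> 0" using ne0 zc(2) by (metis imageI)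
   moreover have "\<sigma> * Re (F (reflect_axis (-z))) = - (\<sigma> * Re (F (-z)))" using sym[OF zc(1)] by simp
   ultimately show ?thesis by linarith
  qed
  thus ?thesis by (intro bexI[of _ "-1"]) auto
 qed
 then obtain \<epsilon> where \<epsilon>: "\<epsilon> = 1 \<or> \<epsilon> = -1" "!!z. z \<in> E ==> \<sigma> * Re (F (\<epsilon> * z)) < 0" by blast
 have \<epsilon>\<epsilon>: "\<epsilon> * (\<epsilon> * z) = z" "norm (\<epsilon> * z) = norm z" "Re (\<epsilon> * z) = 0 \<longleftrightarrow> Re z = 0" for z using \<epsilon>(1) by (auto simp: norm_mult)
 have \<epsilon>im: "(\<lambda>z. \<epsilon> * z) ` cball 0 1 = cball 0 1" "(\<lambda>z. \<epsilon> * z) ` disk = disk" "(\<lambda>z. \<epsilon> * z) ` sphere 0 1 = sphere 0 1"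
  using \<epsilon>\<epsilon>(1,2) by (auto intro!: image_eqI[of _ _ "\<epsilon> * _"])
 have hom\<epsilon>: "homeomorphism (cball 0 1) (cball 0 1) (\<lambda>z. \<epsilon> * z) (\<lambda>z. \<epsilon> * z)"
  by (rule homeomorphismI) (auto intro!: continuous_intros simp: \<epsilon>\<epsilon>)
 show thesis
 proof (rule that)
  show "homeomorphism (cball 0 1) (G \<union> K) (F \<circ> (\<lambda>z. \<epsilon> * z)) ((\<lambda>z. \<epsilon> * z) \<circ> F')"
   by (rule homeomorphism_compose[OF hom\<epsilon> F(1)])
  have "(\<lambda>z. \<epsilon> * z) holomorphic_on disk" by (intro holomorphic_intros)
  moreover have "F holomorphic_on disk" using gf(1) F(2) by (metis holomorphic_transform)
  ultimately show "(F \<circ> (\<lambda>z. \<epsilon> * z)) holomorphic_on disk" by (rule holomorphic_on_compose_gen) (use \<epsilon>im in blast)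
  show "(F \<circ> (\<lambda>z. \<epsilon> * z)) ` disk = G" "(F \<circ> (\<lambda>z. \<epsilon> * z)) ` sphere 0 1 = K"
   unfolding image_comp[symmetric] using \<epsilon>im Fball Fsph by simp_all
  show "(F \<circ> (\<lambda>z. \<epsilon> * z)) ` left_semicircle = c ` {0<..<1}"
  proof (intro equalityI subsetI)
   fix w assume "w \<in> (F \<circ> (\<lambda>z. \<epsilon> * z)) ` left_semicircle"
   then obtain z where z: "z \<in> left_semicircle" "w = F (\<epsilon> * z)" by auto
   have "\<epsilon> * z \<in> sphere 0 1" using z lc(2) \<epsilon>\<epsilon>(2) by auto
   hence "w \<in> K" using Fsph z(2) by blast
   thus "w \<in> c ` {0<..<1}" using Kc[of w] \<epsilon>(2)[of z] lE z by auto
  next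
   fix w assume w: "w \<in> c ` {0<..<1}"
   hence "w \<in> K" using c_image unfolding K_def by blast
   hence "w \<in> F ` sphere 0 1" using Fsph by simp
   then obtain z where z: "z \<in> sphere 0 1" "F z = w" by (elim imageE) simp
   define y where "y = \<epsilon> * z"
   have y: "norm y = 1" "F (\<epsilon> * y) = w"
   proof -
    show "norm y = 1" using z(1) \<epsilon>\<epsilon>(2)[of z] by (simp add: y_def)
    show "F (\<epsilon> * y) = w" unfolding y_def \<epsilon>\<epsilon>(1) by (rule z(2))
   qed
   have yc: "\<epsilon> * y \<in> cball 0 1" using y \<epsilon>\<epsilon>(2) by simp
   have "Re y < 0"
   proof (rule ccontr)
    assume "\<not> Re y < 0"
    moreover have "Re y \<noteq> 0" using Re0'[OF yc] \<epsilon>\<epsilon>(3) y(2) c_side[OF w] by auto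
    ultimately have "reflect_axis y \<in> E" using y(1) by (simp add: E_def)
    hence "\<sigma> * Re (F (\<epsilon> * reflect_axis y)) < 0" by (rule \<epsilon>(2))
    moreover have "\<epsilon> * reflect_axis y = reflect_axis (\<epsilon> * y)" using \<epsilon>(1) by (auto simp: reflect_axis_def)
    ultimately show False using sym[OF yc] y(2) c_side[OF w] by simp
   qed
   thus "w \<in> (F \<circ> (\<lambda>z. \<epsilon> * z)) ` left_semicircle" using y by (auto simp: left_semicircle_def)
  qed
  show "(F \<circ> (\<lambda>z. \<epsilon> * z)) z \<in> seg \<longleftrightarrow> Re z = 0" if z: "z \<in> disk" for z
  proof -
   have e: "\<epsilon> * z \<in> disk" "\<epsilon> * z \<in> cball 0 1" using z \<epsilon>\<epsilon>(2) by auto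
   hence "F (\<epsilon> * z) \<in> G" using Fball by blast
   hence "F (\<epsilon> * z) \<in> seg \<longleftrightarrow> Re (F (\<epsilon> * z)) = 0" using G_axis by (auto simp: seg_eq)
   also have "... \<longleftrightarrow> Re z = 0" using Re0[OF e(2)] Re0'[OF e(2)] \<epsilon>\<epsilon>(3) by blast
   finally show ?thesis by simp
  qed
  show "(F \<circ> (\<lambda>z. \<epsilon> * z)) z \<in> inside (path_image c \<union> closed_segment (imag u) (imag v))"
   if z: "z \<in> disk" "Re z < 0" for z
  proof -
   have "z \<in> E" using z by (simp add: E_def)
   moreover have "F (\<epsilon> * z) \<in> G" using z \<epsilon>\<epsilon>(2) Fball by auto
   ultimately show ?thesis using half_inside \<epsilon>(2) by simp
  qed
 qed
qed

end

section \<open>Crosscuts whose domain is bounded by the image of the left semicircle\<close>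

lemma Schwarz_Pick:
 assumes hol: "f holomorphic_on disk" and fD: "!!z. z \<in> disk ==> f z \<in> disk"
  and z: "norm z < 1" "norm w < 1"
 shows "norm ((f z - f w) / (1 - cnj (f w) * f z)) <= norm ((z - w) / (1 - cnj w * z))"
proof -
 define M where "M = Moebius_function 0"
 have fw: "norm (f w) < 1" using fD[of w] z by simp
 define h where "h = M (f w) \<circ> f \<circ> M (-w)"
 have MD: "norm (M a x) < 1" if "norm a < 1" "norm x < 1" for a x using that Moebius_function_norm_lt_1[of a x 0] by (simp add: M_def)
 have holM: "M a holomorphic_on disk" if "norm a < 1" for a using that Moebius_function_holomorphic by (simp add: M_def)
 have "f \<circ> M (-w) holomorphic_on disk"
 proof (rule holomorphic_on_compose_gen[OF holM hol])
  show "norm (-w) < 1" using z by simp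
  thus "M (-w) ` disk \<subseteq> disk" using MD[of "-w"] by (intro image_subsetI) simp
 qed
 hence "M (f w) \<circ> (f \<circ> M (-w)) holomorphic_on disk"
 proof (rule holomorphic_on_compose_gen[OF _ holM[OF fw]])
  have "norm (-w) < 1" using z by simp
  thus "(f \<circ> M (-w)) ` disk \<subseteq> disk" using MD[of "-w"] fD by (intro image_subsetI) simp
 qed
 hence "h holomorphic_on disk" by (simp add: h_def o_assoc)
 moreover have "M (-w) 0 = w" by (simp add: M_def Moebius_function_def)
 hence "h 0 = 0" by (simp add: h_def M_def Moebius_function_def)
 moreover have "norm (h x) < 1" if "norm x < 1" for x using that z fw MD[of "-w" x] fD[of "M (-w) x"] MD[of "f w" "f (M (-w) x)"] by (simp add: h_def)
 ultimately have "norm (h (M w z)) <= norm (M w z)" using MD[of w z] z by (intro Schwarz_Lemma(1)) auto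
 moreover have "M (-w) (M w z) = z" unfolding M_def using z by (intro Moebius_function_compose) auto
 ultimately show ?thesis by (simp add: h_def M_def Moebius_function_def)
qed

definition axis_length :: "(complex => complex) => real => real => ennreal" where
 "axis_length f u v = curve_length {min u v..max u v} (\<lambda>t. f (imag t))"

context axis_crosscut
begin

context
 fixes \<phi> \<phi>' :: "complex => complex"
 assumes hom: "homeomorphism (cball 0 1) (G \<union> K) \<phi> \<phi>'" and \<phi>ball: "\<phi> ` disk = G"
  and \<phi>left: "\<phi> ` left_semicircle = c ` {0<..<1}" and \<phi>seg: "!!z. z \<in> disk ==> \<phi> z \<in> seg \<longleftrightarrow> Re z = 0"
begin

lemma axis_length_le_diameter_image_length:
 assumes "continuous_on {min u v..max u v} (\<lambda>t. f (imag t))"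
 shows "axis_length f u v <= diameter_image_length (f \<circ> \<phi>)"
proof -
 have "axis_length f u v = curve_length {min u v<..<max u v} (f \<circ> imag)"
  unfolding axis_length_def o_def using uv by (intro curve_length_open_interval[symmetric] assms) auto
 also have "... <= curve_length {-1<..<1} (f \<circ> (\<lambda>t. \<phi> (imag t)))"
 proof (rule curve_length_reparametrize[where b' = "\<lambda>w. Im (\<phi>' w)"])
  show "imag ` {min u v<..<max u v} \<subseteq> (\<lambda>t. \<phi> (imag t)) ` {-1<..<1}"
  proof
   fix w assume "w \<in> imag ` {min u v<..<max u v}"
   hence w: "w \<in> seg" by (simp add: seg_def)
   hence "w \<in> \<phi> ` disk" using seg_subset_G \<phi>ball by blast
   then obtain z where z: "z \<in> disk" "w = \<phi> z" by blast
   have Re: "Re z = 0" using \<phi>seg[OF z(1)] w z(2) by simp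
   have "z = imag (Im z)" using Re by (simp add: complex_eq_iff)
   moreover have "\<bar>Im z\<bar> < 1" using z(1) abs_Im_le_cmod[of z] by simp
   ultimately show "w \<in> (\<lambda>t. \<phi> (imag t)) ` {-1<..<1}" using z(2) by (intro image_eqI[of _ _ "Im z"]) (auto simp: abs_less_iff)
  qed
  have "(\<lambda>t. \<phi> (imag t)) ` {-1<..<1} \<subseteq> G \<union> K" using hom by (auto simp: homeomorphism_def norm_mult abs_le_iff)
  thus "continuous_on ((\<lambda>t. \<phi> (imag t)) ` {-1<..<1}) (\<lambda>w. Im (\<phi>' w))"
   using hom unfolding homeomorphism_def by (intro continuous_intros) (blast intro: continuous_on_subset)
  show "Im (\<phi>' (\<phi> (imag t))) = t" if "t \<in> {-1<..<1}" for t
  proof -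
   have "imag t \<in> cball 0 1" using that by (simp add: norm_mult abs_le_iff)
   hence "\<phi>' (\<phi> (imag t)) = imag t" using hom by (simp add: homeomorphism_def)
   thus ?thesis by simp
  qed
 qed (auto intro!: continuous_intros simp: inj_on_def is_interval_oo)
 finally show ?thesis by (simp add: diameter_image_length_def o_def)
qed

lemma semicircle_image_length_le_crosscut: "semicircle_image_length (f \<circ> \<phi>) <= curve_length {0..1} (f \<circ> c)"
proof -
 obtain h where h: "homeomorphism {0..1} (path_image c) c h" using homeomorphism_arc[OF arc] by blast
 have lc: "left_semicircle \<subseteq> cball 0 1" by (auto simp: left_semicircle_def)
 have inj: "inj_on \<phi> (cball 0 1)" using hom by (metis homeomorphism_apply1 inj_on_inverseI)
 have "curve_length {pi/2<..<3*pi/2} (f \<circ> (\<phi> \<circ> cis)) <= curve_length {0..1} (f \<circ> c)"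
 proof (rule curve_length_reparametrize[where b' = h])
  show "continuous_on {pi/2<..<3*pi/2} (\<phi> \<circ> cis)"
   using hom lc by (intro continuous_on_compose continuous_intros) (auto simp: homeomorphism_def left_semicircle_eq intro: continuous_on_subset)
  have "inj_on cis {pi/2<..<3*pi/2}" by (metis inj_on_inverseI left_angle_cis)
  thus "inj_on (\<phi> \<circ> cis) {pi/2<..<3*pi/2}" by (intro comp_inj_on inj_on_subset[OF inj]) (use lc in \<open>auto simp: left_semicircle_eq\<close>)
  have "(\<phi> \<circ> cis) ` {pi/2<..<3*pi/2} = c ` {0<..<1}" unfolding image_comp[symmetric] left_semicircle_eq[symmetric] by (rule \<phi>left)
  thus "(\<phi> \<circ> cis) ` {pi/2<..<3*pi/2} \<subseteq> c ` {0..1}" by auto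
 qed (use h in \<open>auto simp: homeomorphism_def path_image_def is_interval_oo\<close>)
 thus ?thesis by (simp add: semicircle_image_length_def o_def)
qed

lemma semicircle_image_length_pos:
 assumes inj: "inj_on f (path_image c)"
  and m: "continuous_on left_semicircle m" "inj_on m left_semicircle" "m ` left_semicircle \<subseteq> left_semicircle"
 shows "semicircle_image_length (f \<circ> \<phi> \<circ> m) > 0"
proof (rule semicircle_image_length_pos_inj)
 have "inj_on \<phi> (cball 0 1)" using hom by (metis homeomorphism_apply1 inj_on_inverseI)
 hence "inj_on \<phi> left_semicircle" by (rule inj_on_subset) (auto simp: left_semicircle_def)
 moreover have "\<phi> ` left_semicircle \<subseteq> path_image c" using \<phi>left c_image by blast
 ultimately have "inj_on (f \<circ> \<phi>) left_semicircle" by (rule comp_inj_on[OF _ inj_on_subset[OF inj]])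
 thus "inj_on (f \<circ> \<phi> \<circ> m) left_semicircle" by (rule comp_inj_on[OF m(2) inj_on_subset[OF _ m(3)]])
qed

end

end

text \<open>The last three assumptions say that the pole is not in the hull of the crosscut and the axis segment.\<close>

locale univalent_crosscut = axis_crosscut +
 fixes f :: "complex => complex" and s :: complex
 assumes hol: "f holomorphic_on disk - {s}" and inj: "inj_on f (disk - {s})" and pole: "is_pole f s" "f s = 0" and sD: "s \<in> disk"
  and cD: "path_image c \<subseteq> disk" and s_c: "s \<notin> path_image c" and s_seg: "s \<notin> closed_segment (imag u) (imag v)"
  and s_half: "s \<notin> inside (path_image c \<union> closed_segment (imag u) (imag v))"
begin

lemma KD: "K \<subseteq> disk" using cD by (auto simp: K_def)

lemma GD: "G \<subseteq> disk" using outside_subset_convex[OF convex_ball KD] inside_Int_outside[of K] unfolding G_def by blast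

lemma seg_segment: "seg \<subseteq> closed_segment (imag u) (imag v)"
 "t \<in> {min u v..max u v} ==> imag t \<in> closed_segment (imag u) (imag v)"
proof -
 show *: "imag t \<in> closed_segment (imag u) (imag v)" if "t \<in> {min u v..max u v}" for t
 proof -
  have "t \<in> closed_segment u v" using that by (auto simp: closed_segment_eq_real_ivl min_def max_def split: if_splits)
  then obtain k where k: "0 <= k" "k <= 1" "t = (1 - k) * u + k * v" by (auto simp: closed_segment_def)
  hence "imag t = (1 - k) *\<^sub>R (imag u) + k *\<^sub>R (imag v)" by (simp add: complex_eq_iff)
  thus ?thesis using k by (auto simp: closed_segment_def)
 qed
 show "seg \<subseteq> closed_segment (imag u) (imag v)" unfolding seg_def by (auto intro!: *)
qed

lemma segment_D: "closed_segment (imag u) (imag v) \<subseteq> disk"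
 using cD pathstart_in_path_image[of c] pathfinish_in_path_image[of c] by (intro closed_segment_subset) (auto simp: ends)

lemma cont_f: "continuous_on (disk - {s}) f" using hol holomorphic_on_imp_continuous_on by blast

lemma cont_f_seg: "continuous_on {min u v..max u v} (\<lambda>t. f (imag t))"
proof (rule continuous_on_compose2[OF cont_f])
 show "imag ` {min u v..max u v} \<subseteq> disk - {s}" using seg_segment(2) segment_D s_seg by blast
qed (intro continuous_intros)

lemma inj_f_c: "inj_on f (path_image c)" using inj by (rule inj_on_subset) (use cD s_c in blast)

theorem no_pole_bound:
 assumes "s \<notin> G"
 shows "axis_length f u v <= GH_const * curve_length {0..1} (f \<circ> c)"
proof -
 obtain \<phi> \<phi>' where \<phi>: "homeomorphism (cball 0 1) (G \<union> K) \<phi> \<phi>'" "\<phi> holomorphic_on disk" "\<phi> ` disk = G" "\<phi> ` sphere 0 1 = K"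
  "\<phi> ` left_semicircle = c ` {0<..<1}" "!!z. z \<in> disk ==> \<phi> z \<in> seg \<longleftrightarrow> Re z = 0"
  "!!z. z \<in> disk ==> Re z < 0 ==> \<phi> z \<in> inside (path_image c \<union> closed_segment (imag u) (imag v))" using semicircle_parametrization by blast
 have inj\<phi>: "inj_on \<phi> (cball 0 1)" by (rule inj_on_inverseI[of _ \<phi>']) (use \<phi>(1) in \<open>simp add: homeomorphism_def\<close>)
 have cont\<phi>: "continuous_on (cball 0 1) \<phi>" using \<phi>(1) by (simp add: homeomorphism_def)
 have im: "\<phi> z \<in> disk - {s}" if "z \<in> disk \<union> left_semicircle" for z
 proof -
  have "\<phi> z \<in> G \<or> \<phi> z \<in> path_image c" using that \<phi>(3,5) c_image by blast
  thus ?thesis using GD assms cD s_c by blast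
 qed
 have sub: "disk \<union> left_semicircle \<subseteq> cball 0 1" by (auto simp: left_semicircle_def)
 have "diameter_image_length (f \<circ> \<phi>) <= GH_const * semicircle_image_length (f \<circ> \<phi>)"
 proof (rule diameter_le_GH_const)
  show "(f \<circ> \<phi>) holomorphic_on disk" by (rule holomorphic_on_compose_gen[OF \<phi>(2) hol]) (use im in blast)
  show "inj_on (f \<circ> \<phi>) disk"
  proof (rule comp_inj_on)
   show "inj_on \<phi> disk" using inj\<phi> by (rule inj_on_subset) auto
   show "inj_on f (\<phi> ` disk)" using inj by (rule inj_on_subset) (use im in blast)
  qed
  show "continuous_on (disk \<union> left_semicircle) (f \<circ> \<phi>)"
   by (intro continuous_on_compose continuous_on_subset[OF cont\<phi> sub] continuous_on_subset[OF cont_f]) (use im in blast)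
  show "semicircle_image_length (f \<circ> \<phi>) > 0" using semicircle_image_length_pos[OF \<phi>(1,3,5,6) inj_f_c, of id] by simp
 qed
 moreover have "axis_length f u v <= diameter_image_length (f \<circ> \<phi>)" by (rule axis_length_le_diameter_image_length[OF \<phi>(1,3,5,6) cont_f_seg])
 moreover have "semicircle_image_length (f \<circ> \<phi>) <= curve_length {0..1} (f \<circ> c)" by (rule semicircle_image_length_le_crosscut[OF \<phi>(1,3,5,6)])
 ultimately show ?thesis by (meson mult_left_mono order_trans zero_le)
qed

text \<open>The preimage of the pole has positive real part, since the left half of the disk corresponds to the half of \<open>G\<close> next to \<open>c\<close>. Its pseudohyperbolic distance from the diameter is at least \<open>\<tau>\<close> because \<open>\<phi>\<close> contracts that distance.\<close>

theorem inner_pole_bound: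
 assumes sG: "s \<in> G" and \<tau>: "!!x. x \<in> seg ==> \<tau> <= norm ((s - x) / (1 - cnj x * s))"
 shows "axis_length f u v <= GH_pole_const_sup \<tau> * curve_length {0..1} (f \<circ> c)"
proof -
 obtain \<phi> \<phi>' where \<phi>: "homeomorphism (cball 0 1) (G \<union> K) \<phi> \<phi>'" "\<phi> holomorphic_on disk" "\<phi> ` disk = G" "\<phi> ` sphere 0 1 = K"
  "\<phi> ` left_semicircle = c ` {0<..<1}" "!!z. z \<in> disk ==> \<phi> z \<in> seg \<longleftrightarrow> Re z = 0"
  "!!z. z \<in> disk ==> Re z < 0 ==> \<phi> z \<in> inside (path_image c \<union> closed_segment (imag u) (imag v))" using semicircle_parametrization by blast
 have inj\<phi>: "inj_on \<phi> (cball 0 1)" by (rule inj_on_inverseI[of _ \<phi>']) (use \<phi>(1) in \<open>simp add: homeomorphism_def\<close>)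
 have cont\<phi>: "continuous_on (cball 0 1) \<phi>" using \<phi>(1) by (simp add: homeomorphism_def)
 have "s \<in> \<phi> ` disk" using sG \<phi>(3) by simp
 then obtain q where q: "q \<in> disk" "\<phi> q = s" by (elim imageE) simp
 have "Re q > 0"
 proof (rule ccontr)
  assume "\<not> Re q > 0"
  then consider "Re q = 0" | "Re q < 0" by linarith
  thus False
  proof cases
   case 1 thus False using \<phi>(6)[OF q(1)] q(2) seg_segment(1) s_seg by blast
  next
   case 2 thus False using \<phi>(7)[OF q(1)] q(2) s_half by simp
  qed
 qed
 have sub: "disk \<union> left_semicircle \<subseteq> cball 0 1" by (auto simp: left_semicircle_def)
 have im: "\<phi> z \<in> disk - {s}" if "z \<in> disk \<union> left_semicircle - {q}" for z
 proof -
  have "\<phi> z \<in> G \<or> \<phi> z \<in> path_image c" using that \<phi>(3,5) c_image by blast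
  moreover have "\<phi> z \<noteq> s" using inj\<phi> that q sub by (metis Diff_iff inj_onD insertI1 mem_ball_imp_mem_cball subsetD)
  ultimately show ?thesis using GD cD by blast
 qed
 have q1: "norm q < 1" using q(1) by simp
 obtain a p where ap: "\<bar>a\<bar> < 1" "0 < p" "p < 1" "norm (axis_map (-a) q) = p"
  "!!\<tau>. \<tau> <= p ==> diameter_image_length (f \<circ> \<phi>) <= GH_pole_const_sup \<tau> * semicircle_image_length (f \<circ> \<phi>)"
 proof (rule pole_bound_off_axis[of q "f \<circ> \<phi>"])
  show "(f \<circ> \<phi>) holomorphic_on disk - {q}" by (rule holomorphic_on_compose_gen[OF holomorphic_on_subset[OF \<phi>(2)] hol]) (use im in blast)+
  show "inj_on (f \<circ> \<phi>) (disk - {q})"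
  proof (rule comp_inj_on)
   show "inj_on \<phi> (disk - {q})" using inj\<phi> by (rule inj_on_subset) auto
   show "inj_on f (\<phi> ` (disk - {q}))" using inj by (rule inj_on_subset) (use im in blast)
  qed
  show "continuous_on (disk \<union> left_semicircle - {q}) (f \<circ> \<phi>)"
   by (intro continuous_on_compose continuous_on_subset[OF cont\<phi>] continuous_on_subset[OF cont_f]) (use im sub in blast)+
  show "(f \<circ> \<phi>) q = 0" using q pole by simp
  show "is_pole (f \<circ> \<phi>) q" unfolding o_def
  proof (rule is_pole_compose[OF pole(1)])
   have "isCont \<phi> q" using cont\<phi> q(1) by (auto intro: continuous_on_interior)
   thus "\<phi> \<midarrow>q\<rightarrow> s" using q(2) unfolding isCont_def by simp
   have "eventually (\<lambda>z. z \<in> disk - {q}) (at q)" using q by (intro eventually_at_in_open) auto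
   thus "eventually (\<lambda>z. \<phi> z \<noteq> s) (at q)" by eventually_elim (use im in blast)
  qed
  show "semicircle_image_length (f \<circ> \<phi> \<circ> m) > 0"
   if "continuous_on left_semicircle m" "inj_on m left_semicircle" "m ` left_semicircle \<subseteq> left_semicircle" for m
   by (rule semicircle_image_length_pos[OF \<phi>(1,3,5,6) inj_f_c that])
 qed (use q1 \<open>Re q > 0\<close> in auto)
 have "\<tau> <= p"
 proof -
  define y where "y = imag a"
  have y: "y \<in> disk" "Re y = 0" using ap(1) by (auto simp: y_def norm_mult)
  hence "\<phi> y \<in> seg" using \<phi>(6) by blast
  hence "\<tau> <= norm ((s - \<phi> y) / (1 - cnj (\<phi> y) * s))" by (rule \<tau>)
  also have "... <= norm ((q - y) / (1 - cnj y * q))" unfolding q(2)[symmetric]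
  proof (rule Schwarz_Pick[OF \<phi>(2)])
   show "\<phi> z \<in> disk" if "z \<in> disk" for z using \<phi>(3) GD that by blast
  qed (use q1 y in auto)
  also have "... = p" unfolding ap(4)[symmetric] axis_map_def by (simp add: y_def)
  finally show ?thesis .
 qed
 hence "diameter_image_length (f \<circ> \<phi>) <= GH_pole_const_sup \<tau> * semicircle_image_length (f \<circ> \<phi>)" by (rule ap(5))
 moreover have "axis_length f u v <= diameter_image_length (f \<circ> \<phi>)" by (rule axis_length_le_diameter_image_length[OF \<phi>(1,3,5,6) cont_f_seg])
 moreover have "semicircle_image_length (f \<circ> \<phi>) <= curve_length {0..1} (f \<circ> c)" by (rule semicircle_image_length_le_crosscut[OF \<phi>(1,3,5,6)])
 ultimately show ?thesis by (meson mult_left_mono order_trans zero_le)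
qed

end

section \<open>Approximation by functions with a pole\<close>

lemma koebe_lemma_eventually:
 fixes \<phi> :: "nat => complex => complex"
 assumes hol: "!!n. \<phi> n holomorphic_on disk"
  and M: "!!n z. z \<in> disk ==> norm (\<phi> n z - b) <= M"
  and lim: "!!z. z \<in> disk ==> (\<lambda>n. \<phi> n z) \<longlonglongrightarrow> h z"
  and G: "!!n. compact (G n)" "!!n. connected (G n)" "!!n. G n \<subseteq> disk"
  and Gesc: "!!c. c < 1 ==> eventually (\<lambda>n. G n \<inter> cball 0 c = {}) sequentially"
  and xy: "!!n. x n \<in> G n" "!!n. y n \<in> G n" "x \<longlonglongrightarrow> \<xi>" "y \<longlonglongrightarrow> \<eta>" "norm \<xi> = 1" "norm \<eta> = 1" "\<xi> \<noteq> \<eta>"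
  and eps: "!!e. e > 0 ==> eventually (\<lambda>n. \<forall>z\<in>G n. norm (\<phi> n z - b) <= e) sequentially"
 obtains w0 r0 where "r0 > 0" "ball w0 r0 \<subseteq> disk" "!!w. w \<in> ball w0 r0 ==> h w = b"
proof -
 define e where "e n = (SUP z\<in>G n. norm (\<phi> n z - b))" for n
 have bdd: "bdd_above ((\<lambda>z. norm (\<phi> n z - b)) ` G n)" for n using M G(3)[of n] by (intro bdd_aboveI2[of _ _ M]) auto
 have le: "norm (\<phi> n z - b) <= e n" if "z \<in> G n" for n z unfolding e_def using bdd that by (rule cSUP_upper2) auto
 have "e \<longlonglongrightarrow> 0"
 proof (rule tendstoI)
  fix d :: real assume "d > 0"
  hence "eventually (\<lambda>n. \<forall>z\<in>G n. norm (\<phi> n z - b) <= d/2) sequentially" by (intro eps) simp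
  thus "eventually (\<lambda>n. dist (e n) 0 < d) sequentially"
  proof eventually_elim
   case (elim n)
   have "e n <= d/2" unfolding e_def using elim xy(1)[of n] by (intro cSUP_least) auto
   moreover have "e n \<ge> 0" using le[OF xy(1)[of n]] norm_ge_zero order_trans by blast
   ultimately show ?case using \<open>d > 0\<close> by (simp add: dist_norm)
  qed
 qed
 show thesis by (rule koebe_lemma[OF hol M lim G Gesc xy le \<open>e \<longlonglongrightarrow> 0\<close>]) (use that in blast)+
qed

text \<open>\<open>slit n\<close> is the image of the circle minus a short arc around \<open>1\<close>. Its complement in the sphere is inverted at the point \<open>w0 = k (-1)\<close> of the slit.
 The result is the plane domain \<open>H n\<close>, in which \<open>0\<close> stands for infinity; \<open>kt\<close> is the inverted function \<open>k\<close>.\<close>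

locale slit_domain =
 fixes k :: "complex => complex"
 assumes cont_k: "continuous_on (cball 0 1) k" and inj_k: "inj_on k (cball 0 1)" and hol_k: "k holomorphic_on disk"
begin

definition w0 where "w0 = k (-1)"
definition N where "N w = 1 / (w - w0)"
definition kt where "kt z = N (k z)"
definition gap :: "nat => real" where "gap n = 1 / real (n + 1)"
definition slit :: "nat => complex set" where "slit n = k ` cis ` {gap n..2*pi - gap n}"
definition H where "H n = - N ` (slit n - {w0})"

lemma gap: "0 < gap n" "gap n <= 1" "gap n < pi"
proof -
 show "0 < gap n" "gap n <= 1" by (auto simp: gap_def)
 thus "gap n < pi" using pi_gt3 by linarith
qed

lemma gap_antimono: "m <= n ==> gap n <= gap m" by (auto simp: gap_def field_simps)

lemma k_eq_iff: "norm z <= 1 ==> norm w <= 1 ==> k z = k w \<longleftrightarrow> z = w" using inj_k by (auto dest: inj_onD)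

lemma k_w0: "norm z <= 1 ==> k z = w0 \<longleftrightarrow> z = -1" unfolding w0_def by (rule k_eq_iff) auto

lemma N_inj: "N v = N w \<longleftrightarrow> v = w" by (auto simp: N_def)

lemma N_0: "N w = 0 \<longleftrightarrow> w = w0" by (simp add: N_def)

lemma kt_eq_iff: "norm z <= 1 ==> norm w <= 1 ==> kt z = kt w \<longleftrightarrow> z = w" by (simp add: kt_def N_inj k_eq_iff)

lemma kt_nz: "norm z <= 1 ==> z \<noteq> -1 ==> kt z \<noteq> 0" using k_w0[of z] by (simp add: kt_def N_0)

lemma k_kt: "w0 + 1 / kt z = k z" by (simp add: kt_def N_def)

lemma cont_kt: "continuous_on (cball 0 1 - {-1}) kt" unfolding kt_def N_def using k_w0 by (intro continuous_intros continuous_on_subset[OF cont_k]) auto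

lemma hol_kt: "kt holomorphic_on disk" unfolding kt_def N_def using k_w0 by (intro holomorphic_intros hol_k) (auto simp: dist_norm)

lemma inj_kt: "inj_on kt disk" using kt_eq_iff by (auto simp: inj_on_def)

lemma cis_eq: "cis s = cis t ==> 0 < s ==> s < 2*pi ==> 0 < t ==> t < 2*pi ==> s = t"
proof -
 assume h: "cis s = cis t" "0 < s" "s < 2*pi" "0 < t" "t < 2*pi"
 hence "sin s = sin t \<and> cos s = cos t" by (metis cis.sel)
 then obtain n :: int where n: "s = t + 2 * pi * n" using sin_cos_eq_iff by blast
 hence "\<bar>2 * pi * n\<bar> < 2 * pi" using h by auto
 hence "\<bar>real_of_int n\<bar> < 1" by (simp add: abs_mult)
 thus "s = t" using n by simp
qed

lemma slit_arc: "\<exists>a. arc a \<and> path_image a = slit n"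
proof -
 define l where "l t = gap n + (2*pi - 2 * gap n) * t" for t
 have l: "l t \<in> {gap n..2*pi - gap n}" if "t \<in> {0..1}" for t
 proof -
  have "0 <= (2*pi - 2 * gap n) * t" "(2*pi - 2 * gap n) * t <= (2*pi - 2 * gap n)" using that gap[of n] by (auto intro: mult_left_le)
  thus ?thesis by (simp add: l_def)
 qed
 have lim: "l ` {0..1} = {gap n..2*pi - gap n}"
 proof (intro equalityI subsetI)
  fix y assume y: "y \<in> {gap n..2*pi - gap n}"
  have "y = l ((y - gap n) / (2*pi - 2 * gap n))" using gap[of n] by (simp add: l_def)
  moreover have "(y - gap n) / (2*pi - 2 * gap n) \<in> {0..1}" using y gap[of n] by (auto simp: field_simps)
  ultimately show "y \<in> l ` {0..1}" by blast
 qed (use l in auto)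
 define a where "a = k \<circ> (cis \<circ> l)"
 have "continuous_on {0..1} a" unfolding a_def by (intro continuous_on_compose continuous_on_subset[OF cont_k]) (auto simp: l_def intro!: continuous_intros)
 moreover have "inj_on a {0..1}"
 proof (rule inj_onI)
  fix s t assume st: "s \<in> {0..1}" "t \<in> {0..1}" "a s = a t"
  hence "cis (l s) = cis (l t)" by (simp add: a_def k_eq_iff)
  hence "l s = l t" by (rule cis_eq) (use l[OF st(1)] l[OF st(2)] gap[of n] in auto)
  thus "s = t" using gap[of n] by (simp add: l_def)
 qed
 ultimately have "arc a" by (simp add: arc_def path_def)
 moreover have "path_image a = slit n" unfolding a_def path_image_def image_comp[symmetric] lim slit_def ..
 ultimately show ?thesis by blast
qed

lemma compact_slit: "compact (slit n)" using slit_arc by (metis compact_arc_image)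

lemma w0_slit: "w0 \<in> slit n"
proof -
 have "pi \<in> {gap n..2*pi - gap n}" using gap[of n] by auto
 hence "k (cis pi) \<in> slit n" unfolding slit_def by blast
 thus ?thesis by (simp add: w0_def)
qed

lemma H_iff: "y \<in> H n \<longleftrightarrow> y = 0 \<or> w0 + 1 / y \<notin> slit n"
proof -
 have "y \<in> N ` (slit n - {w0}) \<longleftrightarrow> y \<noteq> 0 \<and> w0 + 1 / y \<in> slit n"
 proof
  assume "y \<in> N ` (slit n - {w0})"
  thus "y \<noteq> 0 \<and> w0 + 1 / y \<in> slit n" by (auto simp: N_def)
 next
  assume y: "y \<noteq> 0 \<and> w0 + 1 / y \<in> slit n"
  hence "y = N (w0 + 1 / y)" "w0 + 1 / y \<in> slit n - {w0}" by (auto simp: N_def)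
  thus "y \<in> N ` (slit n - {w0})" by blast
 qed
 thus ?thesis by (auto simp: H_def)
qed

lemma zero_H: "0 \<in> H n" by (simp add: H_iff)

lemma open_H: "open (H n)"
proof -
 obtain B where B: "B > 0" "!!w. w \<in> slit n ==> norm (w - w0) <= B"
 proof -
  have "bounded ((\<lambda>w. w - w0) ` slit n)" using compact_imp_bounded[OF compact_slit[of n]] by (intro bounded_translation_minus)
  thus thesis using that unfolding bounded_pos by blast
 qed
 have ball: "y \<in> H n" if "y \<in> ball 0 (1 / B)" for y
 proof (cases "y = 0")
  case False
  hence "norm (1 / y) > B" using that B(1) by (simp add: norm_divide field_simps)
  hence "w0 + 1 / y \<notin> slit n" using B(2)[of "w0 + 1 / y"] by auto
  thus ?thesis by (simp add: H_iff)
 qed (simp add: zero_H)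
 have "open {y \<in> - {0}. w0 + 1 / y \<in> - slit n}"
 proof -
  have "open ((- {0}) \<inter> (\<lambda>y. w0 + 1 / y) -` (- slit n))"
   using compact_slit[of n] by (intro continuous_open_preimage continuous_intros) (auto simp: compact_imp_closed open_Compl)
  moreover have "{y \<in> - {0}. w0 + 1 / y \<in> - slit n} = (- {0}) \<inter> (\<lambda>y. w0 + 1 / y) -` (- slit n)" by auto
  ultimately show ?thesis by (simp only:)
 qed
 hence "open (ball 0 (1 / B) \<union> {y \<in> - {0}. w0 + 1 / y \<in> - slit n})" by (intro open_Un open_ball)
 moreover have "H n = ball 0 (1 / B) \<union> {y \<in> - {0}. w0 + 1 / y \<in> - slit n}" using ball B(1) by (auto simp: H_iff)
 ultimately show ?thesis by simp
qed

lemma H_antimono: "m <= n ==> H n \<subseteq> H m"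
proof -
 assume "m <= n"
 hence "slit m \<subseteq> slit n" unfolding slit_def using gap_antimono by (intro image_mono) auto
 thus ?thesis by (auto simp: H_iff)
qed

lemma kt_H: "norm z < 1 ==> kt z \<in> H n"
proof -
 assume z: "norm z < 1"
 have "k z \<notin> slit n"
 proof
  assume "k z \<in> slit n"
  then obtain t where "k z = k (cis t)" unfolding slit_def by blast
  hence "z = cis t" using z by (subst (asm) k_eq_iff) auto
  thus False using z by simp
 qed
 thus ?thesis by (simp add: H_iff k_kt)
qed

lemma kt_cis_H: "\<bar>t\<bar> < gap n ==> kt (cis t) \<in> H n"
proof -
 assume t: "\<bar>t\<bar> < gap n"
 have "k (cis t) \<notin> slit n"
 proof
  assume "k (cis t) \<in> slit n"
  then obtain s where s: "k (cis t) = k (cis s)" "gap n <= s" "s <= 2*pi - gap n" unfolding slit_def by auto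
  hence "cis t = cis s" by (simp add: k_eq_iff)
  hence "sin t = sin s \<and> cos t = cos s" by (metis cis.sel)
  then obtain m :: int where m: "t = s + 2 * pi * m" using sin_cos_eq_iff by blast
  have "2 * pi * m < 0" using m t s by auto
  hence "m < 0" by (simp add: mult_less_0_iff)
  hence "real_of_int m <= -1" by simp
  hence "2 * pi * m <= - (2 * pi)" using pi_gt_zero mult_left_mono[of m "-1" "2*pi"] by simp
  thus False using m t s by auto
 qed
 thus ?thesis by (simp add: H_iff k_kt)
qed

lemma kt_boundary_cases: "norm z <= 1 ==> z \<noteq> -1 ==> kt z \<in> H n ==> norm z < 1 \<or> (\<exists>t. \<bar>t\<bar> < gap n \<and> z = cis t)"
proof (rule ccontr)
 assume z: "norm z <= 1" "z \<noteq> -1" "kt z \<in> H n" "\<not> (norm z < 1 \<or> (\<exists>t. \<bar>t\<bar> < gap n \<and> z = cis t))"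
 hence z1: "norm z = 1" by simp
 define t where "t = Arg z"
 have t: "z = cis t" "-pi < t" "t <= pi"
 proof -
  have "z \<noteq> 0" using z1 by auto
  hence "cis (Arg z) = z" using z1 cis_Arg[of z] by (simp add: sgn_div_norm)
  thus "z = cis t" by (simp add: t_def)
  show "-pi < t" "t <= pi" using Arg_bounded[of z] by (auto simp: t_def)
 qed
 have gt: "gap n <= \<bar>t\<bar>"
 proof (rule ccontr)
  assume "\<not> gap n <= \<bar>t\<bar>"
  hence "\<exists>t. \<bar>t\<bar> < gap n \<and> z = cis t" using t(1) by (intro exI[of _ t]) auto
  thus False using z(4) by blast
 qed
 have "k z \<in> slit n"
 proof (cases "t \<ge> 0")
  case True
  hence "t \<in> {gap n..2*pi - gap n}" using gt t gap[of n] by auto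
  thus ?thesis unfolding slit_def t(1) by blast
 next
  case False
  hence "t + 2*pi \<in> {gap n..2*pi - gap n}" using gt t gap[of n] by auto
  moreover have "z = cis (t + 2*pi)" unfolding t(1) by (simp add: cis_mult[symmetric])
  ultimately show ?thesis unfolding slit_def by blast
 qed
 thus False using z kt_nz[of z] by (simp add: H_iff k_kt)
qed

text \<open>Boundedness of \<open>kt (z j)\<close> keeps the limit of \<open>z j\<close> away from \<open>-1\<close>, which \<open>k\<close> maps to the centre of the inversion.\<close>

lemma kt_convergent:
 assumes "!!j. norm (z j) <= 1" "z \<longlonglongrightarrow> x" "(\<lambda>j. kt (z j)) \<longlonglongrightarrow> y" "!!j. z j \<noteq> -1"
 shows "x \<noteq> -1" "kt x = y" "norm x <= 1"
proof -
 show x1: "norm x <= 1" by (rule Lim_norm_ubound[OF _ assms(2)]) (use assms(1) in auto)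
 have kx: "(\<lambda>j. k (z j)) \<longlonglongrightarrow> k x" by (rule continuous_on_tendsto_compose[OF cont_k assms(2)]) (use x1 assms(1) in auto)
 show xn: "x \<noteq> -1"
 proof
  assume "x = -1"
  hence "(\<lambda>j. (k (z j) - w0) * kt (z j)) \<longlonglongrightarrow> (w0 - w0) * y" using kx assms(3) by (intro tendsto_intros) (auto simp: w0_def)
  moreover have "(k (z j) - w0) * kt (z j) = 1" for j using k_w0[OF assms(1)[of j]] assms(4)[of j] by (simp add: kt_def N_def)
  ultimately have "(\<lambda>j. 1::complex) \<longlonglongrightarrow> 0" by simp
  thus False by (simp add: LIMSEQ_const_iff)
 qed
 have "(\<lambda>j. kt (z j)) \<longlonglongrightarrow> kt x" by (rule continuous_on_tendsto_compose[OF cont_kt assms(2)]) (use x1 xn assms(1,4) in auto)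
 thus "kt x = y" using assms(3) LIMSEQ_unique by blast
qed

text \<open>The complement of an arc is connected; the complement of \<open>H n\<close> is the inverted slit, all of whose components are unbounded.\<close>

lemma simply_connected_H: "simply_connected (H n)"
proof -
 have "connected (H n)"
 proof -
  obtain a where a: "arc a" "path_image a = slit n" using slit_arc by blast
  have "connected (- slit n)" using connected_arc_complement[OF a(1)] a(2) by simp
  hence con: "connected (N ` (- slit n))" unfolding N_def using w0_slit[of n] by (intro connected_continuous_image continuous_intros) auto
  have sub: "N ` (- slit n) \<subseteq> H n"
  proof
   fix y assume "y \<in> N ` (- slit n)"
   then obtain w where w: "w \<notin> slit n" "y = N w" by blast
   hence "w \<noteq> w0" using w0_slit by blast
   hence "w0 + 1 / y = w" using w by (simp add: N_def)
   thus "y \<in> H n" using w by (simp add: H_iff)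
  qed
  moreover have "H n \<subseteq> closure (N ` (- slit n))"
  proof
   fix y assume y: "y \<in> H n"
   show "y \<in> closure (N ` (- slit n))"
   proof (cases "y = 0")
    case False
    hence "w0 + 1 / y \<in> - slit n" "y = N (w0 + 1 / y)" using y by (auto simp: H_iff N_def)
    hence "y \<in> N ` (- slit n)" by blast
    thus ?thesis using closure_subset[of "N ` (- slit n)"] by (rule subsetD[rotated])
   next
    case True
    obtain r where r: "r > 0" "ball 0 r \<subseteq> H n" by (rule openE[OF open_H zero_H])
    have "x \<in> N ` (- slit n)" if "x \<in> ball 0 r - {0}" for x
    proof -
     have "x \<in> H n" using that r by blast
     hence "w0 + 1 / x \<in> - slit n" "x = N (w0 + 1 / x)" using that by (auto simp: H_iff N_def)
     thus ?thesis by blast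
    qed
    hence "ball 0 r - {0} \<subseteq> N ` (- slit n)" by blast
    moreover have "0 \<in> closure (ball (0::complex) r - {0})"
    proof -
     have "0 islimpt ball (0::complex) r" using r(1) by (simp add: islimpt_ball)
     thus ?thesis by (simp add: islimpt_in_closure)
    qed
    ultimately show ?thesis using True closure_mono by blast
   qed
  qed
  ultimately show ?thesis using con connected_intermediate_closure by blast
 qed
 moreover have "\<not> bounded C" if C: "C \<in> components (- H n)" for C
 proof
  assume "bounded C"
  obtain y where y: "y \<in> - H n" "C = connected_component_set (- H n) y" using C unfolding components_def by blast
  hence "y \<noteq> 0" "w0 + 1 / y \<in> slit n" by (auto simp: H_iff)
  then obtain t where t: "w0 + 1 / y = k (cis t)" "gap n <= t" "t <= 2*pi - gap n" unfolding slit_def by auto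
  have yt: "y = kt (cis t)" unfolding kt_def t(1)[symmetric] using \<open>y \<noteq> 0\<close> by (simp add: N_def)
  have tpi: "t \<noteq> pi" using \<open>y \<noteq> 0\<close> unfolding yt by (auto simp: kt_def N_def w0_def)
  define l where "l x = t + x * (pi - t)" for x
  define X where "X = (\<lambda>x. kt (cis (l x))) ` {0..<1}"
  have l: "l x \<in> {gap n..2*pi - gap n}" "l x \<noteq> pi" if "x \<in> {0..<1}" for x
  proof -
   have e: "l x = (1 - x) * t + x * pi" by (simp add: l_def algebra_simps)
   have "gap n <= (1 - x) * t + x * pi" "(1 - x) * t + x * pi <= 2*pi - gap n"
   proof -
    have x: "0 <= x" "0 <= 1 - x" "(1 - x) + x = 1" using that by auto
    have "- ((1 - x) * t + x * pi) <= - gap n" using convex_bound_le[of "-t" "- gap n" "-pi" "1 - x" x] x t gap[of n] by (simp add: algebra_simps)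
    thus "gap n <= (1 - x) * t + x * pi" by simp
    show "(1 - x) * t + x * pi <= 2*pi - gap n" using convex_bound_le[of t "2*pi - gap n" pi "1 - x" x] x t gap[of n] by simp
   qed
   thus "l x \<in> {gap n..2*pi - gap n}" by (simp add: e)
   have "l x - pi = (1 - x) * (t - pi)" by (simp add: l_def algebra_simps)
   thus "l x \<noteq> pi" using that tpi by auto
  qed
  have ln1: "cis (l x) \<noteq> -1" if "x \<in> {0..<1}" for x
  proof
   assume "cis (l x) = -1"
   hence "cis (l x) = cis pi" by simp
   hence "l x = pi" by (rule cis_eq) (use l(1)[OF that] gap[of n] in auto)
   thus False using l(2)[OF that] by simp
  qed
  have "connected X" unfolding X_def
  proof (intro connected_continuous_image)
   show "continuous_on {0..<1} (\<lambda>x. kt (cis (l x)))"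
    by (rule continuous_on_compose2[OF cont_kt]) (use ln1 in \<open>auto simp: l_def intro!: continuous_intros\<close>)
  qed auto
  moreover have "X \<subseteq> - H n"
  proof -
   have "kt (cis (l x)) \<notin> H n" if "x \<in> {0..<1}" for x using l(1)[OF that] kt_nz[of "cis (l x)"] ln1[OF that] unfolding H_iff k_kt slit_def by auto
   thus ?thesis unfolding X_def by blast
  qed
  moreover have "y \<in> X" unfolding X_def yt by (rule image_eqI[of _ _ 0]) (auto simp: l_def)
  ultimately have "X \<subseteq> C" unfolding y(2) by (intro connected_component_maximal)
  hence "bounded X" using \<open>bounded C\<close> bounded_subset by blast
  then obtain B where B: "B > 0" "!!y. y \<in> X ==> norm y <= B" unfolding bounded_pos by blast
  have "((\<lambda>x. k (cis (l x))) \<longlongrightarrow> k (cis (l 1))) (at 1 within {0..1})"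
  proof -
   have "continuous_on {0..1} (\<lambda>x. k (cis (l x)))" by (rule continuous_on_compose2[OF cont_k]) (auto simp: l_def intro!: continuous_intros)
   thus ?thesis by (simp add: continuous_on_def)
  qed
  moreover have "cis (l 1) = -1" by (simp add: l_def)
  ultimately have "((\<lambda>x. k (cis (l x))) \<longlongrightarrow> w0) (at 1 within {0..1})" by (simp add: w0_def)
  hence "eventually (\<lambda>x. dist (k (cis (l x))) w0 < 1 / (B + 1)) (at 1 within {0..1})" using B by (intro tendstoD) auto
  then obtain d where d: "d > 0" "!!x. x \<in> {0..1} ==> x \<noteq> 1 ==> dist x 1 < d ==> dist (k (cis (l x))) w0 < 1 / (B + 1)" unfolding eventually_at by blast
  define x where "x = max 0 (1 - d/2)"
  have x: "x \<in> {0..<1}" "dist x 1 < d" using d(1) by (auto simp: x_def dist_real_def max_def)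
  have "norm (k (cis (l x)) - w0) < 1 / (B + 1)" using d(2)[of x] x by (simp add: dist_norm)
  moreover have "norm (k (cis (l x)) - w0) > 0" using k_w0[of "cis (l x)"] ln1[OF x(1)] by simp
  ultimately have "B + 1 < norm (kt (cis (l x)))" using B(1) by (simp add: kt_def N_def norm_divide field_simps)
  moreover have "norm (kt (cis (l x))) <= B" using B(2) x(1) unfolding X_def by blast
  ultimately show False by simp
 qed
 ultimately show ?thesis by (simp add: simply_connected_eq_unbounded_complement_components[OF open_H])
qed

lemma H_not_UNIV: "H n \<noteq> UNIV"
proof -
 have "gap n \<in> {gap n..2*pi - gap n}" using gap[of n] by auto
 hence "k (cis (gap n)) \<in> slit n" unfolding slit_def by blast
 moreover have "cis (gap n) \<noteq> -1"
 proof
  assume "cis (gap n) = -1"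
  hence "cis (gap n) = cis pi" by simp
  hence "gap n = pi" by (rule cis_eq) (use gap[of n] in auto)
  thus False using gap[of n] by simp
 qed
 ultimately have "kt (cis (gap n)) \<notin> H n" using kt_nz[of "cis (gap n)"] by (simp add: H_iff k_kt)
 thus ?thesis by blast
qed

lemma riemann_map_H:
 "\<exists>\<Phi> \<Psi> a. \<Phi> holomorphic_on disk \<and> (\<forall>z\<in>disk. \<Phi> z \<in> H n \<and> \<Psi> (\<Phi> z) = z) \<and>
  \<Psi> holomorphic_on H n \<and> (\<forall>w\<in>H n. \<Psi> w \<in> disk \<and> \<Phi> (\<Psi> w) = w) \<and> \<Psi> (kt 0) = 0 \<and>
  deriv (\<lambda>z. \<Psi> (kt z)) 0 = of_real a \<and> (a::real) > 0"
proof -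
 obtain f1 g1 where fg1: "f1 holomorphic_on H n" "g1 holomorphic_on disk"
  "!!z. z \<in> H n ==> f1 z \<in> disk \<and> g1 (f1 z) = z" "!!z. z \<in> disk ==> g1 z \<in> H n \<and> f1 (g1 z) = z"
 proof -
  have "H n \<noteq> {}" using zero_H by blast
  thus thesis using that simply_connected_H[of n] H_not_UNIV[of n] unfolding simply_connected_eq_biholomorphic_to_disc[OF open_H[of n]] by blast
 qed
 have o: "kt 0 \<in> H n" using kt_H by simp
 obtain h j where hk: "h (f1 (kt 0)) = 0" "h holomorphic_on disk" "h ` disk \<subseteq> disk"
  "j holomorphic_on disk" "j ` disk \<subseteq> disk" "!!z. z \<in> disk ==> h (j z) = z" "!!z. z \<in> disk ==> j (h z) = z"
  using ball_biholomorphism_exists[of "f1 (kt 0)"] fg1(3)[OF o] by blast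
 define f0 where "f0 = h \<circ> f1"
 define g0 where "g0 = g1 \<circ> j"
 have hb: "h z \<in> disk" if "z \<in> disk" for z using hk(3) that by blast
 have jb: "j z \<in> disk" if "z \<in> disk" for z using hk(5) that by blast
 have f0: "f0 holomorphic_on H n" "!!w. w \<in> H n ==> f0 w \<in> disk" "!!w. w \<in> H n ==> g0 (f0 w) = w" "f0 (kt 0) = 0"
 proof -
  show "f0 holomorphic_on H n" unfolding f0_def by (rule holomorphic_on_compose_gen[OF fg1(1) hk(2)]) (use fg1(3) in blast)
  show "f0 w \<in> disk" "g0 (f0 w) = w" if "w \<in> H n" for w using fg1(3)[OF that] hb hk(7) by (auto simp: f0_def g0_def)
  show "f0 (kt 0) = 0" using hk(1) by (simp add: f0_def)
 qed
 have g0: "g0 holomorphic_on disk" "!!z. z \<in> disk ==> g0 z \<in> H n" "!!z. z \<in> disk ==> f0 (g0 z) = z"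
 proof -
  show "g0 holomorphic_on disk" unfolding g0_def by (rule holomorphic_on_compose_gen[OF hk(4) fg1(2) hk(5)])
  show "g0 z \<in> H n" "f0 (g0 z) = z" if "z \<in> disk" for z using fg1(4)[OF jb[OF that]] hk(6)[OF that] by (auto simp: f0_def g0_def)
 qed
 have hol: "(\<lambda>z. f0 (kt z)) holomorphic_on disk"
 proof -
  have "f0 \<circ> kt holomorphic_on disk" by (rule holomorphic_on_compose_gen[OF hol_kt f0(1)]) (use kt_H in auto)
  thus ?thesis by (simp add: o_def)
 qed
 have "inj_on (\<lambda>z. f0 (kt z)) disk"
 proof (rule inj_onI)
  fix x y assume xy: "x \<in> disk" "y \<in> disk" "f0 (kt x) = f0 (kt y)"
  hence "kt x \<in> H n" "kt y \<in> H n" using kt_H by simp_all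
  hence "kt x = kt y" using f0(3) xy(3) by metis
  thus "x = y" using xy kt_eq_iff by simp
 qed
 hence d0: "deriv (\<lambda>z. f0 (kt z)) 0 \<noteq> 0" (is "?d \<noteq> 0") using holomorphic_injective_imp_regular[OF hol open_ball] by simp
 define \<beta> where "\<beta> = cnj ?d / norm ?d"
 have \<beta>: "norm \<beta> = 1" "\<beta> * ?d = of_real (norm ?d)"
  using d0 by (simp_all add: \<beta>_def norm_divide complex_norm_square[symmetric] mult.commute power2_eq_square)
 have \<beta>c: "\<beta> * cnj \<beta> = 1" using \<beta>(1) by (simp add: complex_norm_square[symmetric])
 have \<beta>D: "\<beta> * z \<in> disk" "cnj \<beta> * z \<in> disk" if "z \<in> disk" for z using that \<beta>(1) by (simp_all add: norm_mult)
 have A: "(\<lambda>z. g0 (cnj \<beta> * z)) holomorphic_on disk"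
 proof -
  have "g0 \<circ> (\<lambda>z. cnj \<beta> * z) holomorphic_on disk"
   by (rule holomorphic_on_compose_gen[OF _ g0(1)]) (use \<beta>D(2) in \<open>auto intro!: holomorphic_intros simp del: mem_ball\<close>)
  thus ?thesis by (simp add: o_def)
 qed
 have "((\<lambda>z. f0 (kt z)) has_field_derivative ?d) (at 0)" using holomorphic_derivI[OF hol open_ball, of 0] by simp
 hence "((\<lambda>z. \<beta> * f0 (kt z)) has_field_derivative \<beta> * ?d) (at 0)" by (rule DERIV_cmult)
 hence B: "deriv (\<lambda>z. \<beta> * f0 (kt z)) 0 = of_real (norm ?d)" using \<beta>(2) DERIV_imp_deriv by metis
 show ?thesis
 proof (rule exI[of _ "\<lambda>z. g0 (cnj \<beta> * z)"], rule exI[of _ "\<lambda>w. \<beta> * f0 w"], rule exI[of _ "norm ?d"], intro conjI ballI A B)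
  show "(\<lambda>w. \<beta> * f0 w) holomorphic_on H n" by (intro holomorphic_intros f0(1))
  show "g0 (cnj \<beta> * z) \<in> H n" if "z \<in> disk" for z using g0(2) \<beta>D(2) that by blast
  show "\<beta> * f0 (g0 (cnj \<beta> * z)) = z" if "z \<in> disk" for z using g0(3)[OF \<beta>D(2)[OF that]] \<beta>c by (simp add: mult.assoc[symmetric])
  show "\<beta> * f0 w \<in> disk" if "w \<in> H n" for w using f0(2) \<beta>D(1) that by blast
  show "g0 (cnj \<beta> * (\<beta> * f0 w)) = w" if "w \<in> H n" for w using f0(3)[OF that] \<beta>c by (simp add: mult.assoc[symmetric] mult.commute[of "cnj \<beta>"])
 qed (use f0(4) d0 in auto)
qed

end

text \<open>\<open>\<Phi> n\<close> is the Riemann map of \<open>H n\<close> and \<open>\<Psi> n\<close> its inverse. As every \<open>H n\<close> lies in \<open>H 0\<close>, the self-maps \<open>\<theta> n\<close> of the disk, which are \<open>\<Phi> n\<close> in the coordinate of \<open>H 0\<close>,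
 and \<open>g n\<close>, which embed the original disk into that of \<open>H n\<close>, form normal families.\<close>

locale slit_maps = slit_domain +
 fixes \<Phi> \<Psi> :: "nat => complex => complex" and a :: "nat => real"
 assumes \<Phi>: "!!n. \<Phi> n holomorphic_on disk" "!!n z. norm z < 1 ==> \<Phi> n z \<in> H n" "!!n z. norm z < 1 ==> \<Psi> n (\<Phi> n z) = z"
  and \<Psi>: "!!n. \<Psi> n holomorphic_on H n" "!!n w. w \<in> H n ==> norm (\<Psi> n w) < 1" "!!n w. w \<in> H n ==> \<Phi> n (\<Psi> n w) = w"
  and \<Psi>0: "!!n. \<Psi> n (kt 0) = 0"
  and a: "!!n. deriv (\<lambda>z. \<Psi> n (kt z)) 0 = of_real (a n)" "!!n. a n > 0"
begin

definition g where "g n z = \<Psi> n (kt z)"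
definition E where "E z = \<Psi> 0 (kt z)"
definition \<theta> where "\<theta> n z = \<Psi> 0 (\<Phi> n z)"

lemma hol_g: "g n holomorphic_on disk"
proof -
 have "\<Psi> n \<circ> kt holomorphic_on disk" by (rule holomorphic_on_compose_gen[OF hol_kt \<Psi>(1)]) (use kt_H in auto)
 thus ?thesis by (simp add: o_def g_def[abs_def])
qed

lemma E_g: "E = g 0" by (simp add: E_def g_def fun_eq_iff)

lemma norm_g: "norm z < 1 ==> norm (g n z) < 1" using \<Psi>(2) kt_H by (simp add: g_def)

lemma g_0: "g n 0 = 0" by (simp add: g_def \<Psi>0)

lemma inj_g: "inj_on (g n) disk"
proof (rule inj_onI)
 fix x y assume xy: "x \<in> disk" "y \<in> disk" "g n x = g n y"
 hence "kt x \<in> H n" "kt y \<in> H n" using kt_H by simp_all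
 hence "kt x = kt y" using \<Psi>(3) xy(3) unfolding g_def by metis
 thus "x = y" using xy kt_eq_iff by simp
qed

lemma \<Phi>_H0: "norm z < 1 ==> \<Phi> n z \<in> H 0" using \<Phi>(2)[of z n] H_antimono[of 0 n] by blast

lemma hol_\<theta>: "\<theta> n holomorphic_on disk"
proof -
 have "\<Psi> 0 \<circ> \<Phi> n holomorphic_on disk" by (rule holomorphic_on_compose_gen[OF \<Phi>(1) \<Psi>(1)]) (use \<Phi>_H0 in auto)
 thus ?thesis by (simp add: o_def \<theta>_def[abs_def])
qed

lemma norm_\<theta>: "norm z < 1 ==> norm (\<theta> n z) < 1" using \<Psi>(2) \<Phi>_H0 by (simp add: \<theta>_def)

lemma \<theta>_g: "kt z \<in> H n ==> \<theta> n (g n z) = E z" by (simp add: \<theta>_def g_def E_def \<Psi>(3))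

lemma inj_\<theta>: "inj_on (\<theta> n) disk"
proof (rule inj_onI)
 fix x y assume xy: "x \<in> disk" "y \<in> disk" "\<theta> n x = \<theta> n y"
 hence "\<Phi> n x \<in> H 0" "\<Phi> n y \<in> H 0" using \<Phi>_H0 by simp_all
 hence "\<Phi> n x = \<Phi> n y" using \<Psi>(3) xy(3) unfolding \<theta>_def by metis
 moreover have "norm x < 1" "norm y < 1" using xy by simp_all
 ultimately show "x = y" using \<Phi>(3) by metis
qed

lemma \<theta>_0: "\<theta> n 0 = 0" using \<theta>_g[OF kt_H, of 0 n] g_0[of n] by (simp add: E_g g_0)

lemma deriv_\<theta>: "deriv (\<theta> n) 0 * of_real (a n) = of_real (a 0)"
proof -
 have dg: "(g m has_field_derivative of_real (a m)) (at 0)" for m using holomorphic_derivI[OF hol_g open_ball, of 0 m] a(1)[of m] by (simp add: g_def[abs_def])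
 have "(\<theta> n has_field_derivative deriv (\<theta> n) 0) (at (g n 0))" using holomorphic_derivI[OF hol_\<theta> open_ball, of 0 n] by (simp add: g_0)
 from DERIV_chain2[OF this dg] have "((\<lambda>z. \<theta> n (g n z)) has_field_derivative deriv (\<theta> n) 0 * of_real (a n)) (at 0)" .
 moreover have "eventually (\<lambda>z. z \<in> disk) (nhds (0::complex))" by (rule eventually_nhds_in_open) auto
 hence "eventually (\<lambda>z. \<theta> n (g n z) = g 0 z) (nhds 0)" by eventually_elim (use \<theta>_g kt_H in \<open>auto simp: E_g\<close>)
 ultimately have "(g 0 has_field_derivative deriv (\<theta> n) 0 * of_real (a n)) (at 0)" by (simp add: DERIV_cong_ev)
 thus ?thesis using dg[of 0] DERIV_unique by blast
qed

lemma a_le_1: "a n <= 1"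
proof -
 have "norm (deriv (g n) 0) <= 1" using Schwarz_Lemma(2)[OF hol_g g_0 norm_g, of 0] by simp
 thus ?thesis using a[of n] by (simp add: g_def[abs_def])
qed

lemma kernel:
 assumes \<Theta>: "open \<Theta>" "connected \<Theta>" "kt 0 \<in> \<Theta>" and sub: "!!n. \<Theta> \<subseteq> H n"
 shows "\<Theta> \<subseteq> kt ` disk"
proof -
 define V where "V = kt ` disk"
 have oV: "open V" unfolding V_def by (rule open_mapping_thm3[OF hol_kt open_ball inj_kt])
 have con: "connected (\<Theta> - {kt 1})" using \<Theta> by (intro connected_open_delete) auto
 have cl: "y \<in> V" if y: "y \<in> \<Theta> - {kt 1}" "y \<in> closure V" for y
 proof -
  obtain v where v: "!!j. v j \<in> V" "v \<longlonglongrightarrow> y" using y(2) unfolding closure_sequential by blast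
  have "\<exists>z. norm z < 1 \<and> kt z = v j" for j
  proof -
   have "v j \<in> kt ` disk" using v(1)[of j] by (simp add: V_def)
   thus ?thesis by (elim imageE) (use mem_ball_0 in metis)
  qed
  then obtain z where z: "!!j. norm (z j) < 1" "!!j. kt (z j) = v j" by metis
  have "compact (cball (0::complex) 1)" by simp
  moreover have "\<forall>j. z j \<in> cball 0 1" using z(1) by (simp add: less_imp_le)
  ultimately obtain x r where x: "strict_mono (r :: nat => nat)" "(z \<circ> r) \<longlonglongrightarrow> x" unfolding compact_def by metis
  have "(\<lambda>j. kt (z (r j))) \<longlonglongrightarrow> y" unfolding z(2) using LIMSEQ_subseq_LIMSEQ[OF v(2) x(1)] by (simp add: o_def)
  hence xx: "x \<noteq> -1" "kt x = y" "norm x <= 1"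
  proof -
   have 1: "norm (z (r j)) <= 1" for j using z(1)[of "r j"] by simp
   have 2: "(\<lambda>j. z (r j)) \<longlonglongrightarrow> x" using x(2) by (simp add: o_def)
   have 3: "z (r j) \<noteq> -1" for j using z(1)[of "r j"] by auto
   show "x \<noteq> -1" "kt x = y" "norm x <= 1" using kt_convergent[OF 1 2 \<open>(\<lambda>j. kt (z (r j))) \<longlonglongrightarrow> y\<close> 3] by auto
  qed
  have "x \<noteq> 1" using xx(2) y(1) by auto
  have "norm x < 1"
  proof (rule ccontr)
   assume "\<not> norm x < 1"
   moreover have "kt x \<in> H n" for n using sub[of n] y(1) xx(2) by blast
   ultimately have "\<forall>n. \<exists>t. \<bar>t\<bar> < gap n \<and> x = cis t" using kt_boundary_cases[OF xx(3,1)] by blast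
   then obtain t where t: "!!n. \<bar>t n\<bar> < gap n" "!!n. x = cis (t n)" by metis
   have "gap \<longlonglongrightarrow> 0" unfolding gap_def[abs_def] by real_asymp
   hence "t \<longlonglongrightarrow> 0" by (rule Lim_null_comparison[rotated]) (use t(1) in \<open>auto intro!: eventuallyI less_imp_le\<close>)
   hence "(\<lambda>n. cis (t n)) \<longlonglongrightarrow> cis 0" by (intro tendsto_intros)
   hence "(\<lambda>n::nat. x) \<longlonglongrightarrow> 1" by (simp flip: t(2))
   hence "x = 1" by (simp add: LIMSEQ_const_iff)
   thus False using \<open>x \<noteq> 1\<close> by simp
  qed
  thus ?thesis using xx(2) unfolding V_def by auto
 qed
 have sub1: "\<Theta> - {kt 1} \<subseteq> V"
 proof -
  have "\<Theta> - {kt 1} \<subseteq> V \<union> - closure V" using cl by blast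
  moreover have "V \<inter> - closure V \<inter> (\<Theta> - {kt 1}) = {}" using closure_subset by blast
  ultimately have "V \<inter> (\<Theta> - {kt 1}) = {} \<or> - closure V \<inter> (\<Theta> - {kt 1}) = {}" using connectedD[OF con oV] by (simp add: open_Compl)
  moreover have "kt 0 \<in> V \<inter> (\<Theta> - {kt 1})" using \<Theta>(3) kt_eq_iff[of 0 1] by (auto simp: V_def)
  ultimately show ?thesis using cl \<open>\<Theta> - {kt 1} \<subseteq> V \<union> - closure V\<close> by blast
 qed
 have "kt 1 \<notin> \<Theta>"
 proof
  assume "kt 1 \<in> \<Theta>"
  have "continuous_on UNIV (\<lambda>t. cis t)" by (intro continuous_intros)
  have "((\<lambda>n. kt (cis (gap n))) \<longlongrightarrow> kt (cis 0)) sequentially"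
  proof (rule continuous_on_tendsto_compose[OF cont_kt])
   have "gap \<longlonglongrightarrow> 0" unfolding gap_def[abs_def] by real_asymp
   thus "(\<lambda>n. cis (gap n)) \<longlonglongrightarrow> cis 0" by (intro tendsto_intros)
   have "cis (gap n) \<noteq> -1" for n
   proof
    assume "cis (gap n) = -1"
    hence "cis (gap n) = cis pi" by simp
    hence "gap n = pi" by (rule cis_eq) (use gap[of n] in auto)
    thus False using gap[of n] by simp
   qed
   thus "eventually (\<lambda>n. cis (gap n) \<in> cball 0 1 - {-1}) sequentially" by simp
  qed simp
  hence "eventually (\<lambda>n. kt (cis (gap n)) \<in> \<Theta>) sequentially" using \<Theta>(1) \<open>kt 1 \<in> \<Theta>\<close> topological_tendstoD by fastforce
  then obtain n where n: "kt (cis (gap n)) \<in> \<Theta>" by (auto simp: eventually_sequentially)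
  have "cis (gap n) \<noteq> 1"
  proof
   assume "cis (gap n) = 1"
   hence "sin (gap n) = 0" by (metis cis.sel(2) one_complex.sel(2))
   thus False using sin_gt_zero[of "gap n"] gap[of n] by simp
  qed
  hence "kt (cis (gap n)) \<in> V" using n sub1 kt_eq_iff[of "cis (gap n)" 1] by auto
  then obtain z where "norm z < 1" "kt (cis (gap n)) = kt z" unfolding V_def by auto
  hence "cis (gap n) = z" using kt_eq_iff[of "cis (gap n)" z] by simp
  thus False using \<open>norm z < 1\<close> by auto
 qed
 thus ?thesis using sub1 V_def by blast
qed

text \<open>A limit \<open>t\<close> of the maps \<open>\<theta> n\<close> is injective, and its image corresponds to a connected open subset of all \<open>H n\<close>. By the kernel lemma \<open>t\<close> is \<open>E \<circ> \<omega>\<close> for a self-map \<open>\<omega>\<close> of the disk. The derivatives at \<open>0\<close> give \<open>\<omega>' 0 \<ge> 1\<close>, hence \<open>\<omega>\<close> is the identity by the lemma of Schwarz.\<close>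

lemma subsequence_limit:
 obtains r where "strict_mono (r :: nat => nat)"
  "!!C. compact C ==> C \<subseteq> disk ==> uniform_limit C (\<lambda>n. \<theta> (r n)) E sequentially"
  "!!z. norm z < 1 ==> (\<lambda>n. g (r n) z) \<longlonglongrightarrow> z"
proof -
 define F where "F = {h. h holomorphic_on disk \<and> (\<forall>z\<in>disk. norm (h z) <= (1::real))}"
 have bdd: "\<exists>B. \<forall>h\<in>F. \<forall>z\<in>C. norm (h z) <= B" if "C \<subseteq> disk" for C using that by (intro exI[of _ 1]) (auto simp: F_def)
 obtain t r1 where t: "t holomorphic_on disk" "strict_mono (r1 :: nat => nat)"
  "!!x. x \<in> disk ==> (\<lambda>n. \<theta> (r1 n) x) \<longlonglongrightarrow> t x"
  "!!C. [|compact C; C \<subseteq> disk|] ==> uniform_limit C (\<theta> \<circ> r1) t sequentially"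
  by (rule Montel[of "disk" F \<theta>]) (use bdd hol_\<theta> norm_\<theta> in \<open>auto simp: F_def less_imp_le\<close>)
 have dt: "(\<lambda>n. deriv (\<theta> (r1 n)) 0) \<longlonglongrightarrow> deriv t 0"
 proof -
  have "(\<lambda>n. (deriv ^^ 1) (\<theta> (r1 n)) 0) \<longlonglongrightarrow> (deriv ^^ 1) t 0"
  proof (rule higher_deriv_complex_uniform_limit[where A = "ball 0 (1/2)"])
   have "uniform_limit (cball 0 (1/2)) (\<theta> \<circ> r1) t sequentially" by (rule t(4)) auto
   thus "uniform_limit (ball 0 (1/2)) (\<lambda>n. \<theta> (r1 n)) t sequentially" unfolding o_def by (rule uniform_limit_on_subset) auto
   show "eventually (\<lambda>n. \<theta> (r1 n) holomorphic_on ball 0 (1/2)) sequentially" by (intro eventuallyI holomorphic_on_subset[OF hol_\<theta>]) auto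
  qed auto
  thus ?thesis by simp
 qed
 have d\<theta>: "deriv (\<theta> n) 0 = of_real (a 0 / a n)" "a 0 <= a 0 / a n" for n
  using deriv_\<theta>[of n] a(2)[of n] a_le_1[of n] a(2)[of 0] by (simp_all add: field_simps)
 have dt': "deriv t 0 = of_real (Re (deriv t 0))" "a 0 <= Re (deriv t 0)"
 proof -
  have "(\<lambda>n. a 0 / a (r1 n)) \<longlonglongrightarrow> Re (deriv t 0)" "(\<lambda>n. 0) \<longlonglongrightarrow> Im (deriv t 0)"
   using tendsto_Re[OF dt] tendsto_Im[OF dt] by (simp_all add: d\<theta>(1) del: of_real_divide)
  thus "deriv t 0 = of_real (Re (deriv t 0))" "a 0 <= Re (deriv t 0)"
   using LIMSEQ_le_const[of "\<lambda>n. a 0 / a (r1 n)" "Re (deriv t 0)" "a 0"] d\<theta>(2) by (auto simp: LIMSEQ_const_iff complex_eq_iff)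
 qed
 have nonconst: "\<not> t constant_on disk"
 proof
  assume "t constant_on disk"
  hence "deriv t 0 = 0" using holomorphic_nonconstant[OF t(1) open_ball, of 0] by auto
  thus False using dt'(2) a(2)[of 0] by simp
 qed
 have t0: "t 0 = 0" using t(3)[of 0] \<theta>_0 LIMSEQ_unique[of "\<lambda>n. 0" "t 0" 0] by simp
 have t_in: "t z \<in> \<Psi> 0 ` H m" if z: "norm z < 1" for z m
 proof (rule ccontr)
  assume no: "t z \<notin> \<Psi> 0 ` H m"
  define f where "f n x = \<theta> (r1 (n + m)) x - t z" for n x
  have "f n x \<noteq> 0" if "norm x < 1" for n x
  proof
   assume "f n x = 0"
   hence "t z = \<Psi> 0 (\<Phi> (r1 (n + m)) x)" by (simp add: f_def \<theta>_def)
   moreover have "m <= r1 (n + m)" using seq_suble[OF t(2), of "n + m"] by simp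
   hence "\<Phi> (r1 (n + m)) x \<in> H m" using \<Phi>(2)[OF that] H_antimono by blast
   ultimately show False using no by blast
  qed
  note fnz = this
  have "t z - t z \<noteq> 0"
  proof (rule Hurwitz_no_zeros[of "disk" f "\<lambda>x. t x - t z" z])
   show "f n holomorphic_on disk" for n unfolding f_def by (intro holomorphic_intros hol_\<theta>)
   show "(\<lambda>x. t x - t z) holomorphic_on disk" by (intro holomorphic_intros t(1))
   show "uniform_limit C f (\<lambda>x. t x - t z) sequentially" if "compact C" "C \<subseteq> disk" for C
   proof -
    have "uniform_limit C (\<lambda>n. (\<theta> \<circ> r1) (n + m)) t sequentially" using t(4)[OF that] by (rule filterlim_compose[OF _ filterlim_add_const_nat_at_top])
    thus ?thesis unfolding f_def[abs_def] by (intro uniform_limit_intros) (simp add: o_def)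
   qed
   show "\<not> (\<lambda>x. t x - t z) constant_on disk" using nonconst by (auto simp: constant_on_def) (metis diff_add_cancel)
  qed (use z fnz in auto)
  thus False by simp
 qed
 define \<Theta> where "\<Theta> = (\<lambda>z. \<Phi> 0 (t z)) ` disk"
 have tH: "\<Phi> 0 (t z) \<in> H m" "norm (t z) < 1" if z: "norm z < 1" for z m
 proof -
  obtain w where "w \<in> H m" "t z = \<Psi> 0 w" using t_in[OF z, of m] by blast
  moreover have "w \<in> H 0" using \<open>w \<in> H m\<close> H_antimono[of 0 m] by blast
  ultimately show "\<Phi> 0 (t z) \<in> H m" "norm (t z) < 1" using \<Psi>(2,3) by auto
 qed
 have injt: "inj_on t disk" by (rule Hurwitz_injective[of "disk" "\<theta> \<circ> r1" t]) (use t(1,4) hol_\<theta> inj_\<theta> nonconst in auto)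
 have hol\<Phi>t: "(\<lambda>z. \<Phi> 0 (t z)) holomorphic_on disk"
 proof -
  have "\<Phi> 0 \<circ> t holomorphic_on disk" by (rule holomorphic_on_compose_gen[OF t(1) \<Phi>(1)]) (use tH(2) in auto)
  thus ?thesis by (simp add: o_def)
 qed
 have inj\<Phi>t: "inj_on (\<lambda>z. \<Phi> 0 (t z)) disk"
 proof (rule inj_onI)
  fix x y assume xy: "x \<in> disk" "y \<in> disk" "\<Phi> 0 (t x) = \<Phi> 0 (t y)"
  hence "norm (t x) < 1" "norm (t y) < 1" using tH(2) by simp_all
  hence "t x = t y" using \<Phi>(3) xy(3) by metis
  thus "x = y" using injt xy by (auto dest: inj_onD)
 qed
 have \<Phi>00: "\<Phi> 0 0 = kt 0" using \<Psi>(3)[OF kt_H, of 0 0] \<Psi>0 by simp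
 have "\<Theta> \<subseteq> kt ` disk"
 proof (rule kernel)
  show "open \<Theta>" unfolding \<Theta>_def by (rule open_mapping_thm3[OF hol\<Phi>t open_ball inj\<Phi>t])
  show "connected \<Theta>" unfolding \<Theta>_def by (intro connected_continuous_image holomorphic_on_imp_continuous_on[OF hol\<Phi>t]) auto
  show "kt 0 \<in> \<Theta>" unfolding \<Theta>_def by (rule image_eqI[of _ _ 0]) (auto simp: t0 \<Phi>00)
 qed (use tH in \<open>auto simp: \<Theta>_def\<close>)
 note sub = this
 obtain ki where ki: "ki holomorphic_on kt ` disk" "!!z. z \<in> disk ==> deriv kt z * deriv ki (kt z) = 1" "!!z. z \<in> disk ==> ki (kt z) = z"
  using holomorphic_has_inverse[OF hol_kt open_ball inj_kt] by metis
 define \<omega> where "\<omega> z = ki (\<Phi> 0 (t z))" for z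
 have \<omega>: "norm (\<omega> z) < 1" "kt (\<omega> z) = \<Phi> 0 (t z)" if "norm z < 1" for z
 proof -
  have "\<Phi> 0 (t z) \<in> kt ` disk" using sub that unfolding \<Theta>_def by auto
  then obtain y where "y \<in> disk" "\<Phi> 0 (t z) = kt y" by blast
  thus "norm (\<omega> z) < 1" "kt (\<omega> z) = \<Phi> 0 (t z)" using ki(3) by (auto simp: \<omega>_def)
 qed
 have hol\<omega>: "\<omega> holomorphic_on disk"
 proof -
  have "ki \<circ> (\<lambda>z. \<Phi> 0 (t z)) holomorphic_on disk" by (rule holomorphic_on_compose_gen[OF hol\<Phi>t ki(1)]) (use sub in \<open>simp add: \<Theta>_def\<close>)
  thus ?thesis by (simp add: o_def \<omega>_def[abs_def])
 qed
 have \<omega>0: "\<omega> 0 = 0" using ki(3)[of 0] by (simp add: \<omega>_def t0 \<Phi>00)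
 have E\<omega>: "g 0 (\<omega> z) = t z" if "norm z < 1" for z using \<omega>(2)[OF that] \<Phi>(3)[OF tH(2)[OF that]] by (simp add: g_def)
 have dE: "of_real (a 0) * deriv \<omega> 0 = deriv t 0"
 proof -
  have "(g 0 has_field_derivative of_real (a 0)) (at (\<omega> 0))"
   using holomorphic_derivI[OF hol_g open_ball, of 0 0] a(1)[of 0] by (simp add: g_def[abs_def] \<omega>0)
  moreover have "(\<omega> has_field_derivative deriv \<omega> 0) (at 0)" using holomorphic_derivI[OF hol\<omega> open_ball, of 0] by simp
  ultimately have "((\<lambda>z. g 0 (\<omega> z)) has_field_derivative of_real (a 0) * deriv \<omega> 0) (at 0)" by (rule DERIV_chain2)
  moreover have "eventually (\<lambda>z. z \<in> disk) (nhds (0::complex))" by (rule eventually_nhds_in_open) auto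
  hence "eventually (\<lambda>z. g 0 (\<omega> z) = t z) (nhds 0)" by eventually_elim (use E\<omega> in auto)
  ultimately have "(t has_field_derivative of_real (a 0) * deriv \<omega> 0) (at 0)" by (simp add: DERIV_cong_ev)
  thus ?thesis by (metis DERIV_imp_deriv)
 qed
 have "deriv \<omega> 0 = 1"
 proof -
  define x where "x = Re (deriv t 0) / a 0"
  have x: "deriv \<omega> 0 = of_real x" using dE dt'(1) a(2)[of 0] unfolding x_def of_real_divide by (metis nonzero_mult_div_cancel_left of_real_eq_0_iff less_irrefl)
  have "x \<ge> 1" using dt'(2) a(2)[of 0] by (simp add: x_def)
  moreover have "norm (deriv \<omega> 0) <= 1" using Schwarz_Lemma(2)[OF hol\<omega> \<omega>0 \<omega>(1), of 0] by simp
  ultimately show ?thesis unfolding x by simp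
 qed
 have tE: "t z = E z" if z: "norm z < 1" for z
 proof -
  obtain \<alpha> where \<alpha>: "!!z. norm z < 1 ==> \<omega> z = \<alpha> * z"
   using Schwarz_Lemma(3)[OF hol\<omega> \<omega>0 \<omega>(1), of 0] \<open>deriv \<omega> 0 = 1\<close> by auto
  have "eventually (\<lambda>z. z \<in> disk) (nhds (0::complex))" by (rule eventually_nhds_in_open) auto
  hence "eventually (\<lambda>z. \<omega> z = \<alpha> * z) (nhds 0)" by eventually_elim (use \<alpha> in auto)
  hence "deriv \<omega> 0 = deriv (\<lambda>z. \<alpha> * z) 0" by (rule deriv_cong_ev) simp
  hence "\<omega> z = z" using \<open>deriv \<omega> 0 = 1\<close> \<alpha>[OF z] by simp
  thus ?thesis using E\<omega>[OF z] by (simp add: E_g)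
 qed
 have ul: "uniform_limit C (\<lambda>n. \<theta> (r1 n)) E sequentially" if C: "compact C" "C \<subseteq> disk" for C
 proof -
  have "uniform_limit C (\<lambda>n. \<theta> (r1 n)) t sequentially" using t(4)[OF C] by (simp add: o_def)
  moreover have "t z = E z" if "z \<in> C" for z using tE C(2) that by auto
  ultimately show ?thesis using uniform_limit_cong'[of C "\<lambda>n. \<theta> (r1 n)" "\<lambda>n. \<theta> (r1 n)" t E] by auto
 qed
 show thesis
 proof (rule that[OF t(2) ul])
  fix z :: complex assume z: "norm z < 1"
  define C where "C = cball (0::complex) (norm z)"
  have C: "compact C" "C \<subseteq> disk" using z by (auto simp: C_def)
  have gC: "g n z \<in> C" for n using Schwarz_Lemma(1)[OF hol_g g_0 norm_g z] by (simp add: C_def)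
  have contE: "continuous_on C E" unfolding E_g by (rule continuous_on_subset[OF holomorphic_on_imp_continuous_on[OF hol_g] C(2)])
  have injE: "inj_on E C" unfolding E_g by (rule inj_on_subset[OF inj_g C(2)])
  have "(\<lambda>n. E (g (r1 n) z)) \<longlonglongrightarrow> E z"
  proof (rule tendstoI)
   fix e :: real assume "e > 0"
   show "eventually (\<lambda>n. dist (E (g (r1 n) z)) (E z) < e) sequentially" using uniform_limitD[OF ul[OF C] \<open>e > 0\<close>]
   proof eventually_elim
    case (elim n)
    thus ?case using gC[of "r1 n"] \<theta>_g[OF kt_H[OF z], of "r1 n"] by (metis dist_commute)
   qed
  qed
  hence "(\<lambda>n. the_inv_into C E (E (g (r1 n) z))) \<longlonglongrightarrow> the_inv_into C E (E z)"
   by (rule continuous_on_tendsto_compose[OF continuous_on_inv_into[OF contE C(1) injE]]) (use gC in \<open>auto simp: C_def\<close>)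
  thus "(\<lambda>n. g (r1 n) z) \<longlonglongrightarrow> z" using gC the_inv_into_f_f[OF injE] by (simp add: C_def)
 qed
qed

lemma g_D_or_gap:
 assumes z: "!!j. norm (z j) < 1" "z \<longlonglongrightarrow> x" "(\<lambda>j. g n (z j)) \<longlonglongrightarrow> w" and w: "norm w < 1"
 shows "w = g n x" "norm x < 1 \<or> (\<exists>t. \<bar>t\<bar> < gap n \<and> x = cis t)"
proof -
 have "(\<lambda>j. \<Phi> n (g n (z j))) \<longlonglongrightarrow> \<Phi> n w"
  by (rule continuous_on_tendsto_compose[OF holomorphic_on_imp_continuous_on[OF \<Phi>(1)] z(3)]) (use w z(1) norm_g in auto)
 hence "(\<lambda>j. kt (z j)) \<longlonglongrightarrow> \<Phi> n w" using \<Psi>(3)[OF kt_H[OF z(1)]] by (simp add: g_def)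
 moreover have "norm (z j) <= 1" "z j \<noteq> -1" for j using z(1)[of j] by auto
 ultimately have x: "x \<noteq> -1" "kt x = \<Phi> n w" "norm x <= 1" using kt_convergent[OF _ z(2)] by auto
 thus "w = g n x" using \<Phi>(3)[OF w] by (simp add: g_def)
 show "norm x < 1 \<or> (\<exists>t. \<bar>t\<bar> < gap n \<and> x = cis t)" using kt_boundary_cases[OF x(3,1)] x(2) \<Phi>(2)[OF w] by simp
qed

text \<open>Otherwise the \<open>g\<close>-image of a short segment from the real axis near \<open>1\<close> to a point of the gap joins a neighbourhood of \<open>1\<close> to points of the disk whose limit is another point of the circle.
 On these continua \<open>\<theta>\<close> is close to the value \<open>E 1\<close>, so Koebe's lemma gives \<open>E = E 1\<close> on a disk, although \<open>E\<close> is injective.\<close>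

lemma gap_near_1:
 assumes r: "strict_mono (r :: nat => nat)"
  "!!C. compact C ==> C \<subseteq> disk ==> uniform_limit C (\<lambda>n. \<theta> (r n)) E sequentially"
  "!!z. norm z < 1 ==> (\<lambda>n. g (r n) z) \<longlonglongrightarrow> z" and e: "e > 0"
 shows "\<exists>\<^sub>F n in sequentially. \<forall>t. \<bar>t\<bar> < gap (r n) --> dist (g (r n) (cis t)) 1 < e"
proof (rule ccontr)
 assume "\<not> ?thesis"
 hence "eventually (\<lambda>n. \<exists>t. \<bar>t\<bar> < gap (r n) \<and> dist (g (r n) (cis t)) 1 \<ge> e) sequentially" by (simp add: not_frequently not_le not_less)
 then obtain N0 where N0: "!!n. n \<ge> N0 ==> \<exists>t. \<bar>t\<bar> < gap (r n) \<and> dist (g (r n) (cis t)) 1 \<ge> e" by (auto simp: eventually_sequentially)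
 define \<rho> where "\<rho> m = 1 - 1 / real (m + 1)" for m
 have \<rho>: "0 <= \<rho> m" "\<rho> m < 1" for m by (auto simp: \<rho>_def)
 have "\<exists>n t. n \<ge> m \<and> \<bar>t\<bar> < gap (r n) \<and> dist (g (r n) (cis t)) 1 \<ge> e \<and> dist (g (r n) (of_real (\<rho> m))) (of_real (\<rho> m)) < 1 / real (m + 1)" for m
 proof -
  have "eventually (\<lambda>n. dist (g (r n) (of_real (\<rho> m))) (of_real (\<rho> m)) < 1 / real (m + 1)) sequentially"
   using r(3)[of "of_real (\<rho> m)"] \<rho>[of m] by (intro tendstoD) auto
  then obtain N1 where N1: "!!n. n \<ge> N1 ==> dist (g (r n) (of_real (\<rho> m))) (of_real (\<rho> m)) < 1 / real (m + 1)" by (auto simp: eventually_sequentially)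
  define n where "n = max m (max N0 N1)"
  have nn: "n \<ge> N0" "n \<ge> N1" "n \<ge> m" by (auto simp: n_def)
  obtain t where "\<bar>t\<bar> < gap (r n)" "dist (g (r n) (cis t)) 1 \<ge> e" using N0[OF nn(1)] by blast
  thus ?thesis using N1[OF nn(2)] nn(3) by (intro exI[of _ n] exI[of _ t] conjI)
 qed
 then obtain n t where nt: "!!m. n m \<ge> m" "!!m. \<bar>t m\<bar> < gap (r (n m))" "!!m. dist (g (r (n m)) (cis (t m))) 1 \<ge> e"
   "!!m. dist (g (r (n m)) (of_real (\<rho> m))) (of_real (\<rho> m)) < 1 / real (m + 1)" by metis
 define \<nu> where "\<nu> m = r (n m)" for m
 have \<nu>m: "m <= \<nu> m" for m unfolding \<nu>_def using nt(1)[of m] seq_suble[OF r(1), of "n m"] by linarith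
 define A where "A m = closed_segment (of_real (\<rho> m)) (cis (t m))" for m
 have A1: "dist z 1 <= 1 / real (m + 1)" if "z \<in> A m" for z m
 proof -
  have "dist (of_real (\<rho> m)) (1::complex) = \<bar>\<rho> m - 1\<bar>" by (metis dist_of_real dist_real_def of_real_1)
  hence "of_real (\<rho> m) \<in> cball (1::complex) (1 / real (m + 1))" by (simp add: dist_commute \<rho>_def)
  moreover have "dist (cis (t m)) 1 <= gap m" using dist_cis_le[of "t m" 0] nt(2)[of m] gap_antimono[OF \<nu>m[of m]] by (simp add: \<nu>_def)
  hence "cis (t m) \<in> cball 1 (1 / real (m + 1))" by (simp add: dist_commute gap_def)
  ultimately have "A m \<subseteq> cball 1 (1 / real (m + 1))" unfolding A_def by (intro closed_segment_subset) auto
  thus ?thesis using that by (auto simp: dist_commute)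
 qed
 have AH: "kt z \<in> H (\<nu> m)" "z \<in> cball 0 1 - {-1}" if zA: "z \<in> A m" for z m
 proof -
  obtain l where l: "0 <= l" "l <= 1" "z = (1 - l) *\<^sub>R of_real (\<rho> m) + l *\<^sub>R cis (t m)" using zA unfolding A_def in_segment by blast
  have z: "norm z < 1 \<or> z = cis (t m)"
  proof (cases "l = 1")
   case False
   have "norm z <= (1 - l) * \<rho> m + l" unfolding l(3) using l(1,2) \<rho>[of m] by (intro norm_triangle_le) simp
   also have "... < (1 - l) * 1 + l" using False l(2) \<rho>[of m] by (intro add_strict_right_mono mult_strict_left_mono) auto
   finally show ?thesis by simp
  qed (use l in simp)
  thus "kt z \<in> H (\<nu> m)" using kt_H kt_cis_H[OF nt(2)[of m]] by (auto simp: \<nu>_def)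
  have "dist z 1 <= 1" using A1[OF zA] by (rule order_trans) simp
  hence "z \<noteq> -1" by (auto simp: dist_norm)
  thus "z \<in> cball 0 1 - {-1}" using z by auto
 qed
 have contg: "continuous_on (A m) (g (\<nu> m))" for m
 proof -
  have "continuous_on (A m) (\<Psi> (\<nu> m) \<circ> kt)"
   by (intro continuous_on_compose continuous_on_subset[OF cont_kt] continuous_on_subset[OF holomorphic_on_imp_continuous_on[OF \<Psi>(1)]])
    (use AH in blast)+
  thus ?thesis by (simp add: g_def[abs_def] o_def)
 qed
 have cG: "compact (g (\<nu> m) ` A m)" for m by (rule compact_continuous_image[OF contg]) (simp add: A_def)
 have conG: "connected (g (\<nu> m) ` A m)" for m by (rule connected_continuous_image[OF contg]) (simp add: A_def)
 have GD: "g (\<nu> m) ` A m \<subseteq> disk" for m using \<Psi>(2)[OF AH(1)] by (auto simp: g_def)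
 define b where "b = E 1"
 have Eb: "eventually (\<lambda>m. \<forall>z\<in>A m. dist (E z) b < d) sequentially" if d: "d > 0" for d
 proof -
  define S where "S = {z \<in> cball 0 1 - {-1}. kt z \<in> H 0}"
  have one: "1 \<in> S" using kt_cis_H[of 0 0] gap[of 0] by (simp add: S_def)
  have "continuous_on S (\<Psi> 0 \<circ> kt)"
   by (intro continuous_on_compose continuous_on_subset[OF cont_kt] continuous_on_subset[OF holomorphic_on_imp_continuous_on[OF \<Psi>(1)]])
    (auto simp: S_def)
  hence "continuous_on S E" by (simp add: E_def[abs_def] o_def)
  then obtain c where c: "c > 0" "!!z. z \<in> S ==> dist z 1 < c ==> dist (E z) (E 1) < d" using one d unfolding continuous_on_iff by metis
  have "(\<lambda>m. 1 / real (m + 1)) \<longlonglongrightarrow> 0" by real_asymp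
  hence "eventually (\<lambda>m. 1 / real (m + 1) < c) sequentially" using c(1) by (rule order_tendstoD)
  thus ?thesis
  proof eventually_elim
   case (elim m)
   show ?case
   proof
    fix z assume z: "z \<in> A m"
    have "z \<in> S" using AH[OF z] H_antimono[of 0 "\<nu> m"] by (auto simp: S_def)
    moreover have "dist z 1 < c" using A1[OF z] elim by simp
    ultimately show "dist (E z) b < d" using c(2) by (simp add: b_def)
   qed
  qed
 qed
 have E_ne_b: "E z \<noteq> b" if z: "norm z < 1" for z
 proof
  assume "E z = b"
  hence "\<Phi> 0 (\<Psi> 0 (kt z)) = \<Phi> 0 (\<Psi> 0 (kt 1))" by (simp add: b_def E_def)
  moreover have "kt 1 \<in> H 0" using kt_cis_H[of 0 0] gap[of 0] by simp
  ultimately have "kt z = kt 1" using \<Psi>(3) kt_H[OF z] by metis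
  thus False using kt_eq_iff[of z 1] z by auto
 qed
 have fl: "filterlim n sequentially sequentially" by (rule filterlim_at_top_mono[OF filterlim_ident]) (use nt(1) in auto)
 have ul: "uniform_limit C (\<lambda>m. \<theta> (\<nu> m)) E sequentially" if "compact C" "C \<subseteq> disk" for C
  using filterlim_compose[OF r(2)[OF that] fl] by (simp add: \<nu>_def)
 have contE: "continuous_on disk E" using hol_g[of 0] holomorphic_on_imp_continuous_on unfolding E_g by blast
 define y where "y m = g (\<nu> m) (cis (t m))" for m
 have tA: "cis (t m) \<in> A m" for m by (simp add: A_def)
 have yD: "norm (y m) < 1" for m
 proof -
  have "y m \<in> g (\<nu> m) ` A m" unfolding y_def using tA by blast
  thus ?thesis using GD[of m] by auto
 qed
 have "compact (cball (0::complex) 1)" by simp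
 moreover have "\<forall>m. y m \<in> cball 0 1" using yD by (simp add: less_imp_le)
 ultimately obtain \<eta> r' where \<eta>: "strict_mono (r' :: nat => nat)" "(y \<circ> r') \<longlonglongrightarrow> \<eta>" unfolding compact_def by metis
 have Gesc: "eventually (\<lambda>m. g (\<nu> m) ` A m \<inter> cball 0 c = {}) sequentially" if c: "c < 1" for c
 proof -
  have sub: "cball 0 c \<subseteq> disk" using c by auto
  have "compact (E ` cball 0 c)" by (intro compact_continuous_image continuous_on_subset[OF contE sub]) auto
  moreover have "b \<notin> E ` cball 0 c"
  proof
   assume "b \<in> E ` cball 0 c"
   then obtain z where "z \<in> cball 0 c" "E z = b" by (elim imageE) simp
   thus False using E_ne_b[of z] c by simp
  qed
  ultimately obtain d where d: "d > 0" "ball b d \<subseteq> - E ` cball 0 c" using openE[of "- E ` cball 0 c" b] by (auto simp: compact_imp_closed open_Compl)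
  have "eventually (\<lambda>m. \<forall>z\<in>cball 0 c. dist (\<theta> (\<nu> m) z) (E z) < d/2) sequentially"
   using uniform_limitD[OF ul[OF compact_cball sub], of "d/2"] d(1) by simp
  moreover have "eventually (\<lambda>m. \<forall>z\<in>A m. dist (E z) b < d/2) sequentially" using d(1) by (intro Eb) simp
  ultimately show ?thesis
  proof eventually_elim
   case (elim m)
   have False if "z \<in> A m" "g (\<nu> m) z \<in> cball 0 c" for z
   proof -
    have "dist (E z) (E (g (\<nu> m) z)) < d/2" using elim(1) that(2) \<theta>_g[OF AH(1)[OF that(1)]] by metis
    moreover have "dist (E z) b < d/2" using elim(2) that(1) by blast
    ultimately have "dist b (E (g (\<nu> m) z)) < d" using dist_triangle_half_r[of "E z" b d] by blast
    thus False using d(2) that(2) by (auto simp: subset_iff)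
   qed
   thus ?case by blast
  qed
 qed
 have rl: "filterlim r' sequentially sequentially" using \<eta>(1) by (simp add: filterlim_subseq)
 have \<eta>1: "norm \<eta> = 1"
 proof -
  have "(\<lambda>m. norm (y (r' m))) \<longlonglongrightarrow> norm \<eta>" using tendsto_norm[OF \<eta>(2)] by (simp add: o_def)
  moreover have "norm (y m) <= 1" for m using yD[of m] by simp
  ultimately have "norm \<eta> <= 1" by (intro LIMSEQ_le_const2[of "\<lambda>m. norm (y (r' m))"]) auto
  moreover have "\<not> norm \<eta> < 1"
  proof
   assume "norm \<eta> < 1"
   define c where "c = (1 + norm \<eta>) / 2"
   have c: "c < 1" "norm \<eta> < c" using \<open>norm \<eta> < 1\<close> by (auto simp: c_def)
   have "eventually (\<lambda>m. g (\<nu> (r' m)) ` A (r' m) \<inter> cball 0 c = {}) sequentially" using Gesc[OF c(1)] rl by (rule eventually_compose_filterlim)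
   moreover have "eventually (\<lambda>m. norm (y (r' m)) < c) sequentially"
    using \<open>(\<lambda>m. norm (y (r' m))) \<longlonglongrightarrow> norm \<eta>\<close> c(2) by (rule order_tendstoD)
   ultimately have "eventually (\<lambda>m. False) sequentially"
   proof eventually_elim
    case (elim m)
    have "cis (t (r' m)) \<in> A (r' m)" by (rule tA)
    hence "y (r' m) \<in> g (\<nu> (r' m)) ` A (r' m) \<inter> cball 0 c" using elim(2) by (auto simp: y_def)
    thus ?case using elim(1) by blast
   qed
   thus False by simp
  qed
  ultimately show ?thesis by simp
 qed
 have "dist \<eta> 1 \<ge> e" by (rule LIMSEQ_le_const[OF tendsto_dist[OF \<eta>(2) tendsto_const]]) (use nt(3) in \<open>auto simp: y_def \<nu>_def\<close>)
 have xlim: "(\<lambda>m. g (\<nu> m) (of_real (\<rho> m))) \<longlonglongrightarrow> 1"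
 proof -
  have \<rho>1: "(\<lambda>m. complex_of_real (\<rho> m)) \<longlonglongrightarrow> of_real 1" unfolding \<rho>_def by (intro tendsto_of_real) real_asymp
  have "(\<lambda>m. dist (g (\<nu> m) (of_real (\<rho> m))) (of_real (\<rho> m))) \<longlonglongrightarrow> 0"
  proof (rule Lim_null_comparison)
   show "(\<lambda>m. 1 / real (m + 1)) \<longlonglongrightarrow> 0" by real_asymp
  qed (use nt(4) in \<open>auto intro!: eventuallyI less_imp_le simp: \<nu>_def\<close>)
  hence "(\<lambda>m. g (\<nu> m) (of_real (\<rho> m)) - of_real (\<rho> m)) \<longlonglongrightarrow> 0" by (simp add: dist_norm tendsto_norm_zero_iff)
  from tendsto_add[OF this \<rho>1] show ?thesis by simp
 qed
 obtain w1 r1 where w: "r1 > 0" "ball w1 r1 \<subseteq> disk" "!!w. w \<in> ball w1 r1 ==> E w = b"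
 proof (rule koebe_lemma_eventually[of "\<lambda>m. \<theta> (\<nu> (r' m))" b 2 E "\<lambda>m. g (\<nu> (r' m)) ` A (r' m)" "\<lambda>m. g (\<nu> (r' m)) (of_real (\<rho> (r' m)))" "\<lambda>m. y (r' m)" 1 \<eta>])
  have b1: "norm b < 1" using \<Psi>(2)[of "kt 1" 0] kt_cis_H[of 0 0] gap[of 0] by (simp add: b_def E_def)
  show "norm (\<theta> (\<nu> (r' m)) z - b) <= 2" if "z \<in> disk" for m z
   using norm_\<theta>[of z "\<nu> (r' m)"] that b1 norm_triangle_ineq4[of "\<theta> (\<nu> (r' m)) z" b] by simp
  show "(\<lambda>m. \<theta> (\<nu> (r' m)) z) \<longlonglongrightarrow> E z" if "z \<in> disk" for z
  proof -
   have "(\<lambda>m. \<theta> (\<nu> m) z) \<longlonglongrightarrow> E z" using tendsto_uniform_limitI[OF ul[of "{z}"], of z] that by simp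
   thus ?thesis by (rule filterlim_compose[OF _ rl])
  qed
  show "eventually (\<lambda>m. g (\<nu> (r' m)) ` A (r' m) \<inter> cball 0 c = {}) sequentially" if "c < 1" for c
   using Gesc[OF that] rl by (rule eventually_compose_filterlim)
  show "g (\<nu> (r' m)) (of_real (\<rho> (r' m))) \<in> g (\<nu> (r' m)) ` A (r' m)" for m using \<rho>[of "r' m"] by (intro imageI) (auto simp: A_def)
  show "y (r' m) \<in> g (\<nu> (r' m)) ` A (r' m)" for m unfolding y_def by (intro imageI tA)
  show "(\<lambda>m. g (\<nu> (r' m)) (of_real (\<rho> (r' m)))) \<longlonglongrightarrow> 1" by (rule filterlim_compose[OF xlim rl])
  show "(\<lambda>m. y (r' m)) \<longlonglongrightarrow> \<eta>" using \<eta>(2) by (simp add: o_def)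
  show "1 \<noteq> \<eta>" using \<open>dist \<eta> 1 \<ge> e\<close> e by auto
  show "eventually (\<lambda>m. \<forall>z\<in>g (\<nu> (r' m)) ` A (r' m). norm (\<theta> (\<nu> (r' m)) z - b) <= d) sequentially" if "d > 0" for d
  proof -
   have "eventually (\<lambda>m. \<forall>z\<in>A (r' m). dist (E z) b < d) sequentially" using Eb[OF that] rl by (rule eventually_compose_filterlim)
   thus ?thesis
   proof eventually_elim
    case (elim m)
    show ?case
    proof
     fix z assume "z \<in> g (\<nu> (r' m)) ` A (r' m)"
     then obtain x where "x \<in> A (r' m)" "z = g (\<nu> (r' m)) x" by blast
     thus "norm (\<theta> (\<nu> (r' m)) z - b) <= d" using elim \<theta>_g[OF AH(1)] by (simp add: dist_norm less_imp_le)
    qed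
   qed
  qed
 qed (use hol_\<theta> cG conG GD \<eta>1 in auto)
 have "norm w1 < 1" using w(1,2) centre_in_ball mem_ball_0 by blast
 moreover have "E w1 = b" using w(1) by (intro w(3)) simp
 ultimately show False using E_ne_b by blast
qed

text \<open>The preimage of infinity is not in \<open>g n ` disk\<close>. On the part of the disk with real part below \<open>1 - e\<close> the boundary of this image does not enter, as it is reached only through the gap; so this part lies in the image.\<close>

lemma pole_near_1:
 assumes e: "0 < e" "e < 1" and near: "!!t. \<bar>t\<bar> < gap n ==> dist (g n (cis t)) 1 < e"
 shows "Re (\<Psi> n 0) \<ge> 1 - e"
proof (rule ccontr)
 assume no: "\<not> Re (\<Psi> n 0) \<ge> 1 - e"
 define Q where "Q = disk \<inter> {z. Re z < 1 - e}"
 have "connected Q" unfolding Q_def by (intro convex_connected convex_Int convex_halfspace_Re_lt) auto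
 have og: "open (g n ` disk)" by (rule open_mapping_thm3[OF hol_g open_ball inj_g])
 have cl: "w \<in> g n ` disk" if w: "w \<in> Q" "w \<in> closure (g n ` disk)" for w
 proof -
  obtain v where v: "!!j. v j \<in> g n ` disk" "v \<longlonglongrightarrow> w" using w(2) unfolding closure_sequential by blast
  have "\<exists>z. norm z < 1 \<and> g n z = v j" for j using v(1)[of j] by (elim imageE) (use mem_ball_0 in metis)
  then obtain z where z: "!!j. norm (z j) < 1" "!!j. g n (z j) = v j" by metis
  have "compact (cball (0::complex) 1)" by simp
  moreover have "\<forall>j. z j \<in> cball 0 1" using z(1) by (simp add: less_imp_le)
  ultimately obtain x r where x: "strict_mono (r :: nat => nat)" "(z \<circ> r) \<longlonglongrightarrow> x" unfolding compact_def by metis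
  have 1: "(\<lambda>j. z (r j)) \<longlonglongrightarrow> x" using x(2) by (simp add: o_def)
  have 2: "(\<lambda>j. g n (z (r j))) \<longlonglongrightarrow> w" unfolding z(2) using LIMSEQ_subseq_LIMSEQ[OF v(2) x(1)] by (simp add: o_def)
  have 3: "norm w < 1" using w(1) by (simp add: Q_def)
  note gx = g_D_or_gap[OF z(1) 1 2 3]
  show ?thesis
  proof (cases "norm x < 1")
   case True thus ?thesis using gx(1) by simp
  next
   case False
   then obtain s where "\<bar>s\<bar> < gap n" "x = cis s" using gx(2) by blast
   hence "dist w 1 < e" using near gx(1) by simp
   moreover have "\<bar>Re (w - 1)\<bar> <= dist w 1" unfolding dist_norm by (rule abs_Re_le_cmod)
   ultimately show ?thesis using w(1) by (auto simp: Q_def)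
  qed
 qed
 have QQ: "Q \<subseteq> g n ` disk \<union> - closure (g n ` disk)"
 proof
  fix w assume "w \<in> Q"
  thus "w \<in> g n ` disk \<union> - closure (g n ` disk)" using cl[of w] by (cases "w \<in> closure (g n ` disk)") simp_all
 qed
 moreover have "g n ` disk \<inter> - closure (g n ` disk) \<inter> Q = {}" using closure_subset[of "g n ` disk"] by blast
 ultimately have "g n ` disk \<inter> Q = {} \<or> - closure (g n ` disk) \<inter> Q = {}" using connectedD[OF \<open>connected Q\<close> og] by (simp add: open_Compl)
 moreover have "g n 0 \<in> g n ` disk \<inter> Q" using e g_0[of n] by (simp add: Q_def)
 ultimately have "- closure (g n ` disk) \<inter> Q = {}" by blast
 hence "Q \<subseteq> g n ` disk" using QQ by blast
 moreover have "\<Psi> n 0 \<in> Q" using no \<Psi>(2)[OF zero_H] by (simp add: Q_def)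
 ultimately have "\<Psi> n 0 \<in> g n ` disk" by blast
 then obtain z where z: "norm z < 1" "\<Psi> n 0 = \<Psi> n (kt z)" unfolding g_def by (elim imageE) simp
 have "\<Phi> n (\<Psi> n 0) = 0" "\<Phi> n (\<Psi> n (kt z)) = kt z" by (intro \<Psi>(3) zero_H kt_H z(1))+
 hence "kt z = 0" using z(2) by metis
 moreover have "z \<noteq> -1" "norm z <= 1" using z(1) by auto
 ultimately show False using kt_nz[of z] by blast
qed

end

section \<open>Comparison of functions without a pole with functions with a pole near \<open>1\<close>\<close>

lemma polygon_length_perturb:
 assumes "sorted xs" "!!x y. x \<in> set xs ==> y \<in> set xs ==> dist (g x) (g y) <= dist (h x) (h y) + L * \<bar>x - y\<bar>" and L: "L \<ge> 0"
 shows "polygon_length g xs <= polygon_length h xs + polygon_length (\<lambda>t. of_real (L * t)) xs" using assms(1,2)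
proof (induction xs)
 case C: (Cons x xs)
 show ?case
 proof (cases xs)
  case (Cons y ys)
  have "dist (g x) (g y) <= dist (h x) (h y) + L * \<bar>x - y\<bar>" by (rule C.prems(2)) (simp_all add: Cons)
  also have "L * \<bar>x - y\<bar> = dist (complex_of_real (L * x)) (of_real (L * y))"
  proof -
   have "complex_of_real (L * x) - of_real (L * y) = of_real (L * (x - y))" by (simp add: algebra_simps)
   thus ?thesis using L by (simp add: dist_norm abs_mult del: of_real_mult of_real_diff)
  qed
  finally have "ennreal (dist (g x) (g y)) <= ennreal (dist (h x) (h y)) + ennreal (dist (complex_of_real (L * x)) (of_real (L * y)))"
   by (subst ennreal_plus[symmetric]) (rule zero_le_dist ennreal_leI | assumption)+
  moreover have "polygon_length g xs <= polygon_length h xs + polygon_length (\<lambda>t. of_real (L * t)) xs" using C.IH C.prems by simp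
  ultimately have "ennreal (dist (g x) (g y)) + polygon_length g xs <=
   (ennreal (dist (h x) (h y)) + ennreal (dist (complex_of_real (L * x)) (of_real (L * y))))
    + (polygon_length h xs + polygon_length (\<lambda>t. of_real (L * t)) xs)" by (rule add_mono)
  thus ?thesis unfolding Cons polygon_length.simps by (simp only: ac_simps)
 qed auto
qed auto

text \<open>Adding a function with Lipschitz constant \<open>L\<close> changes the length by at most \<open>L\<close> times that of the parameter interval.\<close>

lemma curve_length_perturb:
 assumes I: "I \<subseteq> {a..b}" "a <= b" and le: "!!x y. x \<in> I ==> y \<in> I ==> dist (g x) (g y) <= dist (h x) (h y) + L * \<bar>x - y\<bar>" and L: "L \<ge> 0"
 shows "curve_length I g <= curve_length I h + ennreal (L * (b - a))"
proof (rule curve_length_leI)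
 fix xs assume xs: "sorted xs" "set xs \<subseteq> I"
 have "polygon_length g xs <= polygon_length h xs + polygon_length (\<lambda>t. of_real (L * t)) xs"
  by (rule polygon_length_perturb[OF xs(1) _ L]) (use le xs(2) in blast)
 also have "... <= curve_length I h + curve_length I (\<lambda>t. of_real (L * t))" by (intro add_mono polygon_length_le xs)
 also have "curve_length I (\<lambda>t. of_real (L * t)) <= ennreal (L * (b - a))"
 proof (rule curve_length_Lipschitz[OF I(1) _ L I(2)])
  fix u v :: real assume "u <= v"
  have "complex_of_real (L * u) - of_real (L * v) = of_real (L * (u - v))" by (simp add: algebra_simps)
  thus "dist (complex_of_real (L * u)) (of_real (L * v)) <= L * (v - u)" using L \<open>u <= v\<close> by (simp add: dist_norm abs_mult del: of_real_mult of_real_diff)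
 qed
 finally show "polygon_length g xs <= curve_length I h + ennreal (L * (b - a))" by (simp add: add_left_mono)
qed

text \<open>Cauchy's estimate for the derivative.\<close>

lemma Lipschitz_on_smaller_disk:
 fixes x y :: complex
 assumes hol: "d holomorphic_on ball 0 R" and B: "!!z. z \<in> ball 0 R ==> norm (d z) <= B" and r: "r < R"
  and xy: "x \<in> cball 0 r" "y \<in> cball 0 r"
 shows "dist (d x) (d y) <= 2 * B / (R - r) * dist x y"
proof -
 define \<delta> where "\<delta> = (R - r) / 2"
 have \<delta>: "\<delta> > 0" using r by (simp add: \<delta>_def)
 have r0: "r \<ge> 0" using xy(1) norm_ge_zero[of x] unfolding mem_cball_0 by linarith
 have sub: "cball z \<delta> \<subseteq> ball 0 R" if "z \<in> cball 0 r" for z :: complex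
 proof
  fix w assume "w \<in> cball z \<delta>"
  hence "norm w <= norm z + \<delta>" using norm_triangle_sub[of w z] by (simp add: dist_norm norm_minus_commute)
  moreover have "norm z <= r" using that by simp
  ultimately show "w \<in> ball 0 R" using r by (simp add: \<delta>_def field_simps)
 qed
 have "norm (d x - d y) <= B / \<delta> * norm (x - y)"
 proof (rule field_differentiable_bound[OF convex_cball])
  fix z :: complex assume z: "z \<in> cball 0 r"
  hence "z \<in> ball 0 R" using r by auto
  thus "(d has_field_derivative deriv d z) (at z within cball 0 r)" using holomorphic_derivI[OF hol open_ball] has_field_derivative_at_within by blast
  have "norm ((deriv ^^ 1) d z) <= fact 1 * B / \<delta> ^ 1"
  proof (rule Cauchy_inequality[OF _ _ \<delta>])
   show "d holomorphic_on ball z \<delta>" using hol sub[OF z] ball_subset_cball[of z \<delta>] by (blast intro: holomorphic_on_subset)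
   show "continuous_on (cball z \<delta>) d" using holomorphic_on_imp_continuous_on[OF hol] sub[OF z] by (rule continuous_on_subset)
   show "norm (d w) <= B" if "norm (z - w) = \<delta>" for w using B[of w] sub[OF z] that by (auto simp: dist_norm)
  qed
  thus "norm (deriv d z) <= B / \<delta>" by simp
 qed (use xy in auto)
 thus ?thesis by (simp add: \<delta>_def dist_norm mult.commute)
qed

lemma ennreal_le_mult_epsilon:
 fixes A S x :: ennreal
 assumes S: "S > 0" and le: "!!e::real. e > 0 ==> x <= A * (S + ennreal e)"
 shows "x <= A * S"
proof (cases "A = top")
 case True thus ?thesis using S by (simp add: ennreal_top_mult)
next
 case False
 then obtain c where c: "c \<ge> 0" "A = ennreal c" by (cases A) auto
 show ?thesis
 proof (rule ennreal_le_epsilon)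
  fix e :: real assume e: "0 < e"
  have "x <= A * (S + ennreal (e / (c + 1)))" using e c by (intro le) (auto simp: add_nonneg_pos)
  also have "... = A * S + ennreal (c * (e / (c + 1)))" using c e by (simp only: distrib_left) (simp add: ennreal_mult[symmetric])
  also have "... <= A * S + ennreal e"
  proof (intro add_left_mono ennreal_leI)
   have "c * (e / (c + 1)) = e * (c / (c + 1))" by simp
   also have "... <= e * 1" using c e by (intro mult_left_mono) auto
   finally show "c * (e / (c + 1)) <= e" by simp
  qed
  finally show "x <= A * S + ennreal e" .
 qed
qed

text \<open>Lengths of the diameter are lower semicontinuous, while the lengths of the semicircle are assumed to converge from above.\<close>

lemma diameter_image_length_le_limit:
 assumes lim: "!!z. norm z < 1 ==> Re z = 0 ==> ((\<lambda>n. F n z) \<longlongrightarrow> h z) (at_top :: nat filter)"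
  and le: "!!n. diameter_image_length (F n) <= A * semicircle_image_length (F n)"
  and S: "!!e. e > 0 ==> eventually (\<lambda>n. semicircle_image_length (F n) <= S + ennreal e) at_top" "S > 0"
 shows "diameter_image_length h <= A * S"
proof (rule ennreal_le_mult_epsilon[OF S(2)])
 fix e :: real assume e: "e > 0"
 show "diameter_image_length h <= A * (S + ennreal e)" unfolding diameter_image_length_def
 proof (rule curve_length_lower_semicontinuous[where G = "\<lambda>n v. F n (imag v)" and F = at_top])
  show "eventually (\<lambda>n. curve_length {-1<..<1} (\<lambda>v. F n (imag v)) <= A * (S + ennreal e)) at_top" using S(1)[OF e]
  proof eventually_elim
   case (elim n)
   thus ?case using le[of n] mult_left_mono[OF elim, of A] by (simp add: diameter_image_length_def)
  qed
 qed (use lim in \<open>auto simp: norm_mult\<close>)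
qed

definition shrink :: "real => complex => complex" where "shrink \<kappa> z = of_real (1 - \<kappa>) + of_real \<kappa> * z"

lemma shrink_affine: "shrink \<kappa> x - shrink \<kappa> y = of_real \<kappa> * (x - y)" by (simp add: shrink_def algebra_simps)

lemma norm_shrink_lt: assumes "0 < \<kappa>" "\<kappa> <= 1" "norm z < 1" shows "norm (shrink \<kappa> z) < 1"
proof -
 have "norm (shrink \<kappa> z) <= (1 - \<kappa>) + \<kappa> * norm z"
  unfolding shrink_def using assms by (intro norm_triangle_le) (simp add: norm_mult del: of_real_diff)
 also have "... < (1 - \<kappa>) + \<kappa> * 1" using assms by (intro add_strict_left_mono mult_strict_left_mono) auto
 finally show ?thesis by simp
qed

text \<open>The bound is the value at \<open>\<plusminus> \<i>\<close>.\<close>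

lemma norm_shrink_left:
 assumes "0 < \<kappa>" "\<kappa> < 1" "norm z <= 1" "Re z <= 0" shows "norm (shrink \<kappa> z) <= sqrt ((1-\<kappa>)\<^sup>2 + \<kappa>\<^sup>2)"
proof (rule real_le_rsqrt)
 have "(norm (shrink \<kappa> z))\<^sup>2 = (1-\<kappa>)\<^sup>2 + \<kappa>\<^sup>2 * (norm z)\<^sup>2 + 2 * (\<kappa> * (1 - \<kappa>)) * Re z"
  unfolding shrink_def cmod_power2 by (simp add: power2_eq_square algebra_simps)
 also have "... <= (1-\<kappa>)\<^sup>2 + \<kappa>\<^sup>2 * 1 + 0" using assms by (intro add_mono mult_left_mono mult_nonneg_nonpos) (auto simp: power_le_one)
 finally show "(norm (shrink \<kappa> z))\<^sup>2 <= (1-\<kappa>)\<^sup>2 + \<kappa>\<^sup>2" by simp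
qed

lemma shrink_radius: assumes "0 < \<kappa>" "\<kappa> < 1" shows "sqrt ((1-\<kappa>)\<^sup>2 + \<kappa>\<^sup>2) < (1::real)"
proof -
 have "(1-\<kappa>)\<^sup>2 + \<kappa>\<^sup>2 = 1 - 2 * (\<kappa> * (1 - \<kappa>))" by (simp add: power2_eq_square algebra_simps)
 hence "(1-\<kappa>)\<^sup>2 + \<kappa>\<^sup>2 < 1" using assms by simp
 thus ?thesis by simp
qed

context slit_maps
begin

lemma \<Phi>_eq_iff: "norm z < 1 ==> norm w < 1 ==> \<Phi> n z = \<Phi> n w \<longleftrightarrow> z = w" using \<Phi>(3) by metis

lemma norm_pole: "norm (\<Psi> n 0) < 1" by (intro \<Psi>(2) zero_H)

lemma \<Phi>_pole: "\<Phi> n (\<Psi> n 0) = 0" by (intro \<Psi>(3) zero_H)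

lemma \<Phi>_eq_0_iff: "norm z < 1 ==> \<Phi> n z = 0 \<longleftrightarrow> z = \<Psi> n 0" using \<Phi>_eq_iff[OF _ norm_pole, of z n n] \<Phi>_pole by simp

text \<open>Read \<open>\<Phi> n\<close> in the fixed coordinate of \<open>H 0\<close>, where it is \<open>\<theta> n\<close>.\<close>

lemma \<Phi>_tendsto:
 assumes lim: "!!C. compact C ==> C \<subseteq> disk ==> uniform_limit C (\<lambda>n. \<theta> (P n)) E sequentially"
  and x: "x \<longlonglongrightarrow> y" "norm y < 1" "!!n. norm (x n) < 1"
 shows "(\<lambda>n. \<Phi> (P n) (x n)) \<longlonglongrightarrow> kt y"
proof -
 obtain \<rho> where \<rho>: "norm y < \<rho>" "\<rho> < 1" using dense[OF x(2)] by blast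
 have ul: "uniform_limit (cball 0 \<rho>) (\<lambda>n. \<theta> (P n)) E sequentially" by (rule lim) (use \<rho> in auto)
 have "eventually (\<lambda>n. norm (x n) < \<rho>) sequentially" using order_tendstoD(2)[OF tendsto_norm[OF x(1)] \<rho>(1)] .
 hence ev: "eventually (\<lambda>n. x n \<in> cball 0 \<rho>) sequentially" by eventually_elim simp
 have "isCont E y"
 proof -
  have "E holomorphic_on disk" unfolding E_g by (rule hol_g)
  thus ?thesis using x(2) by (intro continuous_on_interior[OF holomorphic_on_imp_continuous_on]) (auto simp: interior_open)
 qed
 hence "(\<lambda>n. E (x n)) \<longlonglongrightarrow> E y" using x(1) by (rule isCont_tendsto_compose)
 moreover have "(\<lambda>n. \<theta> (P n) (x n) - E (x n)) \<longlonglongrightarrow> 0"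
 proof (rule tendstoI)
  fix e :: real assume "e > 0"
  show "eventually (\<lambda>n. dist (\<theta> (P n) (x n) - E (x n)) 0 < e) sequentially"
   using uniform_limitD[OF ul \<open>e > 0\<close>] ev by eventually_elim (auto simp: dist_norm)
 qed
 ultimately have t: "(\<lambda>n. \<theta> (P n) (x n)) \<longlonglongrightarrow> E y" using tendsto_add by fastforce
 have "(\<lambda>n. \<Phi> 0 (\<theta> (P n) (x n))) \<longlonglongrightarrow> \<Phi> 0 (E y)" using norm_\<theta>[OF x(3)] norm_g[OF x(2), of 0]
  by (intro continuous_on_tendsto_compose[OF holomorphic_on_imp_continuous_on[OF \<Phi>(1)] t]) (auto simp: E_g)
 moreover have "\<Phi> 0 (\<theta> (P n) (x n)) = \<Phi> (P n) (x n)" for n unfolding \<theta>_def by (intro \<Psi>(3) \<Phi>_H0 x(3))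
 moreover have "\<Phi> 0 (E y) = kt y" unfolding E_def by (intro \<Psi>(3) kt_H x(2))
 ultimately show ?thesis by simp
qed

lemma poles_tend_to_1:
 obtains P where "!!C. compact C ==> C \<subseteq> disk ==> uniform_limit C (\<lambda>n. \<theta> (P n)) E sequentially"
  "(\<lambda>n. \<Psi> (P n) 0) \<longlonglongrightarrow> 1"
proof -
 obtain r where r: "strict_mono (r :: nat => nat)"
  "!!C. compact C ==> C \<subseteq> disk ==> uniform_limit C (\<lambda>n. \<theta> (r n)) E sequentially"
  "!!z. norm z < 1 ==> (\<lambda>n. g (r n) z) \<longlonglongrightarrow> z" using subsequence_limit by blast
 have "\<exists>l\<ge>m. Re (\<Psi> (r l) 0) \<ge> 1 - 1 / real (m + 2)" for m
 proof -
  have e: "0 < 1 / real (m + 2)" "1 / real (m + 2) < 1" by (auto simp: field_simps)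
  have "\<exists>\<^sub>F n in sequentially. \<forall>t. \<bar>t\<bar> < gap (r n) --> dist (g (r n) (cis t)) 1 < 1 / real (m + 2)" by (rule gap_near_1[OF r e(1)])
  then obtain l where l: "l \<ge> m" "!!t. \<bar>t\<bar> < gap (r l) ==> dist (g (r l) (cis t)) 1 < 1 / real (m + 2)" unfolding frequently_sequentially by blast
  show ?thesis using pole_near_1[OF e l(2)] l(1) by blast
 qed
 then obtain l where l: "!!m. l m \<ge> m" "!!m. Re (\<Psi> (r (l m)) 0) \<ge> 1 - 1 / real (m + 2)" by metis
 have lt: "filterlim l at_top sequentially" by (rule filterlim_at_top_mono[OF filterlim_ident]) (use l(1) in auto)
 show thesis
 proof (rule that[of "\<lambda>n. r (l n)"])
  show "uniform_limit C (\<lambda>n. \<theta> (r (l n))) E sequentially" if "compact C" "C \<subseteq> disk" for C by (rule filterlim_compose[OF r(2)[OF that] lt])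
  have Re1: "(\<lambda>n. Re (\<Psi> (r (l n)) 0)) \<longlonglongrightarrow> 1"
  proof (rule tendsto_sandwich[of "\<lambda>n. 1 - 1 / real (n + 2)" _ _ "\<lambda>_. 1"])
   show "(\<lambda>n. 1 - 1 / real (n + 2)) \<longlonglongrightarrow> 1" by real_asymp
   show "eventually (\<lambda>n. Re (\<Psi> (r (l n)) 0) <= 1) sequentially"
    using norm_pole complex_Re_le_cmod order_trans less_imp_le by (intro always_eventually allI) blast
  qed (use l(2) in auto)
  have sq: "(norm (\<Psi> m 0 - 1))\<^sup>2 <= 2 * (1 - Re (\<Psi> m 0))" for m
  proof -
   have "(norm (\<Psi> m 0 - 1))\<^sup>2 = (norm (\<Psi> m 0))\<^sup>2 + 1 - 2 * Re (\<Psi> m 0)" unfolding cmod_power2 by (simp add: power2_eq_square algebra_simps)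
   moreover have "(norm (\<Psi> m 0))\<^sup>2 <= 1" using norm_pole[of m] by (simp add: power_le_one)
   ultimately show ?thesis by simp
  qed
  have "(\<lambda>n. sqrt (2 * (1 - Re (\<Psi> (r (l n)) 0)))) \<longlonglongrightarrow> sqrt (2 * (1 - 1))" by (intro tendsto_intros Re1)
  hence "(\<lambda>n. sqrt (2 * (1 - Re (\<Psi> (r (l n)) 0)))) \<longlonglongrightarrow> 0" by simp
  hence "(\<lambda>n. \<Psi> (r (l n)) 0 - 1) \<longlonglongrightarrow> 0" by (rule Lim_null_comparison[rotated]) (intro always_eventually allI real_le_rsqrt sq)
  thus "(\<lambda>n. \<Psi> (r (l n)) 0) \<longlonglongrightarrow> 1" by (rule LIM_zero_cancel)
 qed
qed

text \<open>The factor \<open>sgn (q n)\<close> turns the preimage of infinity to the positive axis; \<open>p n\<close> is where \<open>shrink\<close> takes the value \<open>norm (q n)\<close>.\<close>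

lemma slit_map_M_class:
 fixes \<kappa> :: real
 defines "q n \<equiv> \<Psi> n 0"
 defines "p n \<equiv> (norm (q n) - (1 - \<kappa>)) / \<kappa>"
 defines "f n \<equiv> (\<lambda>z. if z = of_real (p n) then 0 else w0 + 1 / \<Phi> n (sgn (q n) * shrink \<kappa> z))"
 assumes \<kappa>: "0 < \<kappa>" "\<kappa> < 1" and p0: "0 <= p n" and q0: "q n \<noteq> 0"
 shows "p n < 1" "f n \<in> M_class (p n)" "semicircle_image_length (f n) > 0"
proof -
 have q1: "norm (q n) < 1" unfolding q_def by (rule norm_pole)
 show p1: "p n < 1" using q1 \<kappa> by (simp add: p_def field_simps)
 define m where "m z = sgn (q n) * shrink \<kappa> z" for z
 have sg: "norm (sgn (q n)) = 1" using q0 by (simp add: norm_sgn)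
 have shp: "shrink \<kappa> (of_real (p n)) = of_real (norm (q n))" unfolding shrink_def p_def using \<kappa> by (simp add: field_simps)
 have mp: "m (of_real (p n)) = q n" unfolding m_def shp using q0 by (simp add: sgn_div_norm scaleR_conv_of_real)
 have m_iff: "m x = m y \<longleftrightarrow> x = y" for x y
 proof -
  have "m x - m y = sgn (q n) * (of_real \<kappa> * (x - y))" unfolding m_def by (simp add: shrink_affine flip: right_diff_distrib)
  thus ?thesis using q0 \<kappa> by (metis eq_iff_diff_eq_0 mult_eq_0_iff of_real_eq_0_iff order_less_irrefl sgn_zero_iff)
 qed
 have mD: "norm (m z) < 1" if "z \<in> disk \<union> left_semicircle" for z
 proof (cases "norm z < 1")
  case True thus ?thesis using norm_shrink_lt[of \<kappa> z] \<kappa> by (simp add: m_def norm_mult sg)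
 next
  case False
  hence "norm z <= 1" "Re z <= 0" using that by (auto simp: left_semicircle_def)
  hence "norm (shrink \<kappa> z) < 1" using norm_shrink_left[OF \<kappa>] shrink_radius[OF \<kappa>] by (meson le_less_trans)
  thus ?thesis by (simp add: m_def norm_mult sg)
 qed
 have mhol: "m holomorphic_on S" for S unfolding m_def shrink_def by (intro holomorphic_intros)
 have mcont: "continuous_on S m" for S by (rule holomorphic_on_imp_continuous_on[OF mhol])
 have nz: "\<Phi> n (m z) \<noteq> 0" if "z \<in> disk \<union> left_semicircle" "z \<noteq> of_real (p n)" for z
  using \<Phi>_eq_0_iff[OF mD[OF that(1)], of n] m_iff[of z "of_real (p n)"] mp that(2) by (simp add: q_def)
 have \<Phi>m: "(\<lambda>z. \<Phi> n (m z)) holomorphic_on disk"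
 proof -
  have "\<Phi> n \<circ> m holomorphic_on disk" by (rule holomorphic_on_compose_gen[OF mhol \<Phi>(1)]) (use mD in auto)
  thus ?thesis by (simp add: o_def)
 qed
 have \<Phi>mc: "continuous_on (disk \<union> left_semicircle) (\<lambda>z. \<Phi> n (m z))"
  by (rule continuous_on_compose2[OF holomorphic_on_imp_continuous_on[OF \<Phi>(1)] mcont]) (use mD in auto)
 have feq: "f n z = w0 + 1 / \<Phi> n (m z)" if "z \<noteq> of_real (p n)" for z using that by (simp add: f_def m_def)
 have inj: "inj_on (f n) (disk \<union> left_semicircle - {of_real (p n)})"
 proof (rule inj_onI)
  fix x y assume x: "x \<in> disk \<union> left_semicircle - {of_real (p n)}" and y: "y \<in> disk \<union> left_semicircle - {of_real (p n)}" and eq: "f n x = f n y"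
  have "w0 + 1 / \<Phi> n (m x) = w0 + 1 / \<Phi> n (m y)" using eq feq[of x] feq[of y] x y by simp
  hence "\<Phi> n (m x) = \<Phi> n (m y)" by simp
  hence "m x = m y" using \<Phi>_eq_iff[OF mD mD] x y by blast
  thus "x = y" by (simp add: m_iff)
 qed
 show "f n \<in> M_class (p n)"
 proof (rule M_classI[OF p0 p1])
  show "f n holomorphic_on disk - {of_real (p n)}"
  proof (rule holomorphic_transform[of "\<lambda>z. w0 + 1 / \<Phi> n (m z)"])
   have "(\<lambda>z. \<Phi> n (m z)) holomorphic_on disk - {of_real (p n)}" by (rule holomorphic_on_subset[OF \<Phi>m]) auto
   thus "(\<lambda>z. w0 + 1 / \<Phi> n (m z)) holomorphic_on disk - {of_real (p n)}"
    by (intro holomorphic_on_add holomorphic_on_divide holomorphic_on_const) (use nz in auto)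
  qed (use feq in auto)
  show "inj_on (f n) (disk - {of_real (p n)})" by (rule inj_on_subset[OF inj]) auto
  show "f n (of_real (p n)) = 0" by (simp add: f_def)
  show "continuous_on (disk \<union> left_semicircle - {of_real (p n)}) (f n)"
  proof (rule continuous_on_eq[of _ "\<lambda>z. w0 + 1 / \<Phi> n (m z)"])
   have "continuous_on (disk \<union> left_semicircle - {of_real (p n)}) (\<lambda>z. \<Phi> n (m z))" by (rule continuous_on_subset[OF \<Phi>mc]) auto
   thus "continuous_on (disk \<union> left_semicircle - {of_real (p n)}) (\<lambda>z. w0 + 1 / \<Phi> n (m z))"
    by (intro continuous_on_add continuous_on_divide continuous_on_const) (use nz in auto)
  qed (use feq in auto)
  have pB: "complex_of_real (p n) \<in> disk" using p0 p1 by simp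
  have near: "eventually (\<lambda>z. z \<in> disk \<and> z \<noteq> of_real (p n)) (at (complex_of_real (p n)))"
   using eventually_at_in_open[OF open_ball pB] by (rule eventually_mono) auto
  have "((\<lambda>z. \<Phi> n (m z)) \<longlongrightarrow> \<Phi> n (m (of_real (p n)))) (at (of_real (p n)))"
   using holomorphic_on_imp_continuous_on[OF \<Phi>m] pB by (simp add: continuous_on_eq_continuous_at isCont_def)
  hence "((\<lambda>z. \<Phi> n (m z)) \<longlongrightarrow> 0) (at (of_real (p n)))" by (simp add: mp \<Phi>_pole q_def)
  moreover have "eventually (\<lambda>z. \<Phi> n (m z) \<noteq> 0) (at (of_real (p n)))" using near by (rule eventually_mono) (use nz in blast)
  ultimately have "filterlim (\<lambda>z. \<Phi> n (m z)) (at 0) (at (of_real (p n)))" by (rule filterlim_atI)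
  hence "filterlim (\<lambda>z. inverse (\<Phi> n (m z))) at_infinity (at (of_real (p n)))" by (rule filterlim_compose[OF filterlim_inverse_at_infinity])
  hence "filterlim (\<lambda>z. w0 + inverse (\<Phi> n (m z))) at_infinity (at (of_real (p n)))" by (rule tendsto_add_filterlim_at_infinity[OF tendsto_const])
  moreover have "eventually (\<lambda>z. w0 + inverse (\<Phi> n (m z)) = f n z) (at (of_real (p n)))" using near by eventually_elim (simp add: feq divide_inverse)
  ultimately have "filterlim (f n) at_infinity (at (complex_of_real (p n)))" by (rule filterlim_cong[OF refl refl, THEN iffD1, rotated])
  thus "is_pole (f n) (of_real (p n))" by (simp only: is_pole_def)
 qed
 show "semicircle_image_length (f n) > 0" by (intro semicircle_image_length_pos_inj inj_on_subset[OF inj]) (use p0 in \<open>auto simp: left_semicircle_def\<close>)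
qed

text \<open>The functions of the preceding lemma converge to \<open>k \<circ> shrink \<kappa>\<close>, together with their derivatives near the left semicircle, and their poles tend to \<open>1\<close>.\<close>

lemma diameter_shrink_le:
 assumes \<kappa>: "0 < \<kappa>" "\<kappa> < 1" and \<tau>: "\<tau> < 1"
 shows "diameter_image_length (k \<circ> shrink \<kappa>) <= GH_pole_const_sup \<tau> * semicircle_image_length (k \<circ> shrink \<kappa>)"
proof -
 obtain P where ul: "!!C. compact C ==> C \<subseteq> disk ==> uniform_limit C (\<lambda>n. \<theta> (P n)) E sequentially"
  and pole: "(\<lambda>n. \<Psi> (P n) 0) \<longlonglongrightarrow> 1" using poles_tend_to_1 by blast
 define q where "q n = \<Psi> (P n) 0" for n
 define p where "p n = (norm (q n) - (1 - \<kappa>)) / \<kappa>" for n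
 define f where "f n = (\<lambda>z. if z = of_real (p n) then 0 else w0 + 1 / \<Phi> (P n) (sgn (q n) * shrink \<kappa> z))" for n
 have q: "q \<longlonglongrightarrow> 1" using pole by (simp add: q_def[abs_def])
 hence nq: "(\<lambda>n. norm (q n)) \<longlonglongrightarrow> 1" using tendsto_norm[of q 1] by simp
 have sq: "(\<lambda>n. sgn (q n)) \<longlonglongrightarrow> 1" using tendsto_sgn[OF q] by simp
 have "p \<longlonglongrightarrow> (1 - (1 - \<kappa>)) / \<kappa>" unfolding p_def by (intro tendsto_intros nq) (use \<kappa> in auto)
 hence p1: "p \<longlonglongrightarrow> 1" using \<kappa> by simp
 define \<rho> where "\<rho> = sqrt ((1-\<kappa>)\<^sup>2 + \<kappa>\<^sup>2)"
 have \<rho>0: "\<rho> \<ge> 0" by (simp add: \<rho>_def)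
 have "\<rho> < 1" unfolding \<rho>_def by (rule shrink_radius[OF \<kappa>])
 then obtain \<rho>1 where \<rho>1: "\<rho> < \<rho>1" "\<rho>1 < 1" using dense by blast
 have ev: "eventually (\<lambda>n. p n > max 0 \<tau> \<and> norm (q n) > \<rho>1) sequentially"
  using order_tendstoD(1)[OF p1, of "max 0 \<tau>"] order_tendstoD(1)[OF nq, of \<rho>1] \<tau> \<rho>1 by (intro eventually_conj) auto
 then obtain n0 where n0: "!!n. n \<ge> n0 ==> p n > max 0 \<tau> \<and> norm (q n) > \<rho>1" unfolding eventually_sequentially by blast
 have qne: "q n \<noteq> 0" if "n \<ge> n0" for n using n0[OF that] \<rho>0 \<rho>1 by auto
 define F where "F n = f (n + n0)" for n
 have F: "F n \<in> M_class (p (n + n0))" "p (n + n0) < 1" "semicircle_image_length (F n) > 0" for n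
 proof -
  have a: "0 <= (norm (\<Psi> (P (n + n0)) 0) - (1 - \<kappa>)) / \<kappa>" using n0[of "n+n0"] unfolding p_def q_def by simp
  have b: "\<Psi> (P (n + n0)) 0 \<noteq> 0" using qne[of "n+n0"] by (simp add: q_def)
  show "F n \<in> M_class (p (n + n0))" "p (n + n0) < 1" "semicircle_image_length (F n) > 0"
   unfolding F_def f_def p_def q_def by (rule slit_map_M_class[OF \<kappa> a b])+
 qed
 have seq: "(\<lambda>n. w0 + 1 / \<Phi> (P (r n)) (sgn (q (r n)) * y n)) \<longlonglongrightarrow> k x"
  if r: "filterlim r at_top sequentially" and y: "y \<longlonglongrightarrow> x" "norm x < 1" "!!n. norm (y n) < 1" for r y x
 proof -
  have "(\<lambda>n. \<Phi> (P (r n)) (sgn (q (r n)) * y n)) \<longlonglongrightarrow> kt x"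
  proof (rule \<Phi>_tendsto[of "\<lambda>n. P (r n)"])
   show "uniform_limit C (\<lambda>n. \<theta> (P (r n))) E sequentially" if "compact C" "C \<subseteq> disk" for C by (rule filterlim_compose[OF ul[OF that] r])
   show "(\<lambda>n. sgn (q (r n)) * y n) \<longlonglongrightarrow> x" using tendsto_mult[OF filterlim_compose[OF sq r] y(1)] by simp
   show "norm (sgn (q (r n)) * y n) < 1" for n using y(3)[of n] by (simp add: norm_mult norm_sgn)
  qed (rule y)
  moreover have "kt x \<noteq> 0" using y(2) by (intro kt_nz) auto
  ultimately have "(\<lambda>n. w0 + 1 / \<Phi> (P (r n)) (sgn (q (r n)) * y n)) \<longlonglongrightarrow> w0 + 1 / kt x" by (intro tendsto_intros)
  thus ?thesis by (simp add: k_kt)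
 qed
 have near_k: "eventually (\<lambda>n. \<forall>y\<in>cball 0 \<rho>1. dist (w0 + 1 / \<Phi> (P n) (sgn (q n) * y)) (k y) < e) sequentially" if e: "e > 0" for e
 proof (rule ccontr)
  assume no: "\<not> ?thesis"
  obtain r where r: "strict_mono (r :: nat => nat)"
   "!!n. \<exists>y\<in>cball 0 \<rho>1. \<not> dist (w0 + 1 / \<Phi> (P (r n)) (sgn (q (r n)) * y)) (k y) < e" using not_eventually_sequentiallyD[OF no] by metis
  then obtain y where y: "!!n. y n \<in> cball 0 \<rho>1" "!!n. \<not> dist (w0 + 1 / \<Phi> (P (r n)) (sgn (q (r n)) * y n)) (k (y n)) < e" by metis
  obtain x l where x: "x \<in> cball 0 \<rho>1" "strict_mono (l :: nat => nat)" "(y \<circ> l) \<longlonglongrightarrow> x"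
   using compact_cball[of 0 \<rho>1] y(1) unfolding compact_def by meson
  have yl: "(\<lambda>n. y (l n)) \<longlonglongrightarrow> x" using x(3) by (simp add: o_def)
  have x1: "norm x < 1" using x(1) \<rho>1 by simp
  have y1: "norm (y n) < 1" for n using y(1)[of n] \<rho>1 by simp
  have "filterlim (\<lambda>n. r (l n)) at_top sequentially" using filterlim_subseq[OF strict_mono_o[OF r(1) x(2)]] by (simp add: o_def)
  from seq[OF this yl x1 y1] have A: "(\<lambda>n. w0 + 1 / \<Phi> (P (r (l n))) (sgn (q (r (l n))) * y (l n))) \<longlonglongrightarrow> k x" .
  have "(\<lambda>n. k (y (l n))) \<longlonglongrightarrow> k x"
   by (rule continuous_on_tendsto_compose[OF cont_k yl]) (use x1 y1 in \<open>auto simp: less_imp_le\<close>)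
  from tendsto_dist[OF A this] have "(\<lambda>n. dist (w0 + 1 / \<Phi> (P (r (l n))) (sgn (q (r (l n))) * y (l n))) (k (y (l n)))) \<longlonglongrightarrow> 0" by simp
  from order_tendstoD(2)[OF this e] have "eventually (\<lambda>n. False) sequentially" by eventually_elim (use y(2) in auto)
  thus False by simp
 qed
 have hol: "(\<lambda>y. (w0 + 1 / \<Phi> (P n) (sgn (q n) * y)) - k y) holomorphic_on ball 0 \<rho>1" if n: "n \<ge> n0" for n
 proof -
  have sg: "norm (sgn (q n)) = 1" using qne[OF n] by (simp add: norm_sgn)
  have m1: "norm (sgn (q n) * y) < 1" if "y \<in> ball 0 \<rho>1" for y using that \<rho>1 by (simp add: norm_mult sg)
  have "(\<lambda>y. sgn (q n) * y) holomorphic_on ball 0 \<rho>1" by (intro holomorphic_intros)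
  hence "\<Phi> (P n) \<circ> (\<lambda>y. sgn (q n) * y) holomorphic_on ball 0 \<rho>1" by (rule holomorphic_on_compose_gen[OF _ \<Phi>(1)]) (use m1 in auto)
  hence 1: "(\<lambda>y. \<Phi> (P n) (sgn (q n) * y)) holomorphic_on ball 0 \<rho>1" by (simp add: o_def)
  have nz: "\<Phi> (P n) (sgn (q n) * y) \<noteq> 0" if "y \<in> ball 0 \<rho>1" for y
  proof
   assume "\<Phi> (P n) (sgn (q n) * y) = 0"
   hence "sgn (q n) * y = q n" using \<Phi>_eq_0_iff[OF m1[OF that]] by (simp add: q_def)
   hence "norm y = norm (q n)" using sg by (metis mult_1 norm_mult)
   thus False using n0[OF n] that by simp
  qed
  have 2: "k holomorphic_on ball 0 \<rho>1" by (rule holomorphic_on_subset[OF hol_k]) (use \<rho>1 in auto)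
  show ?thesis by (intro holomorphic_on_diff holomorphic_on_add holomorphic_on_divide holomorphic_on_const 1 2 nz)
 qed
 have shl: "shrink \<kappa> (cis t) \<in> cball 0 \<rho>" if "t \<in> {pi/2<..<3*pi/2}" for t
 proof -
  have "cis t \<in> left_semicircle" unfolding left_semicircle_eq using that by blast
  hence "norm (shrink \<kappa> (cis t)) <= \<rho>" unfolding \<rho>_def by (intro norm_shrink_left[OF \<kappa>]) (auto simp: left_semicircle_def)
  thus ?thesis by simp
 qed
 have S: "eventually (\<lambda>n. semicircle_image_length (F n) <= semicircle_image_length (k \<circ> shrink \<kappa>) + ennreal e) sequentially" if e: "e > 0" for e
 proof -
  define d where "d = e * (\<rho>1 - \<rho>) / (2 * pi)"
  have d: "d > 0" using e \<rho>1 by (simp add: d_def)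
  have L: "2 * d / (\<rho>1 - \<rho>) = e / pi" using \<rho>1 by (simp add: d_def)
  have "eventually (\<lambda>n. \<forall>y\<in>cball 0 \<rho>1. dist (w0 + 1 / \<Phi> (P (n + n0)) (sgn (q (n + n0)) * y)) (k y) < d) sequentially"
   using near_k[OF d] by (rule sequentially_offset)
  thus ?thesis
  proof eventually_elim
   case (elim n)
   define D where "D y = (w0 + 1 / \<Phi> (P (n+n0)) (sgn (q (n+n0)) * y)) - k y" for y
   have D: "dist (D x) (D y) <= e / pi * dist x y" if "x \<in> cball 0 \<rho>" "y \<in> cball 0 \<rho>" for x y
   proof -
    have hD: "D holomorphic_on ball 0 \<rho>1" unfolding D_def by (rule hol) simp
    have bD: "norm (D z) <= d" if "z \<in> ball 0 \<rho>1" for z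
    proof -
     have "z \<in> cball 0 \<rho>1" using that by simp
     thus ?thesis using elim by (auto simp: D_def dist_norm less_imp_le)
    qed
    show ?thesis using Lipschitz_on_smaller_disk[OF hD bD \<rho>1(1) that] by (simp add: L)
   qed
   have "curve_length {pi/2<..<3*pi/2} (\<lambda>t. F n (cis t)) <=
    curve_length {pi/2<..<3*pi/2} (\<lambda>t. (k \<circ> shrink \<kappa>) (cis t)) + ennreal (e / pi * (3*pi/2 - pi/2))"
   proof (rule curve_length_perturb)
    fix s t :: real assume st: "s \<in> {pi/2<..<3*pi/2}" "t \<in> {pi/2<..<3*pi/2}"
    have Feq: "F n (cis t) = k (shrink \<kappa> (cis t)) + D (shrink \<kappa> (cis t))" if "t \<in> {pi/2<..<3*pi/2}" for t
    proof -
     have "cis t \<in> left_semicircle" unfolding left_semicircle_eq using that by blast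
     hence "Re (cis t) < 0" by (simp add: left_semicircle_def)
     moreover have "Re (of_real (p (n + n0))) > 0" using n0[of "n+n0"] by simp
     ultimately have "cis t \<noteq> of_real (p (n + n0))" by (metis less_asym)
     thus ?thesis by (simp add: F_def f_def D_def)
    qed
    have "dist (F n (cis s)) (F n (cis t)) <= dist (k (shrink \<kappa> (cis s))) (k (shrink \<kappa> (cis t))) + dist (D (shrink \<kappa> (cis s))) (D (shrink \<kappa> (cis t)))"
     unfolding Feq[OF st(1)] Feq[OF st(2)] by (rule dist_triangle_add)
    also have "dist (D (shrink \<kappa> (cis s))) (D (shrink \<kappa> (cis t))) <= e / pi * dist (shrink \<kappa> (cis s)) (shrink \<kappa> (cis t))" by (intro D shl st)
    also have "dist (shrink \<kappa> (cis s)) (shrink \<kappa> (cis t)) = \<kappa> * dist (cis s) (cis t)" using \<kappa> by (simp add: dist_norm shrink_affine norm_mult)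
    also have "... <= 1 * \<bar>s - t\<bar>" using \<kappa> by (intro mult_mono dist_cis_le) auto
    finally show "dist (F n (cis s)) (F n (cis t)) <= dist ((k \<circ> shrink \<kappa>) (cis s)) ((k \<circ> shrink \<kappa>) (cis t)) + e / pi * \<bar>s - t\<bar>"
     using e by (simp add: mult_left_mono divide_right_mono)
   qed (use e pi_gt_zero in auto)
   thus ?case by (simp add: semicircle_image_length_def)
  qed
 qed
 show ?thesis
 proof (rule diameter_image_length_le_limit[where F = F])
  show "diameter_image_length (F n) <= GH_pole_const_sup \<tau> * semicircle_image_length (F n)" for n
   using F[of n] n0[of "n + n0"] by (intro diameter_le_GH_pole_const_sup[of "F n" "p (n + n0)"]) auto
  show "eventually (\<lambda>n. semicircle_image_length (F n) <= semicircle_image_length (k \<circ> shrink \<kappa>) + ennreal e) sequentially" if "e > 0" for e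
   by (rule S[OF that])
  show "semicircle_image_length (k \<circ> shrink \<kappa>) > 0"
  proof (intro semicircle_image_length_pos_inj inj_onI)
   fix x y assume xy: "x \<in> left_semicircle" "y \<in> left_semicircle" "(k \<circ> shrink \<kappa>) x = (k \<circ> shrink \<kappa>) y"
   have "norm (shrink \<kappa> z) <= 1" if "z \<in> left_semicircle" for z
   proof -
    have "norm (shrink \<kappa> z) <= \<rho>" unfolding \<rho>_def using that by (intro norm_shrink_left[OF \<kappa>]) (auto simp: left_semicircle_def)
    thus ?thesis using \<rho>1 by simp
   qed
   hence "shrink \<kappa> x = shrink \<kappa> y" using xy k_eq_iff by simp
   thus "x = y" using shrink_affine[of \<kappa> x y] \<kappa> by simp
  qed
  fix z :: complex assume z: "norm z < 1" "Re z = 0"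
  have s1: "norm (shrink \<kappa> z) < 1" using \<kappa> z by (intro norm_shrink_lt) auto
  have "(\<lambda>n. w0 + 1 / \<Phi> (P (n + n0)) (sgn (q (n + n0)) * shrink \<kappa> z)) \<longlonglongrightarrow> k (shrink \<kappa> z)"
   using s1 by (intro seq filterlim_add_const_nat_at_top tendsto_const)
  moreover have "F n z = w0 + 1 / \<Phi> (P (n + n0)) (sgn (q (n + n0)) * shrink \<kappa> z)" for n
  proof -
   have "z \<noteq> of_real (p (n + n0))" using n0[of "n+n0"] z(2) by auto
   thus ?thesis by (simp add: F_def f_def)
  qed
  ultimately show "(\<lambda>n. F n z) \<longlonglongrightarrow> (k \<circ> shrink \<kappa>) z" by simp
 qed
qed

end

theorem (in slit_domain) diameter_shrink_le_pole_const:
 assumes "0 < \<kappa>" "\<kappa> < 1" "\<tau> < 1"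
 shows "diameter_image_length (k \<circ> shrink \<kappa>) <= GH_pole_const_sup \<tau> * semicircle_image_length (k \<circ> shrink \<kappa>)"
proof -
 define R where "R n \<Phi> \<Psi> a \<longleftrightarrow> \<Phi> holomorphic_on disk \<and> (\<forall>z\<in>disk. \<Phi> z \<in> H n \<and> \<Psi> (\<Phi> z) = z) \<and>
  \<Psi> holomorphic_on H n \<and> (\<forall>w\<in>H n. \<Psi> w \<in> disk \<and> \<Phi> (\<Psi> w) = w) \<and> \<Psi> (kt 0) = 0 \<and>
  deriv (\<lambda>z. \<Psi> (kt z)) 0 = of_real a \<and> (a::real) > 0" for n \<Phi> \<Psi> a
 have "\<forall>n. \<exists>\<Phi> \<Psi> a. R n \<Phi> \<Psi> a" unfolding R_def using riemann_map_H by blast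
 then obtain \<Phi> \<Psi> a where "!!n. R n (\<Phi> n) (\<Psi> n) (a n)" by metis
 note * = this[unfolded R_def]
 interpret slit_maps k \<Phi> \<Psi> a
 proof unfold_locales
  fix n show "\<Phi> n holomorphic_on disk" "\<Psi> n holomorphic_on H n" "\<Psi> n (kt 0) = 0"
   "deriv (\<lambda>z. \<Psi> n (kt z)) 0 = of_real (a n)" "a n > 0" using *[of n] by blast+
  fix z :: complex assume "norm z < 1"
  hence "z \<in> disk" by simp
  thus "\<Phi> n z \<in> H n" "\<Psi> n (\<Phi> n z) = z" using *[of n] by blast+
 next
  fix n w assume "w \<in> H n"
  hence "\<Psi> n w \<in> disk" "\<Phi> n (\<Psi> n w) = w" using *[of n] by blast+
  thus "norm (\<Psi> n w) < 1" "\<Phi> n (\<Psi> n w) = w" by simp_all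
 qed
 show ?thesis using assms by (rule diameter_shrink_le)
qed

text \<open>The inverse of the contraction enlarges the disk only slightly, so it can be absorbed into \<open>h\<close>.\<close>

theorem diameter_le_pole_const_univalent_beyond:
 assumes hol: "h holomorphic_on ball 0 R" and R: "R > 1" and inj: "inj_on h (ball 0 R)" and \<tau>: "\<tau> < 1"
 shows "diameter_image_length h <= GH_pole_const_sup \<tau> * semicircle_image_length h"
proof -
 obtain \<kappa> where "2 / (R + 1) < \<kappa>" "\<kappa> < 1" using dense[of "2 / (R + 1)" 1] R by auto
 note k = this
 have "2 / (R + 1) > 0" using R by simp
 hence \<kappa>: "0 < \<kappa>" "\<kappa> < 1" using k by linarith+
 have \<kappa>R: "2 < \<kappa> * (R + 1)" using k(1) R by (simp add: pos_divide_less_eq)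
 define b where "b w = (w - of_real (1 - \<kappa>)) / of_real \<kappa>" for w :: complex
 have bR: "b w \<in> ball 0 R" if "w \<in> cball 0 1" for w
 proof -
  have "norm (w - of_real (1 - \<kappa>)) <= 1 + (1 - \<kappa>)" using norm_triangle_ineq4[of w "of_real (1 - \<kappa>)"] that \<kappa> unfolding norm_of_real by simp
  also have "... < \<kappa> * R" using \<kappa>R by (simp add: algebra_simps)
  finally show ?thesis using \<kappa>(1) by (simp add: b_def norm_divide divide_less_eq mult.commute del: of_real_diff)
 qed
 have bhol: "b holomorphic_on X" for X unfolding b_def using \<kappa>(1) by (intro holomorphic_intros) auto
 have hb: "h \<circ> b holomorphic_on disk" by (rule holomorphic_on_compose_gen[OF bhol hol]) (use bR in auto)
 interpret slit_domain "h \<circ> b"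
 proof unfold_locales
  show "continuous_on (cball 0 1) (h \<circ> b)" by (intro continuous_on_compose holomorphic_on_imp_continuous_on[OF bhol]
    continuous_on_subset[OF holomorphic_on_imp_continuous_on[OF hol]]) (use bR in auto)
  have "inj_on b (cball 0 1)" using \<kappa>(1) by (auto simp: inj_on_def b_def)
  thus "inj_on (h \<circ> b) (cball 0 1)" by (intro comp_inj_on inj_on_subset[OF inj]) (use bR in auto)
 qed (rule hb)
 have "(h \<circ> b) \<circ> shrink \<kappa> = h" using \<kappa>(1) by (simp add: fun_eq_iff b_def shrink_def)
 thus ?thesis using diameter_shrink_le_pole_const[OF \<kappa>(1,2) \<tau>] by simp
qed

section \<open>Boundary values of bounded variation\<close>

lemma curve_length_rotate:
 "curve_length {-pi/2..3*pi/2} (\<lambda>t. h (cis (\<theta> + t))) <= curve_length {-pi/2..3*pi/2} (\<lambda>t. h (cis t))" if "0 <= \<theta>" "\<theta> <= 2 * pi" for h :: "complex => complex"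
proof -
 define m where "m = 3*pi/2 - \<theta>"
 have m: "-pi/2 <= m" "m <= 3*pi/2" using that by (auto simp: m_def)
 have "curve_length {-pi/2..3*pi/2} (\<lambda>t. h (cis (\<theta> + t))) =
   curve_length {-pi/2..m} (\<lambda>t. h (cis (\<theta> + t))) + curve_length {m..3*pi/2} (\<lambda>t. h (cis (\<theta> + t)))"
  by (rule curve_length_interval_split[OF m])
 also have "curve_length {-pi/2..m} (\<lambda>t. h (cis (\<theta> + t))) <= curve_length {\<theta> - pi/2..3*pi/2} (\<lambda>t. h (cis t))"
  using curve_length_compose_mono[of "{-pi/2..m}" "\<lambda>t. \<theta> + t" "{\<theta> - pi/2..3*pi/2}" "\<lambda>t. h (cis t)"]
  by (auto simp: o_def monotone_on_def m_def)
 also have "curve_length {m..3*pi/2} (\<lambda>t. h (cis (\<theta> + t))) <= curve_length {-pi/2..\<theta> - pi/2} (\<lambda>t. h (cis t))"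
 proof -
  have "cis (\<theta> + t) = cis (\<theta> + t - 2 * pi)" for t by (simp add: cis_divide[symmetric])
  hence "curve_length {m..3*pi/2} (\<lambda>t. h (cis (\<theta> + t))) = curve_length {m..3*pi/2} ((\<lambda>t. h (cis t)) \<circ> (\<lambda>t. \<theta> + t - 2 * pi))"
   by (simp add: o_def)
  also have "... <= curve_length {-pi/2..\<theta> - pi/2} (\<lambda>t. h (cis t))" by (rule curve_length_compose_mono) (auto simp: monotone_on_def m_def)
  finally show ?thesis .
 qed
 also have "curve_length {\<theta> - pi/2..3*pi/2} (\<lambda>t. h (cis t)) + curve_length {-pi/2..\<theta> - pi/2} (\<lambda>t. h (cis t)) = curve_length {-pi/2..3*pi/2} (\<lambda>t. h (cis t))"
  using that by (subst (3) curve_length_interval_split[of _ "\<theta> - pi/2"]) (auto simp: add.commute)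
 finally show ?thesis by (simp add: add_mono)
qed

text \<open>The length of a polygon inscribed in the image of a circle of radius \<open>r\<close> is a value \<open>Q r\<close> of a holomorphic function: multiply the differences by constants of modulus \<open>1\<close> that make them positive at \<open>r\<close>.
 By the maximum principle it is at most the modulus of \<open>Q\<close> at some point of the unit circle.\<close>

lemma curve_length_smaller_circle:
 assumes cont: "continuous_on (cball 0 1) h" and hol: "h holomorphic_on disk" and r: "0 <= r" "r < 1"
 shows "curve_length {-pi/2..3*pi/2} (\<lambda>t. h (of_real r * cis t)) <= curve_length {-pi/2..3*pi/2} (\<lambda>t. h (cis t))"
  (is "_ <= ?V")
proof (cases "?V = top")
 case False
 then obtain V where V: "?V = ennreal V" "V \<ge> 0" by (cases ?V) auto
 show ?thesis
 proof (rule curve_length_leI)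
  fix xs assume xs: "sorted xs" "set xs \<subseteq> {-pi/2..3*pi/2}"
  define n where "n = length xs - 1"
  define \<delta> where "\<delta> i z = h (z * cis (xs ! Suc i)) - h (z * cis (xs ! i))" for i z
  define c where "c i = cnj (sgn (\<delta> i (of_real r)))" for i
  define Q where "Q z = (\<Sum>i<n. c i * \<delta> i z)" for z
  have c1: "norm (c i) <= 1" for i by (simp add: c_def norm_sgn)
  have "c i * \<delta> i (of_real r) = of_real (norm (\<delta> i (of_real r)))" for i
  proof -
   have "c i * \<delta> i (of_real r) = of_real (inverse (norm (\<delta> i (of_real r)))) * (\<delta> i (of_real r) * cnj (\<delta> i (of_real r)))"
    by (simp add: c_def sgn_div_norm scaleR_conv_of_real mult_ac del: of_real_inverse)
   also have "... = of_real (inverse (norm (\<delta> i (of_real r))) * (norm (\<delta> i (of_real r)))\<^sup>2)" by (simp only: complex_norm_square of_real_mult)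
   finally show ?thesis by (cases "\<delta> i (of_real r) = 0") (simp_all add: power2_eq_square)
  qed
  hence Qr: "Q (of_real r) = of_real (\<Sum>i<n. norm (\<delta> i (of_real r)))" by (simp add: Q_def)
  have hc: "continuous_on (cball 0 1) (\<lambda>z. h (z * cis a))" for a by (rule continuous_on_compose2[OF cont]) (auto intro!: continuous_intros simp: norm_mult)
  have hh: "(\<lambda>z. h (z * cis a)) holomorphic_on disk" for a
  proof -
   have "(\<lambda>z. z * cis a) holomorphic_on disk" by (intro holomorphic_intros)
   hence "h \<circ> (\<lambda>z. z * cis a) holomorphic_on disk" by (rule holomorphic_on_compose_gen[OF _ hol]) (auto simp: norm_mult)
   thus ?thesis by (simp add: o_def)
  qed
  have "norm (Q (of_real r)) <= V"
  proof (rule maximum_modulus_frontier[of Q "disk"])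
   show "Q holomorphic_on interior disk" unfolding Q_def[abs_def] \<delta>_def interior_open[OF open_ball]
    by (intro holomorphic_on_sum holomorphic_on_mult holomorphic_on_const holomorphic_on_diff hh)
   show "continuous_on (closure disk) Q" unfolding Q_def[abs_def] \<delta>_def closure_ball[OF zero_less_one]
    by (intro continuous_on_sum continuous_on_mult continuous_on_const continuous_on_diff hc)
   fix z :: complex assume "z \<in> frontier disk"
   hence "norm z = 1" by (simp add: frontier_ball)
   then obtain \<theta> where \<theta>: "0 <= \<theta>" "\<theta> < 2 * pi" "z = cis \<theta>"
    using complex_unimodular_polar[of z] by (metis cis.code complex_eq_iff cis.simps complex.sel)
   have "norm (Q z) <= (\<Sum>i<n. norm (\<delta> i z))" unfolding Q_def using c1 by (intro sum_norm_le) (simp add: norm_mult mult_left_le_one_le)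
   also have "(\<Sum>i<n. norm (\<delta> i z)) <= V"
   proof -
   have "ennreal (\<Sum>i<n. norm (\<delta> i z)) = polygon_length (\<lambda>t. h (cis (\<theta> + t))) xs"
    unfolding polygon_length_sum n_def[symmetric] by (subst sum_ennreal[symmetric])
     (auto simp: \<delta>_def \<theta>(3) cis_mult dist_norm norm_minus_commute)
   also have "... <= curve_length {-pi/2..3*pi/2} (\<lambda>t. h (cis (\<theta> + t)))" by (rule polygon_length_le[OF xs])
   also have "... <= ennreal V" unfolding V(1)[symmetric] using \<theta> by (intro curve_length_rotate) auto
   finally show ?thesis using V(2) by (simp add: ennreal_le_iff)
   qed
   finally show "norm (Q z) <= V" .
  qed (use r in auto)
  hence "(\<Sum>i<n. norm (\<delta> i (of_real r))) <= V" unfolding Qr norm_of_real by linarith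
  moreover have "polygon_length (\<lambda>t. h (of_real r * cis t)) xs = ennreal (\<Sum>i<n. norm (\<delta> i (of_real r)))"
   unfolding polygon_length_sum n_def[symmetric] by (subst sum_ennreal[symmetric])
     (auto simp: \<delta>_def dist_norm norm_minus_commute)
  ultimately show "polygon_length (\<lambda>t. h (of_real r * cis t)) xs <= ?V" unfolding V(1) by (simp add: ennreal_leI)
 qed
qed simp

lemma curve_length_eventually_gt:
 assumes "!!t. t \<in> I ==> ((\<lambda>n. G n t) \<longlongrightarrow> g t) F" and L: "L < curve_length I g"
 shows "eventually (\<lambda>n. L < curve_length I (G n)) F"
proof -
 obtain xs where xs: "sorted xs" "set xs \<subseteq> I" "L < polygon_length g xs" using L unfolding curve_length_eq less_SUP_iff by blast
 have "((\<lambda>n. polygon_length (G n) xs) \<longlongrightarrow> polygon_length g xs) F" by (rule tendsto_polygon_length) (use assms(1) xs(2) in blast)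
 from order_tendstoD(1)[OF this xs(3)] show ?thesis by eventually_elim (use polygon_length_le[OF xs(1,2)] less_le_trans in blast)
qed

text \<open>The whole circle of radius \<open>r\<close> has an image no longer than the boundary curve, while in the limit \<open>r \<rightarrow> 1\<close> the right half of the image does not become shorter.
 Hence the left half does not become longer.\<close>

theorem diameter_le_pole_const_univalent:
 assumes cont: "continuous_on (cball 0 1) h" and inj: "inj_on h (cball 0 1)" and hol: "h holomorphic_on disk"
  and fin: "curve_length {-pi/2..3*pi/2} (\<lambda>t. h (cis t)) < top" and \<tau>: "\<tau> < 1"
 shows "diameter_image_length h <= GH_pole_const_sup \<tau> * semicircle_image_length h"
proof -
 define r where "r n = 1 - 1 / real (n + 2)" for n
 have r: "0 < r n" "r n < 1" for n by (auto simp: r_def field_simps)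
 have r1: "r \<longlonglongrightarrow> 1" unfolding r_def by real_asymp
 define hr where "hr n = (\<lambda>z. h (of_real (r n) * z))" for n
 have lim: "(\<lambda>n. hr n z) \<longlonglongrightarrow> h z" if z: "norm z <= 1" for z unfolding hr_def
 proof (rule continuous_on_tendsto_compose[OF cont])
  show "(\<lambda>n. of_real (r n) * z) \<longlonglongrightarrow> z" using tendsto_mult[OF tendsto_of_real[OF r1] tendsto_const[of z]] by simp
  show "eventually (\<lambda>n. of_real (r n) * z \<in> cball 0 1) sequentially" using z r by (intro always_eventually allI) (simp add: norm_mult mult_le_one less_imp_le)
 qed (use z in simp)
 have len: "semicircle_image_length u = curve_length {pi/2..3*pi/2} (\<lambda>t. u (cis t))" if "continuous_on (cball 0 1) u" for u unfolding semicircle_image_length_def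
  by (rule curve_length_open_interval) (auto intro!: continuous_on_compose2[OF that] continuous_intros simp: pi_gt_zero)
 have hrc: "continuous_on (cball 0 1) (hr n)" for n unfolding hr_def by (rule continuous_on_compose2[OF cont])
   (use r in \<open>auto intro!: continuous_intros simp: norm_mult mult_le_one less_imp_le\<close>)
 have inj_l: "inj_on h left_semicircle" by (rule inj_on_subset[OF inj]) (auto simp: left_semicircle_def)
 show ?thesis
 proof (rule diameter_image_length_le_limit[where F = hr])
  show "semicircle_image_length h > 0" by (rule semicircle_image_length_pos_inj[OF inj_l])
  show "(\<lambda>n. hr n z) \<longlonglongrightarrow> h z" if "norm z < 1" for z using lim[of z] that by simp
  show "diameter_image_length (hr n) <= GH_pole_const_sup \<tau> * semicircle_image_length (hr n)" for n
  proof (rule diameter_le_pole_const_univalent_beyond[OF _ _ _ \<tau>])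
   show "1 < 1 / r n" using r[of n] by simp
   have b: "norm (of_real (r n) * z) < 1" if "z \<in> ball 0 (1 / r n)" for z :: complex using that r[of n] by (simp add: norm_mult field_simps)
   have "(\<lambda>z. of_real (r n) * z) holomorphic_on ball 0 (1 / r n)" by (intro holomorphic_intros)
   hence "h \<circ> (\<lambda>z. of_real (r n) * z) holomorphic_on ball 0 (1 / r n)" by (rule holomorphic_on_compose_gen[OF _ hol]) (use b in auto)
   thus "hr n holomorphic_on ball 0 (1 / r n)" by (simp add: hr_def o_def)
   show "inj_on (hr n) (ball 0 (1 / r n))"
   proof (rule inj_onI)
    fix x y assume xy: "x \<in> ball 0 (1 / r n)" "y \<in> ball 0 (1 / r n)" "hr n x = hr n y"
    have "of_real (r n) * x = of_real (r n) * y" by (rule inj_onD[OF inj]) (use b[OF xy(1)] b[OF xy(2)] xy(3) in \<open>auto simp: hr_def less_imp_le\<close>)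
    thus "x = y" using r[of n] by simp
   qed
  qed
  fix e :: real assume e: "e > 0"
  define a where "a u = curve_length {pi/2..3*pi/2} (\<lambda>t. u (cis t))" for u :: "complex => complex"
  define b where "b u = curve_length {-pi/2..pi/2} (\<lambda>t. u (cis t))" for u :: "complex => complex"
  have ab: "curve_length {-pi/2..3*pi/2} (\<lambda>t. u (cis t)) = b u + a u" for u :: "complex => complex"
   unfolding a_def b_def by (rule curve_length_interval_split) (use pi_gt_zero in auto)
  have le: "b (hr n) + a (hr n) <= b h + a h" for n using curve_length_smaller_circle[OF cont hol, of "r n"] r[of n] unfolding ab[symmetric] by (simp add: hr_def)
  have fb: "b h < top" and fab: "b h + a h < top" using fin unfolding ab by (auto simp: ennreal_add_less_top)
  have ev: "eventually (\<lambda>n. b h <= b (hr n) + ennreal e) sequentially"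
  proof (cases "b h = 0")
   case False
   hence "b h - ennreal e < b h" using e fb by (intro ennreal_between) (auto simp: zero_less_iff_neq_zero)
   hence "eventually (\<lambda>n. b h - ennreal e < b (hr n)) sequentially" unfolding b_def
    by (intro curve_length_eventually_gt[of _ "\<lambda>n t. hr n (cis t)" "\<lambda>t. h (cis t)"] lim) auto
   thus ?thesis
   proof eventually_elim
    case (elim n)
    hence "b h - ennreal e <= b (hr n)" by simp
    thus ?case by (simp add: ennreal_minus_le_iff add.commute)
   qed
  qed simp
  show "eventually (\<lambda>n. semicircle_image_length (hr n) <= semicircle_image_length h + ennreal e) sequentially" using ev
  proof eventually_elim
   case (elim n)
   have "b (hr n) \<noteq> \<infinity>" using order_le_less_trans[OF le fab, of n] by (auto simp: ennreal_add_less_top)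
   moreover have "b (hr n) + a (hr n) <= b (hr n) + (a h + ennreal e)" using order_trans[OF le[of n] add_right_mono[OF elim, of "a h"]] by (simp add: ac_simps)
   ultimately have "a (hr n) <= a h + ennreal e" by (simp add: ennreal_add_left_cancel_le)
   thus ?case by (simp add: len[OF cont] len[OF hrc] a_def)
  qed
 qed
qed

section \<open>Crosscuts whose domain does not contain the pole\<close>

text \<open>The mean value inequality, with the continuity of the derivative.\<close>

lemma holomorphic_strict_derivative:
 assumes hol: "F holomorphic_on U" and U: "open U" "x \<in> U" and e: "e > 0"
 obtains r where "r > 0" "!!a b. a \<in> ball x r ==> b \<in> ball x r ==> norm (F a - F b - deriv F x * (a - b)) <= e * norm (a - b)"
proof -
 have "deriv F holomorphic_on U" by (rule holomorphic_deriv[OF hol U(1)])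
 hence "isCont (deriv F) x" using U by (auto dest!: holomorphic_on_imp_continuous_on simp: continuous_on_eq_continuous_at)
 then obtain r1 where r1: "r1 > 0" "!!z. dist z x < r1 ==> dist (deriv F z) (deriv F x) < e" using e unfolding continuous_at_eps_delta by blast
 obtain r2 where r2: "r2 > 0" "ball x r2 \<subseteq> U" using U openE by blast
 define r where "r = min r1 r2"
 show thesis
 proof (rule that[of r])
  show "r > 0" using r1 r2 by (simp add: r_def)
  fix a b assume ab: "a \<in> ball x r" "b \<in> ball x r"
  define D where "D z = F z - deriv F x * z" for z
  have "norm (D a - D b) <= e * norm (a - b)"
  proof (rule field_differentiable_bound[OF convex_ball _ _ ab])
   fix z assume z: "z \<in> ball x r"
   have "z \<in> U" using z r2 by (auto simp: r_def)
   hence "(F has_field_derivative deriv F z) (at z)" by (rule holomorphic_derivI[OF hol U(1)])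
   hence "(D has_field_derivative (deriv F z - deriv F x)) (at z)" unfolding D_def[abs_def] by (auto intro!: derivative_eq_intros)
   thus "(D has_field_derivative (deriv F z - deriv F x)) (at z within ball x r)" by (rule has_field_derivative_at_within)
   show "norm (deriv F z - deriv F x) <= e" using r1(2)[of z] z by (auto simp: dist_norm r_def norm_minus_commute less_imp_le)
  qed
  thus "norm (F a - F b - deriv F x * (a - b)) <= e * norm (a - b)" by (simp add: D_def algebra_simps)
 qed
qed

lemma compact_pairs_limit:
 fixes X :: "complex set"
 assumes X: "compact X" and xy: "!!n. x n \<in> X" "!!n. y n \<in> X"
 obtains l a b where "strict_mono (l :: nat => nat)" "a \<in> X" "b \<in> X" "(\<lambda>n. x (l n)) \<longlonglongrightarrow> a" "(\<lambda>n. y (l n)) \<longlonglongrightarrow> b"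
proof -
 have "!!n. (x n, y n) \<in> X \<times> X" using xy by auto
 then obtain p l where p: "p \<in> X \<times> X" "strict_mono (l :: nat => nat)" "((\<lambda>n. (x n, y n)) \<circ> l) \<longlonglongrightarrow> p"
  using compact_Times[OF X X] unfolding compact_def by meson
 have "(\<lambda>n. x (l n)) \<longlonglongrightarrow> fst p" "(\<lambda>n. y (l n)) \<longlonglongrightarrow> snd p"
  using tendsto_fst[OF p(3)] tendsto_snd[OF p(3)] by (simp_all add: o_def)
 thus thesis using p that by (metis mem_Times_iff)
qed

text \<open>By compactness; the local bound deals with pairs that come together, injectivity of \<open>Q\<close> with the others.\<close>

lemma dist_ratio_bounded:
 fixes P Q :: "complex => complex"
 assumes X: "compact X" and cont: "continuous_on X P" "continuous_on X Q" and inj: "inj_on Q X"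
  and loc: "!!a. a \<in> X ==> \<exists>r>0. \<exists>L. \<forall>u\<in>X \<inter> ball a r. \<forall>v\<in>X \<inter> ball a r. dist (P u) (P v) <= L * dist (Q u) (Q v)"
 shows "\<exists>L\<ge>0. \<forall>x\<in>X. \<forall>y\<in>X. dist (P x) (P y) <= L * dist (Q x) (Q y)"
proof (rule ccontr)
 assume no: "\<not> ?thesis"
 have "\<exists>x y. x \<in> X \<and> y \<in> X \<and> dist (P x) (P y) > real (n+1) * dist (Q x) (Q y)" for n using no by (metis not_le of_nat_0_le_iff)
 then obtain x y where xy: "!!n. x n \<in> X" "!!n. y n \<in> X" "!!n. dist (P (x n)) (P (y n)) > real (n+1) * dist (Q (x n)) (Q (y n))" by metis
 obtain l a b where l: "strict_mono (l :: nat => nat)" "a \<in> X" "b \<in> X" "(\<lambda>n. x (l n)) \<longlonglongrightarrow> a" "(\<lambda>n. y (l n)) \<longlonglongrightarrow> b"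
  by (rule compact_pairs_limit[OF X xy(1,2)])
 have lim: "(\<lambda>n. dist (H (x (l n))) (H (y (l n)))) \<longlonglongrightarrow> dist (H a) (H b)" if "continuous_on X H" for H :: "complex => complex"
  by (intro tendsto_dist continuous_on_tendsto_compose[OF that] l always_eventually allI xy)
 have lt: "filterlim (\<lambda>n. real (l n + 1)) at_top sequentially"
 proof (rule filterlim_at_top_mono[OF filterlim_real_sequentially])
  show "eventually (\<lambda>n. real n <= real (l n + 1)) sequentially"
  proof (intro always_eventually allI)
   fix n have "real n <= real (l n)" using seq_suble[OF l(1), of n] by simp
   thus "real n <= real (l n + 1)" by simp
  qed
 qed
 have "(\<lambda>n. dist (P (x (l n))) (P (y (l n))) / real (l n + 1)) \<longlonglongrightarrow> 0" by (rule real_tendsto_divide_at_top[OF lim[OF cont(1)] lt])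
 hence "(\<lambda>n. dist (Q (x (l n))) (Q (y (l n)))) \<longlonglongrightarrow> 0"
 proof (rule tendsto_sandwich[OF _ _ tendsto_const, rotated 2])
  show "eventually (\<lambda>n. dist (Q (x (l n))) (Q (y (l n))) <= dist (P (x (l n))) (P (y (l n))) / real (l n + 1)) sequentially"
  proof (intro always_eventually allI)
   fix n show "dist (Q (x (l n))) (Q (y (l n))) <= dist (P (x (l n))) (P (y (l n))) / real (l n + 1)" using xy(3)[of "l n"] by (simp add: pos_le_divide_eq mult.commute)
  qed
 qed auto
 hence "dist (Q a) (Q b) = 0" by (rule LIMSEQ_unique[OF lim[OF cont(2)]])
 hence "Q a = Q b" by simp
 hence ab: "a = b" using inj l by (meson inj_onD)
 obtain r L where r: "r > 0" "!!u v. u \<in> X \<inter> ball a r ==> v \<in> X \<inter> ball a r ==> dist (P u) (P v) <= L * dist (Q u) (Q v)" using loc[OF l(2)] by metis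
 have "eventually (\<lambda>n. x (l n) \<in> X \<inter> ball a r \<and> y (l n) \<in> X \<inter> ball a r) sequentially"
  using tendstoD[OF l(4) r(1)] tendstoD[OF l(5) r(1)] unfolding ab by eventually_elim (use xy in \<open>auto simp: dist_commute\<close>)
 moreover have "eventually (\<lambda>n. real (l n + 1) > L) sequentially" using lt unfolding filterlim_at_top_dense by blast
 ultimately have "eventually (\<lambda>n::nat. False) sequentially"
 proof eventually_elim
  case (elim n)
  hence "dist (P (x (l n))) (P (y (l n))) <= L * dist (Q (x (l n))) (Q (y (l n)))" by (intro r(2)) auto
  also have "... <= real (l n + 1) * dist (Q (x (l n))) (Q (y (l n)))" using elim by (intro mult_right_mono) auto
  finally show False using xy(3)[of "l n"] by simp
 qed
 thus False by simp
qed

lemma univalent_locally_bi_Lipschitz: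
 assumes hol: "F holomorphic_on U" and inj: "inj_on F U" and U: "open U" "a \<in> U"
 obtains r M m where "r > 0" "M \<ge> 0" "\<forall>u\<in>ball a r. \<forall>v\<in>ball a r. dist u v <= m * dist (F u) (F v) \<and> dist (F u) (F v) <= M * dist u v"
proof -
 define d where "d = norm (deriv F a)"
 have d: "d > 0" using holomorphic_injective_imp_regular[OF hol U(1) inj U(2)] by (simp add: d_def)
 obtain r where r: "r > 0" "!!u v. u \<in> ball a r ==> v \<in> ball a r ==> norm (F u - F v - deriv F a * (u - v)) <= d / 2 * norm (u - v)"
  using holomorphic_strict_derivative[OF hol U, of "d / 2"] d by auto
 show thesis
 proof (rule that[OF r(1), of "2 * d" "2 / d"], goal_cases)
  case 2
  show ?case
  proof (intro ballI)
  fix u v assume uv: "u \<in> ball a r" "v \<in> ball a r"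
  have n: "norm (deriv F a * (u - v)) = d * norm (u - v)" by (simp add: norm_mult d_def)
  have "d * norm (u - v) <= norm (F u - F v) + norm (F u - F v - deriv F a * (u - v))" unfolding n[symmetric] by (metis norm_minus_commute norm_triangle_sub)
  hence "d * norm (u - v) <= norm (F u - F v) + d / 2 * norm (u - v)" using r(2)[OF uv] by linarith
  hence 1: "dist u v <= 2 / d * dist (F u) (F v)" using d by (simp add: dist_norm field_simps)
  have "norm (F u - F v) <= d * norm (u - v) + norm (F u - F v - deriv F a * (u - v))" unfolding n[symmetric] by (rule norm_triangle_sub)
  hence "norm (F u - F v) <= d * norm (u - v) + d / 2 * norm (u - v)" using r(2)[OF uv] by linarith
  also have "... <= 2 * d * norm (u - v)" using d by (simp add: mult_right_mono)
  finally have "dist (F u) (F v) <= 2 * d * dist u v" by (simp add: dist_norm)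
  thus "dist u v <= 2 / d * dist (F u) (F v) \<and> dist (F u) (F v) <= 2 * d * dist u v" using 1 by blast
  qed
 qed (use d in simp)
qed

lemma ennreal_le_factor_epsilon:
 fixes x y :: ennreal
 assumes le: "!!e::real. e > 0 ==> x <= ennreal (1 + e) * y"
 shows "x <= y"
proof (cases "y = top")
 case False
 show ?thesis
 proof (cases "y = 0")
  case True thus ?thesis using le[of 1] by simp
 next
  case y0: False
  have "x <= y * 1"
  proof (rule ennreal_le_mult_epsilon)
   fix e :: real assume "e > 0"
   from le[OF this] show "x <= y * (1 + ennreal e)" using \<open>e > 0\<close> by (simp add: mult.commute)
  qed simp
  thus ?thesis by simp
 qed
qed simp

context axis_crosscut
begin

text \<open>If the image of \<open>c\<close> is rectifiable, so is that of its mirror image, because \<open>F\<close> is locally bi-Lipschitz. So the bound for the closed disk applies to \<open>F \<circ> \<phi>\<close>.\<close>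

theorem outer_bound:
 assumes F: "F holomorphic_on U" "inj_on F U" "open U" "G \<union> K \<subseteq> U" and \<tau>: "\<tau> < 1"
 shows "axis_length F u v <= GH_pole_const_sup \<tau> * curve_length {0..1} (F \<circ> c)"
proof (cases "curve_length {0..1} (F \<circ> c) = top")
 case True
 have "GH_pole_const_sup \<tau> \<noteq> 0" using GH_pole_const_sup_ge_1[OF \<tau>] by auto
 thus ?thesis using True by (simp add: ennreal_mult_top)
next
 case fin: False
 obtain \<phi> \<phi>' where \<phi>: "homeomorphism (cball 0 1) (G \<union> K) \<phi> \<phi>'" "\<phi> holomorphic_on disk" "\<phi> ` disk = G" "\<phi> ` sphere 0 1 = K"
  "\<phi> ` left_semicircle = c ` {0<..<1}" "!!z. z \<in> disk ==> \<phi> z \<in> seg \<longleftrightarrow> Re z = 0"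
  "!!z. z \<in> disk ==> Re z < 0 ==> \<phi> z \<in> inside (path_image c \<union> closed_segment (imag u) (imag v))" using semicircle_parametrization by blast
 have inj\<phi>: "inj_on \<phi> (cball 0 1)" by (rule inj_on_inverseI[of _ \<phi>']) (use \<phi>(1) in \<open>simp add: homeomorphism_def\<close>)
 have cont\<phi>: "continuous_on (cball 0 1) \<phi>" and im\<phi>: "\<phi> ` cball 0 1 = G \<union> K" using \<phi>(1) by (auto simp: homeomorphism_def)
 have cpt: "compact (G \<union> K)" using compact_continuous_image[OF cont\<phi> compact_cball] im\<phi> by simp
 have contF: "continuous_on (G \<union> K) F" using holomorphic_on_imp_continuous_on[OF F(1)] F(4) by (rule continuous_on_subset)
 define h where "h = F \<circ> \<phi>"
 have conth: "continuous_on (cball 0 1) h" unfolding h_def using cont\<phi> contF im\<phi> by (intro continuous_on_compose) auto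
 have contcis: "continuous_on {a..b} (\<lambda>t. h (cis t))" for a b by (rule continuous_on_compose2[OF conth]) (auto intro!: continuous_intros)
 have cU: "path_image c \<subseteq> U" and rcU: "reflect_axis ` path_image c \<subseteq> U" using F(4) by (auto simp: K_def)
 have contP: "continuous_on (path_image c) (F \<circ> reflect_axis)"
  by (intro continuous_on_compose continuous_reflect_axis continuous_on_subset[OF holomorphic_on_imp_continuous_on[OF F(1)] rcU])
 obtain L where L: "L \<ge> 0" "!!x y. x \<in> path_image c ==> y \<in> path_image c ==>
   dist ((F \<circ> reflect_axis) x) ((F \<circ> reflect_axis) y) <= L * dist (F x) (F y)"
 proof -
  have "\<exists>L\<ge>0. \<forall>x\<in>path_image c. \<forall>y\<in>path_image c. dist ((F \<circ> reflect_axis) x) ((F \<circ> reflect_axis) y) <= L * dist (F x) (F y)"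
  proof (rule dist_ratio_bounded[OF compact_arc_image[OF arc] contP])
   show "continuous_on (path_image c) F" by (rule continuous_on_subset[OF holomorphic_on_imp_continuous_on[OF F(1)] cU])
   show "inj_on F (path_image c)" by (rule inj_on_subset[OF F(2) cU])
   fix a assume a: "a \<in> path_image c"
   hence aU: "a \<in> U" "reflect_axis a \<in> U" using cU rcU by auto
   obtain r M m where r: "r > 0" "\<forall>u\<in>ball a r. \<forall>v\<in>ball a r. dist u v <= m * dist (F u) (F v) \<and> dist (F u) (F v) <= M * dist u v"
    by (rule univalent_locally_bi_Lipschitz[OF F(1-3) aU(1)])
   obtain r' M' m' where r': "r' > 0" "M' \<ge> 0" "\<forall>u\<in>ball (reflect_axis a) r'. \<forall>v\<in>ball (reflect_axis a) r'. dist u v <= m' * dist (F u) (F v) \<and> dist (F u) (F v) <= M' * dist u v"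
    by (rule univalent_locally_bi_Lipschitz[OF F(1-3) aU(2)])
   have iso: "dist (reflect_axis u) (reflect_axis v) = dist u v" for u v
   proof -
    have "reflect_axis u - reflect_axis v = - cnj (u - v)" by (simp add: reflect_axis_def)
    thus ?thesis by (simp only: dist_norm norm_minus_cancel complex_mod_cnj)
   qed
   have "dist ((F \<circ> reflect_axis) u) ((F \<circ> reflect_axis) v) <= (M' * m) * dist (F u) (F v)" if uv: "u \<in> ball a (min r r')" "v \<in> ball a (min r r')" for u v
   proof -
    have "dist (F (reflect_axis u)) (F (reflect_axis v)) <= M' * dist (reflect_axis u) (reflect_axis v)"
     using uv by (intro r'(3)[rule_format, THEN conjunct2]) (auto simp: iso)
    also have "... <= M' * (m * dist (F u) (F v))" unfolding iso using uv by (intro mult_left_mono r(2)[rule_format, THEN conjunct1] r'(2)) auto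
    finally show ?thesis by (simp add: mult.assoc)
   qed
   thus "\<exists>r>0. \<exists>L. \<forall>u\<in>path_image c \<inter> ball a r. \<forall>v\<in>path_image c \<inter> ball a r. dist ((F \<circ> reflect_axis) u) ((F \<circ> reflect_axis) v) <= L * dist (F u) (F v)"
    using r(1) r'(1) by (intro exI[of _ "min r r'"] conjI exI[of _ "M' * m"]) auto
  qed
  thus thesis using that by blast
 qed
 have "curve_length {0..1} (F \<circ> rc) <= ennreal L * curve_length {0..1} (F \<circ> c)"
  by (rule curve_length_compare) (use L in \<open>auto simp: rc_def path_image_def\<close>)
 also have "... < top" using fin by (simp add: ennreal_mult_less_top top.not_eq_extremum)
 finally have fin_rc: "curve_length {0..1} (F \<circ> rc) < top" .
 have left: "semicircle_image_length h <= curve_length {0..1} (F \<circ> c)" unfolding h_def by (rule semicircle_image_length_le_crosscut[OF \<phi>(1,3,5,6)])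
 have right: "curve_length {-pi/2<..<pi/2} (F \<circ> (\<phi> \<circ> cis)) <= curve_length {0..1} (F \<circ> rc)"
 proof -
  obtain k where k: "homeomorphism {0..1} (path_image rc) rc k" using homeomorphism_arc[OF arc_rc] by blast
  show ?thesis
  proof (rule curve_length_reparametrize[where b' = k])
   show "continuous_on {-pi/2<..<pi/2} (\<phi> \<circ> cis)" by (intro continuous_on_compose continuous_intros continuous_on_subset[OF cont\<phi>]) auto
   have "inj_on cis {-pi/2<..<pi/2}"
   proof (rule inj_onI)
    fix x y :: real assume xy: "x \<in> {-pi/2<..<pi/2}" "y \<in> {-pi/2<..<pi/2}" "cis x = cis y"
    hence "sin x = sin y" by (metis cis.sel(2))
    thus "x = y" using xy sin_inj_pi[of x y] by simp
   qed
   thus "inj_on (\<phi> \<circ> cis) {-pi/2<..<pi/2}" by (intro comp_inj_on inj_on_subset[OF inj\<phi>]) auto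
   show "(\<phi> \<circ> cis) ` {-pi/2<..<pi/2} \<subseteq> rc ` {0..1}"
   proof (rule image_subsetI)
    fix t :: real assume t: "t \<in> {-pi/2<..<pi/2}"
    hence Re: "Re (cis t) > 0" by (simp add: cos_gt_zero_pi)
    have s: "cis t \<in> sphere 0 1" by simp
    have "\<phi> (cis t) \<notin> c ` {0<..<1}"
    proof
     assume "\<phi> (cis t) \<in> c ` {0<..<1}"
     then obtain z where z: "z \<in> left_semicircle" "\<phi> z = \<phi> (cis t)" using \<phi>(5) by (metis imageE)
     have "z \<in> cball 0 1" "cis t \<in> cball 0 1" using z(1) by (auto simp: left_semicircle_def)
     hence "z = cis t" using z(2) inj_onD[OF inj\<phi>] by blast
     thus False using z(1) Re by (simp add: left_semicircle_def)
    qed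
    moreover have "\<phi> (cis t) \<in> K" using s \<phi>(4) by blast
    ultimately have "\<phi> (cis t) \<in> path_image rc" using c_image c_rc_Int unfolding K_def path_image_rc by blast
    thus "(\<phi> \<circ> cis) t \<in> rc ` {0..1}" by (simp add: path_image_def)
   qed
  qed (use k in \<open>auto simp: homeomorphism_def path_image_def is_interval_oo\<close>)
 qed
 have "curve_length {-pi/2..3*pi/2} (\<lambda>t. h (cis t)) = curve_length {-pi/2..pi/2} (\<lambda>t. h (cis t)) + curve_length {pi/2..3*pi/2} (\<lambda>t. h (cis t))"
  using pi_gt_zero by (intro curve_length_interval_split) auto
 also have "curve_length {pi/2..3*pi/2} (\<lambda>t. h (cis t)) = semicircle_image_length h"
  unfolding semicircle_image_length_def by (rule curve_length_open_interval[symmetric, OF contcis]) simp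
 also have "curve_length {-pi/2..pi/2} (\<lambda>t. h (cis t)) = curve_length {-pi/2<..<pi/2} (\<lambda>t. h (cis t))"
  by (rule curve_length_open_interval[symmetric, OF contcis]) simp
 also have "... + semicircle_image_length h < top"
  using left right fin fin_rc unfolding h_def o_def by (auto simp: ennreal_add_less_top top.not_eq_extremum intro: le_less_trans)
 finally have total: "curve_length {-pi/2..3*pi/2} (\<lambda>t. h (cis t)) < top" .
 have "axis_length F u v <= diameter_image_length h" unfolding h_def
 proof (rule axis_length_le_diameter_image_length[OF \<phi>(1,3,5,6)])
  have "imag t \<in> G \<union> K" if t: "t \<in> {min u v..max u v}" for t
  proof (cases "t = u \<or> t = v")
   case True
   hence "imag t \<in> path_image c" using ends pathstart_in_path_image[of c] pathfinish_in_path_image[of c] by auto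
   thus ?thesis by (simp add: K_def)
  next
   case False
   hence "t \<in> {min u v<..<max u v}" using t by (auto simp: min_def max_def split: if_splits)
   hence "imag t \<in> seg" by (simp add: seg_def)
   thus ?thesis using seg_subset_G by blast
  qed
  thus "continuous_on {min u v..max u v} (\<lambda>t. F (imag t))" by (intro continuous_on_compose2[OF contF] continuous_intros) blast
 qed
 also have "... <= GH_pole_const_sup \<tau> * semicircle_image_length h"
 proof (rule diameter_le_pole_const_univalent[OF conth _ _ total \<tau>])
  show "inj_on h (cball 0 1)" unfolding h_def by (intro comp_inj_on inj\<phi> inj_on_subset[OF F(2)]) (use im\<phi> F(4) in auto)
  show "h holomorphic_on disk" unfolding h_def by (rule holomorphic_on_compose_gen[OF \<phi>(2) F(1)]) (use \<phi>(3) F(4) in auto)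
 qed
 also have "... <= GH_pole_const_sup \<tau> * curve_length {0..1} (F \<circ> c)" by (intro mult_left_mono left) simp
 finally show ?thesis .
qed

end

context univalent_crosscut
begin

text \<open>Only a pole on the mirror image of \<open>c\<close> needs an argument: \<open>f\<close> is then unbounded on the closure of \<open>G\<close>.\<close>

theorem outer_pole_bound:
 assumes sG: "s \<notin> G" and \<tau>: "\<tau> < 1"
 shows "axis_length f u v <= GH_pole_const_sup \<tau> * curve_length {0..1} (f \<circ> c)"
proof (cases "s \<in> K")
 case False
 hence "G \<union> K \<subseteq> disk - {s}" using sG KD GD by blast
 thus ?thesis using outer_bound[OF hol inj _ _ \<tau>] by (simp add: open_delete)
next
 case sK: True
 have oD: "open (disk - {s})" by (simp add: open_delete)
 \<comment> \<open>Composition with \<open>w / (1 - w / f s')\<close> moves the pole to a point \<open>s'\<close> outside \<open>K\<close>; as \<open>f s'\<close> is large, it hardly changes lengths on the bounded set \<open>f ` X\<close>.\<close>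
 define X where "X = path_image c \<union> closed_segment (imag u) (imag v)"
 have X: "compact X" "X \<subseteq> disk - {s}" using cD s_c s_seg segment_D compact_arc_image[OF arc] unfolding X_def by auto
 have "bounded (f ` X)" by (intro compact_imp_bounded compact_continuous_image X(1) continuous_on_subset[OF cont_f X(2)])
 then obtain M where M: "M > 0" "!!x. x \<in> X ==> norm (f x) <= M" unfolding bounded_pos by blast
 have bound: "axis_length f u v <= ennreal (((1 + M / B) / (1 - M / B))\<^sup>2) * (GH_pole_const_sup \<tau> * curve_length {0..1} (f \<circ> c))"
  if B: "B > M" for B
 proof -
  have Bpos: "B > 0" using B M by simp
  have q: "0 < M / B" "M / B < 1" using M B by auto
  have frs: "s \<in> frontier (outside K)" using Jordan_inside_outside[OF loop(1,2)] sK unfolding loop(3) by simp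
  have "eventually (\<lambda>z. norm (f z) > B) (at s)" using pole(1) unfolding is_pole_def filterlim_at_infinity_conv_norm_at_top filterlim_at_top_dense by blast
  moreover have "eventually (\<lambda>z. z \<in> disk) (at s)" using sD by (intro eventually_at_in_open') auto
  ultimately have "eventually (\<lambda>z. norm (f z) > B \<and> z \<in> disk) (at s)" by (rule eventually_conj)
  then obtain d where d: "d > 0" "!!z. z \<noteq> s ==> dist z s < d ==> norm (f z) > B \<and> z \<in> disk" unfolding eventually_at by blast
  have "s \<in> closure (outside K)" using frs by (simp add: frontier_def)
  then obtain s' where s': "s' \<in> outside K" "dist s' s < d" using d(1) unfolding closure_approachable by blast
  have s'GK: "s' \<notin> G \<union> K" using s'(1) inside_Int_outside[of K] outside_no_overlap[of K] unfolding G_def by blast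
  hence s's: "s' \<noteq> s" using sK by blast
  define w where "w = f s'"
  have w: "norm w > B" and s'D: "s' \<in> disk - {s}" using d(2)[OF s's s'(2)] s's by (auto simp: w_def)
  have w0: "w \<noteq> 0" using w Bpos by auto
  define F where "F z = (if z = s then - w else f z / (1 - f z / w))" for z
  define U where "U = disk - {s'}"
  have oU: "open U" unfolding U_def by (simp add: open_delete)
  have nw: "f z \<noteq> w" if "z \<in> U" "z \<noteq> s" for z
  proof
   assume "f z = w"
   hence "z = s'" using inj_onD[OF inj _ _ s'D, of z] that unfolding w_def U_def by blast
   thus False using that by (simp add: U_def)
  qed
  have den: "1 - f z / w \<noteq> 0" if "z \<in> U" "z \<noteq> s" for z using nw[OF that] w0 by (simp add: field_simps)
  have holF': "F holomorphic_on U - {s}"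
  proof (rule holomorphic_transform[of "\<lambda>z. f z / (1 - f z / w)"])
   have "f holomorphic_on U - {s}" by (rule holomorphic_on_subset[OF hol]) (auto simp: U_def)
   thus "(\<lambda>z. f z / (1 - f z / w)) holomorphic_on U - {s}" by (intro holomorphic_on_divide holomorphic_on_diff holomorphic_on_const) (use den w0 in auto)
  qed (simp add: F_def)
  have contF: "continuous_on U F"
  proof -
   have "isCont F z" if z: "z \<in> U" for z
   proof (cases "z = s")
    case False
    thus ?thesis using z holomorphic_on_imp_continuous_on[OF holF'] oU by (simp add: continuous_on_eq_continuous_at open_delete)
   next
    case True
    have "((\<lambda>z. inverse (f z)) \<longlongrightarrow> 0) (at s)" using pole(1) unfolding is_pole_def by (rule tendsto_inverse_0[THEN filterlim_compose])
    hence "((\<lambda>z. 1 / (inverse (f z) - 1 / w)) \<longlongrightarrow> 1 / (0 - 1 / w)) (at s)" by (intro tendsto_intros) (use w0 in auto)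
    hence "((\<lambda>z. 1 / (inverse (f z) - 1 / w)) \<longlongrightarrow> F s) (at s)" by (simp add: F_def)
    moreover have "eventually (\<lambda>z. 1 / (inverse (f z) - 1 / w) = F z) (at s)" unfolding eventually_at
    proof (intro exI[of _ d] conjI ballI impI d(1))
     fix z assume z: "z \<noteq> s \<and> dist z s < d"
     hence "f z \<noteq> 0" using d(2)[of z] Bpos by auto
     thus "1 / (inverse (f z) - 1 / w) = F z" using z w0 by (simp add: F_def field_simps)
    qed
    ultimately have "(F \<longlongrightarrow> F s) (at s)" using Lim_transform_eventually by blast
    thus ?thesis by (simp add: True isCont_def)
   qed
   thus ?thesis by (simp add: continuous_at_imp_continuous_on)
  qed
  have holF: "F holomorphic_on U" by (rule no_isolated_singularity[OF contF holF' oU]) simp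
  have injF: "inj_on F U"
  proof (rule inj_onI)
   have ne: "F z \<noteq> - w" if "z \<in> U" "z \<noteq> s" for z
   proof
    assume "F z = - w"
    hence "f z / (1 - f z / w) = - w" using that by (simp add: F_def)
    hence "f z = - w * (1 - f z / w)" using den[OF that] by (simp add: divide_eq_eq)
    hence "w = 0" using w0 by (simp add: algebra_simps)
    thus False using w0 by simp
   qed
   fix x y assume xy: "x \<in> U" "y \<in> U" "F x = F y"
   show "x = y"
   proof (cases "x = s \<or> y = s")
    case True
    thus ?thesis using ne xy by (metis F_def)
   next
    case False
    hence xs: "x \<noteq> s" "y \<noteq> s" by auto
    have "f x / (1 - f x / w) = f y / (1 - f y / w)" using xy(3) xs by (simp add: F_def)
    hence "f x * (1 - f y / w) = f y * (1 - f x / w)" using den[OF xy(1) xs(1)] den[OF xy(2) xs(2)] by (simp add: frac_eq_eq)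
    hence "f x = f y" by (simp add: algebra_simps)
    thus ?thesis using inj_onD[OF inj, of x y] xs xy(1,2) by (auto simp: U_def)
   qed
  qed
  have GKU: "G \<union> K \<subseteq> U" using KD GD s'GK unfolding U_def by blast
  have FX: "F x = f x / (1 - f x / w)" if "x \<in> X" for x using that X(2) by (auto simp: F_def)
  have small: "norm (f x / w) <= M / B" if "x \<in> X" for x unfolding norm_divide using M that w Bpos by (intro frac_le) auto
  have lo: "norm (1 - f x / w) \<ge> 1 - M / B" if "x \<in> X" for x using norm_triangle_ineq2[of 1 "f x / w"] small[OF that] by simp
  have hi: "norm (1 - f x / w) <= 1 + M / B" if "x \<in> X" for x using norm_triangle_ineq4[of 1 "f x / w"] small[OF that] by simp
  have pos: "norm (1 - f x / w) > 0" if "x \<in> X" for x using lo[OF that] q by linarith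
  have id: "norm (f x - f y) = dist (F x) (F y) * (norm (1 - f x / w) * norm (1 - f y / w))" if "x \<in> X" "y \<in> X" for x y
  proof -
   have n: "1 - f x / w \<noteq> 0" "1 - f y / w \<noteq> 0" using pos that by auto
   have "(f x / (1 - f x / w) - f y / (1 - f y / w)) * ((1 - f x / w) * (1 - f y / w)) = f x * (1 - f y / w) - f y * (1 - f x / w)"
   proof -
    have "(p / a - q / b) * (a * b) = p * b - q * a" if "a \<noteq> 0" "b \<noteq> 0" for p q a b :: complex using that by (simp add: field_simps)
    thus ?thesis using n by blast
   qed
   also have "... = f x - f y" by (simp add: algebra_simps)
   finally show ?thesis unfolding FX[OF that(1)] FX[OF that(2)] dist_norm by (metis norm_mult)
  qed
  have "axis_length f u v <= ennreal ((1 + M / B)\<^sup>2) * axis_length F u v" unfolding axis_length_def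
  proof (rule curve_length_compare)
   fix x y assume "x \<in> {min u v..max u v}" "y \<in> {min u v..max u v}"
   hence xy: "imag x \<in> X" "imag y \<in> X" using seg_segment(2) unfolding X_def by blast+
   have "norm (1 - f (imag x) / w) * norm (1 - f (imag y) / w) <= (1 + M / B) * (1 + M / B)" using hi[OF xy(1)] hi[OF xy(2)] q by (intro mult_mono) auto
   thus "dist (f (imag x)) (f (imag y)) <= (1 + M / B)\<^sup>2 * dist (F (imag x)) (F (imag y))"
    unfolding dist_norm[of "f _"] id[OF xy] power2_eq_square by (subst mult.commute) (rule mult_right_mono, auto)
  qed simp
  also have "axis_length F u v <= GH_pole_const_sup \<tau> * curve_length {0..1} (F \<circ> c)" by (rule outer_bound[OF holF injF oU GKU \<tau>])
  also have "curve_length {0..1} (F \<circ> c) <= ennreal (1 / (1 - M / B)\<^sup>2) * curve_length {0..1} (f \<circ> c)"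
  proof (rule curve_length_compare)
   fix x y :: real assume "x \<in> {0..1}" "y \<in> {0..1}"
   hence xy: "c x \<in> X" "c y \<in> X" by (auto simp: X_def path_image_def)
   have "(1 - M / B) * (1 - M / B) <= norm (1 - f (c x) / w) * norm (1 - f (c y) / w)" using lo[OF xy(1)] lo[OF xy(2)] q by (intro mult_mono) auto
   hence "dist (F (c x)) (F (c y)) * (1 - M / B)\<^sup>2 <= dist (f (c x)) (f (c y))"
    unfolding dist_norm[of "f _"] id[OF xy] power2_eq_square by (rule mult_left_mono) auto
   thus "dist ((F \<circ> c) x) ((F \<circ> c) y) <= 1 / (1 - M / B)\<^sup>2 * dist ((f \<circ> c) x) ((f \<circ> c) y)"
   proof -
    have "(1 - M / B)\<^sup>2 > 0" by (rule zero_less_power) (use q in linarith)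
    with \<open>dist (F (c x)) (F (c y)) * (1 - M / B)\<^sup>2 <= _\<close> show ?thesis by (simp add: pos_le_divide_eq)
   qed
  qed simp
  finally have "axis_length f u v <= ennreal ((1 + M / B)\<^sup>2) * (GH_pole_const_sup \<tau> * (ennreal (1 / (1 - M / B)\<^sup>2) * curve_length {0..1} (f \<circ> c)))"
   by (simp add: mult_left_mono)
  also have "... = (ennreal ((1 + M / B)\<^sup>2) * ennreal (1 / (1 - M / B)\<^sup>2)) * (GH_pole_const_sup \<tau> * curve_length {0..1} (f \<circ> c))"
   by (simp only: ac_simps)
  also have "ennreal ((1 + M / B)\<^sup>2) * ennreal (1 / (1 - M / B)\<^sup>2) = ennreal (((1 + M / B) / (1 - M / B))\<^sup>2)"
   by (simp add: power_divide flip: ennreal_mult)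
  finally show ?thesis .
 qed
 show ?thesis
 proof (rule ennreal_le_factor_epsilon)
  fix e :: real assume e: "e > 0"
  have "((\<lambda>B. ((1 + M / B) / (1 - M / B))\<^sup>2) \<longlongrightarrow> 1) at_top" by real_asymp
  from order_tendstoD(2)[OF this, of "1 + e"] e have "eventually (\<lambda>B. ((1 + M / B) / (1 - M / B))\<^sup>2 < 1 + e) at_top" by simp
  hence "eventually (\<lambda>B. ((1 + M / B) / (1 - M / B))\<^sup>2 < 1 + e \<and> B > M) at_top" using eventually_gt_at_top by (rule eventually_conj)
  then obtain B where B: "((1 + M / B) / (1 - M / B))\<^sup>2 < 1 + e" "B > M" unfolding eventually_at_top_linorder by blast
  show "axis_length f u v <= ennreal (1 + e) * (GH_pole_const_sup \<tau> * curve_length {0..1} (f \<circ> c))"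
   by (rule order_trans[OF bound[OF B(2)] mult_right_mono]) (use B(1) in \<open>auto intro: ennreal_leI\<close>)
 qed
qed

end

section \<open>Decomposition of an arc into crosscuts\<close>

lemma axis_length_commute: "axis_length f u v = axis_length f v u" by (simp add: axis_length_def min.commute max.commute)

lemma axis_length_triangle: "axis_length f u w <= axis_length f u v + axis_length f v w"
proof -
 consider "v \<in> {min u w..max u w}" | "{min u w..max u w} \<subseteq> {min u v..max u v}" | "{min u w..max u w} \<subseteq> {min v w..max v w}"
  by (cases "v <= max u w"; cases "v \<ge> min u w"; cases "u <= w"; force simp: min_def max_def)
 thus ?thesis
 proof cases
  case 1
  have "axis_length f u w = curve_length {min u w..v} (\<lambda>t. f (imag t)) + curve_length {v..max u w} (\<lambda>t. f (imag t))"
   unfolding axis_length_def using 1 by (intro curve_length_interval_split) auto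
  also have "... = axis_length f u v + axis_length f v w" using 1 unfolding axis_length_def by (cases "u <= w") (auto simp: min_def max_def add.commute)
  finally show ?thesis by simp
 next
  case 2
  hence "axis_length f u w <= axis_length f u v" unfolding axis_length_def by (rule curve_length_mono)
  thus ?thesis by (simp add: add_increasing2)
 next
  case 3
  hence "axis_length f u w <= axis_length f v w" unfolding axis_length_def by (rule curve_length_mono)
  thus ?thesis by (simp add: add_increasing)
 qed
qed

text \<open>Near a point where the derivative does not vanish the map is a similarity up to a factor close to \<open>1\<close>; a Lebesgue number gives uniformity.\<close>

lemma axis_length_le_chord:
 assumes hol: "F holomorphic_on U" and inj: "inj_on F U" and U: "open U" "imag ` {\<alpha>..\<beta>} \<subseteq> U" and e: "e > 0"
 obtains \<delta> where "\<delta> > 0"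
  "!!u v. u \<in> {\<alpha>..\<beta>} ==> v \<in> {\<alpha>..\<beta>} ==> \<bar>u - v\<bar> < \<delta> ==> axis_length F u v <= ennreal ((1 + e) * dist (F (imag u)) (F (imag v)))"
proof -
 define X where "X = imag ` {\<alpha>..\<beta>}"
 define k where "k = e / (2 + e)"
 have k: "0 < k" "k < 1" using e by (auto simp: k_def)
 have ke: "1 + k = (1 + e) * (1 - k)" using e by (simp add: k_def field_simps)
 define P where "P x r \<longleftrightarrow> r > 0 \<and> (\<forall>a\<in>ball x r. \<forall>b\<in>ball x r. norm (F a - F b - deriv F x * (a - b)) <= k * norm (deriv F x) * norm (a - b))" for x r
 have "\<exists>r. P x r" if x: "x \<in> X" for x
 proof -
  have xU: "x \<in> U" using x U by (auto simp: X_def)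
  have "deriv F x \<noteq> 0" by (rule holomorphic_injective_imp_regular[OF hol U(1) inj xU])
  hence "k * norm (deriv F x) > 0" using k by simp
  thus ?thesis using holomorphic_strict_derivative[OF hol U(1) xU] unfolding P_def by metis
 qed
 then obtain r where r: "!!x. x \<in> X ==> P x (r x)" by metis
 have "compact X" unfolding X_def by (intro compact_continuous_image continuous_intros compact_Icc)
 moreover have "X \<subseteq> \<Union> ((\<lambda>x. ball x (r x)) ` X)" using r unfolding P_def by (intro subsetI UN_I[where B = "\<lambda>x. ball x (r x)"]) auto
 ultimately obtain \<delta> where \<delta>: "\<delta> > 0" "!!x. x \<in> X ==> \<exists>G\<in>(\<lambda>x. ball x (r x)) ` X. ball x \<delta> \<subseteq> G"
  by (rule Heine_Borel_lemma) auto
 show thesis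
 proof (rule that[OF \<delta>(1)])
  have main: "axis_length F u v <= ennreal ((1 + e) * dist (F (imag u)) (F (imag v)))"
   if uv: "u \<in> {\<alpha>..\<beta>}" "v \<in> {\<alpha>..\<beta>}" "\<bar>u - v\<bar> < \<delta>" "u <= v" for u v
  proof -
   have "imag u \<in> X" using uv(1) by (simp add: X_def)
   then obtain x where x: "x \<in> X" "ball (imag u) \<delta> \<subseteq> ball x (r x)" using \<delta>(2) by blast
   have mem: "imag t \<in> ball x (r x)" if "t \<in> {u..v}" for t
   proof -
    have "dist (imag u) (imag t) = \<bar>u - t\<bar>" by (simp add: dist_norm norm_mult flip: right_diff_distrib of_real_diff)
    hence "imag t \<in> ball (imag u) \<delta>" using that uv by simp
    thus ?thesis using x(2) by blast
   qed
   define d where "d = norm (deriv F x)"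
   have est: "norm (F (imag s) - F (imag t) - deriv F x * (imag s - imag t)) <= k * d * \<bar>s - t\<bar>"
    if "s \<in> {u..v}" "t \<in> {u..v}" for s t
   proof -
    have "norm (imag s - imag t) = \<bar>s - t\<bar>" by (simp add: norm_mult flip: right_diff_distrib of_real_diff)
    thus ?thesis using r[OF x(1)] mem[OF that(1)] mem[OF that(2)] unfolding P_def d_def by metis
   qed
   have nd: "norm (deriv F x * (imag s - imag t)) = d * \<bar>s - t\<bar>" for s t by (simp add: norm_mult d_def flip: right_diff_distrib of_real_diff)
   have up: "dist (F (imag s)) (F (imag t)) <= (1 + k) * d * \<bar>s - t\<bar>" if "s \<in> {u..v}" "t \<in> {u..v}" for s t
   proof -
    have "norm (F (imag s) - F (imag t)) <= norm (deriv F x * (imag s - imag t))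
      + norm (F (imag s) - F (imag t) - deriv F x * (imag s - imag t))" by (rule norm_triangle_sub)
    thus ?thesis using est[OF that] nd[of s t] by (simp add: dist_norm algebra_simps)
   qed
   have low: "(1 - k) * d * (v - u) <= dist (F (imag u)) (F (imag v))"
   proof -
    have uvm: "u \<in> {u..v}" "v \<in> {u..v}" using uv(4) by auto
    have "norm (deriv F x * (imag u - imag v)) <= norm (F (imag u) - F (imag v))
      + norm (F (imag u) - F (imag v) - deriv F x * (imag u - imag v))" by (metis norm_minus_commute norm_triangle_sub)
    thus ?thesis using est[OF uvm] nd[of u v] uv(4) by (simp add: dist_norm algebra_simps)
   qed
   have "axis_length F u v <= ennreal ((1 + k) * d * (v - u))" unfolding axis_length_def
   proof (rule curve_length_Lipschitz)
    show "dist (F (imag s)) (F (imag t)) <= (1 + k) * d * (t - s)"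
     if "s \<in> {min u v..max u v}" "t \<in> {min u v..max u v}" "s <= t" for s t using up[of s t] that uv(4) by (simp add: min_def max_def)
   qed (use uv k in \<open>auto simp: d_def\<close>)
   also have "(1 + k) * d * (v - u) = (1 + e) * ((1 - k) * d * (v - u))" unfolding ke by simp
   also have "... <= (1 + e) * dist (F (imag u)) (F (imag v))" using low e by (intro mult_left_mono) auto
   finally show ?thesis by (simp add: ennreal_leI order_trans)
  qed
  show "axis_length F u v <= ennreal ((1 + e) * dist (F (imag u)) (F (imag v)))"
   if "u \<in> {\<alpha>..\<beta>}" "v \<in> {\<alpha>..\<beta>}" "\<bar>u - v\<bar> < \<delta>" for u v
   using main[of u v] main[of v u] that axis_length_commute[of F u v] by (cases "u <= v") (simp_all add: dist_commute abs_minus_commute)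
 qed
qed

text \<open>From a parameter \<open>t\<close> in the set \<open>E'\<close> of axis parameters pass to the last element of \<open>E'\<close> within distance \<open>\<eta>'\<close> and from there across the next gap.
 This advances by at least \<open>\<eta>'\<close>, so finitely many steps lead to \<open>1\<close>.\<close>

theorem axis_length_le_gaps:
 fixes A :: ennreal and j :: "real => complex"
 assumes hol: "F holomorphic_on U" and inj: "inj_on F U" and U: "open U" "imag ` {\<alpha>..\<beta>} \<subseteq> U"
  and j: "continuous_on {0..1} j" and ends: "Re (j 0) = 0" "Re (j 1) = 0" and A: "A \<ge> 1"
  and E: "!!t. t \<in> {0..1} ==> Re (j t) = 0 ==> Im (j t) \<in> {\<alpha>..\<beta>}"
  and gap: "!!a b. 0 <= a ==> a < b ==> b <= 1 ==> Re (j a) = 0 ==> Re (j b) = 0 ==> (!!t. a < t ==> t < b ==> Re (j t) \<noteq> 0) ==>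
   axis_length F (Im (j a)) (Im (j b)) <= A * curve_length {a..b} (F \<circ> j)"
 shows "axis_length F (Im (j 0)) (Im (j 1)) <= A * curve_length {0..1} (F \<circ> j)"
proof (rule ennreal_le_factor_epsilon)
 fix e :: real assume e: "e > 0"
 define y where "y t = Im (j t)" for t
 define E' where "E' = {t \<in> {0..1}. Re (j t) = 0}"
 define L where "L a b = curve_length {a..b} (F \<circ> j)" for a b
 obtain \<delta> where \<delta>: "\<delta> > 0" "!!u v. u \<in> {\<alpha>..\<beta>} ==> v \<in> {\<alpha>..\<beta>} ==> \<bar>u - v\<bar> < \<delta> ==> axis_length F u v <= ennreal ((1 + e) * dist (F (imag u)) (F (imag v)))"
  using axis_length_le_chord[OF hol inj U e] by blast
 have jE: "j t = imag (y t)" if "t \<in> E'" for t using that by (simp add: E'_def y_def complex_eq_iff)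
 have "uniformly_continuous_on {0..1} j" by (rule compact_uniformly_continuous[OF j compact_Icc])
 from uniformly_continuous_onE[OF this \<delta>(1)]
 obtain \<eta> where \<eta>: "\<eta> > 0" "!!s t. s \<in> {0..1} ==> t \<in> {0..1} ==> dist t s < \<eta> ==> dist (j t) (j s) < \<delta>" by metis
 define \<eta>' where "\<eta>' = \<eta> / 2"
 have \<eta>': "\<eta>' > 0" "\<eta>' < \<eta>" using \<eta> by (auto simp: \<eta>'_def)
 define B where "B = ennreal (1 + e) * A"
 have B1: "ennreal (1 + e) <= B" "A <= B"
 proof -
  show "ennreal (1 + e) <= B" unfolding B_def using mult_left_mono[OF A, of "ennreal (1 + e)"] by simp
  have "1 <= ennreal (1 + e)" using e by (simp flip: ennreal_1 add: ennreal_leI del: ennreal_1)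
  thus "A <= B" unfolding B_def using mult_right_mono[of 1 "ennreal (1 + e)" A] by simp
 qed
 have near: "axis_length F (y s) (y t) <= B * L s t" if st: "s \<in> E'" "t \<in> E'" "s <= t" "t <= s + \<eta>'" for s t
 proof -
  have "dist t s < \<eta>" using st \<eta>' by (simp add: dist_real_def)
  hence "dist (j t) (j s) < \<delta>" using st by (intro \<eta>(2)) (auto simp: E'_def)
  moreover have "\<bar>y s - y t\<bar> <= dist (j t) (j s)" using abs_Im_le_cmod[of "j s - j t"] by (simp add: y_def dist_norm norm_minus_commute)
  ultimately have d: "\<bar>y s - y t\<bar> < \<delta>" by simp
  have "axis_length F (y s) (y t) <= ennreal ((1 + e) * dist (F (imag (y s))) (F (imag (y t))))"
   using st by (intro \<delta>(2) d) (use E in \<open>auto simp: E'_def y_def\<close>)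
  also have "... = ennreal (1 + e) * ennreal (dist ((F \<circ> j) s) ((F \<circ> j) t))"
  proof -
   have "(F \<circ> j) s = F (imag (y s))" "(F \<circ> j) t = F (imag (y t))" by (simp_all only: o_apply jE[OF st(1)] jE[OF st(2)])
   moreover have "0 <= 1 + e" using e by simp
   ultimately show ?thesis by (simp only: ennreal_mult zero_le_dist)
  qed
  also have "... <= B * L s t" unfolding L_def by (intro mult_mono B1 dist_le_curve_length) (use st in auto)
  finally show ?thesis .
 qed
 have comp: "compact (E' \<inter> {a..b})" for a b
 proof -
  have "closedin (top_of_set {0..1}) ({0..1} \<inter> (Re \<circ> j) -` {0})"
   by (rule continuous_closedin_preimage) (intro continuous_on_compose continuous_intros j, simp)
  moreover have "{0..1} \<inter> (Re \<circ> j) -` {0} = E'" by (auto simp: E'_def)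
  ultimately have "compact E'" using closedin_compact[OF compact_Icc] by metis
  thus ?thesis by (intro compact_Int_closed) auto
 qed
 have one: "1 \<in> E'" using ends by (simp add: E'_def)
 have main: "t \<in> E' ==> t \<ge> 1 - real n * \<eta>' ==> axis_length F (y t) (y 1) <= B * L t 1" for n t
 proof (induction n arbitrary: t)
  case 0
  hence "t = 1" by (auto simp: E'_def)
  thus ?case using near[OF one one] \<eta>' by simp
 next
  case (Suc n)
  have tE: "t \<in> E' \<inter> {t..t + \<eta>'}" using Suc.prems(1) \<eta>' by simp
  obtain t1 where t1: "t1 \<in> E' \<inter> {t..t + \<eta>'}" "!!x. x \<in> E' \<inter> {t..t + \<eta>'} ==> x <= t1"
   using compact_attains_sup[OF comp[of t "t + \<eta>'"]] tE by blast
  have n1: "axis_length F (y t) (y t1) <= B * L t t1" using t1(1) Suc.prems(1) by (intro near) auto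
  show ?case
  proof (cases "t1 = 1")
   case True thus ?thesis using n1 by simp
  next
   case False
   have t1': "t <= t1" "t1 <= 1" "t1 \<in> E'" using t1(1) by (auto simp: E'_def)
   have "t + \<eta>' <= 1"
   proof (rule ccontr)
    assume "\<not> t + \<eta>' <= 1"
    hence "1 \<in> E' \<inter> {t..t + \<eta>'}" using one Suc.prems(1) by (auto simp: E'_def)
    thus False using t1(2) t1'(2) False by force
   qed
   hence "E' \<inter> {t + \<eta>'..1} \<noteq> {}" using one by auto
   then obtain t2 where t2: "t2 \<in> E' \<inter> {t + \<eta>'..1}" "!!x. x \<in> E' \<inter> {t + \<eta>'..1} ==> t2 <= x"
    using compact_attains_inf[OF comp[of "t + \<eta>'" 1]] by blast
   have t12: "t1 <= t2" "t2 \<in> E'" "t2 <= 1" using t1(1) t2(1) by auto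
   have n2: "axis_length F (y t1) (y t2) <= B * L t1 t2"
   proof (cases "t1 = t2")
    case True thus ?thesis using near[of t1 t2] t12 t1' \<eta>' by simp
   next
    case ne: False
    have "axis_length F (y t1) (y t2) <= A * L t1 t2" unfolding y_def L_def
    proof (rule gap)
     show "0 <= t1" "t1 < t2" "t2 <= 1" "Re (j t1) = 0" "Re (j t2) = 0" using t12 t1' ne by (auto simp: E'_def)
     fix x assume x: "t1 < x" "x < t2"
     show "Re (j x) \<noteq> 0"
     proof
      assume "Re (j x) = 0"
      hence "x \<in> E'" using x t12 t1' by (auto simp: E'_def)
      thus False using t1(2)[of x] t2(2)[of x] x t1' t12 by (cases "x <= t + \<eta>'") auto
     qed
    qed
    also have "... <= B * L t1 t2" by (intro mult_right_mono B1) simp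
    finally show ?thesis .
   qed
   have n3: "axis_length F (y t2) (y 1) <= B * L t2 1"
   proof (rule Suc.IH[OF t12(2)])
    have "1 - real n * \<eta>' <= t + \<eta>'" using Suc.prems(2) by (simp add: algebra_simps)
    thus "1 - real n * \<eta>' <= t2" using t2(1) by simp
   qed
   have "axis_length F (y t) (y 1) <= axis_length F (y t) (y t1) + (axis_length F (y t1) (y t2) + axis_length F (y t2) (y 1))"
    by (meson axis_length_triangle add_left_mono order_trans)
   also have "... <= B * L t t1 + (B * L t1 t2 + B * L t2 1)" by (intro add_mono n1 n2 n3)
   also have "... = B * (L t t1 + (L t1 t2 + L t2 1))" by (simp add: distrib_left)
   also have "L t t1 + (L t1 t2 + L t2 1) = L t 1" unfolding L_def using t12 t1' by (simp add: curve_length_interval_split[symmetric])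
   finally show ?thesis .
  qed
 qed
 obtain n :: nat where "real n > 1 / \<eta>'" using reals_Archimedean2 by blast
 hence "0 \<ge> 1 - real n * \<eta>'" using \<eta>' by (simp add: field_simps)
 moreover have "0 \<in> E'" using ends by (simp add: E'_def)
 ultimately have "axis_length F (y 0) (y 1) <= B * L 0 1" using main by blast
 thus "axis_length F (Im (j 0)) (Im (j 1)) <= ennreal (1 + e) * (A * curve_length {0..1} (F \<circ> j))" by (simp add: y_def L_def B_def mult.assoc)
qed

lemma inside_subset_filled_hull: "X \<subseteq> Y ==> inside X \<subseteq> filled_hull Y"
 unfolding filled_hull_def using outside_mono[of X Y] inside_Int_outside[of X] by blast

lemma subset_filled_hull: "Y \<subseteq> filled_hull Y" unfolding filled_hull_def using outside_no_overlap[of Y] by blast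

text \<open>The bounds \<open>\<alpha>\<close> and \<open>\<beta>\<close> delimit an axis segment that contains all axis points of \<open>j\<close>, as a part of the extended geodesic segment \<open>\<gamma>'\<close> of the theorem does.\<close>

locale axis_arc =
 fixes f :: "complex => complex" and s :: complex and j :: "real => complex" and \<alpha> \<beta> :: real
 assumes hol: "f holomorphic_on disk - {s}" and inj: "inj_on f (disk - {s})" and pole: "is_pole f s" "f s = 0" and sD: "s \<in> disk"
  and j: "arc j" "path_image j \<subseteq> disk" "Re (j 0) = 0" "Re (j 1) = 0" and \<alpha>\<beta>: "-1 < \<alpha>" "\<beta> < 1"
  and E: "!!t. t \<in> {0..1} ==> Re (j t) = 0 ==> Im (j t) \<in> {\<alpha>..\<beta>}"
  and hull: "s \<notin> filled_hull (imag ` {\<alpha>..\<beta>} \<union> path_image j)"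
begin

lemma subarc_crosscut:
 assumes ab: "0 <= a" "a < b" "b <= 1" "Re (j a) = 0" "Re (j b) = 0" and off: "!!t. a < t ==> t < b ==> Re (j t) \<noteq> 0"
 defines "c \<equiv> j \<circ> (\<lambda>t. a + t * (b - a))"
 shows "\<exists>\<sigma>. univalent_crosscut c (Im (j a)) (Im (j b)) \<sigma> f s" "path_image c \<subseteq> path_image j" "curve_length {0..1} (f \<circ> c) <= curve_length {a..b} (f \<circ> j)"
  "closed_segment (imag (Im (j a))) (imag (Im (j b))) \<subseteq> imag ` {\<alpha>..\<beta>}"
proof -
 define l where "l t = a + t * (b - a)" for t
 have l01: "l t \<in> {a..b}" if "t \<in> {0..1}" for t
 proof -
  have "t * (b - a) <= 1 * (b - a)" "0 <= t * (b - a)" using that ab by (intro mult_right_mono mult_nonneg_nonneg; simp)+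
  thus ?thesis unfolding l_def atLeastAtMost_iff by (simp only: mult_1) linarith
 qed
 have lo: "a < l t" "l t < b" if "0 < t" "t < 1" for t
 proof -
  show "a < l t" using that ab by (simp add: l_def)
  have "t * (b - a) < 1 * (b - a)" using that ab by (intro mult_strict_right_mono) auto
  thus "l t < b" by (simp add: l_def)
 qed
 have l': "l t \<in> {0..1}" if "t \<in> {0..1}" for t using l01[OF that] ab by auto
 have cl: "c = j \<circ> l" by (simp add: c_def l_def fun_eq_iff)
 have jc: "continuous_on {0..1} j" and ji: "inj_on j {0..1}" using j(1) by (auto simp: arc_def path_def)
 have lc: "continuous_on {0..1} l" unfolding l_def by (intro continuous_intros)
 have li: "inj_on l {0..1}" using ab by (auto simp: l_def inj_on_def)
 have arc_c: "arc c" unfolding cl arc_def path_def using l' by (intro conjI continuous_on_compose lc continuous_on_subset[OF jc] comp_inj_on li inj_on_subset[OF ji]) auto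
 show pc: "path_image c \<subseteq> path_image j" using l' by (auto simp: cl path_image_def)
 show "curve_length {0..1} (f \<circ> c) <= curve_length {a..b} (f \<circ> j)"
  unfolding cl o_assoc using l01 ab by (intro curve_length_compose_mono) (auto simp: monotone_on_def l_def intro: mult_right_mono)
 show seg: "closed_segment (imag (Im (j a))) (imag (Im (j b))) \<subseteq> imag ` {\<alpha>..\<beta>}"
 proof (rule closed_segment_subset)
  have "Im (j a) \<in> {\<alpha>..\<beta>}" "Im (j b) \<in> {\<alpha>..\<beta>}" using E ab by auto
  thus "imag (Im (j a)) \<in> imag ` {\<alpha>..\<beta>}" "imag (Im (j b)) \<in> imag ` {\<alpha>..\<beta>}" by blast+
  show "convex (imag ` {\<alpha>..\<beta>})" by (intro convex_linear_image convex_real_interval linearI) (auto simp: scaleR_conv_of_real algebra_simps)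
 qed
 define m where "m = (a + b) / 2"
 have m: "a < m" "m < b" using ab by (auto simp: m_def)
 define \<sigma> where "\<sigma> = - Re (j m)"
 have \<sigma>0: "\<sigma> \<noteq> 0" using off[OF m] by (simp add: \<sigma>_def)
 have side: "\<sigma> * Re (j t) < 0" if t: "a < t" "t < b" for t
 proof -
  have cont: "continuous_on {a<..<b} (\<lambda>t. Re (j t))" using ab by (intro continuous_intros continuous_on_subset[OF jc]) auto
  have con: "connected ((\<lambda>t. Re (j t)) ` {a<..<b})" by (intro connected_continuous_image cont) auto
  have nz: "0 \<notin> (\<lambda>t. Re (j t)) ` {a<..<b}" using off by force
  have "\<not> Re (j m) * Re (j t) <= 0"
  proof
   assume "Re (j m) * Re (j t) <= 0"
   hence "Re (j m) <= 0 \<and> 0 <= Re (j t) \<or> Re (j t) <= 0 \<and> 0 <= Re (j m)" by (auto simp: mult_le_0_iff)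
   moreover have "Re (j m) \<in> (\<lambda>t. Re (j t)) ` {a<..<b}" "Re (j t) \<in> (\<lambda>t. Re (j t)) ` {a<..<b}" using t m by auto
   ultimately show False using con nz unfolding connected_iff_interval by blast
  qed
  thus ?thesis by (simp add: \<sigma>_def)
 qed
 have sub: "path_image c \<union> closed_segment (imag (Im (j a))) (imag (Im (j b))) \<subseteq> imag ` {\<alpha>..\<beta>} \<union> path_image j" using pc seg by blast
 have "univalent_crosscut c (Im (j a)) (Im (j b)) \<sigma> f s"
 proof unfold_locales
  show "arc c" by (rule arc_c)
  show "pathstart c = imag (Im (j a))" "pathfinish c = imag (Im (j b))" using ab by (simp_all add: cl l_def pathstart_def pathfinish_def complex_eq_iff)
  show "\<sigma> * Re (c t) < 0" if "0 < t" "t < 1" for t using side lo[OF that] by (simp add: cl)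
  show "s \<notin> path_image c" "s \<notin> closed_segment (imag (Im (j a))) (imag (Im (j b)))" using sub subset_filled_hull hull by blast+
  show "s \<notin> inside (path_image c \<union> closed_segment (imag (Im (j a))) (imag (Im (j b))))" using inside_subset_filled_hull[OF sub] hull by blast
  show "path_image c \<subseteq> disk" using pc j(2) by blast
 qed (use \<sigma>0 hol inj pole sD in auto)
 thus "\<exists>\<sigma>. univalent_crosscut c (Im (j a)) (Im (j b)) \<sigma> f s" by blast
qed

lemma axis_length_le_if_crosscuts:
 assumes A: "A \<ge> 1" and bound: "!!c u v \<sigma>. univalent_crosscut c u v \<sigma> f s ==> path_image c \<subseteq> path_image j ==>
  closed_segment (imag u) (imag v) \<subseteq> imag ` {\<alpha>..\<beta>} ==>
  axis_length f u v <= A * curve_length {0..1} (f \<circ> c)"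
 shows "axis_length f (Im (j 0)) (Im (j 1)) <= A * curve_length {0..1} (f \<circ> j)"
proof (rule axis_length_le_gaps[OF hol inj _ _ _ j(3,4) A E])
 show "open (disk - {s})" by (simp add: open_delete)
 show "continuous_on {0..1} j" using j(1) by (simp add: arc_def path_def)
 have "imag ` {\<alpha>..\<beta>} \<subseteq> disk"
 proof (rule image_subsetI)
  fix y assume "y \<in> {\<alpha>..\<beta>}"
  hence "\<bar>y\<bar> < 1" using \<alpha>\<beta> by auto
  thus "imag y \<in> disk" by (simp add: norm_mult)
 qed
 moreover have "s \<notin> imag ` {\<alpha>..\<beta>}" using hull subset_filled_hull[of "imag ` {\<alpha>..\<beta>} \<union> path_image j"] by (metis UnCI subsetD)
 ultimately show "imag ` {\<alpha>..\<beta>} \<subseteq> disk - {s}" by (simp add: subset_Diff_insert)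
 fix a b assume ab: "0 <= a" "a < b" "b <= 1" "Re (j a) = 0" "Re (j b) = 0" and off: "!!t. a < t ==> t < b ==> Re (j t) \<noteq> 0"
 define c where "c = j \<circ> (\<lambda>t. a + t * (b - a))"
 have c: "\<exists>\<sigma>. univalent_crosscut c (Im (j a)) (Im (j b)) \<sigma> f s" "path_image c \<subseteq> path_image j" "curve_length {0..1} (f \<circ> c) <= curve_length {a..b} (f \<circ> j)"
  "closed_segment (imag (Im (j a))) (imag (Im (j b))) \<subseteq> imag ` {\<alpha>..\<beta>}" unfolding c_def using subarc_crosscut[OF ab off] by blast+
 obtain \<sigma> where "univalent_crosscut c (Im (j a)) (Im (j b)) \<sigma> f s" using c(1) by blast
 hence "axis_length f (Im (j a)) (Im (j b)) <= A * curve_length {0..1} (f \<circ> c)" by (rule bound) (rule c(2,4))+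
 also have "... <= A * curve_length {a..b} (f \<circ> j)" by (intro mult_left_mono c(3)) simp
 finally show "axis_length f (Im (j a)) (Im (j b)) <= A * curve_length {a..b} (f \<circ> j)" .
qed auto

theorem axis_length_le_GH_const:
 assumes s: "s \<notin> interior (filled_hull (path_image j \<union> reflect_axis ` path_image j))"
 shows "axis_length f (Im (j 0)) (Im (j 1)) <= GH_const * curve_length {0..1} (f \<circ> j)"
proof (rule axis_length_le_if_crosscuts[OF GH_const_ge_1])
 fix c u v \<sigma> assume "univalent_crosscut c u v \<sigma> f s" and c: "path_image c \<subseteq> path_image j"
 then interpret uc: univalent_crosscut c u v \<sigma> f s by blast
 have "uc.G \<subseteq> filled_hull (path_image j \<union> reflect_axis ` path_image j)"
  unfolding uc.G_def by (rule inside_subset_filled_hull) (use c in \<open>auto simp: uc.K_def\<close>)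
 hence "s \<notin> uc.G" using s interior_maximal[OF _ uc.G_props(1)] by blast
 thus "axis_length f u v <= GH_const * curve_length {0..1} (f \<circ> c)" by (rule uc.no_pole_bound)
qed

theorem axis_length_le_GH_pole_const_sup:
 assumes \<tau>: "\<tau> < 1" "!!y. y \<in> {\<alpha>..\<beta>} ==> \<tau> <= norm ((s - imag y) / (1 - cnj (imag y) * s))"
 shows "axis_length f (Im (j 0)) (Im (j 1)) <= GH_pole_const_sup \<tau> * curve_length {0..1} (f \<circ> j)"
proof (rule axis_length_le_if_crosscuts[OF GH_pole_const_sup_ge_1[OF \<tau>(1)]])
 fix c u v \<sigma> assume "univalent_crosscut c u v \<sigma> f s"
  and seg: "closed_segment (imag u) (imag v) \<subseteq> imag ` {\<alpha>..\<beta>}"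
 then interpret uc: univalent_crosscut c u v \<sigma> f s by blast
 show "axis_length f u v <= GH_pole_const_sup \<tau> * curve_length {0..1} (f \<circ> c)"
 proof (cases "s \<in> uc.G")
  case True
  thus ?thesis
  proof (rule uc.inner_pole_bound)
   fix x assume "x \<in> uc.seg"
   hence "x \<in> imag ` {\<alpha>..\<beta>}" using uc.seg_segment(1) seg by blast
   thus "\<tau> <= norm ((s - x) / (1 - cnj x * s))" using \<tau>(2) by blast
  qed
 next
  case False
  thus ?thesis by (rule uc.outer_pole_bound[OF _ \<tau>(1)])
 qed
qed

end

section \<open>Hyperbolic geometry\<close>

text \<open>The general automorphism \<open>S\<close> of the disk, with \<open>S 0 = a\<close>, and its inverse \<open>T\<close>.\<close>

locale disk_motion =
 fixes a u :: complex
 assumes a: "norm a < 1" and u: "norm u = 1"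
begin

definition S where "S W = Moebius_function 0 (- a) (u * W)"
definition T where "T z = cnj u * Moebius_function 0 a z"

lemma uu: "cnj u * u = 1" using u by (simp add: complex_norm_square[symmetric] mult.commute)

lemma norm_S: "norm z < 1 ==> norm (S z) < 1" and norm_T: "norm z < 1 ==> norm (T z) < 1"
 unfolding S_def T_def using a u by (simp_all add: norm_mult Moebius_function_norm_lt_1)

lemma T_S: "norm W < 1 ==> T (S W) = W" using Moebius_function_compose[of a "-a" "u * W"] a u by (simp add: S_def T_def norm_mult mult.assoc[symmetric] uu)

lemma S_T: "norm z < 1 ==> S (T z) = z" using Moebius_function_compose[of "-a" a z] a uu by (simp add: S_def T_def mult.assoc[symmetric] mult.commute[of u])

lemma S_hol: "S holomorphic_on disk"
proof -
 have "Moebius_function 0 (- a) \<circ> (*) u holomorphic_on disk"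
  by (rule holomorphic_on_compose_gen[OF _ Moebius_function_holomorphic]) (use a u in \<open>auto intro!: holomorphic_intros simp: norm_mult\<close>)
 thus ?thesis by (simp add: S_def[abs_def] o_def)
qed

lemma T_hol: "T holomorphic_on disk" unfolding T_def by (intro holomorphic_intros Moebius_function_holomorphic a)

lemma S_inj: "norm z < 1 ==> norm w < 1 ==> S z = S w \<longleftrightarrow> z = w" using T_S by metis

lemma S_pseudo:
 assumes z: "norm z < 1" and w: "norm w < 1"
 shows "norm ((S z - S w) / (1 - S z * cnj (S w))) = norm ((z - w) / (1 - z * cnj w))"
 using Schwarz_Pick[OF S_hol _ z w] Schwarz_Pick[OF T_hol _ norm_S[OF z] norm_S[OF w]] norm_S norm_T T_S z w by (simp add: mult.commute)

lemma S_homeomorphism: "homeomorphism disk disk S T"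
proof (rule homeomorphismI)
 show "continuous_on disk S" "continuous_on disk T" by (intro holomorphic_on_imp_continuous_on S_hol T_hol)+
qed (use norm_S norm_T S_T T_S in auto)

lemma S_0: "S 0 = a" by (simp add: S_def Moebius_function_def)

text \<open>The two equations for the reflection below are between functions antiholomorphic in \<open>W\<close>, that is, holomorphic in \<open>V = cnj W\<close>, so it suffices to know them for \<open>W\<close> on a segment of the axis.\<close>

lemma axis_identity:
 assumes P: "P holomorphic_on disk" "Q holomorphic_on disk" and \<tau>: "0 < \<tau>" "\<tau> < 1"
  and eq: "!!t. 0 <= t ==> t <= \<tau> ==> P (- (imag t)) = Q (- (imag t))" and V: "norm V < 1"
 shows "P V = Q V"
proof -
 define X where "X = (\<lambda>t. - (imag t)) ` {0..\<tau>}"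
 have 0: "0 \<in> X" and t: "- (imag \<tau>) \<in> X" using \<tau> by (auto simp: X_def)
 have "connected X" unfolding X_def by (intro connected_continuous_image continuous_intros connected_Icc)
 moreover have "X \<noteq> {0}" using t \<tau> by auto
 ultimately have lim: "0 islimpt X" using 0 by (intro connected_imp_perfect) auto
 have "P V - Q V = 0"
 proof (rule analytic_continuation[of "\<lambda>V. P V - Q V" "disk" X 0])
  show "X \<subseteq> disk" using \<tau> by (auto simp: X_def norm_mult)
 qed (use P V lim eq in \<open>auto intro!: holomorphic_intros simp: X_def\<close>)
 thus ?thesis by simp
qed

lemma cnj_S_hol: "(\<lambda>V. cnj (S (cnj V))) holomorphic_on disk"
proof -
 have "cnj (S (cnj V)) = Moebius_function 0 (- cnj a) (cnj u * V)" for V by (simp add: S_def Moebius_function_def)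
 moreover have "Moebius_function 0 (- cnj a) \<circ> (*) (cnj u) holomorphic_on disk"
  by (rule holomorphic_on_compose_gen[OF _ Moebius_function_holomorphic]) (use a u in \<open>auto intro!: holomorphic_intros simp: norm_mult\<close>)
 ultimately show ?thesis by (simp add: o_def)
qed

lemma S_minus_hol: "(\<lambda>V. S (- V)) holomorphic_on disk"
proof -
 have "S \<circ> uminus holomorphic_on disk" by (rule holomorphic_on_compose_gen[OF _ S_hol]) (auto intro!: holomorphic_intros)
 thus ?thesis by (simp add: o_def)
qed

lemma S_eq_reflection: "norm W < 1 ==> S W = S (reflect_axis W) \<longleftrightarrow> Re W = 0"
 using S_inj[of W "reflect_axis W"] by (auto simp: reflect_axis_def complex_eq_iff)

text \<open>The equation \<open>(cnj (S W) - cnj c) (S (- cnj W) - c) = r^2\<close> holds on the axis, hence everywhere. It says that \<open>S W\<close> and \<open>S (- cnj W)\<close> are mirror images.\<close>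

lemma circle_through_axis:
 assumes \<tau>: "0 < \<tau>" "\<tau> < 1" and r: "r > 0" and on: "!!t. 0 <= t ==> t <= \<tau> ==> S (imag t) \<in> sphere c r" and W: "norm W < 1"
 shows "S W \<in> sphere c r \<longleftrightarrow> Re W = 0" "reflect (Circle c r) (S W) = S (reflect_axis W)"
proof -
 have circ: "z \<in> sphere c r \<longleftrightarrow> (cnj z - cnj c) * (z - c) = of_real (r\<^sup>2)" for z
 proof -
  have "z \<in> sphere c r \<longleftrightarrow> (norm (z - c))\<^sup>2 = r\<^sup>2" using r by (simp add: dist_norm norm_minus_commute)
  also have "... \<longleftrightarrow> (z - c) * cnj (z - c) = of_real (r\<^sup>2)" unfolding complex_norm_square[symmetric] of_real_eq_iff ..
  finally show ?thesis by (simp add: mult.commute)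
 qed
 have "(cnj (S (cnj (cnj W))) - cnj c) * (S (- cnj W) - c) = of_real (r\<^sup>2)"
 proof (rule axis_identity[where P = "\<lambda>V. (cnj (S (cnj V)) - cnj c) * (S (- V) - c)" and Q = "\<lambda>_. of_real (r\<^sup>2)" and V = "cnj W", OF _ holomorphic_on_const \<tau>])
  show "(\<lambda>V. (cnj (S (cnj V)) - cnj c) * (S (- V) - c)) holomorphic_on disk" by (intro holomorphic_intros cnj_S_hol S_minus_hol)
  show "(cnj (S (cnj (- (imag t)))) - cnj c) * (S (- (- (imag t))) - c) = of_real (r\<^sup>2)" if "0 <= t" "t <= \<tau>" for t
   using circ[of "S (imag t)"] on[OF that] by simp
 qed (use W in simp)
 hence eq: "(cnj (S W) - cnj c) * (S (reflect_axis W) - c) = of_real (r\<^sup>2)" by (simp add: reflect_axis_def)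
 hence nz: "cnj (S W) - cnj c \<noteq> 0" using r by auto
 have "S W \<in> sphere c r \<longleftrightarrow> (cnj (S W) - cnj c) * (S W - c) = (cnj (S W) - cnj c) * (S (reflect_axis W) - c)" unfolding circ eq ..
 also have "... \<longleftrightarrow> S W = S (reflect_axis W)" using nz by simp
 finally show "S W \<in> sphere c r \<longleftrightarrow> Re W = 0" unfolding S_eq_reflection[OF W] .
 have "S (reflect_axis W) - c = of_real (r\<^sup>2) / (cnj (S W) - cnj c)" using eq nz by (simp add: eq_divide_eq mult.commute)
 thus "reflect (Circle c r) (S W) = S (reflect_axis W)" by (simp add: diff_eq_eq add.commute)
qed

text \<open>As for circles, with the equation \<open>cnj d (z - p) = d (cnj z - cnj p)\<close> of the line.\<close>

lemma line_through_axis: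
 assumes \<tau>: "0 < \<tau>" "\<tau> < 1" and pq: "p \<noteq> q" and on: "!!t. 0 <= t ==> t <= \<tau> ==> S (imag t) \<in> affine hull {p, q}" and W: "norm W < 1"
 shows "S W \<in> affine hull {p, q} \<longleftrightarrow> Re W = 0" "reflect (Line p q) (S W) = S (reflect_axis W)"
proof -
 define d where "d = q - p"
 have d: "d \<noteq> 0" "cnj d \<noteq> 0" using pq by (auto simp: d_def)
 have line: "z \<in> affine hull {p, q} \<longleftrightarrow> cnj d * (z - p) = d * (cnj z - cnj p)" for z
 proof
  assume "z \<in> affine hull {p, q}"
  then obtain x y where xy: "z = x *\<^sub>R p + y *\<^sub>R q" "x + y = 1" unfolding affine_hull_2 by blast
  hence "x = 1 - y" by simp
  hence "z - p = of_real y * d" unfolding xy(1) \<open>x = 1 - y\<close> d_def by (simp add: scaleR_conv_of_real algebra_simps)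
  moreover from this have "cnj z - cnj p = of_real y * cnj d" by (metis complex_cnj_complex_of_real complex_cnj_diff complex_cnj_mult)
  ultimately show "cnj d * (z - p) = d * (cnj z - cnj p)" by simp
 next
  assume eq: "cnj d * (z - p) = d * (cnj z - cnj p)"
  have "cnj ((z - p) / d) = (z - p) / d" using eq d by (simp add: field_simps)
  hence "(z - p) / d \<in> \<real>" by (simp only: Reals_cnj_iff)
  then obtain l where "(z - p) / d = of_real l" by (auto elim: Reals_cases)
  hence "z - p = of_real l * (q - p)" using d by (simp add: d_def field_simps)
  hence "z = (1 - l) *\<^sub>R p + l *\<^sub>R q" by (simp add: scaleR_conv_of_real algebra_simps)
  thus "z \<in> affine hull {p, q}" unfolding affine_hull_2 by force
 qed
 have "cnj d * (S (- cnj W) - p) = d * (cnj (S (cnj (cnj W))) - cnj p)"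
 proof (rule axis_identity[where P = "\<lambda>V. cnj d * (S (- V) - p)" and Q = "\<lambda>V. d * (cnj (S (cnj V)) - cnj p)" and V = "cnj W", OF _ _ \<tau>])
  show "(\<lambda>V. cnj d * (S (- V) - p)) holomorphic_on disk" "(\<lambda>V. d * (cnj (S (cnj V)) - cnj p)) holomorphic_on disk"
   by (intro holomorphic_intros cnj_S_hol S_minus_hol)+
  show "cnj d * (S (- (- (imag t))) - p) = d * (cnj (S (cnj (- (imag t)))) - cnj p)" if "0 <= t" "t <= \<tau>" for t using line[of "S (imag t)"] on[OF that] by simp
 qed (use W in simp)
 hence eq: "cnj d * (S (reflect_axis W) - p) = d * (cnj (S W) - cnj p)" by (simp add: reflect_axis_def)
 have "S W \<in> affine hull {p, q} \<longleftrightarrow> S W = S (reflect_axis W)" unfolding line eq[symmetric] using d by simp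
 thus "S W \<in> affine hull {p, q} \<longleftrightarrow> Re W = 0" unfolding S_eq_reflection[OF W] .
 have "S (reflect_axis W) - p = d * cnj ((S W - p) / d)" using eq d by (simp add: field_simps)
 thus "reflect (Line p q) (S W) = S (reflect_axis W)" by (simp add: d_def diff_eq_eq add.commute)
qed

end

lemma tanh_artanh: "\<bar>x\<bar> < 1 ==> tanh (artanh x) = (x::real)"
proof -
 assume x: "\<bar>x\<bar> < 1"
 define y where "y = (1 + x) / (1 - x)"
 have y: "y > 0" using x by (auto simp: y_def)
 have "tanh (artanh x) = (y - 1) / (y + 1)" using tanh_ln_real[of "sqrt y"] y by (simp add: artanh_def y_def[symmetric] ln_sqrt)
 also have "... = x" using x unfolding y_def by (simp add: field_simps)
 finally show ?thesis .
qed

text \<open>This covers points outside the disk too: for real \<open>x\<close>, \<open>ln (- x) = ln x\<close> and \<open>ln 0 = 0\<close>. It bounds the infimum in \<open>hyp_setdist\<close> from below.\<close>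

lemma hyp_dist_nonneg: "hyp_dist z w \<ge> 0"
proof -
 have *: "artanh x \<ge> 0" if "x \<ge> 0" for x :: real
 proof -
  consider "x < 1" | "x = 1" | "x > 1" by linarith
  thus ?thesis
  proof cases
   case 1
   thus ?thesis using that by (simp add: artanh_def ln_ge_zero)
  next
   case 3
   have "ln ((1 + x) / (1 - x)) = ln (- ((1 + x) / (1 - x)))" by (simp only: ln_minus)
   also have "- ((1 + x) / (1 - x)) = (1 + x) / (x - 1)" using 3 by (simp add: field_simps)
   also have "ln ((1 + x) / (x - 1)) \<ge> 0" using 3 by (intro ln_ge_zero) (simp add: field_simps)
   finally show ?thesis by (simp add: artanh_def)
  qed (simp add: artanh_def)
 qed
 show ?thesis unfolding hyp_dist_def by (rule *) simp
qed

lemma pseudo_lt_1: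
 assumes "norm z < 1" "norm w < 1" shows "norm ((z - w) / (1 - z * cnj w)) < 1"
proof -
 have "norm (Moebius_function 0 w z) < 1" by (rule Moebius_function_norm_lt_1[OF assms(2,1)])
 thus ?thesis by (simp add: Moebius_function_def mult.commute)
qed

lemma tanh_hyp_dist: "norm z < 1 ==> norm w < 1 ==> tanh (hyp_dist z w) = norm ((z - w) / (1 - z * cnj w))"
 unfolding hyp_dist_def using pseudo_lt_1[of z w] by (intro tanh_artanh) simp

lemma tanh_hyp_setdist_le:
 assumes "w \<in> X" "norm s < 1" "norm w < 1"
 shows "tanh (hyp_setdist s X) <= norm ((s - w) / (1 - s * cnj w))"
proof -
 have "hyp_setdist s X <= hyp_dist s w" unfolding hyp_setdist_def using assms(1) hyp_dist_nonneg by (intro cINF_lower bdd_belowI2[of _ 0]) auto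
 hence "tanh (hyp_setdist s X) <= tanh (hyp_dist s w)" by simp
 thus ?thesis using tanh_hyp_dist assms by simp
qed

lemma (in disk_motion) hyp_dist_S: "norm z < 1 ==> norm w < 1 ==> hyp_dist (S z) (S w) = hyp_dist z w" unfolding hyp_dist_def using S_pseudo by simp

lemma pseudo_identity:
 assumes "norm z < 1" "norm w < 1"
 shows "1 - (norm ((z - w) / (1 - z * cnj w)))\<^sup>2 = (1 - (norm z)\<^sup>2) * (1 - (norm w)\<^sup>2) / (norm (1 - z * cnj w))\<^sup>2"
proof -
 have "norm (z * cnj w) < 1" using assms unfolding norm_mult complex_mod_cnj by (metis mult_less_cancel_left2 mult_strict_mono' norm_ge_zero mult_1)
 hence "1 - z * cnj w \<noteq> 0" by (metis eq_iff_diff_eq_0 less_irrefl norm_one)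
 hence n: "(norm (1 - z * cnj w))\<^sup>2 \<noteq> 0" by simp
 have "(norm (1 - z * cnj w))\<^sup>2 - (norm (z - w))\<^sup>2 = (1 - (norm z)\<^sup>2) * (1 - (norm w)\<^sup>2)"
  by (cases z; cases w) (simp add: cmod_power2, simp add: power2_eq_square algebra_simps)
 thus ?thesis using n by (simp add: norm_divide power_divide field_simps)
qed

text \<open>By the addition theorem for \<open>tanh\<close>, equality in the triangle inequality determines the pseudohyperbolic distance of \<open>z\<close> from \<open>w\<close> in terms of \<open>norm z\<close>; only a point with \<open>Im z = norm z\<close> attains it.\<close>

lemma hyp_segment_axis_subset:
 assumes t: "0 < \<tau>" "\<tau> < 1" and z: "z \<in> hyp_segment 0 (imag \<tau>)"
 shows "Re z = 0 \<and> Im z \<in> {0..\<tau>}"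
proof -
 define w where "w = imag \<tau>"
 have w: "norm w = \<tau>" using t by (simp add: w_def norm_mult)
 have z1: "norm z < 1" and eq: "hyp_dist 0 z + hyp_dist z w = hyp_dist 0 w" using z by (auto simp: hyp_segment_def w_def)
 define r where "r = norm z"
 define \<rho> where "\<rho> = norm ((z - w) / (1 - z * cnj w))"
 have r: "0 <= r" "r < 1" using z1 by (auto simp: r_def)
 have \<rho>: "0 <= \<rho>" "\<rho> < 1" using pseudo_lt_1[OF z1, of w] w t by (auto simp: \<rho>_def)
 have "tanh (hyp_dist 0 z + hyp_dist z w) = (r + \<rho>) / (1 + r * \<rho>)" using z1 w t by (subst tanh_add) (simp_all add: tanh_hyp_dist r_def \<rho>_def)
 hence "(r + \<rho>) / (1 + r * \<rho>) = \<tau>" using tanh_hyp_dist[of 0 w] w t unfolding eq by simp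
 moreover have "1 + r * \<rho> > 0" using r \<rho> by (simp add: add_pos_nonneg)
 ultimately have e1: "\<rho> * (1 - \<tau> * r) = \<tau> - r" by (simp add: field_simps)
 have tr: "1 - \<tau> * r > 0" using t r by (metis diff_gt_0_iff_gt less_le_trans mult_less_cancel_right2 mult_strict_mono' less_eq_real_def mult_1 less_imp_le mult_left_le_one_le order_le_less_trans)
 have "r <= \<tau>" using e1 \<rho>(1) tr by (metis diff_ge_0_iff_ge less_imp_le mult_nonneg_nonneg)
 have "1 - \<rho>\<^sup>2 = (1 - r\<^sup>2) * (1 - \<tau>\<^sup>2) / (norm (1 - z * cnj w))\<^sup>2"
  unfolding \<rho>_def r_def w[symmetric] using pseudo_identity[OF z1, of w] w t by simp
 moreover have "(1 - \<rho>\<^sup>2) * (1 - \<tau> * r)\<^sup>2 = (1 - r\<^sup>2) * (1 - \<tau>\<^sup>2)"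
 proof -
  have "(1 - \<rho>\<^sup>2) * (1 - \<tau> * r)\<^sup>2 = (1 - \<tau> * r)\<^sup>2 - (\<rho> * (1 - \<tau> * r))\<^sup>2" by (simp only: power_mult_distrib left_diff_distrib mult_1)
  also have "... = (1 - r\<^sup>2) * (1 - \<tau>\<^sup>2)" unfolding e1 by (simp add: power2_eq_square algebra_simps)
  finally show ?thesis .
 qed
 moreover have pos: "(1 - r\<^sup>2) * (1 - \<tau>\<^sup>2) > 0" using r t by (simp add: abs_square_less_1)
 ultimately have "(norm (1 - z * cnj w))\<^sup>2 = (1 - \<tau> * r)\<^sup>2"
 proof -
  define P where "P = (1 - r\<^sup>2) * (1 - \<tau>\<^sup>2)"
  define N where "N = (norm (1 - z * cnj w))\<^sup>2"
  assume a: "1 - \<rho>\<^sup>2 = (1 - r\<^sup>2) * (1 - \<tau>\<^sup>2) / (norm (1 - z * cnj w))\<^sup>2" "(1 - \<rho>\<^sup>2) * (1 - \<tau> * r)\<^sup>2 = (1 - r\<^sup>2) * (1 - \<tau>\<^sup>2)"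
  have "P / N * (1 - \<tau> * r)\<^sup>2 = P" "P > 0" using a pos by (simp_all add: P_def N_def)
  moreover from this have "N \<noteq> 0" by auto
  ultimately have "(1 - \<tau> * r)\<^sup>2 = N" by (simp add: divide_eq_eq)
  thus ?thesis by (simp add: N_def)
 qed
 hence "norm (1 - z * cnj w) = 1 - \<tau> * r" using tr by (simp add: power2_eq_iff_nonneg)
 hence "Re (1 - z * cnj w) <= 1 - \<tau> * r" using complex_Re_le_cmod[of "1 - z * cnj w"] by simp
 moreover have "Re (1 - z * cnj w) = 1 - \<tau> * Im z" by (simp add: w_def)
 ultimately have "r <= Im z" using t by simp
 hence "(Re z)\<^sup>2 <= 0" using r cmod_power2[of z] power_mono[of r "Im z" 2] by (simp add: r_def)
 hence "Re z = 0" by simp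
 moreover have "Im z = r" using \<open>r <= Im z\<close> abs_Im_le_cmod[of z] by (simp add: r_def)
 ultimately show ?thesis using r \<open>r <= \<tau>\<close> by simp
qed

lemma (in disk_motion) hyp_segment_S:
 assumes "0 < \<tau>" "\<tau> < 1"
 shows "hyp_segment (S 0) (S (imag \<tau>)) \<subseteq> (\<lambda>y. S (imag y)) ` {0..\<tau>}"
proof
 have n: "norm (imag \<tau>) < 1" using assms by (simp add: norm_mult)
 fix z assume z: "z \<in> hyp_segment (S 0) (S (imag \<tau>))"
 hence z1: "norm z < 1" by (simp add: hyp_segment_def)
 have "hyp_dist (S 0) (S (T z)) + hyp_dist (S (T z)) (S (imag \<tau>)) = hyp_dist (S 0) (S (imag \<tau>))" using z unfolding S_T[OF z1] by (simp add: hyp_segment_def)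
 hence "T z \<in> hyp_segment 0 (imag \<tau>)"
  using hyp_dist_S[of 0 "T z"] hyp_dist_S[OF norm_T[OF z1] n] hyp_dist_S[OF _ n, of 0] norm_T[OF z1] by (simp add: hyp_segment_def)
 hence "Re (T z) = 0" "Im (T z) \<in> {0..\<tau>}" using hyp_segment_axis_subset[OF assms] by blast+
 hence "z = S (imag (Im (T z)))" using S_T[OF z1] by (metis complex_eq mult.commute of_real_0 add_0)
 thus "z \<in> (\<lambda>y. S (imag y)) ` {0..\<tau>}" using \<open>Im (T z) \<in> {0..\<tau>}\<close> by blast
qed

context disk_motion
begin

lemma circline_through_axis:
 assumes \<tau>: "0 < \<tau>" "\<tau> < 1" and C: "proper_circline C" and on: "!!t. 0 <= t ==> t <= \<tau> ==> Some (S (imag t)) \<in> circline_points C"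
  and W: "norm W < 1"
 shows "Some (S W) \<in> circline_points C \<longleftrightarrow> Re W = 0" "reflect C (S W) = S (reflect_axis W)"
proof -
 have "(Some (S W) \<in> circline_points C \<longleftrightarrow> Re W = 0) \<and> reflect C (S W) = S (reflect_axis W)"
 proof (cases C)
  case (Circle c r)
  have "S (imag t) \<in> sphere c r" if "0 <= t" "t <= \<tau>" for t using on[OF that] unfolding Circle circline_points.simps by blast
  note * = circle_through_axis[OF \<tau> _ this W]
  have "r > 0" using C Circle by simp
  moreover have "Some (S W) \<in> circline_points C \<longleftrightarrow> S W \<in> sphere c r" unfolding Circle circline_points.simps by blast
  ultimately show ?thesis using * unfolding Circle by blast
 next
  case (Line p q)
  have "S (imag t) \<in> affine hull {p, q}" if "0 <= t" "t <= \<tau>" for t using on[OF that] unfolding Line circline_points.simps by blast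
  note * = line_through_axis[OF \<tau> _ this W]
  have "p \<noteq> q" using C Line by simp
  moreover have "Some (S W) \<in> circline_points C \<longleftrightarrow> S W \<in> affine hull {p, q}" unfolding Line circline_points.simps by blast
  ultimately show ?thesis using * unfolding Line by blast
 qed
 thus "Some (S W) \<in> circline_points C \<longleftrightarrow> Re W = 0" "reflect C (S W) = S (reflect_axis W)" by blast+
qed

lemma open_S_image: assumes "open V" "V \<subseteq> disk" shows "open (S ` V)"
proof (rule open_mapping_thm3[OF holomorphic_on_subset[OF S_hol assms(2)] assms(1)])
 show "inj_on S V" using assms(2) S_inj by (intro inj_onI) (metis mem_ball_0 subsetD)
qed

text \<open>The part of the circline between two points of \<open>J\<close> on the axis is relatively open and closed in the circline without these two points. A connected set that avoids \<open>J\<close> and leaves the disk cannot meet it.\<close>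

lemma component_avoids_axis:
 assumes iff: "!!W. norm W < 1 ==> Some (S W) \<in> circline_points C \<longleftrightarrow> Re W = 0"
  and ab: "-1 < \<alpha>" "\<beta> < 1" "S (imag \<alpha>) \<in> J" "S (imag \<beta>) \<in> J"
  and C\<^sub>0: "C\<^sub>0 \<in> connected_components_of (subtopology riemann_sphere (circline_points C - Some ` J))"
  and far: "x \<in> C\<^sub>0" "x \<notin> Some ` disk" and y: "y \<in> {\<alpha>..\<beta>}"
 shows "Some (S (imag y)) \<notin> C\<^sub>0"
proof
 assume yC: "Some (S (imag y)) \<in> C\<^sub>0"
 have "connectedin riemann_sphere C\<^sub>0 \<and> C\<^sub>0 \<subseteq> circline_points C - Some ` J"
  using connectedin_connected_components_of[OF C\<^sub>0] by (simp only: connectedin_subtopology)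
 hence con: "connectedin riemann_sphere C\<^sub>0" and sub: "C\<^sub>0 \<subseteq> circline_points C - Some ` J" by blast+
 have n1: "norm (imag t) < 1" if "t \<in> {\<alpha>..\<beta>}" for t using that ab by (auto simp: norm_mult)
 define V where "V = S ` (disk \<inter> {W. \<alpha> < Im W} \<inter> {W. Im W < \<beta>})"
 define K where "K = (\<lambda>t. S (imag t)) ` {\<alpha>..\<beta>}"
 have oV: "open V" unfolding V_def by (rule open_S_image) (auto intro!: open_Int open_halfspace_Im_gt open_halfspace_Im_lt)
 have "compact K" unfolding K_def
 proof (rule compact_continuous_image)
  show "continuous_on {\<alpha>..\<beta>} (\<lambda>t. S (imag t))"
   by (rule continuous_on_compose2[OF holomorphic_on_imp_continuous_on[OF S_hol]]) (auto intro!: continuous_intros n1)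
 qed simp
 have E1: "openin riemann_sphere (Some ` V)" using oV unfolding riemann_sphere_def by simp
 have E2: "openin riemann_sphere (insert None (Some ` (- K)))" unfolding riemann_sphere_def openin_Alexandroff_compactification
  using \<open>compact K\<close> by (intro disjI2 exI[of _ K]) (auto simp: compact_imp_closed Compl_eq_Diff_UNIV)
 have mid: "t \<noteq> \<alpha> \<and> t \<noteq> \<beta>" if "Some (S (imag t)) \<in> C\<^sub>0" for t using that sub ab(3,4) by blast
 have inV: "S (imag t) \<in> V" if t: "t \<in> {\<alpha>..\<beta>}" "Some (S (imag t)) \<in> C\<^sub>0" for t
  unfolding V_def using mid[OF t(2)] t(1) n1[OF t(1)] by (intro imageI) auto
 have cover: "C\<^sub>0 \<subseteq> Some ` V \<union> insert None (Some ` (- K))"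
 proof
  fix w assume w: "w \<in> C\<^sub>0"
  show "w \<in> Some ` V \<union> insert None (Some ` (- K))"
  proof (cases w)
   case (Some z)
   show ?thesis
   proof (cases "z \<in> K")
    case True
    then obtain t where t: "t \<in> {\<alpha>..\<beta>}" "z = S (imag t)" by (auto simp: K_def)
    hence "z \<in> V" using inV[OF t(1)] w Some by simp
    thus ?thesis using Some by blast
   qed (use Some in auto)
  qed auto
 qed
 have disj: "Some ` V \<inter> insert None (Some ` (- K)) \<inter> C\<^sub>0 = {}"
 proof (rule ccontr)
  assume "\<not> ?thesis"
  then obtain z where z: "z \<in> V" "z \<notin> K" "Some z \<in> C\<^sub>0" by auto
  then obtain W where W: "norm W < 1" "\<alpha> < Im W" "Im W < \<beta>" "z = S W" by (auto simp: V_def)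
  have "Re W = 0" using iff[OF W(1)] z(3) sub W(4) by blast
  hence "W = imag (Im W)" by (simp add: complex_eq_iff)
  hence "z \<in> K" unfolding K_def using W by (intro image_eqI[of _ _ "Im W"]) auto
  thus False using z(2) by simp
 qed
 have "Some ` V \<inter> C\<^sub>0 \<noteq> {}" using inV[OF y yC] yC by blast
 moreover have "insert None (Some ` (- K)) \<inter> C\<^sub>0 \<noteq> {}"
 proof -
  have "K \<subseteq> disk" using n1 norm_S by (auto simp: K_def)
  hence "x \<notin> Some ` K" using far(2) by blast
  hence "x \<in> insert None (Some ` (- K))" by (cases x) auto
  thus ?thesis using far(1) by blast
 qed
 ultimately show False using con E1 E2 cover disj unfolding connectedin by blast
qed

text \<open>The filled hull consists of the set and its inside, and homeomorphisms of the disk preserve insides.\<close>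

lemma filled_hull_S:
 assumes X: "compact X" "X \<subseteq> disk" and w: "w \<in> filled_hull X" shows "S w \<in> filled_hull (S ` X)"
proof -
 have "w \<in> X \<or> w \<in> inside X" using w union_with_inside[of X] unfolding filled_hull_def by blast
 hence "S w \<in> S ` X \<or> S w \<in> S ` inside X" by blast
 moreover have "inside (S ` X) = S ` inside X" by (rule inside_homeomorphic_image[OF open_ball convex_ball open_ball convex_ball S_homeomorphism X])
 moreover have "S ` X \<subseteq> filled_hull (S ` X)" "inside (S ` X) \<subseteq> filled_hull (S ` X)"
  by (rule subset_filled_hull, rule inside_subset_filled_hull[OF order_refl])
 ultimately show ?thesis by auto
qed

lemma interior_filled_hull_S:
 assumes X: "compact X" "X \<subseteq> disk" and w: "w \<in> interior (filled_hull X)" "norm w < 1"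
 shows "S w \<in> interior (filled_hull (S ` X))"
proof (rule interiorI)
 show "open (S ` (interior (filled_hull X) \<inter> disk))" by (rule open_S_image) auto
 show "S w \<in> S ` (interior (filled_hull X) \<inter> disk)" using w by auto
 show "S ` (interior (filled_hull X) \<inter> disk) \<subseteq> filled_hull (S ` X)"
 proof (rule image_subsetI)
  fix z assume "z \<in> interior (filled_hull X) \<inter> disk"
  hence "z \<in> filled_hull X" using interior_subset by blast
  thus "S z \<in> filled_hull (S ` X)" by (rule filled_hull_S[OF X])
 qed
qed

end

lemma filled_hull_mono: "X \<subseteq> Y ==> filled_hull X \<subseteq> filled_hull Y" unfolding filled_hull_def using outside_mono[of X Y] by blast

lemma meromorphic_univalent_pole_value:
 assumes "meromorphic_univalent f" "s \<in> disk" "is_pole f s" shows "f s = 0"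
proof -
 have "f nicely_meromorphic_on disk" using assms(1) by (simp add: meromorphic_univalent_def)
 hence "is_pole f s \<and> f s = 0 \<or> f \<midarrow>s\<rightarrow> f s" using assms(2) unfolding nicely_meromorphic_on_def by blast
 moreover have "\<not> f \<midarrow>s\<rightarrow> f s" using assms(3) not_tendsto_and_filterlim_at_infinity[of "at s" f "f s"] unfolding is_pole_def by auto
 ultimately show ?thesis by blast
qed

section \<open>Arcs and hyperbolic segments in general position\<close>

theorem theorem3:
  fixes j g :: "real \<Rightarrow> complex" and J \<gamma> \<gamma>' J' :: "complex set" and \<zeta>\<^sub>1 \<zeta>\<^sub>2 s :: complex
    and C :: circline and C\<^sub>0 :: "complex option set"
    and f :: "complex \<Rightarrow> complex" and \<tau> :: real
  assumes "arc j" "path_image j = J" "J \<subseteq> ball 0 1" "pathstart j = \<zeta>\<^sub>1" "pathfinish j = \<zeta>\<^sub>2"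
    and "\<gamma> = hyp_segment \<zeta>\<^sub>1 \<zeta>\<^sub>2" "arc g" "path_image g = \<gamma>"
    and "proper_circline C" "Some ` \<gamma> \<subseteq> circline_points C"
    and "C\<^sub>0 \<in> connected_components_of (subtopology riemann_sphere (circline_points C - Some ` J))"
    and "\<exists>x\<in>C\<^sub>0. x \<notin> Some ` ball 0 1"
    and "\<gamma>' = {z. Some z \<in> circline_points C - C\<^sub>0}"
    and "J' = reflect C ` J"
    and "meromorphic_univalent f" "s \<in> ball 0 1" "is_pole f s"
    and "s \<notin> filled_hull (\<gamma>' \<union> J)"
    and "\<tau> = tanh (hyp_setdist s \<gamma>')"
  shows "(s \<notin> interior (filled_hull (J \<union> J')) \<longrightarrow>
            curve_length {0..1} (f \<circ> g) \<le> GH_const * curve_length {0..1} (f \<circ> j)) \<and>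
         (s \<in> interior (filled_hull (J \<union> J')) \<longrightarrow>
            curve_length {0..1} (f \<circ> g) \<le> GH_pole_const_sup \<tau> * curve_length {0..1} (f \<circ> j))"
proof -
 note A = assms
 have jD: "norm (j x) < 1" if "x \<in> {0..1}" for x
 proof -
  have "j x \<in> J" using that unfolding A(2)[symmetric] path_image_def by (rule imageI)
  thus ?thesis using A(3) by auto
 qed
 have j01: "j 0 = \<zeta>\<^sub>1" "j 1 = \<zeta>\<^sub>2" using A(4,5) by (simp_all add: pathstart_def pathfinish_def)
 have jc: "continuous_on {0..1} j" and ji: "inj_on j {0..1}" using A(1) by (auto simp: arc_def path_def)
 have \<zeta>: "norm \<zeta>\<^sub>1 < 1" "norm \<zeta>\<^sub>2 < 1" using jD[of 0] jD[of 1] j01 by auto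
 have ne: "\<zeta>\<^sub>1 \<noteq> \<zeta>\<^sub>2" using inj_onD[OF ji, of 0 1] j01 by auto
 define M where "M = (\<zeta>\<^sub>2 - \<zeta>\<^sub>1) / (1 - \<zeta>\<^sub>2 * cnj \<zeta>\<^sub>1)"
 define t where "t = norm M"
 \<comment> \<open>This choice of \<open>u\<close> puts \<open>\<zeta>\<^sub>2\<close> on the positive imaginary axis.\<close>
 define u where "u = - \<i> * sgn M"
 have t1: "t < 1" unfolding t_def M_def by (rule pseudo_lt_1[OF \<zeta>(2,1)])
 have "norm (\<zeta>\<^sub>2 * cnj \<zeta>\<^sub>1) < 1" using \<zeta> unfolding norm_mult complex_mod_cnj by (metis mult_less_cancel_left2 mult_strict_mono' norm_ge_zero mult_1)
 hence "1 - \<zeta>\<^sub>2 * cnj \<zeta>\<^sub>1 \<noteq> 0" by (metis eq_iff_diff_eq_0 less_irrefl norm_one)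
 hence M0: "M \<noteq> 0" using ne by (simp add: M_def)
 hence t0: "0 < t" by (simp add: t_def)
 interpret disk_motion \<zeta>\<^sub>1 u by unfold_locales (use \<zeta> M0 in \<open>auto simp: u_def norm_mult norm_sgn\<close>)
 have T1: "T \<zeta>\<^sub>1 = 0" by (simp add: T_def Moebius_function_def)
 have T2: "T \<zeta>\<^sub>2 = imag t"
 proof -
  have "M = of_real t * sgn M" using M0 by (simp add: t_def sgn_div_norm scaleR_conv_of_real)
  moreover have "u * (imag t) = - (\<i> * \<i>) * (of_real t * sgn M)" unfolding u_def by (simp only: mult_minus_left mult_minus_right mult.assoc mult.commute mult.left_commute)
  ultimately have "M = u * (imag t)" by simp
  moreover have "T \<zeta>\<^sub>2 = cnj u * M" by (simp add: T_def M_def Moebius_function_def mult.commute)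
  ultimately have "T \<zeta>\<^sub>2 = (cnj u * u) * (imag t)" by simp
  thus ?thesis by (simp only: uu mult_1)
 qed
 have St: "S (imag t) = \<zeta>\<^sub>2" using S_T[OF \<zeta>(2)] T2 by simp
 have \<gamma>: "\<gamma> \<subseteq> (\<lambda>y. S (imag y)) ` {0..t}" unfolding A(6) using hyp_segment_S[OF t0 t1] by (simp add: S_0 St)
 have it: "norm (imag x) < 1" if "x \<in> {0..t}" for x using that t1 by (simp add: norm_mult)
 have \<gamma>D: "\<gamma> \<subseteq> disk" unfolding A(6) hyp_segment_def by auto
 \<comment> \<open>The segment \<open>\<gamma>\<close> is connected and contains both endpoints, so it is the whole image of \<open>{0..t}\<close>.\<close>
 have on: "Some (S (imag x)) \<in> circline_points C" if "0 <= x" "x <= t" for x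
 proof -
  have "connected \<gamma>" using A(7) connected_arc_image[of g] unfolding A(8) by blast
  hence "connected ((\<lambda>z. Im (T z)) ` \<gamma>)"
   by (intro connected_continuous_image continuous_intros continuous_on_subset[OF holomorphic_on_imp_continuous_on[OF T_hol] \<gamma>D])
  moreover have "\<zeta>\<^sub>1 \<in> \<gamma>" "\<zeta>\<^sub>2 \<in> \<gamma>" unfolding A(6) hyp_segment_def using \<zeta> by (auto simp: hyp_dist_def)
  hence "Im (T \<zeta>\<^sub>1) \<in> (\<lambda>z. Im (T z)) ` \<gamma>" "Im (T \<zeta>\<^sub>2) \<in> (\<lambda>z. Im (T z)) ` \<gamma>" by blast+
  hence "0 \<in> (\<lambda>z. Im (T z)) ` \<gamma>" "t \<in> (\<lambda>z. Im (T z)) ` \<gamma>" by (simp_all add: T1 T2)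
  ultimately have "x \<in> (\<lambda>z. Im (T z)) ` \<gamma>" using that unfolding connected_iff_interval by blast
  then obtain z where z: "z \<in> \<gamma>" "x = Im (T z)" by blast
  then obtain y where "y \<in> {0..t}" "z = S (imag y)" using \<gamma> by blast
  hence "S (imag x) = z" using z(2) T_S[OF it] by simp
  thus ?thesis using A(10) z(1) by blast
 qed
 have geo: "Some (S W) \<in> circline_points C \<longleftrightarrow> Re W = 0" "reflect C (S W) = S (reflect_axis W)" if "norm W < 1" for W
  by (rule circline_through_axis[OF t0 t1 A(9) _ that], rule on, assumption+)+
 define k where "k = T \<circ> j"
 have kD: "norm (k x) < 1" and Sk: "S (k x) = j x" if "x \<in> {0..1}" for x using norm_T[OF jD[OF that]] S_T[OF jD[OF that]] by (simp_all add: k_def)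
 have kc: "continuous_on {0..1} k" unfolding k_def
  by (intro continuous_on_compose jc continuous_on_subset[OF holomorphic_on_imp_continuous_on[OF T_hol]]) (use jD in auto)
 have arc_k: "arc k"
 proof -
  have "inj_on k {0..1}"
  proof (rule inj_onI)
   fix x y :: real assume xy: "x \<in> {0..1}" "y \<in> {0..1}" "k x = k y"
   hence "j x = j y" using Sk by metis
   thus "x = y" using inj_onD[OF ji] xy by blast
  qed
  thus ?thesis using kc by (simp add: arc_def path_def)
 qed
 have pk: "path_image k \<subseteq> disk" using kD by (auto simp: path_image_def)
 have SJ: "S ` path_image k = J" using Sk A(2) by (force simp: path_image_def image_image)
 have k01: "k 0 = 0" "k 1 = imag t" by (simp_all add: k_def j01 T1 T2)
 define E where "E = {x \<in> {0..1}. Re (k x) = 0}"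
 have "closedin (top_of_set {0..1}) ({0..1} \<inter> (Re \<circ> k) -` {0})"
  by (rule continuous_closedin_preimage) (intro continuous_on_compose continuous_intros kc, simp)
 moreover have "{0..1} \<inter> (Re \<circ> k) -` {0} = E" by (auto simp: E_def)
 ultimately have cE: "compact E" using closedin_compact[OF compact_Icc] by metis
 have E01: "0 \<in> E" "1 \<in> E" using k01 by (auto simp: E_def)
 have cont_Im: "continuous_on E (\<lambda>x. Im (k x))" by (intro continuous_intros continuous_on_subset[OF kc]) (auto simp: E_def)
 obtain xa where xa: "xa \<in> E" "!!x. x \<in> E ==> Im (k xa) <= Im (k x)" using continuous_attains_inf[OF cE _ cont_Im] E01 by blast
 obtain xb where xb: "xb \<in> E" "!!x. x \<in> E ==> Im (k x) <= Im (k xb)" using continuous_attains_sup[OF cE _ cont_Im] E01 by blast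
 \<comment> \<open>The lowest and the highest axis point of \<open>k\<close>; \<open>S\<close> maps the segment between them into \<open>\<gamma>'\<close>.\<close>
 define \<alpha> where "\<alpha> = Im (k xa)"
 define \<beta> where "\<beta> = Im (k xb)"
 have axis: "k x = imag (Im (k x))" if "x \<in> E" for x using that by (simp add: E_def complex_eq_iff)
 have E1: "x \<in> {0..1}" if "x \<in> E" for x using that by (simp add: E_def)
 have end_J: "S (imag \<alpha>) \<in> J" "S (imag \<beta>) \<in> J"
  unfolding \<alpha>_def \<beta>_def axis[OF xa(1), symmetric] axis[OF xb(1), symmetric] Sk[OF E1[OF xa(1)]] Sk[OF E1[OF xb(1)]]
  using A(2) E1[OF xa(1)] E1[OF xb(1)] by (auto simp: path_image_def)
 have \<alpha>\<beta>: "-1 < \<alpha>" "\<beta> < 1"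
  using abs_Im_le_cmod[of "k xa"] kD[OF E1[OF xa(1)]] abs_Im_le_cmod[of "k xb"] kD[OF E1[OF xb(1)]] by (auto simp: \<alpha>_def \<beta>_def)
 define X where "X = imag ` {\<alpha>..\<beta>}"
 have XD: "X \<subseteq> disk" using \<alpha>\<beta> by (auto simp: X_def norm_mult)
 have cX: "compact X" unfolding X_def by (intro compact_continuous_image continuous_intros compact_Icc)
 have SX: "S ` X \<subseteq> \<gamma>'"
 proof (rule image_subsetI)
  fix w assume "w \<in> X"
  then obtain y where y: "y \<in> {\<alpha>..\<beta>}" "w = imag y" by (auto simp: X_def)
  have w1: "norm w < 1" using \<open>w \<in> X\<close> XD by auto
  obtain x where x: "x \<in> C\<^sub>0" "x \<notin> Some ` disk" using A(12) by blast
  have "Some (S w) \<notin> C\<^sub>0" unfolding y(2) by (rule component_avoids_axis[OF geo(1) \<alpha>\<beta> end_J A(11) x y(1)])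
  moreover have "Some (S w) \<in> circline_points C" using geo(1)[OF w1] y(2) by simp
  ultimately show "S w \<in> \<gamma>'" by (simp add: A(13))
 qed
 define s' where "s' = T s"
 have s1: "norm s < 1" using A(16) by simp
 have s': "norm s' < 1" "S s' = s" unfolding s'_def using norm_T[OF s1] S_T[OF s1] by auto
 have Seq: "S z = s \<longleftrightarrow> z = s'" if "norm z < 1" for z using S_inj[OF that s'(1)] s'(2) by simp
 note fD = meromorphic_univalentD[OF A(15-17)]
 define F where "F = f \<circ> S"
 interpret axis_arc F s' k \<alpha> \<beta>
 proof unfold_locales
  have SD: "S ` (disk - {s'}) \<subseteq> disk - {s}"
  proof (rule image_subsetI)
   fix z assume z: "z \<in> disk - {s'}"
   hence "norm z < 1" "z \<noteq> s'" by auto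
   thus "S z \<in> disk - {s}" using norm_S[of z] Seq[of z] by simp
  qed
  show "F holomorphic_on disk - {s'}" unfolding F_def by (rule holomorphic_on_compose_gen[OF holomorphic_on_subset[OF S_hol] fD(1) SD]) auto
  have "inj_on S (disk - {s'})" using S_inj by (auto simp: inj_on_def)
  thus "inj_on F (disk - {s'})" unfolding F_def by (intro comp_inj_on inj_on_subset[OF fD(2) SD])
  show "F s' = 0" using meromorphic_univalent_pole_value[OF A(15-17)] s'(2) by (simp add: F_def)
  have s'b: "s' \<in> disk" using s'(1) by simp
  thus "s' \<in> disk" .
  show "is_pole F s'" unfolding F_def o_def
  proof (rule is_pole_compose[OF A(17)])
   have "isCont S s'" using holomorphic_on_imp_continuous_on[OF S_hol] s'b by (simp add: continuous_on_eq_continuous_at)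
   thus "S \<midarrow>s'\<rightarrow> s" using s'(2) unfolding isCont_def by simp
   have "eventually (\<lambda>z. z \<in> disk - {s'}) (at s')" using s'b by (intro eventually_at_in_open) auto
   thus "eventually (\<lambda>z. S z \<noteq> s) (at s')" by (rule eventually_mono) (use Seq in auto)
  qed
  show "arc k" by (rule arc_k)
  show "path_image k \<subseteq> disk" by (rule pk)
  show "Re (k 0) = 0" "Re (k 1) = 0" by (simp_all add: k01)
  show "-1 < \<alpha>" "\<beta> < 1" by (rule \<alpha>\<beta>)+
  show "Im (k x) \<in> {\<alpha>..\<beta>}" if "x \<in> {0..1}" "Re (k x) = 0" for x using xa(2)[of x] xb(2)[of x] that by (simp add: E_def \<alpha>_def \<beta>_def)
  show "s' \<notin> filled_hull (imag ` {\<alpha>..\<beta>} \<union> path_image k)"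
  proof
   assume "s' \<in> filled_hull (imag ` {\<alpha>..\<beta>} \<union> path_image k)"
   hence "s' \<in> filled_hull (X \<union> path_image k)" by (simp add: X_def)
   hence "s \<in> filled_hull (S ` (X \<union> path_image k))"
    using filled_hull_S[of "X \<union> path_image k" s'] cX XD pk compact_arc_image[OF arc_k] s'(2) by (simp add: compact_Un)
   moreover have "S ` (X \<union> path_image k) \<subseteq> \<gamma>' \<union> J" using SX SJ by (simp add: image_Un) blast
   ultimately show False using filled_hull_mono A(18) by blast
  qed
 qed
 have left: "curve_length {0..1} (f \<circ> g) <= axis_length F (Im (k 0)) (Im (k 1))"
 proof -
  have "curve_length {0..1} (f \<circ> g) <= curve_length {0..t} (f \<circ> (\<lambda>y. S (imag y)))"
  proof (rule curve_length_reparametrize[where b' = "\<lambda>w. Im (T w)"])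
   show "continuous_on {0..1} g" "inj_on g {0..1}" using A(7) by (auto simp: arc_def path_def)
   show "g ` {0..1} \<subseteq> (\<lambda>y. S (imag y)) ` {0..t}" using A(8) \<gamma> unfolding path_image_def by simp
   show "continuous_on ((\<lambda>y. S (imag y)) ` {0..t}) (\<lambda>w. Im (T w))"
    by (intro continuous_intros continuous_on_subset[OF holomorphic_on_imp_continuous_on[OF T_hol]]) (use it norm_S in auto)
   show "Im (T (S (imag x))) = x" if "x \<in> {0..t}" for x using T_S[OF it[OF that]] by simp
  qed (rule is_interval_cc)
  also have "... = axis_length F (Im (k 0)) (Im (k 1))" using t0 by (simp add: axis_length_def F_def k01 o_def min_def max_def)
  finally show ?thesis .
 qed
 have right: "curve_length {0..1} (F \<circ> k) = curve_length {0..1} (f \<circ> j)" by (rule curve_length_cong) (simp add: F_def Sk)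
 have J': "S ` (path_image k \<union> reflect_axis ` path_image k) = J \<union> J'"
 proof -
  have "S ` reflect_axis ` path_image k = reflect C ` S ` path_image k" unfolding image_image using geo(2) pk by (intro image_cong) auto
  thus ?thesis unfolding image_Un SJ A(14) by simp
 qed
 show ?thesis
 proof (intro conjI impI)
  assume s: "s \<notin> interior (filled_hull (J \<union> J'))"
  have "s' \<notin> interior (filled_hull (path_image k \<union> reflect_axis ` path_image k))"
  proof
   assume "s' \<in> interior (filled_hull (path_image k \<union> reflect_axis ` path_image k))"
   hence "S s' \<in> interior (filled_hull (S ` (path_image k \<union> reflect_axis ` path_image k)))"
   proof (rule interior_filled_hull_S[rotated 2])
    show "compact (path_image k \<union> reflect_axis ` path_image k)" by (intro compact_Un compact_continuous_image continuous_reflect_axis compact_arc_image arc_k)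
    show "path_image k \<union> reflect_axis ` path_image k \<subseteq> disk" using pk by (auto simp: reflect_axis_def)
   qed (rule s'(1))
   thus False using s unfolding J' s'(2) by simp
  qed
  from axis_length_le_GH_const[OF this] left show "curve_length {0..1} (f \<circ> g) <= GH_const * curve_length {0..1} (f \<circ> j)"
   unfolding right by (rule order_trans[rotated])
 next
  have \<tau>: "\<tau> <= norm ((s' - imag y) / (1 - cnj (imag y) * s'))" if y: "y \<in> {\<alpha>..\<beta>}" for y
  proof -
   define w where "w = imag y"
   have w: "w \<in> X" using y by (simp add: X_def w_def)
   hence w1: "norm w < 1" using XD by auto
   have "\<tau> <= norm ((s - S w) / (1 - s * cnj (S w)))" unfolding A(19) using SX w by (intro tanh_hyp_setdist_le s1 norm_S w1) blast
   also have "... = norm ((s' - w) / (1 - s' * cnj w))" using S_pseudo[OF s'(1) w1] unfolding s'(2) .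
   finally show ?thesis by (simp only: w_def mult.commute)
  qed
  have "\<tau> < 1" unfolding A(19) by (rule tanh_real_lt_1)
  from axis_length_le_GH_pole_const_sup[OF this \<tau>] left
  show "curve_length {0..1} (f \<circ> g) <= GH_pole_const_sup \<tau> * curve_length {0..1} (f \<circ> j)" unfolding right by (rule order_trans[rotated])
 qed
qed

end
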